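(* Work in $\mathsf{THS}$. For every thin class $X$ there exists a thin class $Z$ such that: (1) $X=Z\cap x$ for some $x\in Z$; (2) for every $x\in Z$ and every class $C\subseteq x\cap Z$ there is $q\in Z$ with $q\cap Z=C$; (3) every set $x$ with $x\subseteq Z$ belongs to $Z$; (4) $Z\models_f\theta$ for every formal formula $\theta$ which is an axiom of $\mathsf{ZC}^-$ (Zermelo set theory with the axiom of choice and without the axiom of regularity).
   Context: $\mathsf{THS}$ is a first-order theory in the language with the single binary predicate $\in$; its objects are classes. A set is a class that is a member of some class; $\mathbb{H}$ is the class of all sets. Set formulas are formulas with quantifiers only over sets and with no class variables/constants. Axioms: (Ext) classes with the same set-elements are equal; (Class) for any formula $\Phi$ and classes $X_1,\dots,X_n$ there is $Y$ with $y\in Y\leftrightarrow\Phi(y,\vec X)$ for all sets $y$; (Set) $\emptyset$ and $x\cup\{y\}$ are sets for sets $x,y$; (Ind) for set formulas $\varphi$: $\varphi(\emptyset)\wedge\forall x\forall y(\varphi(x)\wedge\varphi(y)\to\varphi(x\cup\{y\}))\to\forall x\varphi(x)$. A class $X$ is small iff every subclass of $X$ is a set; infinite iff not small; thin iff every subset of $X$ is small. (Thin) every thin class is a subclass of some set; (Comp) for every thin $X$ and set $u$ with $u\subseteq\bigcup X$ there is a set $x\subseteq X$ with $u\subseteq\bigcup x$; (Exp) for every thin $X$ there is a thin $P$ such that for every set $y$ there is $p\in P$ with $y\cap X=p\cap X$; (Choice) if $\mathrm{dom}(X)$ is thin there is a function $F\subseteq X$ with $\mathrm{dom}F=\mathrm{dom}X$;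 $\mathbb{SN}$ is the smallest class containing $\emptyset$ closed under $n\mapsto n\cup\{n\}$; (DC) for any formula $\Phi$: if $\forall X\exists Y\Phi(X,Y)$ then for every $X_0$ there is $Z$ with $Z``\{\emptyset\}=X_0$ and $\Phi(Z``\{n\},Z``\{n\cup\{n\}\})$ for all $n\in\mathbb{SN}$, where $X``A=\{b:\exists a\in A\,\langle a,b\rangle\in X\}$; $\mathbb{S}$ is the smallest class containing $\emptyset$ closed under $(a,b)\mapsto a\cup\{b\}$; (T) for set formulas $\varphi$ and $t_1,\dots,t_n\in\mathbb{S}$: $\exists x\varphi(x,\vec t)\to\exists x\in\mathbb{S}\,\varphi(x,\vec t)$. Formal formulas: symbols, variables and set parameters are coded by sets (the logical symbols by standard sets), and formal formulas are defined in the theory as well-formed sequences of codes; $\mathrm{SL}(P)$ is the class of formal formulas of small length with parameters from $P$. For a class $X$, $\mathrm{True}(X)$ is the unique class of closed formulas of $\mathrm{SL}(X)$ satisfying Tarski's clauses: $\ulcorner x_1=x_2\urcorner\in\mathrm{True}(X)$ iff $x_1,x_2\in X$ and $x_1=x_2$; similarly for $\in$; disjunction and negation commute with membership in $\mathrm{True}(X)$; $\ulcorner\exists v\,\theta\urcorner\in\mathrm{True}(X)$ iff $\theta_{v\to x}\in\mathrm{True}(X)$ for some $x\in X$. $X\models_f\theta$ means $\theta\in\mathrm{True}(X)$. *)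

theory Defs
  imports Main
begin

text \<open>
  Working in the first-order theory THS is rendered by working in an arbitrary structure
  for its language: the elements of a type of class \<open>membership\<close> are the objects
  (\<open>classes\<close> in the sense of THS), and the type class \<open>ths\<close> below consists of the models
  of THS.  Every notion is interpreted inside the structure: \<open>class\<close> never means
  a HOL set, and formal formulas are objects of the structure.
\<close>

text \<open>
  Formulas of the metalanguage, needed for the axiom schemes only, with named variables.
\<close>

datatype fm =
    Mem_fm nat nat
  | Eq_fm nat nat
  | Neg_fm fm
  | Or_fm fm fm
  | Ex_fm nat fm

class membership =
  fixes mem :: "'a \<Rightarrow> 'a \<Rightarrow> bool"  (infix "\<in>\<^sub>c" 50)
begin

definition is_set :: "'a \<Rightarrow> bool" where
  "is_set x \<longleftrightarrow> (\<exists>Y. x \<in>\<^sub>c Y)"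

text \<open>
  Satisfaction with the quantifiers ranging over \<open>D\<close>.  Arbitrary formulas are evaluated with
  \<open>D = UNIV\<close>.  Set formulas are evaluated with \<open>D = {x. is_set x}\<close> under assignments
  whose values are sets.
\<close>

primrec sat :: "'a set \<Rightarrow> fm \<Rightarrow> (nat \<Rightarrow> 'a) \<Rightarrow> bool" where
  "sat D (Mem_fm i j) s \<longleftrightarrow> s i \<in>\<^sub>c s j"
| "sat D (Eq_fm i j) s \<longleftrightarrow> s i = s j"
| "sat D (Neg_fm \<phi>) s \<longleftrightarrow> \<not> sat D \<phi> s"
| "sat D (Or_fm \<phi> \<psi>) s \<longleftrightarrow> sat D \<phi> s \<or> sat D \<psi> s"
| "sat D (Ex_fm i \<phi>) s \<longleftrightarrow> (\<exists>x\<in>D. sat D \<phi> (s(i := x)))"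

abbreviation class_sat :: "fm \<Rightarrow> (nat \<Rightarrow> 'a) \<Rightarrow> bool" where
  "class_sat \<equiv> sat UNIV"

abbreviation set_sat :: "fm \<Rightarrow> (nat \<Rightarrow> 'a) \<Rightarrow> bool" where
  "set_sat \<equiv> sat {x. is_set x}"


subsection \<open>Basic notions\<close>

text \<open>
  The class of all sets satisfying \<open>P\<close>.  It is used below only for \<open>P\<close> first-order definable
  over the structure, where existence and uniqueness follow from (Class) and (Ext).
\<close>

definition cls :: "('a \<Rightarrow> bool) \<Rightarrow> 'a" where
  "cls P = (THE Y. \<forall>y. y \<in>\<^sub>c Y \<longleftrightarrow> is_set y \<and> P y)"

definition subcls :: "'a \<Rightarrow> 'a \<Rightarrow> bool"  (infix "\<subseteq>\<^sub>c" 50) where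
  "X \<subseteq>\<^sub>c Y \<longleftrightarrow> (\<forall>z. z \<in>\<^sub>c X \<longrightarrow> z \<in>\<^sub>c Y)"

definition emp :: 'a where
  "emp = cls (\<lambda>z. False)"

definition adj :: "'a \<Rightarrow> 'a \<Rightarrow> 'a" where  \<comment> \<open>\<open>x \<union> {y}\<close>\<close>
  "adj x y = cls (\<lambda>z. z \<in>\<^sub>c x \<or> z = y)"

definition inter :: "'a \<Rightarrow> 'a \<Rightarrow> 'a"  (infixl "\<inter>\<^sub>c" 70) where
  "X \<inter>\<^sub>c Y = cls (\<lambda>z. z \<in>\<^sub>c X \<and> z \<in>\<^sub>c Y)"

definition union_of :: "'a \<Rightarrow> 'a"  ("\<Union>\<^sub>c _" [81] 80) where
  "\<Union>\<^sub>c X = cls (\<lambda>z. \<exists>y. y \<in>\<^sub>c X \<and> z \<in>\<^sub>c y)"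

definition upair :: "'a \<Rightarrow> 'a \<Rightarrow> 'a" where
  "upair a b = cls (\<lambda>z. z = a \<or> z = b)"

abbreviation sing :: "'a \<Rightarrow> 'a" where
  "sing a \<equiv> upair a a"

definition pair :: "'a \<Rightarrow> 'a \<Rightarrow> 'a" where
  "pair a b = upair (sing a) (upair a b)"

text \<open>
  The guards are needed: for a proper class \<open>b\<close>, the term \<open>pair a b\<close> collapses to \<open>pair a a\<close>.
\<close>

definition related :: "'a \<Rightarrow> 'a \<Rightarrow> 'a \<Rightarrow> bool" where
  "related R a b \<longleftrightarrow> is_set a \<and> is_set b \<and> pair a b \<in>\<^sub>c R"

definition Dom :: "'a \<Rightarrow> 'a" where
  "Dom R = cls (\<lambda>a. \<exists>b. related R a b)"

definition image_cls :: "'a \<Rightarrow> 'a \<Rightarrow> 'a"  (infixl "``\<^sub>c" 90) where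
  "R ``\<^sub>c A = cls (\<lambda>b. \<exists>a. a \<in>\<^sub>c A \<and> related R a b)"

definition is_function :: "'a \<Rightarrow> bool" where
  "is_function F \<longleftrightarrow>
     (\<forall>p. p \<in>\<^sub>c F \<longrightarrow> (\<exists>a b. is_set a \<and> is_set b \<and> p = pair a b)) \<and>
     (\<forall>a b b'. related F a b \<and> related F a b' \<longrightarrow> b = b')"

definition ap :: "'a \<Rightarrow> 'a \<Rightarrow> 'a" where
  "ap F a = (THE b. related F a b)"

definition small :: "'a \<Rightarrow> bool" where
  "small X \<longleftrightarrow> (\<forall>Y. Y \<subseteq>\<^sub>c X \<longrightarrow> is_set Y)"

definition thin :: "'a \<Rightarrow> bool" where
  "thin X \<longleftrightarrow> (\<forall>x. is_set x \<and> x \<subseteq>\<^sub>c X \<longrightarrow> small x)"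

definition suc :: "'a \<Rightarrow> 'a" where
  "suc n = adj n n"

definition smallest_class :: "('a \<Rightarrow> bool) \<Rightarrow> 'a" where
  "smallest_class P = (THE A. P A \<and> (\<forall>B. P B \<longrightarrow> A \<subseteq>\<^sub>c B))"

definition SN :: 'a where
  "SN = smallest_class (\<lambda>A. emp \<in>\<^sub>c A \<and> (\<forall>n. n \<in>\<^sub>c A \<longrightarrow> suc n \<in>\<^sub>c A))"

definition SS :: 'a where
  "SS = smallest_class (\<lambda>A. emp \<in>\<^sub>c A \<and> (\<forall>a b. a \<in>\<^sub>c A \<and> b \<in>\<^sub>c A \<longrightarrow> adj a b \<in>\<^sub>c A))"

end


subsection \<open>The axioms\<close>

text \<open>
  In the schemes the distinguished variables are \<open>0\<close> (and \<open>1\<close>); the assignment \<open>s\<close> supplies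
  the parameters.
\<close>

class ths = membership +
  assumes Ext: "(\<forall>z. is_set z \<longrightarrow> (z \<in>\<^sub>c X \<longleftrightarrow> z \<in>\<^sub>c Y)) \<longrightarrow> X = Y"
    and Class: "\<exists>Y. \<forall>y. is_set y \<longrightarrow> (y \<in>\<^sub>c Y \<longleftrightarrow> class_sat \<Phi> (s(0 := y)))"
    and Set_emp: "is_set emp"
    and Set_adj: "is_set x \<and> is_set y \<longrightarrow> is_set (adj x y)"
    and Ind: "(\<forall>i. is_set (s i)) \<longrightarrow>
        set_sat \<phi> (s(0 := emp)) \<and>
        (\<forall>x y. is_set x \<and> is_set y \<and> set_sat \<phi> (s(0 := x)) \<and> set_sat \<phi> (s(0 := y))
           \<longrightarrow> set_sat \<phi> (s(0 := adj x y))) \<longrightarrow>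
        (\<forall>x. is_set x \<longrightarrow> set_sat \<phi> (s(0 := x)))"
    and Thin: "thin X \<longrightarrow> (\<exists>u. is_set u \<and> X \<subseteq>\<^sub>c u)"
    and Comp: "thin X \<and> is_set u \<and> u \<subseteq>\<^sub>c \<Union>\<^sub>c X \<longrightarrow>
        (\<exists>x. is_set x \<and> x \<subseteq>\<^sub>c X \<and> u \<subseteq>\<^sub>c \<Union>\<^sub>c x)"
    and Exp: "thin X \<longrightarrow>
        (\<exists>P. thin P \<and> (\<forall>y. is_set y \<longrightarrow> (\<exists>p. p \<in>\<^sub>c P \<and> y \<inter>\<^sub>c X = p \<inter>\<^sub>c X)))"
    and Choice: "thin (Dom X) \<longrightarrow>
        (\<exists>F. is_function F \<and> F \<subseteq>\<^sub>c X \<and> Dom F = Dom X)"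
    and DC: "(\<forall>X. \<exists>Y. class_sat \<Phi> (s(0 := X, 1 := Y))) \<longrightarrow>
        (\<forall>X\<^sub>0. \<exists>Z. Z ``\<^sub>c sing emp = X\<^sub>0 \<and>
          (\<forall>n. n \<in>\<^sub>c SN \<longrightarrow>
             class_sat \<Phi> (s(0 := Z ``\<^sub>c sing n, 1 := Z ``\<^sub>c sing (suc n)))))"
    and T: "(\<forall>i. s i \<in>\<^sub>c SS) \<longrightarrow>
        (\<exists>x. is_set x \<and> set_sat \<phi> (s(0 := x))) \<longrightarrow>
        (\<exists>x. x \<in>\<^sub>c SS \<and> set_sat \<phi> (s(0 := x)))"


subsection \<open>Formal formulas\<close>

context membership
begin

definition transitive :: "'a \<Rightarrow> bool" where
  "transitive x \<longleftrightarrow> (\<forall>y. y \<in>\<^sub>c x \<longrightarrow> y \<subseteq>\<^sub>c x)"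

text \<open>
  The internal natural numbers are the von Neumann ordinals; by (Ind) all sets are well-founded
  and there are no limit ordinals.  They need not belong to \<open>SN\<close>.
\<close>

definition is_nat :: "'a \<Rightarrow> bool" where
  "is_nat n \<longleftrightarrow> is_set n \<and> transitive n \<and> (\<forall>m. m \<in>\<^sub>c n \<longrightarrow> transitive m)"

text \<open>A sequence of length \<open>n\<close> is a set which is a function with domain \<open>n\<close>.\<close>

definition is_seq :: "'a \<Rightarrow> bool" where
  "is_seq s \<longleftrightarrow> is_set s \<and> is_function s \<and> is_nat (Dom s)"

text \<open>
  Concatenation: \<open>s\<close> is an initial segment of \<open>r\<close>, and \<open>h\<close> is the order isomorphism by which
  the positions of \<open>t\<close> are shifted to the remaining positions of \<open>r\<close>.  That \<open>h\<close> is a set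
  is essential, since a proper class may well be an order isomorphism between distinct
  natural numbers.
\<close>

definition cat :: "'a \<Rightarrow> 'a \<Rightarrow> 'a"  (infixr "\<frown>" 65) where
  "s \<frown> t = (THE r. is_seq r \<and> s \<subseteq>\<^sub>c r \<and>
     (\<exists>h. is_set h \<and> is_function h \<and> Dom h = Dom t \<and>
          (\<forall>k. k \<in>\<^sub>c Dom r \<and> \<not> k \<in>\<^sub>c Dom s \<longleftrightarrow> (\<exists>i. i \<in>\<^sub>c Dom t \<and> k = ap h i)) \<and>
          (\<forall>i j. i \<in>\<^sub>c Dom t \<and> j \<in>\<^sub>c Dom t \<longrightarrow> (i \<in>\<^sub>c j \<longleftrightarrow> ap h i \<in>\<^sub>c ap h j)) \<and>
          (\<forall>i. i \<in>\<^sub>c Dom t \<longrightarrow> ap r (ap h i) = ap t i)))"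

primrec word :: "'a list \<Rightarrow> 'a" where
  "word [] = emp"
| "word (a # as) = sing (pair emp a) \<frown> word as"

primrec num :: "nat \<Rightarrow> 'a" where
  "num 0 = emp"
| "num (Suc k) = suc (num k)"

definition sym_code :: "nat \<Rightarrow> 'a" where
  "sym_code k = pair (num 0) (num k)"

definition var :: "'a \<Rightarrow> 'a" where
  "var n = pair (num 1) n"

definition par :: "'a \<Rightarrow> 'a" where
  "par x = pair (num 2) x"

definition is_var :: "'a \<Rightarrow> bool" where
  "is_var v \<longleftrightarrow> (\<exists>n. is_nat n \<and> v = var n)"

definition is_term :: "'a \<Rightarrow> bool" where
  "is_term c \<longleftrightarrow> is_var c \<or> (\<exists>x. is_set x \<and> c = par x)"

text \<open>Formulas are written in prefix notation, so no parentheses are needed.\<close>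

definition fEq :: "'a \<Rightarrow> 'a \<Rightarrow> 'a" where
  "fEq a b = word [sym_code 0, a, b]"

definition fMem :: "'a \<Rightarrow> 'a \<Rightarrow> 'a" where
  "fMem a b = word [sym_code 1, a, b]"

definition fNeg :: "'a \<Rightarrow> 'a" where
  "fNeg \<phi> = word [sym_code 2] \<frown> \<phi>"

definition fOr :: "'a \<Rightarrow> 'a \<Rightarrow> 'a" where
  "fOr \<phi> \<psi> = word [sym_code 3] \<frown> \<phi> \<frown> \<psi>"

definition fEx :: "'a \<Rightarrow> 'a \<Rightarrow> 'a" where
  "fEx v \<phi> = word [sym_code 4, v] \<frown> \<phi>"

definition fAnd :: "'a \<Rightarrow> 'a \<Rightarrow> 'a" where
  "fAnd \<phi> \<psi> = fNeg (fOr (fNeg \<phi>) (fNeg \<psi>))"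

definition fImp :: "'a \<Rightarrow> 'a \<Rightarrow> 'a" where
  "fImp \<phi> \<psi> = fOr (fNeg \<phi>) \<psi>"

definition fIff :: "'a \<Rightarrow> 'a \<Rightarrow> 'a" where
  "fIff \<phi> \<psi> = fAnd (fImp \<phi> \<psi>) (fImp \<psi> \<phi>)"

definition fAll :: "'a \<Rightarrow> 'a \<Rightarrow> 'a" where
  "fAll v \<phi> = fNeg (fEx v (fNeg \<phi>))"

text \<open>
  A formula is an entry of a formation sequence.  The formation sequence is a set of possibly
  nonstandard length, so formulas need not have small length.
\<close>

definition formation_seq :: "'a \<Rightarrow> bool" where
  "formation_seq f \<longleftrightarrow> is_seq f \<and>
     (\<forall>i. i \<in>\<^sub>c Dom f \<longrightarrow>
        (\<exists>a b. is_term a \<and> is_term b \<and> (ap f i = fEq a b \<or> ap f i = fMem a b)) \<or>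
        (\<exists>j. j \<in>\<^sub>c i \<and> ap f i = fNeg (ap f j)) \<or>
        (\<exists>j k. j \<in>\<^sub>c i \<and> k \<in>\<^sub>c i \<and> ap f i = fOr (ap f j) (ap f k)) \<or>
        (\<exists>v j. is_var v \<and> j \<in>\<^sub>c i \<and> ap f i = fEx v (ap f j)))"

definition formal_formula :: "'a \<Rightarrow> bool" where
  "formal_formula \<theta> \<longleftrightarrow> (\<exists>f i. formation_seq f \<and> i \<in>\<^sub>c Dom f \<and> \<theta> = ap f i)"

definition SL :: "'a \<Rightarrow> 'a \<Rightarrow> bool" where
  "SL P \<theta> \<longleftrightarrow> formal_formula \<theta> \<and> small (Dom \<theta>) \<and>
     (\<forall>i x. i \<in>\<^sub>c Dom \<theta> \<and> is_set x \<and> ap \<theta> i = par x \<longrightarrow> x \<in>\<^sub>c P)"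

text \<open>Position \<open>i\<close> lies in a subformula occurrence of the form \<open>\<exists>v \<chi>\<close>.\<close>

definition bound_at :: "'a \<Rightarrow> 'a \<Rightarrow> 'a \<Rightarrow> bool" where
  "bound_at \<theta> v i \<longleftrightarrow>
     (\<exists>\<alpha> \<chi> \<beta>. is_seq \<alpha> \<and> formal_formula \<chi> \<and> is_seq \<beta> \<and> \<theta> = \<alpha> \<frown> fEx v \<chi> \<frown> \<beta> \<and>
        \<not> i \<in>\<^sub>c Dom \<alpha> \<and> i \<in>\<^sub>c Dom (\<alpha> \<frown> fEx v \<chi>))"

definition free_at :: "'a \<Rightarrow> 'a \<Rightarrow> 'a \<Rightarrow> bool" where
  "free_at \<theta> v i \<longleftrightarrow> i \<in>\<^sub>c Dom \<theta> \<and> ap \<theta> i = v \<and> \<not> bound_at \<theta> v i"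

definition free_in :: "'a \<Rightarrow> 'a \<Rightarrow> bool" where
  "free_in v \<theta> \<longleftrightarrow> (\<exists>i. free_at \<theta> v i)"

definition closed_formula :: "'a \<Rightarrow> bool" where
  "closed_formula \<theta> \<longleftrightarrow> formal_formula \<theta> \<and> (\<forall>v. is_var v \<longrightarrow> \<not> free_in v \<theta>)"

definition subst :: "'a \<Rightarrow> 'a \<Rightarrow> 'a \<Rightarrow> 'a" where
  "subst \<theta> v x = (THE \<theta>'. is_seq \<theta>' \<and> Dom \<theta>' = Dom \<theta> \<and>
     (\<forall>i. i \<in>\<^sub>c Dom \<theta> \<longrightarrow> ap \<theta>' i = (if free_at \<theta> v i then par x else ap \<theta> i)))"

definition is_truth_class :: "'a \<Rightarrow> 'a \<Rightarrow> bool" where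
  "is_truth_class X T \<longleftrightarrow>
     (\<forall>\<theta>. \<theta> \<in>\<^sub>c T \<longrightarrow> SL X \<theta> \<and> closed_formula \<theta>) \<and>
     (\<forall>x y. is_set x \<and> is_set y \<longrightarrow>
        (fEq (par x) (par y) \<in>\<^sub>c T \<longleftrightarrow> x \<in>\<^sub>c X \<and> y \<in>\<^sub>c X \<and> x = y)) \<and>
     (\<forall>x y. is_set x \<and> is_set y \<longrightarrow>
        (fMem (par x) (par y) \<in>\<^sub>c T \<longleftrightarrow> x \<in>\<^sub>c X \<and> y \<in>\<^sub>c X \<and> x \<in>\<^sub>c y)) \<and>
     (\<forall>\<theta> \<chi>. SL X \<theta> \<and> closed_formula \<theta> \<and> SL X \<chi> \<and> closed_formula \<chi> \<longrightarrow>
        (fOr \<theta> \<chi> \<in>\<^sub>c T \<longleftrightarrow> \<theta> \<in>\<^sub>c T \<or> \<chi> \<in>\<^sub>c T)) \<and>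
     (\<forall>\<theta>. SL X \<theta> \<and> closed_formula \<theta> \<longrightarrow> (fNeg \<theta> \<in>\<^sub>c T \<longleftrightarrow> \<not> \<theta> \<in>\<^sub>c T)) \<and>
     (\<forall>v \<theta>. is_var v \<and> SL X \<theta> \<and> closed_formula (fEx v \<theta>) \<longrightarrow>
        (fEx v \<theta> \<in>\<^sub>c T \<longleftrightarrow> (\<exists>x. x \<in>\<^sub>c X \<and> subst \<theta> v x \<in>\<^sub>c T)))"

definition True_class :: "'a \<Rightarrow> 'a" where
  "True_class X = (THE T. is_truth_class X T)"

definition models_f :: "'a \<Rightarrow> 'a \<Rightarrow> bool"  (infix "\<Turnstile>\<^sub>f" 50) where
  "X \<Turnstile>\<^sub>f \<theta> \<longleftrightarrow> \<theta> \<in>\<^sub>c True_class X"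


subsection \<open>Zermelo set theory with choice and without regularity\<close>

abbreviation vr :: "nat \<Rightarrow> 'a" where
  "vr k \<equiv> var (num k)"

definition ax_extensionality :: 'a where
  "ax_extensionality = fAll (vr 0) (fAll (vr 1)
     (fImp (fAll (vr 2) (fIff (fMem (vr 2) (vr 0)) (fMem (vr 2) (vr 1)))) (fEq (vr 0) (vr 1))))"

definition ax_empty_set :: 'a where
  "ax_empty_set = fEx (vr 0) (fAll (vr 1) (fNeg (fMem (vr 1) (vr 0))))"

definition ax_pairing :: 'a where
  "ax_pairing = fAll (vr 0) (fAll (vr 1) (fEx (vr 2) (fAll (vr 3)
     (fIff (fMem (vr 3) (vr 2)) (fOr (fEq (vr 3) (vr 0)) (fEq (vr 3) (vr 1)))))))"

definition ax_union :: 'a where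
  "ax_union = fAll (vr 0) (fEx (vr 1) (fAll (vr 2)
     (fIff (fMem (vr 2) (vr 1)) (fEx (vr 3) (fAnd (fMem (vr 3) (vr 0)) (fMem (vr 2) (vr 3)))))))"

definition ax_power_set :: 'a where
  "ax_power_set = fAll (vr 0) (fEx (vr 1) (fAll (vr 2)
     (fIff (fMem (vr 2) (vr 1)) (fAll (vr 3) (fImp (fMem (vr 3) (vr 2)) (fMem (vr 3) (vr 0)))))))"

text \<open>Some set contains the empty set and is closed under \<open>y \<mapsto> y \<union> {y}\<close>.\<close>

definition ax_infinity :: 'a where
  "ax_infinity = fEx (vr 0) (fAnd
     (fEx (vr 1) (fAnd (fAll (vr 2) (fNeg (fMem (vr 2) (vr 1)))) (fMem (vr 1) (vr 0))))
     (fAll (vr 1) (fImp (fMem (vr 1) (vr 0))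
        (fEx (vr 2) (fAnd (fMem (vr 2) (vr 0))
           (fAll (vr 3) (fIff (fMem (vr 3) (vr 2)) (fOr (fMem (vr 3) (vr 1)) (fEq (vr 3) (vr 1))))))))))"

text \<open>Every set of pairwise disjoint nonempty sets has a transversal.\<close>

definition ax_choice :: 'a where
  "ax_choice = fAll (vr 0) (fImp
     (fAnd
       (fAll (vr 1) (fImp (fMem (vr 1) (vr 0)) (fEx (vr 2) (fMem (vr 2) (vr 1)))))
       (fAll (vr 1) (fAll (vr 2) (fImp
          (fAnd (fAnd (fMem (vr 1) (vr 0)) (fMem (vr 2) (vr 0)))
                (fEx (vr 3) (fAnd (fMem (vr 3) (vr 1)) (fMem (vr 3) (vr 2)))))
          (fEq (vr 1) (vr 2))))))
     (fEx (vr 4) (fAll (vr 1) (fImp (fMem (vr 1) (vr 0))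
        (fEx (vr 2) (fAll (vr 3)
           (fIff (fAnd (fMem (vr 3) (vr 1)) (fMem (vr 3) (vr 4))) (fEq (vr 3) (vr 2)))))))))"

text \<open>
  \<open>\<theta>\<close> arises from \<open>\<psi>\<close> by prefixing universal quantifiers.  Their number is an internal
  natural number, hence the sequence inside the structure.
\<close>

definition generalization :: "'a \<Rightarrow> 'a \<Rightarrow> bool" where
  "generalization \<psi> \<theta> \<longleftrightarrow>
     (\<exists>f n. is_seq f \<and> is_nat n \<and> Dom f = suc n \<and> ap f emp = \<psi> \<and> ap f n = \<theta> \<and>
        (\<forall>i. i \<in>\<^sub>c n \<longrightarrow> (\<exists>w. is_var w \<and> ap f (suc i) = fAll w (ap f i))))"

definition ax_separation :: "'a \<Rightarrow> bool" where
  "ax_separation \<theta> \<longleftrightarrow> closed_formula \<theta> \<and>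
     (\<exists>\<phi> x a b. formal_formula \<phi> \<and> is_var x \<and> is_var a \<and> is_var b \<and>
        x \<noteq> a \<and> x \<noteq> b \<and> a \<noteq> b \<and> \<not> free_in b \<phi> \<and>
        generalization
          (fAll a (fEx b (fAll x (fIff (fMem x b) (fAnd (fMem x a) \<phi>))))) \<theta>)"

text \<open>
  Axioms contain no parameters, and they have small length since \<open>Z \<Turnstile>\<^sub>f \<theta>\<close> is
  defined for such \<open>\<theta>\<close> only.
\<close>

definition ZC_minus_axiom :: "'a \<Rightarrow> bool" where
  "ZC_minus_axiom \<theta> \<longleftrightarrow> SL emp \<theta> \<and>
     (\<theta> = ax_extensionality \<or> \<theta> = ax_empty_set \<or> \<theta> = ax_pairing \<or> \<theta> = ax_union \<or>
      \<theta> = ax_power_set \<or> \<theta> = ax_infinity \<or> \<theta> = ax_choice \<or> ax_separation \<theta>)"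

end

end

theory Submission
  imports Defs
begin

text \<open>
  Starting from an extensional thin class which includes \<open>X\<close> and contains all its subsets that are
  sets, one iterates a thin power extension \<open>SN\<close> times using (DC).  (Exp) and (Comp) provide
  representatives of all subclasses of a thin class.  Each extension is an end extension with respect
  to membership, because the new elements are tagged by a non-small set which keeps them apart from
  the old ones.  In the union \<open>Z\<close> of the chain, a subclass bounded by some stage has a representative
  in the next stage, which gives union, power set, infinity and choice.

  For separation, formulas are internal objects of possibly nonstandard length.  Those of small length
  have length in \<open>SN\<close>, where induction holds for arbitrary class formulas, so Tarski's clauses determine
  a unique truth class, and the class of all elements of a given \<open>a \<in> Z\<close> satisfying a formula is
  bounded, hence represented.  This needs unique readability of internal words and commutation of
  substitution with the connectives, proved by induction for set formulas.
\<close>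

text \<open>The axiom schemes speak of formulas, while the proof reasons with HOL predicates. The
  judgement \<open>dfn b P\<close> connects the two: \<open>P\<close> is given by a formula with
  parameters, evaluated over all classes if \<open>b\<close> is \<open>True\<close> and over sets
  only if \<open>b\<close> is \<open>False\<close>. The first kind feeds (Class) and (DC), the
  second (Ind).

  This difference is the main obstacle. Induction along an arbitrary internal natural number is
  available for set formulas only; class formulas are restricted to small lengths. Syntax involves
  nonstandard lengths, so it has to be phrased by set formulas. Operations introduced by a
  description, such as \<open>ap\<close>, \<open>cat\<close> and \<open>subst\<close>, have no
  controlled value outside their intended domain; each is paired with a total operation
  (\<open>apx\<close>, \<open>catx\<close>, \<open>substx\<close>) whose graph is a set formula and
  which agrees with it on that domain. Truth in \<open>Z\<close>, by contrast, has the class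
  \<open>Z\<close> as a parameter, and this is why evaluation is confined to formulas of small
  length.\<close>

primrec fvs :: "fm \<Rightarrow> nat set" where
  "fvs (Mem_fm i j) = {i, j}"
| "fvs (Eq_fm i j) = {i, j}"
| "fvs (Neg_fm \<phi>) = fvs \<phi>"
| "fvs (Or_fm \<phi> \<psi>) = fvs \<phi> \<union> fvs \<psi>"
| "fvs (Ex_fm i \<phi>) = fvs \<phi> - {i}"

lemma finite_fvs: "finite (fvs \<phi>)"
  by (induction \<phi>) auto

section \<open>Renaming of variables in metalanguage formulas\<close>

context ths
begin

lemma sat_cong: "(\<And>i. i \<in> fvs \<phi> ==> s i = t i) ==> sat D \<phi> s = sat D \<phi> t"
proof (induction \<phi> arbitrary: s t)
  case (Neg_fm \<phi>)
  have "sat D \<phi> s = sat D \<phi> t"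
    by (rule Neg_fm.IH) (simp add: Neg_fm.prems)
  then show ?case by simp
next
  case (Or_fm \<phi> \<psi>)
  have "sat D \<phi> s = sat D \<phi> t"
    by (rule Or_fm.IH(1)) (simp add: Or_fm.prems)
  moreover have "sat D \<psi> s = sat D \<psi> t"
    by (rule Or_fm.IH(2)) (simp add: Or_fm.prems)
  ultimately show ?case by simp
next
  case (Ex_fm i \<phi>)
  have "sat D \<phi> (s(i := x)) = sat D \<phi> (t(i := x))" for x
    by (rule Ex_fm.IH) (simp add: Ex_fm.prems)
  then show ?case by simp
qed auto

text \<open>The map \<open>r\<close> is arbitrary and may identify variables; this is what later
  merges and rearranges parameters. Under a quantifier the bound variable moves to some
  \<open>k\<close> outside the image of the free variables, so that nothing is captured.\<close>

lemma sat_rename: "\<exists>\<phi>'. \<forall>s. sat D \<phi>' s = sat D \<phi> (\<lambda>i. s (r i))"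
proof (induction \<phi> arbitrary: r)
  case (Mem_fm i j)
  show ?case by (rule exI[of _ "Mem_fm (r i) (r j)"]) simp
next
  case (Eq_fm i j)
  show ?case by (rule exI[of _ "Eq_fm (r i) (r j)"]) simp
next
  case (Neg_fm \<phi>)
  then obtain \<phi>' where "\<forall>s. sat D \<phi>' s = sat D \<phi> (\<lambda>i. s (r i))" by blast
  then show ?case by (intro exI[of _ "Neg_fm \<phi>'"]) simp
next
  case (Or_fm \<phi> \<psi>)
  then obtain \<phi>' \<psi>' where "\<forall>s. sat D \<phi>' s = sat D \<phi> (\<lambda>i. s (r i))"
    "\<forall>s. sat D \<psi>' s = sat D \<psi> (\<lambda>i. s (r i))" by metis
  then show ?case by (intro exI[of _ "Or_fm \<phi>' \<psi>'"]) simp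
next
  case (Ex_fm i \<phi>)
  obtain k where k: "k \<notin> r ` fvs \<phi>"
    using ex_new_if_finite[OF infinite_UNIV_nat] finite_fvs by (metis finite_imageI)
  obtain \<phi>' where \<phi>': "\<forall>s. sat D \<phi>' s = sat D \<phi> (\<lambda>j. s ((r(i := k)) j))"
    using Ex_fm.IH by blast
  have "sat D \<phi>' (s(k := x)) = sat D \<phi> ((\<lambda>j. s (r j))(i := x))" for s x
    unfolding \<phi>'[rule_format] by (rule sat_cong) (use k in auto)
  then show ?case by (intro exI[of _ "Ex_fm k \<phi>'"]) simp
qed

text \<open>Quantification in de Bruijn style, with the new value in front of the assignment, is
  reduced to a named quantifier: the value is stored at a variable \<open>k\<close> above all free
  variables, and these are shifted down by one.\<close>

lemma sat_Ex_shift: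
  "\<exists>\<phi>'. \<forall>s. sat D \<phi>' s \<longleftrightarrow> (\<exists>x\<in>D. sat D \<phi> (case_nat x s))"
proof -
  obtain k where k: "\<forall>i\<in>fvs \<phi>. i < k"
    using finite_nat_set_iff_bounded[of "fvs \<phi>"] finite_fvs by blast
  obtain \<phi>' where \<phi>': "\<forall>s. sat D \<phi>' s = sat D \<phi> (\<lambda>i. s (case_nat k (\<lambda>j. j) i))"
    using sat_rename[of D \<phi> "case_nat k (\<lambda>j. j)"] by blast
  have "sat D \<phi>' (s(k := x)) = sat D \<phi> (case_nat x s)" for s x
    unfolding \<phi>'[rule_format] by (rule sat_cong) (use k in \<open>auto split: nat.splits\<close>)
  then show ?thesis by (intro exI[of _ "Ex_fm k \<phi>'"]) simp
qed


subsection \<open>Definable predicates and operations\<close>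

definition dm :: "bool \<Rightarrow> 'a set" where
  "dm b = (if b then UNIV else {x. is_set x})"

text \<open>Variables sit at even positions and parameters at odd ones. Both supplies are infinite,
  so the parameters of several formulas can be merged without touching the variables.\<close>

definition mix :: "(nat \<Rightarrow> 'a) \<Rightarrow> (nat \<Rightarrow> 'a) \<Rightarrow> nat \<Rightarrow> 'a" where
  "mix s p i = (if even i then s (i div 2) else p (i div 2))"

text \<open>The equivalence is claimed only at assignments into \<open>dm b\<close>; for
  \<open>False\<close> nothing is said about the behaviour of \<open>P\<close> at proper
  classes.\<close>

definition dfn :: "bool \<Rightarrow> ((nat \<Rightarrow> 'a) \<Rightarrow> bool) \<Rightarrow> bool" where
  "dfn b P \<longleftrightarrow> (\<exists>\<phi> p. (\<forall>i. p i \<in> dm b) \<and>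
     (\<forall>s. (\<forall>i. s i \<in> dm b) --> P s = sat (dm b) \<phi> (mix s p)))"

text \<open>A definable operation is one with a definable graph, variable 0 being the value. It must
  not leave \<open>dm b\<close>, since otherwise a quantifier over sets could not reach the
  value.\<close>

definition dft :: "bool \<Rightarrow> ((nat \<Rightarrow> 'a) \<Rightarrow> 'a) \<Rightarrow> bool" where
  "dft b t \<longleftrightarrow> (\<forall>s. (\<forall>i. s i \<in> dm b) --> t s \<in> dm b) \<and> dfn b (\<lambda>s. s 0 = t (\<lambda>i. s (Suc i)))"

lemma mix_simps [simp]: "mix s p (2 * i) = s i" "mix s p (Suc (2 * i)) = p i" "mix s p 0 = s 0"
  by (auto simp: mix_def)

lemma dm_True [simp]: "dm True = UNIV" by (simp add: dm_def)
lemma dm_False [simp]: "x \<in> dm False \<longleftrightarrow> is_set x" by (simp add: dm_def)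

lemma emp_in_dm [simp]: "emp \<in> dm b"
  using Set_emp by (simp add: dm_def)

lemma dfn_cong:
  assumes "dfn b P" "\<And>s. (\<forall>i. s i \<in> dm b) ==> P s = Q s" shows "dfn b Q"
proof -
  obtain \<phi> p where "\<forall>i. p i \<in> dm b" "\<forall>s. (\<forall>i. s i \<in> dm b) --> P s = sat (dm b) \<phi> (mix s p)"
    using assms(1) unfolding dfn_def by blast
  then show ?thesis unfolding dfn_def
    by (intro exI[of _ \<phi>] exI[of _ p]) (simp add: assms(2))
qed

text \<open>Renaming combined with freezing: variables mapped by \<open>Inl\<close> are renamed,
  those mapped by \<open>Inr\<close> turn into parameters.\<close>

lemma dfn_subst_par:
  assumes P: "dfn b P" and g: "\<And>i c. g i = Inr c ==> c \<in> dm b"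
  shows "dfn b (\<lambda>s. P (\<lambda>i. case g i of Inl j \<Rightarrow> s j | Inr c \<Rightarrow> c))"
proof -
  obtain \<phi> p where p: "(\<forall>i. p i \<in> dm b)"
    and \<phi>: "\<And>s. (\<forall>i. s i \<in> dm b) ==> P s = sat (dm b) \<phi> (mix s p)"
    using P unfolding dfn_def by blast
  define q where "q = mix (\<lambda>i. case g i of Inl j \<Rightarrow> emp | Inr c \<Rightarrow> c) p"
  define r where "r n = (if even n then (case g (n div 2) of Inl j \<Rightarrow> 2 * j | Inr c \<Rightarrow> Suc (2 * n))
     else Suc (2 * n))" for n
  obtain \<phi>' where \<phi>': "\<forall>s. sat (dm b) \<phi>' s = sat (dm b) \<phi> (\<lambda>i. s (r i))"
    using sat_rename by blast
  have q: "(\<forall>i. q i \<in> dm b)"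
    using p g by (auto simp: q_def mix_def split: sum.splits)
  show ?thesis unfolding dfn_def
  proof (intro exI[of _ \<phi>'] exI[of _ q] conjI q allI impI)
    fix s :: "nat \<Rightarrow> 'a" assume s: "(\<forall>i. s i \<in> dm b)"
    let ?t = "\<lambda>i. case g i of Inl j \<Rightarrow> s j | Inr c \<Rightarrow> c"
    have "(\<forall>i. ?t i \<in> dm b)" using s g by (auto split: sum.splits)
    then have "P ?t = sat (dm b) \<phi> (mix ?t p)" by (rule \<phi>)
    also have "mix ?t p = (\<lambda>i. mix s q (r i))"
    proof
      fix n
      show "mix ?t p n = mix s q (r n)"
      proof (cases "even n")
        case True
        then obtain k where "n = 2 * k" by auto
        then show ?thesis by (auto simp: r_def q_def mix_def split: sum.splits)
      next
        case False
        then obtain k where n: "n = Suc (2 * k)" by (auto elim: oddE)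
        then show ?thesis by (simp add: r_def q_def del: mult_Suc_right)
      qed
    qed
    finally show "P ?t = sat (dm b) \<phi>' (mix s q)" using \<phi>' by simp
  qed
qed

lemma dfn_rename: "dfn b P ==> dfn b (\<lambda>s. P (\<lambda>i. s (f i)))"
  using dfn_subst_par[of b P "\<lambda>i. Inl (f i)"] by simp

lemma dfn_fix:
  assumes "dfn b (\<lambda>s. P (\<lambda>i. s (Suc i)) (s 0))" "(\<forall>i. t i \<in> dm b)"
  shows "dfn b (\<lambda>s. P t (s 0))"
proof -
  let ?g = "case_nat (Inl 0) (\<lambda>i. Inr (t i)) :: nat \<Rightarrow> nat + 'a"
  have "c \<in> dm b" if "?g i = Inr c" for i c
    using that assms(2) by (auto split: nat.splits)
  with assms(1) have "dfn b (\<lambda>s. P (\<lambda>i. case ?g (Suc i) of Inl j \<Rightarrow> s j | Inr c \<Rightarrow> c)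
      (case ?g 0 of Inl j \<Rightarrow> s j | Inr c \<Rightarrow> c))"
    by (rule dfn_subst_par[of b "\<lambda>s. P (\<lambda>i. s (Suc i)) (s 0)" ?g])
  then show ?thesis by (simp only: nat.case sum.case)
qed

lemma dfn_const: "dfn b (\<lambda>s. Q)"
proof (cases Q)
  case True
  then show ?thesis unfolding dfn_def
    by (intro exI[of _ "Eq_fm 0 0"] exI[of _ "\<lambda>_. emp"]) simp
next
  case False
  then show ?thesis unfolding dfn_def
    by (intro exI[of _ "Neg_fm (Eq_fm 0 0)"] exI[of _ "\<lambda>_. emp"]) simp
qed

lemma dfn_not: "dfn b P ==> dfn b (\<lambda>s. \<not> P s)"
  unfolding dfn_def
proof (elim exE conjE)
  fix \<phi> p
  assume "\<forall>i. p i \<in> dm b" "\<forall>s. (\<forall>i. s i \<in> dm b) --> P s = sat (dm b) \<phi> (mix s p)"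
  then show "\<exists>\<phi> p. (\<forall>i. p i \<in> dm b) \<and> (\<forall>s. (\<forall>i. s i \<in> dm b) --> (\<not> P s) = sat (dm b) \<phi> (mix s p))"
    by (intro exI[of _ "Neg_fm \<phi>"] exI[of _ p]) simp
qed

lemma dfn_disj:
  assumes "dfn b P" "dfn b Q" shows "dfn b (\<lambda>s. P s \<or> Q s)"
proof -
  obtain \<phi> p where p: "(\<forall>i. p i \<in> dm b)"
    and \<phi>: "\<And>s. (\<forall>i. s i \<in> dm b) ==> P s = sat (dm b) \<phi> (mix s p)"
    using assms unfolding dfn_def by blast
  obtain \<psi> q where q: "(\<forall>i. q i \<in> dm b)"
    and \<psi>: "\<And>s. (\<forall>i. s i \<in> dm b) ==> Q s = sat (dm b) \<psi> (mix s q)"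
    using assms unfolding dfn_def by blast
  define r where "r = mix p q"
  \<comment> \<open>Parameter number k of \<open>P\<close> becomes number 2k of the merged sequence,
    and that of \<open>Q\<close> becomes number 2k + 1.\<close>
  define f where "f n = (if even n then n else Suc (2 * (2 * (n div 2))))" for n :: nat
  define g where "g n = (if even n then n else Suc (2 * (Suc (2 * (n div 2)))))" for n :: nat
  have f: "mix s r (f n) = mix s p n" for s n
  proof (cases "even n")
    case True
    then show ?thesis by (simp add: f_def mix_def)
  next
    case False
    then obtain k where n: "n = Suc (2 * k)" by (auto elim: oddE)
    then have "f n = Suc (2 * (2 * k))" by (simp add: f_def)
    then have "mix s r (f n) = r (2 * k)" by (simp only: mix_simps)
    then show ?thesis by (simp only: n mix_simps r_def)
  qed
  have g: "mix s r (g n) = mix s q n" for s n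
  proof (cases "even n")
    case True
    then show ?thesis by (simp add: g_def mix_def)
  next
    case False
    then obtain k where n: "n = Suc (2 * k)" by (auto elim: oddE)
    then have "g n = Suc (2 * (Suc (2 * k)))" by (simp add: g_def)
    then have "mix s r (g n) = r (Suc (2 * k))" by (simp only: mix_simps)
    then show ?thesis by (simp only: n mix_simps r_def)
  qed
  obtain \<phi>' where \<phi>': "\<forall>s. sat (dm b) \<phi>' s = sat (dm b) \<phi> (\<lambda>i. s (f i))"
    using sat_rename by blast
  obtain \<psi>' where \<psi>': "\<forall>s. sat (dm b) \<psi>' s = sat (dm b) \<psi> (\<lambda>i. s (g i))"
    using sat_rename by blast
  have r: "(\<forall>i. r i \<in> dm b)" using p q by (auto simp: r_def mix_def)
  show ?thesis unfolding dfn_def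
    by (intro exI[of _ "Or_fm \<phi>' \<psi>'"] exI[of _ r] conjI r) (simp add: \<phi> \<psi> \<phi>' \<psi>' f g)
qed

lemma dfn_conj:
  assumes "dfn b P" "dfn b Q" shows "dfn b (\<lambda>s. P s \<and> Q s)"
  by (rule dfn_cong[OF dfn_not[OF dfn_disj[OF dfn_not[OF assms(1)] dfn_not[OF assms(2)]]]]) blast

lemma dfn_imp:
  assumes "dfn b P" "dfn b Q" shows "dfn b (\<lambda>s. P s --> Q s)"
  by (rule dfn_cong[OF dfn_disj[OF dfn_not[OF assms(1)] assms(2)]]) blast

lemma dfn_iff:
  assumes "dfn b P" "dfn b Q" shows "dfn b (\<lambda>s. P s \<longleftrightarrow> Q s)"
  by (rule dfn_cong[OF dfn_conj[OF dfn_imp[OF assms] dfn_imp[OF assms(2,1)]]]) blast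

lemma dfn_bex:
  assumes "dfn b (\<lambda>s. P (\<lambda>i. s (Suc i)) (s 0))"
  shows "dfn b (\<lambda>s. \<exists>x\<in>dm b. P s x)"
proof -
  obtain \<phi> p where p: "(\<forall>i. p i \<in> dm b)"
    and \<phi>: "\<And>s. (\<forall>i. s i \<in> dm b) ==> P (\<lambda>i. s (Suc i)) (s 0) = sat (dm b) \<phi> (mix s p)"
    using assms unfolding dfn_def by blast
  \<comment> \<open>Prepending a value to \<open>s\<close> moves only the even positions of the
    mixture, by two; prepending it to the mixture moves every position by one. The map
    \<open>f\<close> converts the first layout into the second.\<close>
  define f where "f n = (if n = 0 then 0 else if even n then n - 1 else Suc n)" for n :: nat
  obtain \<phi>1 where \<phi>1: "\<forall>s. sat (dm b) \<phi>1 s = sat (dm b) \<phi> (\<lambda>i. s (f i))"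
    using sat_rename by blast
  obtain \<phi>2 where \<phi>2: "\<forall>s. sat (dm b) \<phi>2 s \<longleftrightarrow> (\<exists>x\<in>dm b. sat (dm b) \<phi>1 (case_nat x s))"
    using sat_Ex_shift by blast
  have f: "case_nat x (mix s p) (f n) = mix (case_nat x s) p n" for s x n
  proof (cases "even n")
    case True
    show ?thesis
    proof (cases "n = 0")
      case False
      then obtain k where "n = 2 * Suc k" using True by (metis dvd_def mult_0_right not0_implies_Suc)
      then show ?thesis by (simp add: f_def mix_def)
    qed (simp add: f_def mix_def)
  next
    case False
    then obtain k where n: "n = Suc (2 * k)" by (auto elim: oddE)
    then show ?thesis by (simp add: f_def)
  qed
  show ?thesis unfolding dfn_def
  proof (intro exI[of _ \<phi>2] exI[of _ p] conjI p allI impI)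
    fix s :: "nat \<Rightarrow> 'a" assume s: "(\<forall>i. s i \<in> dm b)"
    have "P s x = sat (dm b) \<phi>1 (case_nat x (mix s p))" if "x \<in> dm b" for x
    proof -
      have "(\<forall>i. (case_nat x s) i \<in> dm b)" using s that by (auto split: nat.splits)
      from \<phi>[OF this] show ?thesis by (simp add: \<phi>1 f)
    qed
    then show "(\<exists>x\<in>dm b. P s x) = sat (dm b) \<phi>2 (mix s p)"
      by (simp add: \<phi>2)
  qed
qed

lemma dfn_ball:
  "dfn b (\<lambda>s. P (\<lambda>i. s (Suc i)) (s 0)) ==> dfn b (\<lambda>s. \<forall>x\<in>dm b. P s x)"
  using dfn_not[OF dfn_bex[of b "\<lambda>s x. \<not> P s x"]] dfn_not[of b "\<lambda>s. P (\<lambda>i. s (Suc i)) (s 0)"]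
  by simp

lemma dfn_ex: "dfn True (\<lambda>s. P (\<lambda>i. s (Suc i)) (s 0)) ==> dfn True (\<lambda>s. \<exists>x. P s x)"
  using dfn_bex[of True P] by simp

lemma dfn_all: "dfn True (\<lambda>s. P (\<lambda>i. s (Suc i)) (s 0)) ==> dfn True (\<lambda>s. \<forall>x. P s x)"
  using dfn_ball[of True P] by simp

lemma dft_var: "dft b (\<lambda>s. s i)"
proof -
  have "dfn b (\<lambda>s. s 0 = s (Suc i))" unfolding dfn_def
    by (intro exI[of _ "Eq_fm 0 (2 * Suc i)"] exI[of _ "\<lambda>_. emp"]) (simp del: mult_Suc_right)
  then show ?thesis by (auto simp: dft_def)
qed

lemma dft_const: "c \<in> dm b ==> dft b (\<lambda>s. c)"
proof -
  assume c: "c \<in> dm b"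
  have "dfn b (\<lambda>s. s 0 = c)" unfolding dfn_def
    by (intro exI[of _ "Eq_fm 0 (Suc 0)"] exI[of _ "\<lambda>_. c"]) (simp add: c mix_def)
  with c show "dft b (\<lambda>s. c)" by (simp add: dft_def)
qed

lemma dft_const_True: "dft True (\<lambda>s. c)"
  by (simp add: dft_const)

lemma dft_const_set: "is_set c ==> dft b (\<lambda>s. c)"
  by (rule dft_const) (simp add: dm_def)

lemma dft_rename:
  assumes t: "dft b t" shows "dft b (\<lambda>s. t (\<lambda>i. s (f i)))"
proof -
  have "t (\<lambda>i. s (f i)) \<in> dm b" if "\<forall>i. s i \<in> dm b" for s
  proof -
    have "\<forall>i. s (f i) \<in> dm b" using that by simp
    then show ?thesis using t unfolding dft_def by (elim conjE allE[of _ "\<lambda>i. s (f i)"]) simp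
  qed
  moreover have "dfn b (\<lambda>s. s 0 = t (\<lambda>i. s (Suc (f i))))"
    using dfn_rename[OF conjunct2[OF t[unfolded dft_def]], of "case_nat 0 (\<lambda>i. Suc (f i))"] by simp
  ultimately show ?thesis unfolding dft_def by simp
qed

text \<open>Substitution of a definable operation goes through its graph: some \<open>x\<close> in
  the domain equals \<open>t s\<close> and satisfies \<open>P\<close>.\<close>

lemma dfn_comp:
  assumes t: "dft b t" and P: "dfn b (\<lambda>s. P (\<lambda>i. s (Suc i)) (s 0))"
  shows "dfn b (\<lambda>s. P s (t s))"
proof (rule dfn_cong)
  show "dfn b (\<lambda>s. \<exists>x\<in>dm b. x = t s \<and> P s x)"
    by (rule dfn_bex, rule dfn_conj[OF _ P]) (use t in \<open>simp add: dft_def\<close>)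
  show "(\<exists>x\<in>dm b. x = t s \<and> P s x) = P s (t s)" if "(\<forall>i. s i \<in> dm b)" for s
    using t that by (auto simp: dft_def)
qed

lemma dfn_comp1:
  assumes P: "dfn b (\<lambda>s. P (s 0))" and t: "dft b t"
  shows "dfn b (\<lambda>s. P (t s))"
  by (rule dfn_comp[OF t]) (rule P)

lemma dfn_comp2:
  assumes P: "dfn b (\<lambda>s. P (s 0) (s (Suc 0)))" and t: "dft b t" and u: "dft b u"
  shows "dfn b (\<lambda>s. P (t s) (u s))"
proof (rule dfn_comp[OF t], rule dfn_comp[OF dft_rename[OF u]])
  show "dfn b (\<lambda>s. P (s (Suc 0)) (s 0))"
    using dfn_rename[OF P, of "\<lambda>i. if i = 0 then Suc 0 else 0"] by simp
qed

lemma dfn_comp3: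
  assumes P: "dfn b (\<lambda>s. P (s 0) (s (Suc 0)) (s (Suc (Suc 0))))"
    and t: "dft b t" and u: "dft b u" and v: "dft b v"
  shows "dfn b (\<lambda>s. P (t s) (u s) (v s))"
proof (rule dfn_comp[OF t], rule dfn_comp[OF dft_rename[OF u]], rule dfn_comp[OF dft_rename[OF v, of "\<lambda>i. Suc (Suc i)"]])
  show "dfn b (\<lambda>s. P (s (Suc (Suc 0))) (s (Suc 0)) (s 0))"
    using dfn_rename[OF P, of "\<lambda>i. if i = 0 then Suc (Suc 0) else if i = Suc 0 then Suc 0 else 0"] by simp
qed


section \<open>Rules for definability that follow the shape of a predicate\<close>

named_theorems dfn_intros

lemma mem_set: "x \<in>\<^sub>c Y ==> is_set x"
  by (auto simp: is_set_def)

lemma cext: "(\<And>z. is_set z ==> z \<in>\<^sub>c X \<longleftrightarrow> z \<in>\<^sub>c Y) ==> X = Y"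
  using Ext by blast

lemma dfn_mem_vars: "dfn b (\<lambda>s. s i \<in>\<^sub>c s j)"
  unfolding dfn_def
  by (intro exI[of _ "Mem_fm (2 * i) (2 * j)"] exI[of _ "\<lambda>_. emp"]) simp

lemma dfn_eq_vars: "dfn b (\<lambda>s. s i = s j)"
  unfolding dfn_def
  by (intro exI[of _ "Eq_fm (2 * i) (2 * j)"] exI[of _ "\<lambda>_. emp"]) simp

lemma dfn_mem: "dft b t ==> dft b u ==> dfn b (\<lambda>s. t s \<in>\<^sub>c u s)"
  by (rule dfn_comp2[where P = "(\<in>\<^sub>c)", OF dfn_mem_vars])

lemma dfn_eq: "dft b t ==> dft b u ==> dfn b (\<lambda>s. t s = u s)"
  by (rule dfn_comp2[where P = "(=)", OF dfn_eq_vars])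

lemma dfn_is_set_var: "dfn b (\<lambda>s. is_set (s i))"
proof (cases b)
  case True
  have "dfn True (\<lambda>s. \<exists>x. s i \<in>\<^sub>c x)"
    by (rule dfn_ex[where P = "\<lambda>s x. s i \<in>\<^sub>c x"]) (rule dfn_mem_vars)
  then show ?thesis using True by (simp add: is_set_def)
next
  case False
  show ?thesis by (rule dfn_cong[OF dfn_const[of _ True]]) (use False in \<open>simp add: dm_def\<close>)
qed

lemma dfn_is_set: "dft b t ==> dfn b (\<lambda>s. is_set (t s))"
  by (rule dfn_comp1[where P = is_set, OF dfn_is_set_var])

text \<open>The guard \<open>is_set\<close> makes the quantifier usable under both flags. For this
  reason many statements below carry explicit guards or quantify by membership: the same text then
  counts as a class formula and as a set formula.\<close>

lemma dfn_ex_set: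
  assumes "dfn b (\<lambda>s. P (\<lambda>i. s (Suc i)) (s 0))"
  shows "dfn b (\<lambda>s. \<exists>x. is_set x \<and> P s x)"
proof -
  have "dfn b (\<lambda>s. \<exists>x\<in>dm b. is_set x \<and> P s x)"
    by (rule dfn_bex, rule dfn_conj[OF dfn_is_set_var assms])
  then show ?thesis by (rule dfn_cong) (auto simp: dm_def)
qed

lemma dfn_ex_mem:
  assumes "dft b t" "dfn b (\<lambda>s. P (\<lambda>i. s (Suc i)) (s 0))"
  shows "dfn b (\<lambda>s. \<exists>x. x \<in>\<^sub>c t s \<and> P s x)"
proof -
  have "dfn b (\<lambda>s. \<exists>x. is_set x \<and> x \<in>\<^sub>c t s \<and> P s x)"
    by (rule dfn_ex_set, rule dfn_conj[OF dfn_mem[OF dft_var dft_rename[OF assms(1)]] assms(2)])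
  then show ?thesis by (rule dfn_cong) (blast dest: mem_set)
qed

lemma dfn_all_set:
  assumes "dfn b (\<lambda>s. P (\<lambda>i. s (Suc i)) (s 0))"
  shows "dfn b (\<lambda>s. \<forall>x. is_set x --> P s x)"
  by (rule dfn_cong[OF dfn_not[OF dfn_ex_set[OF dfn_not[OF assms]]]]) blast

lemma dfn_all_mem:
  assumes "dft b t" "dfn b (\<lambda>s. P (\<lambda>i. s (Suc i)) (s 0))"
  shows "dfn b (\<lambda>s. \<forall>x. x \<in>\<^sub>c t s --> P s x)"
  by (rule dfn_cong[OF dfn_not[OF dfn_ex_mem[OF assms(1) dfn_not[OF assms(2)]]]]) blast

lemma dft_comp1:
  assumes "dft b (\<lambda>s. F (s 0))" "dft b t"
  shows "dft b (\<lambda>s. F (t s))"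
proof -
  have "dfn b (\<lambda>s. s 0 = F (t (\<lambda>i. s (Suc i))))"
    by (rule dfn_comp2[OF _ dft_var dft_rename[OF assms(2)], of "\<lambda>x y. x = F y"])
      (use assms(1) in \<open>simp add: dft_def\<close>)
  moreover have "F (t s) \<in> dm b" if "\<forall>i. s i \<in> dm b" for s
  proof -
    have "t s \<in> dm b" using assms(2) that by (simp add: dft_def)
    then show ?thesis using assms(1) unfolding dft_def by (elim conjE allE[of _ "\<lambda>_. t s"]) simp
  qed
  ultimately show ?thesis by (simp add: dft_def)
qed

lemma dft_comp2:
  assumes "dft b (\<lambda>s. F (s 0) (s (Suc 0)))" "dft b t" "dft b u"
  shows "dft b (\<lambda>s. F (t s) (u s))"
proof -
  have "dfn b (\<lambda>s. s 0 = F (t (\<lambda>i. s (Suc i))) (u (\<lambda>i. s (Suc i))))"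
    by (rule dfn_comp3[OF _ dft_var dft_rename[OF assms(2)] dft_rename[OF assms(3)], of "\<lambda>x y z. x = F y z"])
      (use assms(1) in \<open>simp add: dft_def\<close>)
  moreover have "F (t s) (u s) \<in> dm b" if "\<forall>i. s i \<in> dm b" for s
  proof -
    have "t s \<in> dm b" "u s \<in> dm b" using assms(2,3) that by (simp_all add: dft_def)
    then show ?thesis using assms(1) unfolding dft_def
      by (elim conjE allE[of _ "case_nat (t s) (\<lambda>_. u s)"]) (simp split: nat.splits)
  qed
  ultimately show ?thesis by (simp add: dft_def)
qed

lemma dft_comp3:
  assumes "dft b (\<lambda>s. F (s 0) (s (Suc 0)) (s (Suc (Suc 0))))" "dft b t" "dft b u" "dft b v"
  shows "dft b (\<lambda>s. F (t s) (u s) (v s))"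
proof -
  have 1: "dfn b (\<lambda>s. s 0 = F (s (Suc 0)) (s (Suc (Suc 0))) (v (\<lambda>i. s (Suc (Suc (Suc i))))))"
  proof (rule dfn_comp[OF dft_rename[OF assms(4), of "\<lambda>i. Suc (Suc (Suc i))"], where P = "\<lambda>s x. s 0 = F (s (Suc 0)) (s (Suc (Suc 0))) x"])
    have "dfn b (\<lambda>s. s 0 = F (s (Suc 0)) (s (Suc (Suc 0))) (s (Suc (Suc (Suc 0)))))"
      using assms(1) by (simp add: dft_def)
    from dfn_rename[OF this, of "\<lambda>i. if i = Suc (Suc (Suc 0)) then 0 else Suc i"]
    show "dfn b (\<lambda>s. s (Suc 0) = F (s (Suc (Suc 0))) (s (Suc (Suc (Suc 0)))) (s 0))" by simp
  qed
  have "dfn b (\<lambda>s. s 0 = F (t (\<lambda>i. s (Suc i))) (u (\<lambda>i. s (Suc i))) (v (\<lambda>i. s (Suc i))))"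
  proof (rule dfn_comp[OF dft_rename[OF assms(2), of Suc], where P = "\<lambda>s x. s 0 = F x (u (\<lambda>i. s (Suc i))) (v (\<lambda>i. s (Suc i)))"],
      rule dfn_comp[OF dft_rename[OF assms(3), of "\<lambda>i. Suc (Suc i)"], where P = "\<lambda>s x. s (Suc 0) = F (s 0) x (v (\<lambda>i. s (Suc (Suc i))))"])
    show "dfn b (\<lambda>s. s (Suc (Suc 0)) = F (s (Suc 0)) (s 0) (v (\<lambda>i. s (Suc (Suc (Suc i))))))"
      using dfn_rename[OF 1, of "\<lambda>i. if i = 0 then Suc (Suc 0) else if i = Suc 0 then Suc 0 else if i = Suc (Suc 0) then 0 else i"]
      by simp
  qed
  moreover have "F (t s) (u s) (v s) \<in> dm b" if "\<forall>i. s i \<in> dm b" for s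
  proof -
    have "t s \<in> dm b" "u s \<in> dm b" "v s \<in> dm b" using assms(2-4) that by (simp_all add: dft_def)
    then show ?thesis using assms(1) unfolding dft_def
      by (elim conjE allE[of _ "case_nat (t s) (case_nat (u s) (\<lambda>_. v s))"]) (simp split: nat.splits)
  qed
  ultimately show ?thesis by (simp add: dft_def)
qed

lemmas [dfn_intros] =
  dfn_const dfn_not dfn_disj dfn_conj dfn_imp dfn_iff dfn_ex dfn_all
  dfn_ex_set dfn_ex_mem dfn_all_set dfn_all_mem dfn_mem dfn_eq dfn_is_set dft_var

text \<open>By extensionality the graph is definable as soon as membership in the value is.\<close>

lemma dftI_ext:
  assumes "\<And>s. \<forall>i. s i \<in> dm b ==> t s \<in> dm b"
    and "\<And>s y. \<forall>i. s i \<in> dm b ==> y \<in>\<^sub>c t s \<longleftrightarrow> is_set y \<and> Q s y"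
    and "dfn b (\<lambda>s. Q (\<lambda>i. s (Suc i)) (s 0))"
  shows "dft b t"
proof -
  have "dfn b (\<lambda>s. Q (\<lambda>i. s (Suc (Suc i))) (s 0))"
    using dfn_rename[OF assms(3), of "case_nat 0 (\<lambda>i. Suc (Suc i))"] by simp
  then have "dfn b (\<lambda>s. \<forall>y. is_set y --> (y \<in>\<^sub>c s 0 \<longleftrightarrow> Q (\<lambda>i. s (Suc i)) y))"
    by (intro dfn_intros)
  then have "dfn b (\<lambda>s. s 0 = t (\<lambda>i. s (Suc i)))"
  proof (rule dfn_cong)
    fix s :: "nat \<Rightarrow> 'a" assume "\<forall>i. s i \<in> dm b"
    then have "\<forall>i. s (Suc i) \<in> dm b" by blast
    note m = assms(2)[OF this]
    show "(\<forall>y. is_set y --> (y \<in>\<^sub>c s 0 \<longleftrightarrow> Q (\<lambda>i. s (Suc i)) y)) = (s 0 = t (\<lambda>i. s (Suc i)))"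
    proof
      assume "\<forall>y. is_set y --> (y \<in>\<^sub>c s 0 \<longleftrightarrow> Q (\<lambda>i. s (Suc i)) y)"
      then show "s 0 = t (\<lambda>i. s (Suc i))" by (intro cext) (simp add: m)
    qed (simp add: m)
  qed
  with assms(1) show ?thesis by (simp add: dft_def)
qed

text \<open>The class parameters of \<open>P\<close> sit in the odd variables of the formula.\<close>

lemma comprehension:
  assumes "dfn True (\<lambda>s. P (s 0))"
  shows "\<exists>Y. \<forall>y. y \<in>\<^sub>c Y \<longleftrightarrow> is_set y \<and> P y"
proof -
  obtain \<phi> p where \<phi>: "\<And>s. P (s 0) = class_sat \<phi> (mix s p)"
    using assms unfolding dfn_def by auto
  obtain \<phi>' where \<phi>': "\<forall>s. class_sat \<phi>' s = class_sat \<phi> (\<lambda>i. s (if even i then 0 else i))"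
    using sat_rename[of UNIV \<phi> "\<lambda>i. if even i then 0 else i"] by blast
  obtain Y where Y: "\<forall>y. is_set y --> (y \<in>\<^sub>c Y \<longleftrightarrow> class_sat \<phi>' ((mix p p)(0 := y)))"
    using Class by blast
  have "class_sat \<phi>' ((mix p p)(0 := y)) = P y" for y
  proof -
    have "(\<lambda>i. ((mix p p)(0 := y)) (if even i then 0 else i)) = mix (\<lambda>_. y) p"
      by (auto simp: mix_def)
    then have "class_sat \<phi>' ((mix p p)(0 := y)) = class_sat \<phi> (mix (\<lambda>_. y) p)"
      by (simp only: \<phi>')
    then show ?thesis using \<phi>[of "\<lambda>_. y"] by simp
  qed
  then show ?thesis using Y mem_set by blast
qed

lemma mem_cls:
  assumes "dfn True (\<lambda>s. P (s 0))"
  shows "y \<in>\<^sub>c cls P \<longleftrightarrow> is_set y \<and> P y"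
proof -
  have "\<exists>!Y. \<forall>y. y \<in>\<^sub>c Y \<longleftrightarrow> is_set y \<and> P y"
    using comprehension[OF assms] by (auto intro: cext)
  from theI'[OF this] show ?thesis unfolding cls_def by blast
qed

lemma mem_cls_iff:
  assumes "dfn True (\<lambda>s. P (s 0))" "is_set y \<and> P y \<longleftrightarrow> Q"
  shows "y \<in>\<^sub>c cls P \<longleftrightarrow> Q"
  using mem_cls[OF assms(1)] assms(2) by blast

lemma set_ind:
  assumes "dfn False (\<lambda>s. P (s 0))"
    and "P emp" "\<And>x y. is_set x ==> is_set y ==> P x ==> P y ==> P (adj x y)"
    and "is_set x"
  shows "P x"
proof -
  obtain \<phi> p where p: "\<forall>i. is_set (p i)"
    and \<phi>: "\<And>s. (\<forall>i. is_set (s i)) ==> P (s 0) = set_sat \<phi> (mix s p)"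
    using assms(1) unfolding dfn_def by (auto simp: dm_def)
  \<comment> \<open>The predicate depends on variable 0 alone, so all even variables may be
    identified with it. The single update performed by (Ind) then sets all of them, while the odd
    positions keep the parameters.\<close>
  obtain \<phi>' where \<phi>': "\<forall>s. set_sat \<phi>' s = set_sat \<phi> (\<lambda>i. s (if even i then 0 else i))"
    using sat_rename[of "{x. is_set x}" \<phi> "\<lambda>i. if even i then 0 else i"] by blast
  have *: "set_sat \<phi>' ((mix p p)(0 := y)) = P y" if "is_set y" for y
  proof -
    have "(\<lambda>i. ((mix p p)(0 := y)) (if even i then 0 else i)) = mix (\<lambda>_. y) p"
      by (auto simp: mix_def)
    then have "set_sat \<phi>' ((mix p p)(0 := y)) = set_sat \<phi> (mix (\<lambda>_. y) p)"
      by (simp only: \<phi>')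
    then show ?thesis using \<phi>[of "\<lambda>_. y"] that by simp
  qed
  have "\<forall>i. is_set (mix p p i)" using p by (simp add: mix_def)
  then have "\<forall>x. is_set x --> set_sat \<phi>' ((mix p p)(0 := x))"
    by (rule Ind[THEN mp, THEN mp]) (auto simp: * Set_emp Set_adj assms(2,3))
  then show ?thesis using * assms(4) by blast
qed

lemma dependent_choice:
  assumes "dfn True (\<lambda>s. R (s 0) (s (Suc 0)))" "\<And>X. \<exists>Y. R X Y"
  shows "\<exists>Z. Z ``\<^sub>c sing emp = X \<and>
    (\<forall>n. n \<in>\<^sub>c SN --> R (Z ``\<^sub>c sing n) (Z ``\<^sub>c sing (suc n)))"
proof -
  obtain \<phi> p where \<phi>: "\<And>s. R (s 0) (s (Suc 0)) = class_sat \<phi> (mix s p)"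
    using assms(1) unfolding dfn_def by auto
  \<comment> \<open>Variables 0 and 1 carry the two classes related by (DC). Positive even positions
    are therefore read as 1, and the odd positions, which hold parameters, move up by two;
    \<open>q\<close> undoes this move.\<close>
  define r where "r i = (if i = 0 then 0 else if even i then Suc 0 else i + 2)" for i :: nat
  obtain \<phi>' where \<phi>': "\<forall>s. class_sat \<phi>' s = class_sat \<phi> (\<lambda>i. s (r i))"
    using sat_rename by blast
  define q where "q i = p ((i - 2) div 2)" for i :: nat
  have *: "class_sat \<phi>' (q(0 := X, 1 := Y)) = R X Y" for X Y
  proof -
    have "(\<lambda>i. (q(0 := X, 1 := Y)) (r i)) = mix (\<lambda>i. if i = 0 then X else Y) p"
    proof
      fix i :: nat
      show "(q(0 := X, 1 := Y)) (r i) = mix (\<lambda>i. if i = 0 then X else Y) p i"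
      proof (cases "even i")
        case True
        then obtain k where "i = 2 * k" by auto
        then show ?thesis by (simp add: r_def mix_def)
      next
        case False
        then have "i \<noteq> 0" "r i = i + 2" by (auto simp: r_def odd_pos)
        then show ?thesis using False by (auto simp: q_def mix_def)
      qed
    qed
    then have "class_sat \<phi>' (q(0 := X, 1 := Y)) = class_sat \<phi> (mix (\<lambda>i. if i = 0 then X else Y) p)"
      by (simp only: \<phi>')
    then show ?thesis using \<phi>[of "\<lambda>i. if i = 0 then X else Y"] by simp
  qed
  have "\<forall>X. \<exists>Y. class_sat \<phi>' (q(0 := X, 1 := Y))"
    using assms(2) by (simp only: *) blast
  from DC[rule_format, OF spec[OF this], of X] show ?thesis by (simp only: *)
qed


subsection \<open>Elementary operations\<close>

lemma not_mem_emp [simp]: "\<not> z \<in>\<^sub>c emp"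
  by (simp add: emp_def mem_cls[OF dfn_const])

lemma mem_adj: "z \<in>\<^sub>c adj x y \<longleftrightarrow> z \<in>\<^sub>c x \<or> is_set y \<and> z = y"
  unfolding adj_def by (rule mem_cls_iff) (intro dfn_intros dft_const_True, auto dest: mem_set)

lemma mem_inter [simp]: "z \<in>\<^sub>c X \<inter>\<^sub>c Y \<longleftrightarrow> z \<in>\<^sub>c X \<and> z \<in>\<^sub>c Y"
  unfolding inter_def by (rule mem_cls_iff) (intro dfn_intros dft_const_True, auto dest: mem_set)

lemma mem_union_of [simp]: "z \<in>\<^sub>c \<Union>\<^sub>c X \<longleftrightarrow> (\<exists>y. y \<in>\<^sub>c X \<and> z \<in>\<^sub>c y)"
  unfolding union_of_def by (rule mem_cls_iff) (intro dfn_intros dft_const_True, auto dest: mem_set)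

lemma mem_upair: "z \<in>\<^sub>c upair a b \<longleftrightarrow> is_set z \<and> (z = a \<or> z = b)"
  unfolding upair_def by (rule mem_cls_iff) (intro dfn_intros dft_const_True, auto dest: mem_set)

definition bun :: "'a \<Rightarrow> 'a \<Rightarrow> 'a" where
  "bun x y = cls (\<lambda>z. z \<in>\<^sub>c x \<or> z \<in>\<^sub>c y)"

definition dif :: "'a \<Rightarrow> 'a \<Rightarrow> 'a" where
  "dif x y = cls (\<lambda>z. z \<in>\<^sub>c x \<and> \<not> z \<in>\<^sub>c y)"

definition pow :: "'a \<Rightarrow> 'a" where
  "pow x = cls (\<lambda>z. z \<subseteq>\<^sub>c x)"

definition prd :: "'a \<Rightarrow> 'a \<Rightarrow> 'a" where
  "prd u v = cls (\<lambda>p. \<exists>a. a \<in>\<^sub>c u \<and> (\<exists>b. b \<in>\<^sub>c v \<and> p = pair a b))"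

lemma mem_bun [simp]: "z \<in>\<^sub>c bun x y \<longleftrightarrow> z \<in>\<^sub>c x \<or> z \<in>\<^sub>c y"
  unfolding bun_def by (rule mem_cls_iff) (intro dfn_intros dft_const_True, auto dest: mem_set)

lemma mem_dif [simp]: "z \<in>\<^sub>c dif x y \<longleftrightarrow> z \<in>\<^sub>c x \<and> \<not> z \<in>\<^sub>c y"
  unfolding dif_def by (rule mem_cls_iff) (intro dfn_intros dft_const_True, auto dest: mem_set)

lemma is_set_emp [simp]: "is_set emp"
  by (rule Set_emp)

lemma is_set_adj [simp]: "is_set x ==> is_set y ==> is_set (adj x y)"
  using Set_adj by blast

lemma upair_adj: "is_set a ==> is_set b ==> upair a b = adj (adj emp a) b"
  by (rule cext) (auto simp: mem_upair mem_adj)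

lemma is_set_upair [simp]: "is_set (upair a b)"
proof -
  \<comment> \<open>Proper classes do not show up as elements, so the pair may shrink to a singleton
    or to \<open>emp\<close>; in each case (Set) applies.\<close>
  have "upair a b = (if is_set a then if is_set b then upair a b else upair a a
     else if is_set b then upair b b else emp)"
    by (rule cext) (auto simp: mem_upair)
  then show ?thesis by (auto simp: upair_adj split: if_splits)
qed

lemma is_set_pair [simp]: "is_set (pair a b)"
  by (simp add: pair_def)

lemma dft_upair [dfn_intros]: "dft b t ==> dft b u ==> dft b (\<lambda>s. upair (t s) (u s))"
proof (rule dft_comp2[where F = upair])
  show "dft b (\<lambda>s. upair (s 0) (s (Suc 0)))"
    by (rule dftI_ext[where Q = "\<lambda>s y. y = s 0 \<or> y = s (Suc 0)"])
      (simp add: dm_def, simp add: mem_upair, intro dfn_intros)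
qed

lemma dft_pair [dfn_intros]: "dft b t ==> dft b u ==> dft b (\<lambda>s. pair (t s) (u s))"
  unfolding pair_def by (intro dfn_intros)

lemma dfn_subcls [dfn_intros]: "dft b t ==> dft b u ==> dfn b (\<lambda>s. t s \<subseteq>\<^sub>c u s)"
proof (rule dfn_comp2[where P = "(\<subseteq>\<^sub>c)"])
  show "dfn b (\<lambda>s. s 0 \<subseteq>\<^sub>c s (Suc 0))"
    unfolding subcls_def by (intro dfn_intros)
qed

lemma dfn_related [dfn_intros]:
  "dft b r ==> dft b t ==> dft b u ==> dfn b (\<lambda>s. related (r s) (t s) (u s))"
  unfolding related_def by (intro dfn_intros)

lemma mem_pow [simp]: "z \<in>\<^sub>c pow x \<longleftrightarrow> is_set z \<and> z \<subseteq>\<^sub>c x"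
  unfolding pow_def by (rule mem_cls_iff) (intro dfn_intros dft_const_True, auto)

lemma mem_prd: "z \<in>\<^sub>c prd u v \<longleftrightarrow> (\<exists>a b. a \<in>\<^sub>c u \<and> b \<in>\<^sub>c v \<and> z = pair a b)"
  unfolding prd_def by (rule mem_cls_iff) (intro dfn_intros dft_const_True, auto)

lemma mem_Dom: "a \<in>\<^sub>c Dom R \<longleftrightarrow> (\<exists>b. related R a b)"
  unfolding Dom_def by (rule mem_cls_iff) (intro dfn_intros dft_const_True, auto simp: related_def)

lemma mem_image_cls: "b \<in>\<^sub>c R ``\<^sub>c A \<longleftrightarrow> (\<exists>a. a \<in>\<^sub>c A \<and> related R a b)"
  unfolding image_cls_def by (rule mem_cls_iff) (intro dfn_intros dft_const_True, auto simp: related_def)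

lemma subclsI: "(\<And>z. z \<in>\<^sub>c X ==> z \<in>\<^sub>c Y) ==> X \<subseteq>\<^sub>c Y"
  by (simp add: subcls_def)

lemma subclsD: "X \<subseteq>\<^sub>c Y ==> z \<in>\<^sub>c X ==> z \<in>\<^sub>c Y"
  by (simp add: subcls_def)

lemma upair_eq_iff:
  assumes "is_set a" "is_set b" "is_set c" "is_set d"
  shows "upair a b = upair c d \<longleftrightarrow> a = c \<and> b = d \<or> a = d \<and> b = c"
proof
  assume "upair a b = upair c d"
  then have "\<forall>z. is_set z --> (z = a \<or> z = b \<longleftrightarrow> z = c \<or> z = d)"
    by (metis mem_upair)
  then show "a = c \<and> b = d \<or> a = d \<and> b = c" using assms by metis
next
  assume "a = c \<and> b = d \<or> a = d \<and> b = c"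
  then show "upair a b = upair c d" by (intro cext) (auto simp: mem_upair)
qed

lemma pair_eq_iff [simp]:
  assumes "is_set a" "is_set b" "is_set c" "is_set d"
  shows "pair a b = pair c d \<longleftrightarrow> a = c \<and> b = d"
  using assms unfolding pair_def by (auto simp: upair_eq_iff)


subsection \<open>Sets\<close>

text \<open>The pattern of the set existence proofs below: the induction runs on the assertion that
  a set with the prescribed elements exists, which is a set formula; only afterwards is that set
  identified with the class term.\<close>

lemma is_set_bun [simp]:
  assumes x: "is_set x" and y: "is_set y" shows "is_set (bun x y)"
proof -
  have "\<exists>w. is_set w \<and> (\<forall>z. is_set z --> (z \<in>\<^sub>c w \<longleftrightarrow> z \<in>\<^sub>c x \<or> z \<in>\<^sub>c y))"
  proof (rule set_ind[OF _ _ _ y])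
    show "dfn False (\<lambda>s. \<exists>w. is_set w \<and> (\<forall>z. is_set z --> (z \<in>\<^sub>c w \<longleftrightarrow> z \<in>\<^sub>c x \<or> z \<in>\<^sub>c s 0)))"
      by (intro dfn_intros dft_const_set x)
    show "\<exists>w. is_set w \<and> (\<forall>z. is_set z --> (z \<in>\<^sub>c w \<longleftrightarrow> z \<in>\<^sub>c x \<or> z \<in>\<^sub>c emp))"
      using x by auto
  next
    fix u v assume *: "is_set u" "is_set v" and "\<exists>w. is_set w \<and> (\<forall>z. is_set z --> (z \<in>\<^sub>c w \<longleftrightarrow> z \<in>\<^sub>c x \<or> z \<in>\<^sub>c u))"
    then obtain w where "is_set w" "\<forall>z. is_set z --> (z \<in>\<^sub>c w \<longleftrightarrow> z \<in>\<^sub>c x \<or> z \<in>\<^sub>c u)" by blast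
    with * show "\<exists>w. is_set w \<and> (\<forall>z. is_set z --> (z \<in>\<^sub>c w \<longleftrightarrow> z \<in>\<^sub>c x \<or> z \<in>\<^sub>c adj u v))"
      by (intro exI[of _ "adj w v"]) (auto simp: mem_adj)
  qed
  then obtain w where "is_set w" "\<forall>z. is_set z --> (z \<in>\<^sub>c w \<longleftrightarrow> z \<in>\<^sub>c x \<or> z \<in>\<^sub>c y)" by blast
  moreover from this have "bun x y = w" by (intro cext) auto
  ultimately show ?thesis by simp
qed

lemma is_set_union_of [simp]:
  assumes x: "is_set x" shows "is_set (\<Union>\<^sub>c x)"
proof -
  have "\<exists>w. is_set w \<and> (\<forall>z. is_set z --> (z \<in>\<^sub>c w \<longleftrightarrow> (\<exists>y. y \<in>\<^sub>c x \<and> z \<in>\<^sub>c y)))"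
  proof (rule set_ind[OF _ _ _ x])
    show "dfn False (\<lambda>s. \<exists>w. is_set w \<and> (\<forall>z. is_set z --> (z \<in>\<^sub>c w \<longleftrightarrow> (\<exists>y. y \<in>\<^sub>c s 0 \<and> z \<in>\<^sub>c y))))"
      by (intro dfn_intros)
    show "\<exists>w. is_set w \<and> (\<forall>z. is_set z --> (z \<in>\<^sub>c w \<longleftrightarrow> (\<exists>y. y \<in>\<^sub>c emp \<and> z \<in>\<^sub>c y)))"
      by (intro exI[of _ emp]) simp
  next
    fix u v assume *: "is_set u" "is_set v" and "\<exists>w. is_set w \<and> (\<forall>z. is_set z --> (z \<in>\<^sub>c w \<longleftrightarrow> (\<exists>y. y \<in>\<^sub>c u \<and> z \<in>\<^sub>c y)))"
    then obtain w where "is_set w" "\<forall>z. is_set z --> (z \<in>\<^sub>c w \<longleftrightarrow> (\<exists>y. y \<in>\<^sub>c u \<and> z \<in>\<^sub>c y))" by blast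
    with * show "\<exists>w. is_set w \<and> (\<forall>z. is_set z --> (z \<in>\<^sub>c w \<longleftrightarrow> (\<exists>y. y \<in>\<^sub>c adj u v \<and> z \<in>\<^sub>c y)))"
      by (intro exI[of _ "bun w v"]) (auto simp: mem_adj)
  qed
  then obtain w where "is_set w" "\<forall>z. is_set z --> (z \<in>\<^sub>c w \<longleftrightarrow> (\<exists>y. y \<in>\<^sub>c x \<and> z \<in>\<^sub>c y))" by blast
  moreover from this have "\<Union>\<^sub>c x = w" by (intro cext) auto
  ultimately show ?thesis by simp
qed

text \<open>Only set formulas separate. The same statement for class formulas would make every set
  small.\<close>

lemma separation:
  assumes P: "dfn False (\<lambda>s. P (s 0))" and x: "is_set x" and v: "\<And>z. is_set z ==> z \<in>\<^sub>c v \<longleftrightarrow> z \<in>\<^sub>c x \<and> P z"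
  shows "is_set v"
proof -
  have "\<exists>w. is_set w \<and> (\<forall>z. is_set z --> (z \<in>\<^sub>c w \<longleftrightarrow> z \<in>\<^sub>c x \<and> P z))"
  proof (rule set_ind[OF _ _ _ x])
    show "dfn False (\<lambda>s. \<exists>w. is_set w \<and> (\<forall>z. is_set z --> (z \<in>\<^sub>c w \<longleftrightarrow> z \<in>\<^sub>c s 0 \<and> P z)))"
      by (intro dfn_intros P)
    show "\<exists>w. is_set w \<and> (\<forall>z. is_set z --> (z \<in>\<^sub>c w \<longleftrightarrow> z \<in>\<^sub>c emp \<and> P z))"
      by (intro exI[of _ emp]) simp
  next
    fix u v assume *: "is_set u" "is_set v" and "\<exists>w. is_set w \<and> (\<forall>z. is_set z --> (z \<in>\<^sub>c w \<longleftrightarrow> z \<in>\<^sub>c u \<and> P z))"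
    then obtain w where "is_set w" "\<forall>z. is_set z --> (z \<in>\<^sub>c w \<longleftrightarrow> z \<in>\<^sub>c u \<and> P z)" by blast
    with * show "\<exists>w. is_set w \<and> (\<forall>z. is_set z --> (z \<in>\<^sub>c w \<longleftrightarrow> z \<in>\<^sub>c adj u v \<and> P z))"
      by (intro exI[of _ "if P v then adj w v else w"]) (auto simp: mem_adj)
  qed
  then obtain w where "is_set w" "\<forall>z. is_set z --> (z \<in>\<^sub>c w \<longleftrightarrow> z \<in>\<^sub>c x \<and> P z)" by blast
  moreover from this have "v = w" using v by (intro cext) auto
  ultimately show ?thesis by simp
qed

lemma is_set_clsI:
  assumes "is_set x" "dfn True (\<lambda>s. P (s 0))" "dfn False (\<lambda>s. P (s 0))"
    and "\<And>z. is_set z ==> P z ==> z \<in>\<^sub>c x"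
  shows "is_set (cls P)"
  by (rule separation[OF assms(3,1)]) (use assms(4) in \<open>auto simp: mem_cls[OF assms(2)]\<close>)

lemma is_set_inter [simp]: "is_set x ==> is_set y ==> is_set (x \<inter>\<^sub>c y)"
  by (rule separation[of "\<lambda>z. z \<in>\<^sub>c y" x]) (intro dfn_intros dft_const_set, auto)

lemma is_set_dif [simp]: "is_set x ==> is_set y ==> is_set (dif x y)"
  by (rule separation[of "\<lambda>z. \<not> z \<in>\<^sub>c y" x]) (intro dfn_intros dft_const_set, auto)

text \<open>Every set arises from \<open>emp\<close> by adjunction, and the image is built along
  with it. Definability over sets serves the induction, definability over classes the formation of
  the class of values.\<close>

lemma replacement:
  assumes f: "dft False (\<lambda>s. f (s 0))" "dft True (\<lambda>s. f (s 0))" and x: "is_set x"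
  shows "is_set (cls (\<lambda>z. \<exists>y. y \<in>\<^sub>c x \<and> z = f y))"
proof -
  note f' = dft_comp1[OF f(1)]
  have fs: "is_set (f y)" if "is_set y" for y
    using f(1) that unfolding dft_def by (elim conjE allE[of _ "\<lambda>_. y"]) simp
  have "\<exists>w. is_set w \<and> (\<forall>z. is_set z --> (z \<in>\<^sub>c w \<longleftrightarrow> (\<exists>y. y \<in>\<^sub>c x \<and> z = f y)))"
  proof (rule set_ind[OF _ _ _ x])
    show "dfn False (\<lambda>s. \<exists>w. is_set w \<and> (\<forall>z. is_set z --> (z \<in>\<^sub>c w \<longleftrightarrow> (\<exists>y. y \<in>\<^sub>c s 0 \<and> z = f y))))"
      by (intro dfn_intros f')
    show "\<exists>w. is_set w \<and> (\<forall>z. is_set z --> (z \<in>\<^sub>c w \<longleftrightarrow> (\<exists>y. y \<in>\<^sub>c emp \<and> z = f y)))"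
      by (intro exI[of _ emp]) simp
  next
    fix u v assume *: "is_set u" "is_set v" and "\<exists>w. is_set w \<and> (\<forall>z. is_set z --> (z \<in>\<^sub>c w \<longleftrightarrow> (\<exists>y. y \<in>\<^sub>c u \<and> z = f y)))"
    then obtain w where "is_set w" "\<forall>z. is_set z --> (z \<in>\<^sub>c w \<longleftrightarrow> (\<exists>y. y \<in>\<^sub>c u \<and> z = f y))" by blast
    with * fs[of v] show "\<exists>w. is_set w \<and> (\<forall>z. is_set z --> (z \<in>\<^sub>c w \<longleftrightarrow> (\<exists>y. y \<in>\<^sub>c adj u v \<and> z = f y)))"
      by (intro exI[of _ "adj w (f v)"]) (auto simp: mem_adj)
  qed
  then obtain w where "is_set w" "\<forall>z. is_set z --> (z \<in>\<^sub>c w \<longleftrightarrow> (\<exists>y. y \<in>\<^sub>c x \<and> z = f y))" by blast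
  moreover from this have "cls (\<lambda>z. \<exists>y. y \<in>\<^sub>c x \<and> z = f y) = w"
    by (intro cext mem_cls_iff) (intro dfn_intros dft_const_True dft_comp1[OF f(2)], auto)
  ultimately show ?thesis by simp
qed

lemma dft_adj_set [dfn_intros]: "dft b t ==> dft b u ==> dft b (\<lambda>s. adj (t s) (u s))"
proof (rule dft_comp2[where F = adj])
  show "dft b (\<lambda>s. adj (s 0) (s (Suc 0)))"
    by (rule dftI_ext[where Q = "\<lambda>s y. y \<in>\<^sub>c s 0 \<or> y = s (Suc 0)"])
      (simp add: dm_def, auto simp: mem_adj dest: mem_set, intro dfn_intros)
qed

lemma dft_emp [dfn_intros]: "dft b (\<lambda>s. emp)"
  by (rule dft_const_set) simp

lemma is_set_pow [simp]:
  assumes x: "is_set x" shows "is_set (pow x)"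
proof -
  have "\<exists>w. is_set w \<and> (\<forall>z. is_set z --> (z \<in>\<^sub>c w \<longleftrightarrow> z \<subseteq>\<^sub>c x))"
  proof (rule set_ind[OF _ _ _ x])
    show "dfn False (\<lambda>s. \<exists>w. is_set w \<and> (\<forall>z. is_set z --> (z \<in>\<^sub>c w \<longleftrightarrow> z \<subseteq>\<^sub>c s 0)))"
      by (intro dfn_intros)
    have "z = emp" if "z \<subseteq>\<^sub>c emp" for z
      using that by (intro cext) (auto dest: subclsD)
    then show "\<exists>w. is_set w \<and> (\<forall>z. is_set z --> (z \<in>\<^sub>c w \<longleftrightarrow> z \<subseteq>\<^sub>c emp))"
      by (intro exI[of _ "sing emp"]) (auto simp: mem_upair subcls_def)
  next
    fix u v assume *: "is_set u" "is_set v" and "\<exists>w. is_set w \<and> (\<forall>z. is_set z --> (z \<in>\<^sub>c w \<longleftrightarrow> z \<subseteq>\<^sub>c u))"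
    then obtain w where w: "is_set w" "\<forall>z. is_set z --> (z \<in>\<^sub>c w \<longleftrightarrow> z \<subseteq>\<^sub>c u)" by blast
    \<comment> \<open>The subsets of \<open>adj u v\<close> are those of \<open>u\<close> together
      with the sets \<open>adj y v\<close> for \<open>y\<close> included in
      \<open>u\<close>.\<close>
    let ?w' = "cls (\<lambda>z. \<exists>y. y \<in>\<^sub>c w \<and> z = adj y v)"
    have w': "z \<in>\<^sub>c ?w' \<longleftrightarrow> is_set z \<and> (\<exists>y. y \<in>\<^sub>c w \<and> z = adj y v)" for z
      by (rule mem_cls_iff) (intro dfn_intros dft_const_True, auto)
    have "is_set ?w'" by (rule replacement) (intro dfn_intros dft_const_True dft_const_set w *)+
    moreover have "z \<in>\<^sub>c bun w ?w' \<longleftrightarrow> z \<subseteq>\<^sub>c adj u v" if z: "is_set z" for z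
    proof
      assume "z \<in>\<^sub>c bun w ?w'"
      then consider "z \<subseteq>\<^sub>c u" | y where "y \<subseteq>\<^sub>c u" "z = adj y v"
        using w z mem_set[of _ w] by (auto simp: w')
      then show "z \<subseteq>\<^sub>c adj u v" by cases (auto simp: subcls_def mem_adj)
    next
      assume z': "z \<subseteq>\<^sub>c adj u v"
      show "z \<in>\<^sub>c bun w ?w'"
      proof (cases "v \<in>\<^sub>c z")
        case True
        let ?y = "dif z (sing v)"
        have "?y \<subseteq>\<^sub>c u" using z' by (auto simp: subcls_def mem_adj mem_upair dest: mem_set)
        then have "?y \<in>\<^sub>c w" using z w(2) by simp
        moreover have "z = adj ?y v" using True by (intro cext) (auto simp: mem_adj mem_upair)
        ultimately show ?thesis using z by (auto simp: w')
      next
        case False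
        then have "z \<subseteq>\<^sub>c u" using z' by (auto simp: subcls_def mem_adj)
        then show ?thesis using w z by auto
      qed
    qed
    ultimately show "\<exists>w. is_set w \<and> (\<forall>z. is_set z --> (z \<in>\<^sub>c w \<longleftrightarrow> z \<subseteq>\<^sub>c adj u v))"
      using w(1) by (intro exI[of _ "bun w ?w'"]) auto
  qed
  then obtain w where "is_set w" "\<forall>z. is_set z --> (z \<in>\<^sub>c w \<longleftrightarrow> z \<subseteq>\<^sub>c x)" by blast
  moreover from this have "pow x = w" by (intro cext) auto
  ultimately show ?thesis by simp
qed

lemma related_mem2: "related R a b ==> a \<in>\<^sub>c \<Union>\<^sub>c (\<Union>\<^sub>c R) \<and> b \<in>\<^sub>c \<Union>\<^sub>c (\<Union>\<^sub>c R)"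
proof -
  assume "related R a b"
  then have ab: "is_set a" "is_set b" "pair a b \<in>\<^sub>c R" by (auto simp: related_def)
  have "upair a b \<in>\<^sub>c pair a b" by (simp add: pair_def mem_upair)
  then have "upair a b \<in>\<^sub>c \<Union>\<^sub>c R" using ab by auto
  moreover have "a \<in>\<^sub>c upair a b" "b \<in>\<^sub>c upair a b" using ab by (simp_all add: mem_upair)
  ultimately show ?thesis unfolding mem_union_of[of _ "\<Union>\<^sub>c R"] by blast
qed

lemma is_set_Dom [simp]: "is_set R ==> is_set (Dom R)"
  unfolding Dom_def
proof (rule is_set_clsI[of "\<Union>\<^sub>c (\<Union>\<^sub>c R)"])
  assume R: "is_set R"
  then show "is_set (\<Union>\<^sub>c (\<Union>\<^sub>c R))" by simp
  show "dfn True (\<lambda>s. \<exists>b. related R (s 0) b)" by (intro dfn_intros dft_const_True)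
  show "dfn False (\<lambda>s. \<exists>b. related R (s 0) b)"
    by (rule dfn_cong[of _ "\<lambda>s. \<exists>b. is_set b \<and> related R (s 0) b"], intro dfn_intros dft_const_set R)
      (auto simp: related_def)
qed (use related_mem2 in blast)

lemma is_set_image_cls [simp]: "is_set R ==> is_set A ==> is_set (R ``\<^sub>c A)"
  unfolding image_cls_def
proof (rule is_set_clsI[of "\<Union>\<^sub>c (\<Union>\<^sub>c R)"])
  assume R: "is_set R" "is_set A"
  then show "is_set (\<Union>\<^sub>c (\<Union>\<^sub>c R))" by simp
  show "dfn True (\<lambda>s. \<exists>a. a \<in>\<^sub>c A \<and> related R a (s 0))" by (intro dfn_intros dft_const_True)
  show "dfn False (\<lambda>s. \<exists>a. a \<in>\<^sub>c A \<and> related R a (s 0))"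
    by (intro dfn_intros dft_const_set R)
qed (use related_mem2 in blast)


lemma cls_False [simp]: "cls (\<lambda>z. False) = emp"
  by (simp add: emp_def)

text \<open>The induction is on \<open>x\<close>, for all sets \<open>u\<close> that contain or meet
  \<open>x\<close>. If \<open>u\<close> contains \<open>adj x y\<close> without meeting it, then
  \<open>adj x y\<close> itself is minimal; otherwise \<open>u\<close> meets \<open>x\<close> or
  contains \<open>y\<close>, and a hypothesis applies.\<close>

lemma foundation:
  assumes "is_set u" "x \<in>\<^sub>c u"
  shows "\<exists>m. m \<in>\<^sub>c u \<and> (\<forall>z. z \<in>\<^sub>c m --> \<not> z \<in>\<^sub>c u)"
proof -
  let ?M = "\<lambda>u. \<exists>m. m \<in>\<^sub>c u \<and> (\<forall>z. z \<in>\<^sub>c m --> \<not> z \<in>\<^sub>c u)"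
  have "\<forall>u. is_set u --> x \<in>\<^sub>c u \<or> (\<exists>z. z \<in>\<^sub>c x \<and> z \<in>\<^sub>c u) --> ?M u"
  proof (rule set_ind[where x = x])
    show "dfn False (\<lambda>s. \<forall>u. is_set u --> s 0 \<in>\<^sub>c u \<or> (\<exists>z. z \<in>\<^sub>c s 0 \<and> z \<in>\<^sub>c u) --> ?M u)"
      by (intro dfn_intros)
    show "is_set x" using assms mem_set by blast
  next
    fix x y
    assume "is_set x" "is_set y"
      and x: "\<forall>u. is_set u --> x \<in>\<^sub>c u \<or> (\<exists>z. z \<in>\<^sub>c x \<and> z \<in>\<^sub>c u) --> ?M u"
      and y: "\<forall>u. is_set u --> y \<in>\<^sub>c u \<or> (\<exists>z. z \<in>\<^sub>c y \<and> z \<in>\<^sub>c u) --> ?M u"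
    show "\<forall>u. is_set u --> adj x y \<in>\<^sub>c u \<or> (\<exists>z. z \<in>\<^sub>c adj x y \<and> z \<in>\<^sub>c u) --> ?M u"
    proof (intro allI impI)
      fix u assume u: "is_set u" and *: "adj x y \<in>\<^sub>c u \<or> (\<exists>z. z \<in>\<^sub>c adj x y \<and> z \<in>\<^sub>c u)"
      show "?M u"
      proof (cases "\<exists>z. z \<in>\<^sub>c adj x y \<and> z \<in>\<^sub>c u")
        case True
        then have "(\<exists>z. z \<in>\<^sub>c x \<and> z \<in>\<^sub>c u) \<or> y \<in>\<^sub>c u" by (auto simp: mem_adj)
        then show ?thesis using x y u by blast
      next
        case False
        then show ?thesis using * by blast
      qed
    qed
  qed auto
  then show ?thesis using assms by blast
qed

lemma mem_irrefl [simp]: "\<not> x \<in>\<^sub>c x"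
proof
  assume "x \<in>\<^sub>c x"
  then have "is_set x" by (rule mem_set)
  then have "x \<in>\<^sub>c sing x" by (simp add: mem_upair)
  from foundation[OF _ this] \<open>x \<in>\<^sub>c x\<close> show False by (auto simp: mem_upair)
qed

lemma mem_asym: "x \<in>\<^sub>c y ==> \<not> y \<in>\<^sub>c x"
proof
  assume *: "x \<in>\<^sub>c y" "y \<in>\<^sub>c x"
  then have "x \<in>\<^sub>c upair x y" by (simp add: mem_upair mem_set)
  from foundation[OF _ this] obtain m where m: "m = x \<or> m = y" "\<And>z. z \<in>\<^sub>c m ==> \<not> z \<in>\<^sub>c upair x y"
    by (auto simp: mem_upair)
  show False using m(1) m(2)[of x] m(2)[of y] * mem_set by (auto simp: mem_upair)
qed

lemma dfn_transitive [dfn_intros]: "dft b t ==> dfn b (\<lambda>s. transitive (t s))"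
proof (rule dfn_comp1[where P = transitive])
  show "dfn b (\<lambda>s. transitive (s 0))" unfolding transitive_def by (intro dfn_intros)
qed

lemma transitive_superset:
  assumes "is_set x" shows "\<exists>t. is_set t \<and> transitive t \<and> x \<subseteq>\<^sub>c t"
proof (rule set_ind[OF _ _ _ assms])
  show "dfn False (\<lambda>s. \<exists>t. is_set t \<and> transitive t \<and> s 0 \<subseteq>\<^sub>c t)" by (intro dfn_intros)
  show "\<exists>t. is_set t \<and> transitive t \<and> emp \<subseteq>\<^sub>c t"
    by (intro exI[of _ emp]) (simp add: transitive_def subcls_def)
next
  fix x y assume y: "is_set y" and "\<exists>t. is_set t \<and> transitive t \<and> x \<subseteq>\<^sub>c t" "\<exists>t. is_set t \<and> transitive t \<and> y \<subseteq>\<^sub>c t"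
  then obtain t u where "is_set t" "transitive t" "x \<subseteq>\<^sub>c t" "is_set u" "transitive u" "y \<subseteq>\<^sub>c u" by blast
  with y show "\<exists>t. is_set t \<and> transitive t \<and> adj x y \<subseteq>\<^sub>c t"
    by (intro exI[of _ "adj (bun t u) y"]) (auto simp: transitive_def subcls_def mem_adj)
qed


subsection \<open>Internal natural numbers\<close>

lemma mem_suc: "is_set n ==> m \<in>\<^sub>c suc n \<longleftrightarrow> m \<in>\<^sub>c n \<or> m = n"
  by (auto simp: suc_def mem_adj)

lemma is_set_suc [simp]: "is_set n ==> is_set (suc n)"
  by (simp add: suc_def)

lemma dft_suc [dfn_intros]: "dft b t ==> dft b (\<lambda>s. suc (t s))"
  unfolding suc_def by (intro dfn_intros)

lemma dfn_is_nat [dfn_intros]: "dft b t ==> dfn b (\<lambda>s. is_nat (t s))"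
proof (rule dfn_comp1[where P = is_nat])
  show "dfn b (\<lambda>s. is_nat (s 0))" unfolding is_nat_def by (intro dfn_intros)
qed

lemma nat_is_set: "is_nat n ==> is_set n" by (simp add: is_nat_def)

lemma transitiveD: "transitive x ==> y \<in>\<^sub>c x ==> z \<in>\<^sub>c y ==> z \<in>\<^sub>c x"
  unfolding transitive_def subcls_def by blast

lemma nat_trans: "is_nat n ==> m \<in>\<^sub>c n ==> k \<in>\<^sub>c m ==> k \<in>\<^sub>c n"
  unfolding is_nat_def using transitiveD by blast

lemma nat_mem: "is_nat n ==> m \<in>\<^sub>c n ==> is_nat m"
  using nat_trans[of n m] mem_set[of m n] unfolding is_nat_def by blast

lemma nat_emp [simp]: "is_nat emp" by (simp add: is_nat_def transitive_def)

lemma nat_suc [simp]: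
  assumes n: "is_nat n" shows "is_nat (suc n)"
proof -
  note m = mem_suc[OF nat_is_set[OF n]]
  have "transitive (suc n)" unfolding transitive_def subcls_def m using nat_trans[OF n] by blast
  moreover have "\<forall>m. m \<in>\<^sub>c suc n --> transitive m" using n by (simp add: m is_nat_def)
  ultimately show ?thesis using nat_is_set[OF n] by (simp add: is_nat_def)
qed

lemma small_is_set: "small x ==> is_set x"
  by (simp add: small_def subcls_def)

lemma small_subcls: "small x ==> y \<subseteq>\<^sub>c x ==> small y"
  by (auto simp: small_def subcls_def)

lemma small_emp [simp]: "small emp"
proof -
  have "Y = emp" if "Y \<subseteq>\<^sub>c emp" for Y using that by (intro cext) (auto dest: subclsD)
  then show ?thesis unfolding small_def by (metis is_set_emp)
qed

lemma small_adj [simp]: "small x ==> small (adj x y)"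
  unfolding small_def[of "adj x y"]
proof (intro allI impI)
  fix Y assume x: "small x" and Y: "Y \<subseteq>\<^sub>c adj x y"
  have i: "is_set (Y \<inter>\<^sub>c x)" using x by (simp add: small_def subcls_def)
  show "is_set Y"
  proof (cases "y \<in>\<^sub>c Y")
    case True
    then have "Y = adj (Y \<inter>\<^sub>c x) y" using Y by (intro cext) (auto simp: mem_adj subcls_def)
    then show ?thesis using i True mem_set by (metis is_set_adj)
  next
    case False
    then have "Y = Y \<inter>\<^sub>c x" using Y by (intro cext) (auto simp: mem_adj subcls_def)
    then show ?thesis using i by simp
  qed
qed

lemma small_suc: "small n ==> small (suc n)" by (simp add: suc_def)

text \<open>A least counterexample exists once the counterexamples up to \<open>n\<close> form a
  set. For set formulas this holds for every \<open>n\<close>; for class formulas smallness of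
  \<open>n\<close> provides it, because then every subclass of \<open>suc n\<close> is a
  set.\<close>

lemma nat_strong_induct:
  assumes P: "dfn b (\<lambda>s. P (s 0))" and b: "b ==> small n" and n: "is_nat n"
    and step: "\<And>m. is_nat m ==> (\<And>k. k \<in>\<^sub>c m ==> P k) ==> P m"
  shows "P n"
proof (rule ccontr)
  assume "\<not> P n"
  have n': "is_set n" using n by (rule nat_is_set)
  have "\<exists>A. is_set A \<and> (\<forall>m. is_set m --> (m \<in>\<^sub>c A \<longleftrightarrow> m \<in>\<^sub>c suc n \<and> \<not> P m))"
  proof (cases b)
    case True
    let ?A = "cls (\<lambda>m. m \<in>\<^sub>c suc n \<and> \<not> P m)"
    have A: "m \<in>\<^sub>c ?A \<longleftrightarrow> is_set m \<and> m \<in>\<^sub>c suc n \<and> \<not> P m" for m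
      using P True by (intro mem_cls dfn_intros dft_const_True) simp_all
    then have "?A \<subseteq>\<^sub>c suc n" by (simp add: subcls_def)
    moreover have "small (suc n)" using b[OF True] by (rule small_suc)
    ultimately have "is_set ?A" by (simp add: small_def)
    with A show ?thesis by blast
  next
    case False
    have "\<exists>w. is_set w \<and> (\<forall>z. is_set z --> (z \<in>\<^sub>c w \<longleftrightarrow> z \<in>\<^sub>c suc n \<and> \<not> P z))"
    proof (rule set_ind[where x = "suc n"])
      show "dfn False (\<lambda>s. \<exists>w. is_set w \<and> (\<forall>z. is_set z --> (z \<in>\<^sub>c w \<longleftrightarrow> z \<in>\<^sub>c s 0 \<and> \<not> P z)))"
        using P False by (intro dfn_intros) simp
      show "\<exists>w. is_set w \<and> (\<forall>z. is_set z --> (z \<in>\<^sub>c w \<longleftrightarrow> z \<in>\<^sub>c emp \<and> \<not> P z))"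
        by (intro exI[of _ emp]) simp
    next
      fix u v assume *: "is_set u" "is_set v" and "\<exists>w. is_set w \<and> (\<forall>z. is_set z --> (z \<in>\<^sub>c w \<longleftrightarrow> z \<in>\<^sub>c u \<and> \<not> P z))"
      then obtain w where "is_set w" "\<forall>z. is_set z --> (z \<in>\<^sub>c w \<longleftrightarrow> z \<in>\<^sub>c u \<and> \<not> P z)" by blast
      with * show "\<exists>w. is_set w \<and> (\<forall>z. is_set z --> (z \<in>\<^sub>c w \<longleftrightarrow> z \<in>\<^sub>c adj u v \<and> \<not> P z))"
        by (intro exI[of _ "if P v then w else adj w v"]) (auto simp: mem_adj)
    qed (use n' in simp)
    then show ?thesis by blast
  qed
  then obtain A where A: "is_set A" "\<And>m. is_set m ==> m \<in>\<^sub>c A \<longleftrightarrow> m \<in>\<^sub>c suc n \<and> \<not> P m" by blast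
  have "n \<in>\<^sub>c A" using A(2)[OF n'] \<open>\<not> P n\<close> by (simp add: mem_suc n')
  from foundation[OF A(1) this] obtain m where m: "m \<in>\<^sub>c A" "\<And>z. z \<in>\<^sub>c m ==> \<not> z \<in>\<^sub>c A" by blast
  from m(1) have "m \<in>\<^sub>c suc n" "\<not> P m" using A(2)[OF mem_set[OF m(1)]] by simp_all
  have sn: "is_nat (suc n)" using n by simp
  have "P m"
  proof (rule step)
    show "is_nat m" using nat_mem[OF sn] \<open>m \<in>\<^sub>c suc n\<close> by blast
    show "P k" if "k \<in>\<^sub>c m" for k
      using A(2)[OF mem_set[OF that]] m(2)[OF that] nat_trans[OF sn \<open>m \<in>\<^sub>c suc n\<close> that] by blast
  qed
  with \<open>\<not> P m\<close> show False by simp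
qed

text \<open>Two nested strong inductions: if \<open>m\<close> and \<open>n\<close> were
  incomparable, the hypotheses would give them the same elements.\<close>

lemma nat_linear:
  assumes "is_nat m" "is_nat n" shows "m \<in>\<^sub>c n \<or> m = n \<or> n \<in>\<^sub>c m"
proof -
  have "\<forall>n. is_set n --> is_nat n --> m \<in>\<^sub>c n \<or> m = n \<or> n \<in>\<^sub>c m"
  proof (rule nat_strong_induct[of False _ m])
    show "dfn False (\<lambda>s. \<forall>n. is_set n --> is_nat n --> s 0 \<in>\<^sub>c n \<or> s 0 = n \<or> n \<in>\<^sub>c s 0)"
      by (intro dfn_intros)
  next
    fix m assume m: "is_nat m"
      and IH: "\<And>k. k \<in>\<^sub>c m ==> \<forall>n. is_set n --> is_nat n --> k \<in>\<^sub>c n \<or> k = n \<or> n \<in>\<^sub>c k"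
    have "m \<in>\<^sub>c n \<or> m = n \<or> n \<in>\<^sub>c m" if "is_nat n" for n
    proof (rule nat_strong_induct[of False _ n])
      show "dfn False (\<lambda>s. m \<in>\<^sub>c s 0 \<or> m = s 0 \<or> s 0 \<in>\<^sub>c m)"
        by (intro dfn_intros dft_const_set nat_is_set m)
    next
      fix n assume n: "is_nat n" and IH': "\<And>k. k \<in>\<^sub>c n ==> m \<in>\<^sub>c k \<or> m = k \<or> k \<in>\<^sub>c m"
      show "m \<in>\<^sub>c n \<or> m = n \<or> n \<in>\<^sub>c m"
      proof (rule ccontr)
        assume *: "\<not> (m \<in>\<^sub>c n \<or> m = n \<or> n \<in>\<^sub>c m)"
        have "m = n"
        proof (rule cext)
          fix z
          show "z \<in>\<^sub>c m \<longleftrightarrow> z \<in>\<^sub>c n"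
          proof
            assume z: "z \<in>\<^sub>c m"
            then have "z \<in>\<^sub>c n \<or> z = n \<or> n \<in>\<^sub>c z" using IH n nat_is_set by blast
            then show "z \<in>\<^sub>c n" using z * nat_trans[OF m z, of n] by auto
          next
            assume z: "z \<in>\<^sub>c n"
            then have "m \<in>\<^sub>c z \<or> m = z \<or> z \<in>\<^sub>c m" by (rule IH')
            then show "z \<in>\<^sub>c m" using z * nat_trans[OF n z, of m] by auto
          qed
        qed
        with * show False by blast
      qed
    qed (use that in simp_all)
    then show "\<forall>n. is_set n --> is_nat n --> m \<in>\<^sub>c n \<or> m = n \<or> n \<in>\<^sub>c m" by blast
  qed (use assms in simp_all)
  then show ?thesis using assms(2) nat_is_set by blast
qed

text \<open>Sets are finite in the sense of the structure, so a maximum can be kept up to date while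
  elements are adjoined. This is what excludes limit ordinals. The conjunct \<open>True\<close>
  brings nonemptiness into the bounded form covered by \<open>dfn_ex_mem\<close>.\<close>

lemma nats_max:
  assumes "is_set x" "\<forall>y. y \<in>\<^sub>c x --> is_nat y" "\<exists>y. y \<in>\<^sub>c x \<and> True"
  shows "\<exists>m. m \<in>\<^sub>c x \<and> (\<forall>y. y \<in>\<^sub>c x --> y = m \<or> y \<in>\<^sub>c m)"
proof -
  let ?Q = "\<lambda>x. \<exists>m. m \<in>\<^sub>c x \<and> (\<forall>y. y \<in>\<^sub>c x --> y = m \<or> y \<in>\<^sub>c m)"
  have "(\<forall>y. y \<in>\<^sub>c x --> is_nat y) --> (\<exists>y. y \<in>\<^sub>c x \<and> True) --> ?Q x"
  proof (rule set_ind[OF _ _ _ assms(1)])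
    show "dfn False (\<lambda>s. (\<forall>y. y \<in>\<^sub>c s 0 --> is_nat y) --> (\<exists>y. y \<in>\<^sub>c s 0 \<and> True) --> ?Q (s 0))"
      by (intro dfn_intros)
  next
    fix x z assume z: "is_set z" and IH: "(\<forall>y. y \<in>\<^sub>c x --> is_nat y) --> (\<exists>y. y \<in>\<^sub>c x \<and> True) --> ?Q x"
    show "(\<forall>y. y \<in>\<^sub>c adj x z --> is_nat y) --> (\<exists>y. y \<in>\<^sub>c adj x z \<and> True) --> ?Q (adj x z)"
    proof (intro impI)
      assume nat: "\<forall>y. y \<in>\<^sub>c adj x z --> is_nat y"
      then have zn: "is_nat z" using z by (simp add: mem_adj)
      show "?Q (adj x z)"
      proof (cases "\<exists>y. y \<in>\<^sub>c x")
        case False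
        then show ?thesis using z by (intro exI[of _ z]) (auto simp: mem_adj)
      next
        case True
        then obtain m where m: "m \<in>\<^sub>c x" "\<forall>y. y \<in>\<^sub>c x --> y = m \<or> y \<in>\<^sub>c m"
          using IH nat by (auto simp: mem_adj)
        have mn: "is_nat m" using nat m(1) by (simp add: mem_adj)
        consider "m \<in>\<^sub>c z" | "m = z \<or> z \<in>\<^sub>c m" using nat_linear[OF mn zn] by blast
        then show ?thesis
        proof cases
          case 1
          then show ?thesis using m z nat_trans[OF zn 1] by (intro exI[of _ z]) (auto simp: mem_adj)
        next
          case 2
          then show ?thesis using m z by (intro exI[of _ m]) (auto simp: mem_adj)
        qed
      qed
    qed
  qed simp
  with assms show ?thesis by blast
qed

lemma nat_cases:
  assumes n: "is_nat n" obtains "n = emp" | m where "is_nat m" "n = suc m"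
proof (cases "\<exists>y. y \<in>\<^sub>c n")
  case False
  then have "n = emp" by (intro cext) simp
  then show ?thesis by (rule that)
next
  case True
  then obtain m where m: "m \<in>\<^sub>c n" "\<forall>y. y \<in>\<^sub>c n --> y = m \<or> y \<in>\<^sub>c m"
    using nats_max[OF nat_is_set[OF n]] nat_mem[OF n] by blast
  have "n = suc m"
  proof (rule cext)
    fix z
    show "z \<in>\<^sub>c n \<longleftrightarrow> z \<in>\<^sub>c suc m"
      using m nat_trans[OF n m(1)] by (auto simp: mem_suc[OF mem_set[OF m(1)]])
  qed
  with nat_mem[OF n m(1)] show ?thesis by (rule that(2))
qed

lemma nat_induct_set:
  assumes P: "dfn False (\<lambda>s. P (s 0))" and n: "is_nat n"
    and 0: "P emp" and step: "\<And>m. is_nat m ==> P m ==> P (suc m)"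
  shows "P n"
proof (rule nat_strong_induct[OF P _ n])
  fix m assume m: "is_nat m" and IH: "\<And>k. k \<in>\<^sub>c m ==> P k"
  from m show "P m"
  proof (cases rule: nat_cases)
    case 1
    then show ?thesis using 0 by simp
  next
    case (2 k)
    then have "k \<in>\<^sub>c m" by (simp add: mem_suc nat_is_set)
    then show ?thesis using 2 step IH by blast
  qed
qed simp

lemma suc_inj: "is_nat m ==> is_nat n ==> suc m = suc n ==> m = n"
  using mem_asym mem_suc nat_is_set by metis

lemma suc_not_emp [simp]: "is_set n ==> suc n \<noteq> emp"
  using mem_suc not_mem_emp by metis

lemma emp_mem_suc: "is_nat n ==> emp \<in>\<^sub>c suc n"
  using nat_linear[of emp "suc n"] suc_not_emp[OF nat_is_set, of n] by (metis nat_emp nat_suc not_mem_emp)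

lemma nat_suc_mono: "is_nat n ==> m \<in>\<^sub>c n ==> suc m \<in>\<^sub>c suc n"
proof -
  assume *: "is_nat n" "m \<in>\<^sub>c n"
  then have m: "is_nat m" using nat_mem by blast
  have "\<not> n \<in>\<^sub>c suc m" using * mem_asym[of m n] by (auto simp: mem_suc[OF nat_is_set[OF m]])
  then have "suc m \<in>\<^sub>c n \<or> suc m = n" using nat_linear[of "suc m" n] m * by auto
  then show ?thesis by (simp add: mem_suc[OF nat_is_set[OF *(1)]])
qed


subsection \<open>Standard natural numbers\<close>

lemma dfn_small [dfn_intros]: "dft True t ==> dfn True (\<lambda>s. small (t s))"
proof (rule dfn_comp1[where P = small])
  show "dfn True (\<lambda>s. small (s 0))" unfolding small_def by (intro dfn_intros)
qed

lemma dft_cls [dfn_intros]: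
  assumes "dfn True (\<lambda>s. P (\<lambda>i. s (Suc i)) (s 0))"
  shows "dft True (\<lambda>s. cls (P s))"
proof (rule dftI_ext[OF _ _ assms])
  show "y \<in>\<^sub>c cls (P s) \<longleftrightarrow> is_set y \<and> P s y" for s y
    by (rule mem_cls) (use dfn_fix[OF assms, of s] in simp)
qed simp

text \<open>The intersection of all closed classes is a class because the formula in (Class) may
  quantify over classes.\<close>

lemma SN_eq: "SN = cls (\<lambda>n. \<forall>B. emp \<in>\<^sub>c B \<and> (\<forall>n. n \<in>\<^sub>c B --> suc n \<in>\<^sub>c B) --> n \<in>\<^sub>c B)" (is "_ = ?A")
proof -
  have A: "n \<in>\<^sub>c ?A \<longleftrightarrow> is_set n \<and> (\<forall>B. emp \<in>\<^sub>c B \<and> (\<forall>n. n \<in>\<^sub>c B --> suc n \<in>\<^sub>c B) --> n \<in>\<^sub>c B)" for n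
    by (rule mem_cls) (intro dfn_intros)
  let ?P = "\<lambda>A. emp \<in>\<^sub>c A \<and> (\<forall>n. n \<in>\<^sub>c A --> suc n \<in>\<^sub>c A)"
  have P: "?P ?A" by (auto simp: A)
  have least: "?A \<subseteq>\<^sub>c B" if "?P B" for B using that by (auto simp: A subcls_def)
  show ?thesis unfolding SN_def smallest_class_def
  proof (rule the_equality)
    show "?P ?A \<and> (\<forall>B. ?P B --> ?A \<subseteq>\<^sub>c B)" using P least by blast
  next
    fix A' assume A': "?P A' \<and> (\<forall>B. ?P B --> A' \<subseteq>\<^sub>c B)"
    then have "A' \<subseteq>\<^sub>c ?A" "?A \<subseteq>\<^sub>c A'" using P least by blast+
    then show "A' = ?A" by (intro cext) (auto dest: subclsD)
  qed
qed

lemma mem_SN: "n \<in>\<^sub>c SN \<longleftrightarrow> is_set n \<and> (\<forall>B. emp \<in>\<^sub>c B \<and> (\<forall>n. n \<in>\<^sub>c B --> suc n \<in>\<^sub>c B) --> n \<in>\<^sub>c B)"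
  unfolding SN_eq by (rule mem_cls) (intro dfn_intros)

lemma emp_in_SN [simp]: "emp \<in>\<^sub>c SN" by (simp add: mem_SN)

lemma suc_in_SN [simp]: "n \<in>\<^sub>c SN ==> suc n \<in>\<^sub>c SN" by (auto simp: mem_SN)

lemma SN_induct:
  assumes P: "dfn True (\<lambda>s. P (s 0))" and n: "n \<in>\<^sub>c SN"
    and 0: "P emp" and step: "\<And>m. m \<in>\<^sub>c SN ==> P m ==> P (suc m)"
  shows "P n"
proof -
  let ?B = "cls (\<lambda>n. n \<in>\<^sub>c SN \<and> P n)"
  have B: "m \<in>\<^sub>c ?B \<longleftrightarrow> is_set m \<and> m \<in>\<^sub>c SN \<and> P m" for m
    by (rule mem_cls) (intro dfn_intros dft_const_True P)
  have "emp \<in>\<^sub>c ?B" using 0 by (simp add: B)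
  moreover have "suc m \<in>\<^sub>c ?B" if "m \<in>\<^sub>c ?B" for m
    using that step by (auto simp: B)
  ultimately have "n \<in>\<^sub>c ?B" using n unfolding mem_SN by blast
  then show ?thesis by (simp add: B)
qed

text \<open>From left to right by induction along \<open>SN\<close>. Conversely, smallness of
  \<open>n\<close> permits strong induction for a class formula, here for membership in
  \<open>SN\<close>.\<close>

lemma SN_iff: "n \<in>\<^sub>c SN \<longleftrightarrow> is_nat n \<and> small n"
proof
  assume "n \<in>\<^sub>c SN"
  then show "is_nat n \<and> small n"
    by (rule SN_induct[where P = "\<lambda>n. is_nat n \<and> small n", rotated]) (auto simp: small_suc intro!: dfn_intros)
next
  assume n: "is_nat n \<and> small n"
  show "n \<in>\<^sub>c SN"
  proof (rule nat_strong_induct[of True "\<lambda>n. n \<in>\<^sub>c SN"])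
    show "dfn True (\<lambda>s. s 0 \<in>\<^sub>c SN)" by (intro dfn_intros dft_const_True)
  next
    fix m assume "is_nat m" and IH: "\<And>k. k \<in>\<^sub>c m ==> k \<in>\<^sub>c SN"
    then show "m \<in>\<^sub>c SN"
    proof (cases rule: nat_cases)
      case (2 k)
      then have "k \<in>\<^sub>c m" by (simp add: mem_suc nat_is_set)
      then show ?thesis using IH 2(2) by auto
    qed simp
  qed (use n in auto)
qed

lemma SN_nat: "n \<in>\<^sub>c SN ==> is_nat n" by (simp add: SN_iff)

lemma SN_mem: "n \<in>\<^sub>c SN ==> m \<in>\<^sub>c n ==> m \<in>\<^sub>c SN"
proof -
  assume *: "n \<in>\<^sub>c SN" "m \<in>\<^sub>c n"
  then have n: "is_nat n" "small n" by (simp_all add: SN_iff)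
  have "m \<subseteq>\<^sub>c n" using nat_trans[OF n(1) *(2)] by (rule subclsI)
  then show "m \<in>\<^sub>c SN" using nat_mem[OF n(1) *(2)] small_subcls[OF n(2)] by (simp add: SN_iff)
qed

text \<open>As a set, \<open>SN\<close> would be an internal natural number, hence
  \<open>emp\<close> or some \<open>suc m\<close>. In the latter case \<open>m\<close> lies in
  \<open>SN\<close>, so \<open>SN\<close> would be an element of itself.\<close>

lemma SN_not_set: "\<not> is_set SN"
proof
  assume "is_set SN"
  moreover have "transitive SN" unfolding transitive_def subcls_def using SN_mem by blast
  moreover have "transitive n" if "n \<in>\<^sub>c SN" for n using SN_nat[OF that] by (simp add: is_nat_def)
  ultimately have n: "is_nat SN" by (simp add: is_nat_def)
  then show False
  proof (cases rule: nat_cases)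
    case 1
    then show False using emp_in_SN by simp
  next
    case (2 m)
    then have "m \<in>\<^sub>c SN" using mem_suc[of m m] nat_is_set by metis
    then have "SN \<in>\<^sub>c SN" using 2 suc_in_SN by metis
    then show False by simp
  qed
qed


subsection \<open>Small sets\<close>

text \<open>The internal finiteness of sets, witnessed by a bijection \<open>g\<close> that is
  itself a set. It is described through pairs and bounded quantifiers only, so that the assertion is
  a set formula and (Ind) applies.\<close>

lemma enumeration:
  assumes "is_set x"
  shows "\<exists>n. is_set n \<and> is_nat n \<and> (\<exists>g. is_set g \<and>
    (\<forall>i. i \<in>\<^sub>c n --> (\<exists>b. b \<in>\<^sub>c x \<and> pair i b \<in>\<^sub>c g)) \<and>
    (\<forall>b. b \<in>\<^sub>c x --> (\<exists>i. i \<in>\<^sub>c n \<and> pair i b \<in>\<^sub>c g)) \<and>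
    (\<forall>i. i \<in>\<^sub>c n --> (\<forall>b. b \<in>\<^sub>c x --> (\<forall>c. c \<in>\<^sub>c x --> pair i b \<in>\<^sub>c g \<and> pair i c \<in>\<^sub>c g --> b = c))) \<and>
    (\<forall>i. i \<in>\<^sub>c n --> (\<forall>j. j \<in>\<^sub>c n --> (\<forall>b. b \<in>\<^sub>c x --> pair i b \<in>\<^sub>c g \<and> pair j b \<in>\<^sub>c g --> i = j))))"
proof -
  define E where "E x n g \<longleftrightarrow>
    (\<forall>i. i \<in>\<^sub>c n --> (\<exists>b. b \<in>\<^sub>c x \<and> pair i b \<in>\<^sub>c g)) \<and>
    (\<forall>b. b \<in>\<^sub>c x --> (\<exists>i. i \<in>\<^sub>c n \<and> pair i b \<in>\<^sub>c g)) \<and>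
    (\<forall>i. i \<in>\<^sub>c n --> (\<forall>b. b \<in>\<^sub>c x --> (\<forall>c. c \<in>\<^sub>c x --> pair i b \<in>\<^sub>c g \<and> pair i c \<in>\<^sub>c g --> b = c))) \<and>
    (\<forall>i. i \<in>\<^sub>c n --> (\<forall>j. j \<in>\<^sub>c n --> (\<forall>b. b \<in>\<^sub>c x --> pair i b \<in>\<^sub>c g \<and> pair j b \<in>\<^sub>c g --> i = j)))" for x n g
  \<comment> \<open>The induction also carries that \<open>g\<close> contains only pairs formed from
    \<open>n\<close> and \<open>x\<close>; otherwise the new pair could clash with stray elements of
    \<open>g\<close>.\<close>
  have "\<exists>n. is_set n \<and> is_nat n \<and> (\<exists>g. is_set g \<and> (\<forall>p. p \<in>\<^sub>c g --> (\<exists>i. i \<in>\<^sub>c n \<and> (\<exists>b. b \<in>\<^sub>c x \<and> p = pair i b))) \<and> E x n g)"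
  proof (rule set_ind[OF _ _ _ assms])
    show "dfn False (\<lambda>s. \<exists>n. is_set n \<and> is_nat n \<and> (\<exists>g. is_set g \<and> (\<forall>p. p \<in>\<^sub>c g --> (\<exists>i. i \<in>\<^sub>c n \<and> (\<exists>b. b \<in>\<^sub>c s 0 \<and> p = pair i b))) \<and> E (s 0) n g))"
      unfolding E_def by (intro dfn_intros)
    show "\<exists>n. is_set n \<and> is_nat n \<and> (\<exists>g. is_set g \<and> (\<forall>p. p \<in>\<^sub>c g --> (\<exists>i. i \<in>\<^sub>c n \<and> (\<exists>b. b \<in>\<^sub>c emp \<and> p = pair i b))) \<and> E emp n g)"
      by (intro exI[of _ emp]) (auto simp: E_def intro!: exI[of _ emp])
  next
    fix x y assume x: "is_set x" and y: "is_set y"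
      and "\<exists>n. is_set n \<and> is_nat n \<and> (\<exists>g. is_set g \<and> (\<forall>p. p \<in>\<^sub>c g --> (\<exists>i. i \<in>\<^sub>c n \<and> (\<exists>b. b \<in>\<^sub>c x \<and> p = pair i b))) \<and> E x n g)"
    then obtain n g where n: "is_set n" "is_nat n" and g: "is_set g" and sub: "\<forall>p. p \<in>\<^sub>c g --> (\<exists>i. i \<in>\<^sub>c n \<and> (\<exists>b. b \<in>\<^sub>c x \<and> p = pair i b))"
      and E: "E x n g" by blast
    show "\<exists>n. is_set n \<and> is_nat n \<and> (\<exists>g. is_set g \<and> (\<forall>p. p \<in>\<^sub>c g --> (\<exists>i. i \<in>\<^sub>c n \<and> (\<exists>b. b \<in>\<^sub>c adj x y \<and> p = pair i b))) \<and> E (adj x y) n g)"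
    proof (cases "y \<in>\<^sub>c x")
      case True
      then have "adj x y = x" by (intro cext) (auto simp: mem_adj)
      then show ?thesis using n g sub E by auto
    next
      case False
      let ?g = "adj g (pair n y)"
      have g': "pair i b \<in>\<^sub>c ?g \<longleftrightarrow> (pair i b \<in>\<^sub>c g \<and> i \<in>\<^sub>c n \<and> b \<in>\<^sub>c x) \<or> (i = n \<and> b = y)" if "is_set i" "is_set b" for i b
      proof -
        have "i \<in>\<^sub>c n \<and> b \<in>\<^sub>c x" if p: "pair i b \<in>\<^sub>c g"
        proof -
          obtain j c where "j \<in>\<^sub>c n" "c \<in>\<^sub>c x" "pair i b = pair j c" using sub p by blast
          then show ?thesis using \<open>is_set i\<close> \<open>is_set b\<close> mem_set[of j n] mem_set[of c x] by simp
        qed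
        then show ?thesis using that n y by (auto simp: mem_adj)
      qed
      have bs: "b \<in>\<^sub>c adj x y \<longleftrightarrow> b \<in>\<^sub>c x \<or> b = y" for b using y by (auto simp: mem_adj)
      have iss: "i \<in>\<^sub>c suc n \<longleftrightarrow> i \<in>\<^sub>c n \<or> i = n" for i using n by (rule_tac mem_suc)
      have set: "\<And>b. b \<in>\<^sub>c x \<or> b = y ==> is_set b" "\<And>i. i \<in>\<^sub>c n \<or> i = n ==> is_set i"
        using y n mem_set by auto
      have "E (adj x y) (suc n) ?g"
        unfolding E_def iss bs
      proof (intro conjI allI impI)
        fix i assume i: "i \<in>\<^sub>c n \<or> i = n"
        then consider "i \<in>\<^sub>c n" | "i = n" by blast
        then show "\<exists>b. (b \<in>\<^sub>c x \<or> b = y) \<and> pair i b \<in>\<^sub>c ?g"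
        proof cases
          case 1
          then obtain b where "b \<in>\<^sub>c x" "pair i b \<in>\<^sub>c g" using E unfolding E_def by blast
          then show ?thesis by (auto simp: mem_adj)
        next
          case 2
          then show ?thesis by (auto simp: mem_adj)
        qed
      next
        fix b assume "b \<in>\<^sub>c x \<or> b = y"
        then consider "b \<in>\<^sub>c x" | "b = y" by blast
        then show "\<exists>i. (i \<in>\<^sub>c n \<or> i = n) \<and> pair i b \<in>\<^sub>c ?g"
        proof cases
          case 1
          then obtain i where "i \<in>\<^sub>c n" "pair i b \<in>\<^sub>c g" using E unfolding E_def by blast
          then show ?thesis by (auto simp: mem_adj)
        next
          case 2
          then show ?thesis by (auto simp: mem_adj)
        qed
      next
        fix i b c assume i: "i \<in>\<^sub>c n \<or> i = n" and b: "b \<in>\<^sub>c x \<or> b = y" and c: "c \<in>\<^sub>c x \<or> c = y"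
          and *: "pair i b \<in>\<^sub>c ?g \<and> pair i c \<in>\<^sub>c ?g"
        have "(pair i b \<in>\<^sub>c g \<and> i \<in>\<^sub>c n \<and> b \<in>\<^sub>c x) \<or> (i = n \<and> b = y)" "(pair i c \<in>\<^sub>c g \<and> i \<in>\<^sub>c n \<and> c \<in>\<^sub>c x) \<or> (i = n \<and> c = y)"
          using * g'[OF set(2)[OF i] set(1)[OF b]] g'[OF set(2)[OF i] set(1)[OF c]] by blast+
        then show "b = c" using E mem_irrefl[of n] unfolding E_def by blast
      next
        fix i j b assume i: "i \<in>\<^sub>c n \<or> i = n" and j: "j \<in>\<^sub>c n \<or> j = n" and b: "b \<in>\<^sub>c x \<or> b = y"
          and *: "pair i b \<in>\<^sub>c ?g \<and> pair j b \<in>\<^sub>c ?g"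
        have "(pair i b \<in>\<^sub>c g \<and> i \<in>\<^sub>c n \<and> b \<in>\<^sub>c x) \<or> (i = n \<and> b = y)" "(pair j b \<in>\<^sub>c g \<and> j \<in>\<^sub>c n \<and> b \<in>\<^sub>c x) \<or> (j = n \<and> b = y)"
          using * g'[OF set(2)[OF i] set(1)[OF b]] g'[OF set(2)[OF j] set(1)[OF b]] by blast+
        then show "i = j" using E False unfolding E_def by blast
      qed
      moreover have "\<forall>p. p \<in>\<^sub>c ?g --> (\<exists>i. i \<in>\<^sub>c suc n \<and> (\<exists>b. b \<in>\<^sub>c adj x y \<and> p = pair i b))"
      proof (intro allI impI)
        fix p assume "p \<in>\<^sub>c ?g"
        then have "p \<in>\<^sub>c g \<or> p = pair n y" by (auto simp: mem_adj)
        then show "\<exists>i. i \<in>\<^sub>c suc n \<and> (\<exists>b. b \<in>\<^sub>c adj x y \<and> p = pair i b)"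
          unfolding bs iss using sub by blast
      qed
      ultimately show ?thesis using n g
        by (intro exI[of _ "suc n"]) (auto intro!: exI[of _ ?g])
    qed
  qed
  then show ?thesis unfolding E_def by blast
qed

text \<open>Induction over small sets for class formulas, which (Ind) does not offer. The set is
  counted by some \<open>n\<close>; this \<open>n\<close> is small and hence in \<open>SN\<close>,
  and the induction runs along \<open>SN\<close> over the images of the initial segments of
  \<open>n\<close>.\<close>

lemma small_induct:
  assumes P: "dfn True (\<lambda>s. P (s 0))" and x: "small x" and 0: "P emp"
    and step: "\<And>y z. small y ==> y \<subseteq>\<^sub>c x ==> z \<in>\<^sub>c x ==> P y ==> P (adj y z)"
  shows "P x"
proof -
  obtain n g where n: "is_nat n" and g: "is_set g"
    and dom: "\<forall>i. i \<in>\<^sub>c n --> (\<exists>b. b \<in>\<^sub>c x \<and> pair i b \<in>\<^sub>c g)"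
    and ran: "\<forall>b. b \<in>\<^sub>c x --> (\<exists>i. i \<in>\<^sub>c n \<and> pair i b \<in>\<^sub>c g)"
    and fn: "\<forall>i. i \<in>\<^sub>c n --> (\<forall>b. b \<in>\<^sub>c x --> (\<forall>c. c \<in>\<^sub>c x --> pair i b \<in>\<^sub>c g \<and> pair i c \<in>\<^sub>c g --> b = c))"
    and inj: "\<forall>i. i \<in>\<^sub>c n --> (\<forall>j. j \<in>\<^sub>c n --> (\<forall>b. b \<in>\<^sub>c x --> pair i b \<in>\<^sub>c g \<and> pair j b \<in>\<^sub>c g --> i = j))"
    using enumeration[OF small_is_set[OF x]] by blast
  let ?I = "\<lambda>m. cls (\<lambda>b. b \<in>\<^sub>c x \<and> (\<exists>i. i \<in>\<^sub>c m \<and> pair i b \<in>\<^sub>c g))"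
  have I: "b \<in>\<^sub>c ?I m \<longleftrightarrow> b \<in>\<^sub>c x \<and> (\<exists>i. i \<in>\<^sub>c m \<and> pair i b \<in>\<^sub>c g)" for b m
    by (rule mem_cls_iff) (intro dfn_intros dft_const_True, auto dest: mem_set)
  \<comment> \<open>A subclass \<open>Y\<close> of \<open>n\<close> is recovered by a set formula
    from its image, which is a set because \<open>x\<close> is small.\<close>
  have "small n" unfolding small_def
  proof (intro allI impI)
    fix Y assume Y: "Y \<subseteq>\<^sub>c n"
    have V: "is_set (?I Y)" using x by (auto simp: small_def subcls_def I)
    show "is_set Y"
    proof (rule separation[OF _ nat_is_set[OF n]])
      show "dfn False (\<lambda>s. \<exists>b. b \<in>\<^sub>c ?I Y \<and> pair (s 0) b \<in>\<^sub>c g)"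
        by (intro dfn_intros dft_const_set V g)
      fix i
      show "i \<in>\<^sub>c Y \<longleftrightarrow> i \<in>\<^sub>c n \<and> (\<exists>b. b \<in>\<^sub>c ?I Y \<and> pair i b \<in>\<^sub>c g)"
      proof
        assume "i \<in>\<^sub>c Y"
        then show "i \<in>\<^sub>c n \<and> (\<exists>b. b \<in>\<^sub>c ?I Y \<and> pair i b \<in>\<^sub>c g)"
          using Y dom unfolding I by (meson subclsD)
      next
        assume "i \<in>\<^sub>c n \<and> (\<exists>b. b \<in>\<^sub>c ?I Y \<and> pair i b \<in>\<^sub>c g)"
        then obtain b j where "i \<in>\<^sub>c n" "b \<in>\<^sub>c x" "pair i b \<in>\<^sub>c g" "j \<in>\<^sub>c Y" "pair j b \<in>\<^sub>c g" unfolding I by blast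
        then show "i \<in>\<^sub>c Y" using inj subclsD[OF Y, of j] by metis
      qed
    qed
  qed
  then have nSN: "n \<in>\<^sub>c SN" using n by (simp add: SN_iff)
  have "m \<subseteq>\<^sub>c n --> P (?I m)" if "m \<in>\<^sub>c SN" for m
  proof (rule SN_induct[OF _ that])
    show "dfn True (\<lambda>s. s 0 \<subseteq>\<^sub>c n --> P (?I (s 0)))"
      by (intro dfn_intros dft_const_True dfn_comp1[OF P])
    have "?I emp = emp" by (rule cext) (simp add: I)
    then show "emp \<subseteq>\<^sub>c n --> P (?I emp)" using 0 by simp
  next
    fix m assume m: "m \<in>\<^sub>c SN" and IH: "m \<subseteq>\<^sub>c n --> P (?I m)"
    have ms: "is_set m" using m by (rule mem_set)
    show "suc m \<subseteq>\<^sub>c n --> P (?I (suc m))"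
    proof
      assume sub: "suc m \<subseteq>\<^sub>c n"
      then have "m \<subseteq>\<^sub>c n" "m \<in>\<^sub>c n" by (auto simp: subcls_def mem_suc[OF ms])
      then obtain b where b: "b \<in>\<^sub>c x" "pair m b \<in>\<^sub>c g" using dom by blast
      have "?I (suc m) = adj (?I m) b"
      proof (rule cext)
        fix z
        have "z = b" if "z \<in>\<^sub>c x" "pair m z \<in>\<^sub>c g" using fn \<open>m \<in>\<^sub>c n\<close> b that by blast
        then show "z \<in>\<^sub>c ?I (suc m) \<longleftrightarrow> z \<in>\<^sub>c adj (?I m) b"
          unfolding mem_adj unfolding I unfolding mem_suc[OF ms] using b mem_set[OF b(1)] by blast
      qed
      moreover have "P (adj (?I m) b)"
      proof (rule step)
        show sx: "?I m \<subseteq>\<^sub>c x" by (auto simp: I subcls_def)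
        show "small (?I m)" by (rule small_subcls[OF x sx])
        show "P (?I m)" using IH \<open>m \<subseteq>\<^sub>c n\<close> by blast
      qed (rule b)
      ultimately show "P (?I (suc m))" by simp
    qed
  qed
  from this[OF nSN] have "P (?I n)" by (simp add: subcls_def)
  moreover have "?I n = x" by (rule cext) (use ran in \<open>auto simp: I\<close>)
  ultimately show ?thesis by simp
qed

lemma small_bun [simp]:
  assumes x: "small x" and y: "small y" shows "small (bun x y)"
proof (rule small_induct[OF _ y])
  show "dfn True (\<lambda>s. small (bun x (s 0)))"
    unfolding bun_def by (intro dfn_intros dft_const_True)
  have "bun x emp = x" by (rule cext) simp
  then show "small (bun x emp)" using x by simp
next
  fix u v assume "small (bun x u)"
  moreover have "bun x (adj u v) = adj (bun x u) v" by (rule cext) (auto simp: mem_adj)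
  ultimately show "small (bun x (adj u v))" by simp
qed

lemma mem_image:
  assumes f: "dft True (\<lambda>s. f (s 0))"
  shows "z \<in>\<^sub>c cls (\<lambda>z. \<exists>y. y \<in>\<^sub>c x \<and> z = f y) \<longleftrightarrow> is_set z \<and> (\<exists>y. y \<in>\<^sub>c x \<and> z = f y)"
  by (rule mem_cls) (intro dfn_intros dft_const_True dft_comp1[OF f])

lemma small_image:
  assumes f: "dft True (\<lambda>s. f (s 0))" and x: "small x"
  shows "small (cls (\<lambda>z. \<exists>y. y \<in>\<^sub>c x \<and> z = f y))"
proof (rule small_induct[OF _ x])
  show "dfn True (\<lambda>s. small (cls (\<lambda>z. \<exists>y. y \<in>\<^sub>c s 0 \<and> z = f y)))"
    by (intro dfn_intros dft_comp1[OF f])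
  have "cls (\<lambda>z. \<exists>y. y \<in>\<^sub>c emp \<and> z = f y) = emp"
    by (rule cext) (simp add: mem_image[OF f])
  then show "small (cls (\<lambda>z. \<exists>y. y \<in>\<^sub>c emp \<and> z = f y))" by simp
next
  fix u v assume v: "v \<in>\<^sub>c x" and "small (cls (\<lambda>z. \<exists>y. y \<in>\<^sub>c u \<and> z = f y))"
  moreover have "cls (\<lambda>z. \<exists>y. y \<in>\<^sub>c adj u v \<and> z = f y) = adj (cls (\<lambda>z. \<exists>y. y \<in>\<^sub>c u \<and> z = f y)) (f v)"
    by (rule cext) (unfold mem_image[OF f], unfold mem_adj, unfold mem_image[OF f], use mem_set[OF v] in blast)
  ultimately show "small (cls (\<lambda>z. \<exists>y. y \<in>\<^sub>c adj u v \<and> z = f y))" by simp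
qed

lemma dft_union_of [dfn_intros]: "dft b t ==> dft b (\<lambda>s. \<Union>\<^sub>c (t s))"
proof (rule dft_comp1[where F = union_of])
  show "dft b (\<lambda>s. \<Union>\<^sub>c (s 0))"
    by (rule dftI_ext[where Q = "\<lambda>s z. \<exists>y. y \<in>\<^sub>c s 0 \<and> z \<in>\<^sub>c y"])
      (simp add: dm_def, use mem_set in auto, intro dfn_intros)
qed

lemma small_union_of:
  assumes x: "small x" and "\<forall>y. y \<in>\<^sub>c x --> small y" shows "small (\<Union>\<^sub>c x)"
proof -
  have "(\<forall>y. y \<in>\<^sub>c x --> small y) --> small (\<Union>\<^sub>c x)"
  proof (rule small_induct[OF _ x])
    show "dfn True (\<lambda>s. (\<forall>y. y \<in>\<^sub>c s 0 --> small y) --> small (\<Union>\<^sub>c (s 0)))"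
      by (intro dfn_intros)
    have "\<Union>\<^sub>c emp = emp" by (rule cext) simp
    then show "(\<forall>y. y \<in>\<^sub>c emp --> small y) --> small (\<Union>\<^sub>c emp)" by simp
  next
    fix u v assume v: "v \<in>\<^sub>c x" and IH: "(\<forall>y. y \<in>\<^sub>c u --> small y) --> small (\<Union>\<^sub>c u)"
    have "\<Union>\<^sub>c (adj u v) = bun (\<Union>\<^sub>c u) v" by (rule cext) (use mem_set[OF v] in \<open>auto simp: mem_adj\<close>)
    then show "(\<forall>y. y \<in>\<^sub>c adj u v --> small y) --> small (\<Union>\<^sub>c (adj u v))"
      using IH mem_set[OF v] by (auto simp: mem_adj)
  qed
  with assms show ?thesis by blast
qed


subsection \<open>Thin classes\<close>

lemma dft_inter [dfn_intros]: "dft True t ==> dft True u ==> dft True (\<lambda>s. t s \<inter>\<^sub>c u s)"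
  by (rule dft_comp2[where F = "(\<inter>\<^sub>c)"]) (unfold inter_def, intro dfn_intros)

lemma dft_bun [dfn_intros]: "dft True t ==> dft True u ==> dft True (\<lambda>s. bun (t s) (u s))"
  by (rule dft_comp2[where F = bun]) (unfold bun_def, intro dfn_intros)

lemma dft_dif [dfn_intros]: "dft True t ==> dft True u ==> dft True (\<lambda>s. dif (t s) (u s))"
  by (rule dft_comp2[where F = dif]) (unfold dif_def, intro dfn_intros)

lemma dft_image_cls [dfn_intros]: "dft True t ==> dft True u ==> dft True (\<lambda>s. t s ``\<^sub>c u s)"
  by (rule dft_comp2[where F = "(``\<^sub>c)"]) (unfold image_cls_def, intro dfn_intros)

lemma dfn_thin [dfn_intros]: "dft True t ==> dfn True (\<lambda>s. thin (t s))"
proof (rule dfn_comp1[where P = thin])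
  have "dfn True (\<lambda>s. \<forall>x. is_set x --> x \<subseteq>\<^sub>c s 0 --> small x)" by (intro dfn_intros)
  then show "dfn True (\<lambda>s. thin (s 0))" by (simp add: thin_def imp_conjL)
qed

definition img :: "('a \<Rightarrow> 'a) \<Rightarrow> 'a \<Rightarrow> 'a" where
  "img f X = cls (\<lambda>z. \<exists>y. y \<in>\<^sub>c X \<and> z = f y)"

lemma mem_img:
  "dft True (\<lambda>s. f (s 0)) ==> z \<in>\<^sub>c img f X \<longleftrightarrow> is_set z \<and> (\<exists>y. y \<in>\<^sub>c X \<and> z = f y)"
  unfolding img_def by (rule mem_image)

lemma small_img: "dft True (\<lambda>s. f (s 0)) ==> small x ==> small (img f x)"
  unfolding img_def by (rule small_image)

lemma thinD: "thin X ==> is_set x ==> x \<subseteq>\<^sub>c X ==> small x"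
  by (simp add: thin_def)

lemma subcls_trans: "X \<subseteq>\<^sub>c Y ==> Y \<subseteq>\<^sub>c V ==> X \<subseteq>\<^sub>c V"
  by (simp add: subcls_def)

lemma subcls_refl [simp]: "X \<subseteq>\<^sub>c X"
  by (simp add: subcls_def)

lemma subcls_antisym: "X \<subseteq>\<^sub>c Y ==> Y \<subseteq>\<^sub>c X ==> X = Y"
  by (rule cext) (auto dest: subclsD)

lemma thin_subcls: "thin X ==> Y \<subseteq>\<^sub>c X ==> thin Y"
  unfolding thin_def using subcls_trans by blast

lemma small_thin: "small x ==> thin x"
  unfolding thin_def using small_subcls by blast

lemma small_upair [simp]: "small (upair a b)"
proof -
  have "upair a b \<subseteq>\<^sub>c adj (adj emp a) b" by (rule subclsI) (auto simp: mem_upair mem_adj)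
  then show ?thesis by (rule small_subcls[rotated]) simp
qed

text \<open>
  The tagged pairs \<open>J a = {(0, f a), (1, a)}\<close> form a thin class whose union covers the copy
  \<open>{0} \<times> v\<close> of any subset \<open>v\<close> of the image, so (Comp) makes \<open>v\<close> small.
\<close>

lemma thin_img:
  assumes f: "dft True (\<lambda>s. f (s 0))" and X: "thin X"
  shows "thin (img f X)"
  unfolding thin_def
proof (intro allI impI, elim conjE)
  fix v assume v: "is_set v" and vX: "v \<subseteq>\<^sub>c img f X"
  note f' = dft_comp1[OF f]
  let ?J = "\<lambda>a. upair (pair emp (f a)) (pair (sing emp) a)"
  \<comment> \<open>Arguments whose value is a proper class are discarded:
    \<open>pair emp (f a)\<close> would collapse for them, and they contribute nothing to the
    image.\<close>
  let ?X = "cls (\<lambda>a. a \<in>\<^sub>c X \<and> is_set (f a))"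
  have mX: "a \<in>\<^sub>c ?X \<longleftrightarrow> a \<in>\<^sub>c X \<and> is_set (f a)" for a
    by (rule mem_cls_iff) (intro dfn_intros dft_const_True f', use mem_set in blast)
  have ne: "sing emp \<noteq> emp" by (metis is_set_emp mem_upair not_mem_emp)
  have Jd: "dft True (\<lambda>s. ?J (s 0))" by (intro dfn_intros f')
  have mJ: "j \<in>\<^sub>c img ?J ?X \<longleftrightarrow> (\<exists>a. a \<in>\<^sub>c X \<and> is_set (f a) \<and> j = ?J a)" for j
    unfolding mem_img[OF Jd] mX by auto
  have "thin (img ?J ?X)" unfolding thin_def
  proof (intro allI impI, elim conjE)
    fix w assume w: "is_set w" and wJ: "w \<subseteq>\<^sub>c img ?J ?X"
    let ?A = "cls (\<lambda>a. \<exists>j. j \<in>\<^sub>c w \<and> pair (sing emp) a \<in>\<^sub>c j)"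
    have A: "a \<in>\<^sub>c ?A \<longleftrightarrow> is_set a \<and> (\<exists>j. j \<in>\<^sub>c w \<and> pair (sing emp) a \<in>\<^sub>c j)" for a
      by (rule mem_cls) (intro dfn_intros dft_const_True)
    have As: "is_set ?A"
    proof (rule is_set_clsI)
      show "is_set (\<Union>\<^sub>c (\<Union>\<^sub>c (\<Union>\<^sub>c w)))" using w by simp
      show "dfn True (\<lambda>s. \<exists>j. j \<in>\<^sub>c w \<and> pair (sing emp) (s 0) \<in>\<^sub>c j)"
        by (intro dfn_intros dft_const_True)
      show "dfn False (\<lambda>s. \<exists>j. j \<in>\<^sub>c w \<and> pair (sing emp) (s 0) \<in>\<^sub>c j)"
        by (intro dfn_intros dft_const_set w)
      fix z assume z: "is_set z" and "\<exists>j. j \<in>\<^sub>c w \<and> pair (sing emp) z \<in>\<^sub>c j"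
      then have "pair (sing emp) z \<in>\<^sub>c \<Union>\<^sub>c w" by simp
      then have "related (\<Union>\<^sub>c w) (sing emp) z" using z by (simp add: related_def)
      then show "z \<in>\<^sub>c \<Union>\<^sub>c (\<Union>\<^sub>c (\<Union>\<^sub>c w))" using related_mem2 by blast
    qed
    have "?A \<subseteq>\<^sub>c X"
    proof (rule subclsI)
      fix a assume "a \<in>\<^sub>c ?A"
      then obtain j where a: "is_set a" and j: "j \<in>\<^sub>c w" "pair (sing emp) a \<in>\<^sub>c j" unfolding A by blast
      obtain a' where a': "a' \<in>\<^sub>c X" "is_set (f a')" "j = ?J a'" using subclsD[OF wJ j(1)] unfolding mJ by blast
      have "pair (sing emp) a = pair emp (f a') \<or> pair (sing emp) a = pair (sing emp) a'"
        using j(2) a'(3) by (simp add: mem_upair)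
      then have "a = a'" using a a' ne mem_set[OF a'(1)] by simp
      then show "a \<in>\<^sub>c X" using a' by simp
    qed
    then have "small ?A" using As by (intro thinD[OF X])
    then have "small (img ?J ?A)" by (rule small_img[OF Jd])
    moreover have "w \<subseteq>\<^sub>c img ?J ?A"
    proof (rule subclsI)
      fix j assume j: "j \<in>\<^sub>c w"
      obtain a where a: "a \<in>\<^sub>c X" "j = ?J a" using subclsD[OF wJ j(1)] unfolding mJ by blast
      have "a \<in>\<^sub>c ?A" unfolding A using a j mem_set[OF a(1)] by (auto simp: mem_upair)
      then show "j \<in>\<^sub>c img ?J ?A" unfolding mem_img[OF Jd] using a j mem_set by blast
    qed
    ultimately show "small w" by (rule small_subcls)
  qed
  let ?u = "cls (\<lambda>p. \<exists>b. b \<in>\<^sub>c v \<and> p = pair emp b)"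
  have u: "p \<in>\<^sub>c ?u \<longleftrightarrow> (\<exists>b. b \<in>\<^sub>c v \<and> p = pair emp b)" for p
    by (rule mem_cls_iff) (intro dfn_intros dft_const_True, auto)
  have us: "is_set ?u" by (rule replacement[OF _ _ v]) (intro dfn_intros)+
  have "?u \<subseteq>\<^sub>c \<Union>\<^sub>c (img ?J ?X)"
  proof (rule subclsI)
    fix p assume "p \<in>\<^sub>c ?u"
    then obtain b where b: "b \<in>\<^sub>c v" "p = pair emp b" unfolding u by blast
    obtain a where a: "a \<in>\<^sub>c X" "b = f a" using subclsD[OF vX b(1)] unfolding mem_img[OF f] by blast
    have "?J a \<in>\<^sub>c img ?J ?X" unfolding mJ using a mem_set[OF b(1)] by blast
    moreover have "p \<in>\<^sub>c ?J a" using a b by (simp add: mem_upair)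
    ultimately show "p \<in>\<^sub>c \<Union>\<^sub>c (img ?J ?X)" unfolding mem_union_of by blast
  qed
  then obtain x where x: "is_set x" "x \<subseteq>\<^sub>c img ?J ?X" "?u \<subseteq>\<^sub>c \<Union>\<^sub>c x"
    using Comp us \<open>thin (img ?J ?X)\<close> by blast
  have "small x" using x \<open>thin (img ?J ?X)\<close> by (intro thinD)
  then have "small (\<Union>\<^sub>c x)"
  proof (rule small_union_of)
    have "small y" if "y \<in>\<^sub>c x" for y
      using subclsD[OF x(2) that] unfolding mJ by auto
    then show "\<forall>y. y \<in>\<^sub>c x --> small y" by blast
  qed
  then have su: "small ?u" using x(3) by (rule small_subcls)
  show "small v" unfolding small_def
  proof (intro allI impI)
    fix Y assume Y: "Y \<subseteq>\<^sub>c v"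
    let ?W = "cls (\<lambda>p. \<exists>b. b \<in>\<^sub>c Y \<and> p = pair emp b)"
    have W: "p \<in>\<^sub>c ?W \<longleftrightarrow> (\<exists>b. b \<in>\<^sub>c Y \<and> p = pair emp b)" for p
      by (rule mem_cls_iff) (intro dfn_intros dft_const_True, auto)
    have "?W \<subseteq>\<^sub>c ?u" by (rule subclsI) (unfold u W, use Y subclsD in blast)
    then have Ws: "is_set ?W" using su by (simp add: small_def)
    show "is_set Y"
    proof (rule separation[OF _ v])
      show "dfn False (\<lambda>s. pair emp (s 0) \<in>\<^sub>c ?W)" by (intro dfn_intros dft_const_set Ws)
      fix z assume z: "is_set z"
      have "z \<in>\<^sub>c Y" if "b \<in>\<^sub>c Y" "pair emp z = pair emp b" for b
        using that z mem_set[OF that(1)] by simp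
      then show "z \<in>\<^sub>c Y \<longleftrightarrow> z \<in>\<^sub>c v \<and> pair emp z \<in>\<^sub>c ?W"
        unfolding W using Y subclsD by blast
    qed
  qed
qed

text \<open>The second projection, given by its elements so that it is total and falls under the
  class rules for definability.\<close>

definition sndp :: "'a \<Rightarrow> 'a" where
  "sndp p = cls (\<lambda>z. \<exists>a. is_set a \<and> (\<exists>b. is_set b \<and> p = pair a b \<and> z \<in>\<^sub>c b))"

lemma sndp_pair [simp]:
  assumes "is_set a" "is_set b" shows "sndp (pair a b) = b"
proof (rule cext)
  fix z
  have "z \<in>\<^sub>c sndp (pair a b) \<longleftrightarrow> is_set z \<and> (\<exists>a'. is_set a' \<and> (\<exists>b'. is_set b' \<and> pair a b = pair a' b' \<and> z \<in>\<^sub>c b'))"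
    unfolding sndp_def by (rule mem_cls) (intro dfn_intros dft_const_True)
  then show "z \<in>\<^sub>c sndp (pair a b) \<longleftrightarrow> z \<in>\<^sub>c b" using assms mem_set[of z b] by auto
qed

lemma dft_sndp [dfn_intros]: "dft True t ==> dft True (\<lambda>s. sndp (t s))"
  by (rule dft_comp1[where F = sndp]) (unfold sndp_def, intro dfn_intros)

lemma mem_Union_family:
  assumes U: "dft True (\<lambda>s. U (s 0))"
  shows "z \<in>\<^sub>c cls (\<lambda>z. \<exists>a. a \<in>\<^sub>c X \<and> z \<in>\<^sub>c U a) \<longleftrightarrow> (\<exists>a. a \<in>\<^sub>c X \<and> z \<in>\<^sub>c U a)"
  by (rule mem_cls_iff) (intro dfn_intros dft_const_True dft_comp1[OF U], use mem_set in blast)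

text \<open>The union is covered by the projection of the disjoint sum \<open>?S\<close>. A set
  \<open>v\<close> included in \<open>?S\<close> has its domain included in \<open>X\<close>, and
  its fibres are included in the thin classes \<open>U a\<close>; all of these are small, and small
  induction on the domain puts the fibres together.\<close>

lemma thin_Union_family:
  assumes U: "dft True (\<lambda>s. U (s 0))" and X: "thin X" and UX: "\<And>a. a \<in>\<^sub>c X ==> thin (U a)"
  shows "thin (cls (\<lambda>z. \<exists>a. a \<in>\<^sub>c X \<and> z \<in>\<^sub>c U a))"
proof -
  note U' = dft_comp1[OF U]
  let ?S = "cls (\<lambda>p. \<exists>a. a \<in>\<^sub>c X \<and> (\<exists>b. b \<in>\<^sub>c U a \<and> p = pair a b))"
  have S: "p \<in>\<^sub>c ?S \<longleftrightarrow> (\<exists>a. a \<in>\<^sub>c X \<and> (\<exists>b. b \<in>\<^sub>c U a \<and> p = pair a b))" for p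
    by (rule mem_cls_iff) (intro dfn_intros dft_const_True U', auto)
  have "thin ?S" unfolding thin_def
  proof (intro allI impI, elim conjE)
    fix v assume v: "is_set v" and vS: "v \<subseteq>\<^sub>c ?S"
    have rel: "a \<in>\<^sub>c X \<and> b \<in>\<^sub>c U a" if "related v a b" for a b
    proof -
      have ab: "is_set a" "is_set b" "pair a b \<in>\<^sub>c v" using that by (simp_all add: related_def)
      then obtain a' b' where "a' \<in>\<^sub>c X" "b' \<in>\<^sub>c U a'" "pair a b = pair a' b'"
        using subclsD[OF vS] unfolding S by blast
      then show ?thesis using ab mem_set[of a' X] mem_set[of b' "U a'"] by simp
    qed
    have DX: "Dom v \<subseteq>\<^sub>c X" by (rule subclsI) (use rel in \<open>auto simp: mem_Dom\<close>)
    then have D: "small (Dom v)" using v by (intro thinD[OF X]) simp_all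
    let ?V = "\<lambda>y. cls (\<lambda>p. p \<in>\<^sub>c v \<and> (\<exists>a. a \<in>\<^sub>c y \<and> (\<exists>b. is_set b \<and> p = pair a b)))"
    have V: "p \<in>\<^sub>c ?V y \<longleftrightarrow> p \<in>\<^sub>c v \<and> (\<exists>a. a \<in>\<^sub>c y \<and> (\<exists>b. is_set b \<and> p = pair a b))" for p y
      by (rule mem_cls_iff) (intro dfn_intros dft_const_True, use mem_set in blast)
    have "small (?V (Dom v))"
    proof (rule small_induct[OF _ D])
      show "dfn True (\<lambda>s. small (?V (s 0)))" by (intro dfn_intros dft_const_True)
      have "?V emp = emp" by (rule cext) (unfold V, simp)
      then show "small (?V emp)" by simp
    next
      fix y a assume a: "a \<in>\<^sub>c Dom v" and IH: "small (?V y)"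
      have as: "is_set a" by (rule mem_set[OF a])
      have pd: "dft True (\<lambda>s. pair a (s 0))" by (intro dfn_intros dft_const_True)
      have "v ``\<^sub>c sing a \<subseteq>\<^sub>c U a"
        by (rule subclsI) (use rel in \<open>auto simp: mem_image_cls mem_upair\<close>)
      then have "small (v ``\<^sub>c sing a)" using v a DX by (intro thinD[OF UX]) (auto dest: subclsD)
      then have sm: "small (bun (?V y) (img (pair a) (v ``\<^sub>c sing a)))"
        using IH small_img[OF pd] by simp
      have "?V (adj y a) \<subseteq>\<^sub>c bun (?V y) (img (pair a) (v ``\<^sub>c sing a))"
      proof (rule subclsI)
        fix p assume "p \<in>\<^sub>c ?V (adj y a)"
        then obtain c b where p: "p \<in>\<^sub>c v" "c \<in>\<^sub>c adj y a" "is_set b" "p = pair c b" unfolding V by blast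
        show "p \<in>\<^sub>c bun (?V y) (img (pair a) (v ``\<^sub>c sing a))"
        proof (cases "c \<in>\<^sub>c y")
          case True
          then show ?thesis using p unfolding mem_bun V by blast
        next
          case False
          then have "c = a" using p by (auto simp: mem_adj)
          then have "b \<in>\<^sub>c v ``\<^sub>c sing a" using p as by (auto simp: mem_image_cls mem_upair related_def)
          then show ?thesis unfolding mem_bun mem_img[OF pd] using p \<open>c = a\<close> by auto
        qed
      qed
      then show "small (?V (adj y a))" by (rule small_subcls[OF sm])
    qed
    moreover have "v \<subseteq>\<^sub>c ?V (Dom v)"
    proof (rule subclsI)
      fix p assume p: "p \<in>\<^sub>c v"
      then obtain a b where ab: "a \<in>\<^sub>c X" "b \<in>\<^sub>c U a" "p = pair a b" using subclsD[OF vS] unfolding S by blast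
      then have "related v a b" using p mem_set[OF ab(1)] mem_set[OF ab(2)] by (simp add: related_def)
      then show "p \<in>\<^sub>c ?V (Dom v)" unfolding V using p ab mem_set[OF ab(2)] by (auto simp: mem_Dom)
    qed
    ultimately show "small v" by (rule small_subcls)
  qed
  moreover have sd: "dft True (\<lambda>s. sndp (s 0))" by (intro dfn_intros)
  ultimately have "thin (img sndp ?S)" by (intro thin_img)
  moreover have "cls (\<lambda>z. \<exists>a. a \<in>\<^sub>c X \<and> z \<in>\<^sub>c U a) \<subseteq>\<^sub>c img sndp ?S"
  proof (rule subclsI)
    fix z assume "z \<in>\<^sub>c cls (\<lambda>z. \<exists>a. a \<in>\<^sub>c X \<and> z \<in>\<^sub>c U a)"
    then obtain a where a: "a \<in>\<^sub>c X" "z \<in>\<^sub>c U a" unfolding mem_Union_family[OF U] by blast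
    then have "pair a z \<in>\<^sub>c ?S" unfolding S by blast
    moreover have "z = sndp (pair a z)" using a mem_set by simp
    ultimately show "z \<in>\<^sub>c img sndp ?S" unfolding mem_img[OF sd] using mem_set[OF a(2)] by blast
  qed
  ultimately show ?thesis by (rule thin_subcls)
qed

lemma thin_bun [simp]:
  assumes "thin X" "thin Y" shows "thin (bun X Y)"
proof -
  \<comment> \<open>A family with two indices: \<open>emp\<close> selects \<open>X\<close>, any
    other index selects \<open>Y\<close>.\<close>
  let ?U = "\<lambda>a. cls (\<lambda>z. a = emp \<and> z \<in>\<^sub>c X \<or> a \<noteq> emp \<and> z \<in>\<^sub>c Y)"
  have U: "dft True (\<lambda>s. ?U (s 0))" by (intro dfn_intros dft_const_True)
  have mU: "z \<in>\<^sub>c ?U a \<longleftrightarrow> a = emp \<and> z \<in>\<^sub>c X \<or> a \<noteq> emp \<and> z \<in>\<^sub>c Y" for z a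
    by (rule mem_cls_iff) (intro dfn_intros dft_const_True, use mem_set in blast)
  have "thin (?U a)" for a
    by (rule thin_subcls[of "if a = emp then X else Y"]) (use assms in simp, rule subclsI, unfold mU, auto)
  then have "thin (cls (\<lambda>z. \<exists>a. a \<in>\<^sub>c upair emp (sing emp) \<and> z \<in>\<^sub>c ?U a))"
    by (rule thin_Union_family[OF U small_thin[OF small_upair]])
  moreover have "bun X Y \<subseteq>\<^sub>c cls (\<lambda>z. \<exists>a. a \<in>\<^sub>c upair emp (sing emp) \<and> z \<in>\<^sub>c ?U a)"
  proof (rule subclsI)
    have "sing emp \<noteq> emp" by (metis is_set_emp mem_upair not_mem_emp)
    moreover fix z assume "z \<in>\<^sub>c bun X Y"
    ultimately show "z \<in>\<^sub>c cls (\<lambda>z. \<exists>a. a \<in>\<^sub>c upair emp (sing emp) \<and> z \<in>\<^sub>c ?U a)"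
      unfolding mem_Union_family[OF U] unfolding mU mem_upair mem_bun using is_set_emp is_set_upair by blast
  qed
  ultimately show ?thesis by (rule thin_subcls)
qed

lemma thin_prd:
  assumes "thin X" "thin Y" shows "thin (prd X Y)"
proof -
  have p: "dft True (\<lambda>s. pair a (s 0))" for a by (intro dfn_intros dft_const_True)
  have d: "dft True (\<lambda>s. img (pair (s 0)) Y)" unfolding img_def by (intro dfn_intros dft_const_True)
  have "thin (cls (\<lambda>z. \<exists>a. a \<in>\<^sub>c X \<and> z \<in>\<^sub>c img (pair a) Y))"
    by (rule thin_Union_family[OF d assms(1)]) (rule thin_img[OF p assms(2)])
  moreover have "prd X Y \<subseteq>\<^sub>c cls (\<lambda>z. \<exists>a. a \<in>\<^sub>c X \<and> z \<in>\<^sub>c img (pair a) Y)"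
    by (rule subclsI, unfold mem_Union_family[OF d], unfold mem_prd mem_img[OF p]) auto
  ultimately show ?thesis by (rule thin_subcls)
qed

text \<open>A nonempty set of standard numbers has a greatest element \<open>m\<close> and is
  therefore included in the small set \<open>suc m\<close>.\<close>

lemma thin_SN: "thin SN"
  unfolding thin_def
proof (intro allI impI, elim conjE)
  fix v assume v: "is_set v" and vS: "v \<subseteq>\<^sub>c SN"
  show "small v"
  proof (cases "\<exists>y. y \<in>\<^sub>c v")
    case False
    then have "v = emp" by (intro cext) simp
    then show ?thesis by simp
  next
    case True
    then obtain m where m: "m \<in>\<^sub>c v" "\<forall>y. y \<in>\<^sub>c v --> y = m \<or> y \<in>\<^sub>c m"
      using nats_max[OF v] SN_nat subclsD[OF vS] by blast
    have "v \<subseteq>\<^sub>c suc m" by (rule subclsI) (use m mem_suc[OF mem_set[OF m(1)]] in blast)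
    moreover have "small (suc m)" using subclsD[OF vS m(1)] by (simp add: SN_iff small_suc)
    ultimately show ?thesis by (rule small_subcls[rotated])
  qed
qed

section \<open>Small subsets, saturation and choice functions\<close>

definition fin :: "'a \<Rightarrow> 'a" where
  "fin X = cls (\<lambda>x. x \<subseteq>\<^sub>c X)"

lemma mem_fin: "x \<in>\<^sub>c fin X \<longleftrightarrow> is_set x \<and> x \<subseteq>\<^sub>c X"
  unfolding fin_def by (rule mem_cls) (intro dfn_intros dft_const_True)

text \<open>(Exp) yields a thin class that realizes the traces on \<open>X\<close> of all sets. A
  set included in \<open>X\<close> is its own trace, so \<open>fin X\<close> is included in a
  definable image of that thin class.\<close>

lemma thin_fin:
  assumes X: "thin X" shows "thin (fin X)"
proof -
  obtain P where P: "thin P" "\<And>y. is_set y ==> \<exists>p. p \<in>\<^sub>c P \<and> y \<inter>\<^sub>c X = p \<inter>\<^sub>c X"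
    using Exp X by blast
  have d: "dft True (\<lambda>s. s 0 \<inter>\<^sub>c X)" by (intro dfn_intros dft_const_True)
  have "fin X \<subseteq>\<^sub>c img (\<lambda>p. p \<inter>\<^sub>c X) P"
  proof (rule subclsI)
    fix x assume "x \<in>\<^sub>c fin X"
    then have x: "is_set x" "x \<subseteq>\<^sub>c X" by (simp_all add: mem_fin)
    then have "x \<inter>\<^sub>c X = x" by (intro cext) (auto dest: subclsD)
    with P(2)[OF x(1)] show "x \<in>\<^sub>c img (\<lambda>p. p \<inter>\<^sub>c X) P" unfolding mem_img[OF d] using x(1) by auto
  qed
  then show ?thesis using thin_img[OF d P(1)] by (rule thin_subcls[rotated])
qed

text \<open>
  Saturation: if no set separated \<open>X\<close> from \<open>K\<close>, then the power set of a set \<open>w\<close> containing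
  \<open>X\<close> would be covered by the thin class of all \<open>A x = {y. x \<notin> y}\<close> and
  \<open>B k = {y. y meets k}\<close>, hence by a small subclass; but the small set of those \<open>x\<close> for which
  \<open>A x\<close> is needed is not covered.
\<close>

lemma separate:
  assumes X: "thin X" and K: "thin K" and disj: "\<And>k z. k \<in>\<^sub>c K ==> z \<in>\<^sub>c k ==> \<not> z \<in>\<^sub>c X"
  shows "\<exists>d. is_set d \<and> X \<subseteq>\<^sub>c d \<and> (\<forall>k z. k \<in>\<^sub>c K --> z \<in>\<^sub>c k --> \<not> z \<in>\<^sub>c d)"
proof (rule ccontr)
  assume neg: "\<not> ?thesis"
  obtain w where w: "is_set w" "X \<subseteq>\<^sub>c w" using Thin X by blast
  let ?A = "\<lambda>a. cls (\<lambda>y. y \<in>\<^sub>c pow w \<and> \<not> a \<in>\<^sub>c y)"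
  let ?B = "\<lambda>k. cls (\<lambda>y. y \<in>\<^sub>c pow w \<and> (\<exists>z. z \<in>\<^sub>c k \<and> z \<in>\<^sub>c y))"
  have A: "y \<in>\<^sub>c ?A a \<longleftrightarrow> y \<in>\<^sub>c pow w \<and> \<not> a \<in>\<^sub>c y" for y a
    by (rule mem_cls_iff) (intro dfn_intros dft_const_True, use mem_set in blast)
  have B: "y \<in>\<^sub>c ?B k \<longleftrightarrow> y \<in>\<^sub>c pow w \<and> (\<exists>z. z \<in>\<^sub>c k \<and> z \<in>\<^sub>c y)" for y k
    by (rule mem_cls_iff) (intro dfn_intros dft_const_True, use mem_set in blast)
  have Ad: "dft True (\<lambda>s. ?A (s 0))" by (intro dfn_intros dft_const_True)
  have Bd: "dft True (\<lambda>s. ?B (s 0))" by (intro dfn_intros dft_const_True)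
  have pw: "is_set (pow w)" using w by simp
  have As: "is_set (?A a)" if "is_set a" for a
    by (rule separation[OF _ pw, of "\<lambda>y. \<not> a \<in>\<^sub>c y"]) (intro dfn_intros dft_const_set that, unfold A, simp)
  have Bs: "is_set (?B k)" if "is_set k" for k
    by (rule separation[OF _ pw, of "\<lambda>y. \<exists>z. z \<in>\<^sub>c k \<and> z \<in>\<^sub>c y"]) (intro dfn_intros dft_const_set that, unfold B, simp)
  let ?F = "bun (img ?A X) (img ?B K)"
  have F: "j \<in>\<^sub>c ?F \<longleftrightarrow> is_set j \<and> ((\<exists>a. a \<in>\<^sub>c X \<and> j = ?A a) \<or> (\<exists>k. k \<in>\<^sub>c K \<and> j = ?B k))" for j
    unfolding mem_bun mem_img[OF Ad] mem_img[OF Bd] by blast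
  have tF: "thin ?F" using thin_img[OF Ad X] thin_img[OF Bd K] by simp
  have "pow w \<subseteq>\<^sub>c \<Union>\<^sub>c ?F"
  proof (rule subclsI)
    fix y assume y: "y \<in>\<^sub>c pow w"
    then have "\<not> (X \<subseteq>\<^sub>c y \<and> (\<forall>k z. k \<in>\<^sub>c K --> z \<in>\<^sub>c k --> \<not> z \<in>\<^sub>c y))" using neg mem_set by blast
    then consider a where "a \<in>\<^sub>c X" "\<not> a \<in>\<^sub>c y" | k z where "k \<in>\<^sub>c K" "z \<in>\<^sub>c k" "z \<in>\<^sub>c y"
      unfolding subcls_def by blast
    then show "y \<in>\<^sub>c \<Union>\<^sub>c ?F"
    proof cases
      case 1
      then have "y \<in>\<^sub>c ?A a" unfolding A using y by blast
      moreover have "?A a \<in>\<^sub>c ?F" unfolding F using 1 As mem_set by blast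
      ultimately show ?thesis unfolding mem_union_of by blast
    next
      case 2
      then have "y \<in>\<^sub>c ?B k" unfolding B using y by blast
      moreover have "?B k \<in>\<^sub>c ?F" unfolding F using 2 Bs mem_set by blast
      ultimately show ?thesis unfolding mem_union_of by blast
    qed
  qed
  then obtain x where x: "is_set x" "x \<subseteq>\<^sub>c ?F" "pow w \<subseteq>\<^sub>c \<Union>\<^sub>c x" using Comp tF pw by blast
  \<comment> \<open>That \<open>j\<close> is \<open>?A a\<close> is expressed through the elements
    of \<open>pow w\<close>, without mentioning the classes \<open>X\<close> and \<open>K\<close>;
    thus \<open>?c\<close> is a set.\<close>
  let ?c = "cls (\<lambda>a. a \<in>\<^sub>c w \<and> (\<exists>j. j \<in>\<^sub>c x \<and> (\<forall>y. y \<in>\<^sub>c pow w --> (y \<in>\<^sub>c j \<longleftrightarrow> \<not> a \<in>\<^sub>c y))))"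
  have c: "a \<in>\<^sub>c ?c \<longleftrightarrow> a \<in>\<^sub>c w \<and> (\<exists>j. j \<in>\<^sub>c x \<and> (\<forall>y. y \<in>\<^sub>c pow w --> (y \<in>\<^sub>c j \<longleftrightarrow> \<not> a \<in>\<^sub>c y)))" for a
    by (rule mem_cls_iff) (intro dfn_intros dft_const_True, use mem_set in blast)
  have cs: "is_set ?c"
    by (rule separation[OF _ w(1), of "\<lambda>a. \<exists>j. j \<in>\<^sub>c x \<and> (\<forall>y. y \<in>\<^sub>c pow w --> (y \<in>\<^sub>c j \<longleftrightarrow> \<not> a \<in>\<^sub>c y))"])
      (intro dfn_intros dft_const_set x pw, unfold c, simp)
  have cX: "a \<in>\<^sub>c X" if "a \<in>\<^sub>c ?c" for a
  proof -
    have aw: "a \<in>\<^sub>c w" and "\<exists>j. j \<in>\<^sub>c x \<and> (\<forall>y. y \<in>\<^sub>c pow w --> (y \<in>\<^sub>c j \<longleftrightarrow> \<not> a \<in>\<^sub>c y))"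
      using that unfolding c by (rule conjunct1, rule conjunct2)
    then obtain j where j: "j \<in>\<^sub>c x" "\<forall>y. y \<in>\<^sub>c pow w --> (y \<in>\<^sub>c j \<longleftrightarrow> \<not> a \<in>\<^sub>c y)"
      by (elim exE conjE)
    \<comment> \<open>The set \<open>emp\<close> lies in every \<open>?A a\<close> and in no
      \<open>?B k\<close>, so \<open>j\<close> is of the first kind; testing with
      \<open>sing a\<close> identifies the index.\<close>
    have "emp \<in>\<^sub>c pow w" by (simp add: subcls_def)
    then have "emp \<in>\<^sub>c j" using j(2) by simp
    then have "j \<noteq> ?B k" for k using B[of emp k] by auto
    then obtain a' where a': "a' \<in>\<^sub>c X" "j = ?A a'" using subclsD[OF x(2) j(1)] unfolding F by blast
    have "sing a \<in>\<^sub>c pow w" using aw by (simp add: subcls_def mem_upair)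
    moreover from this have "\<not> sing a \<in>\<^sub>c j" using j(2) mem_set[OF aw] by (simp add: mem_upair)
    ultimately have "a' \<in>\<^sub>c sing a" using a'(2) A by blast
    then show ?thesis using a'(1) by (simp add: mem_upair)
  qed
  have "?c \<subseteq>\<^sub>c w" by (rule subclsI) (unfold c, blast)
  then have "?c \<in>\<^sub>c pow w" using cs unfolding mem_pow by blast
  then obtain j where j: "j \<in>\<^sub>c x" "?c \<in>\<^sub>c j" using subclsD[OF x(3)] unfolding mem_union_of by blast
  then consider a where "a \<in>\<^sub>c X" "j = ?A a" | k where "k \<in>\<^sub>c K" "j = ?B k"
    using subclsD[OF x(2) j(1)] unfolding F by blast
  then show False
  proof cases
    case 1
    then have "\<not> a \<in>\<^sub>c ?c" using j(2) A by blast
    moreover have "a \<in>\<^sub>c w" using subclsD[OF w(2) 1(1)] .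
    moreover have "y \<in>\<^sub>c j \<longleftrightarrow> \<not> a \<in>\<^sub>c y" if "y \<in>\<^sub>c pow w" for y using that 1(2) A by blast
    ultimately show False unfolding c using j(1) by blast
  next
    case 2
    then obtain z where "z \<in>\<^sub>c k" "z \<in>\<^sub>c ?c" using j(2) B by blast
    then show False using disj[OF 2(1)] cX by blast
  qed
qed

text \<open>(Exp) speaks of traces of sets only. By \<open>separate\<close>, applied to
  \<open>C\<close> and the singletons of the remaining elements of \<open>X\<close>, every subclass
  \<open>C\<close> of \<open>X\<close> is the trace of some set \<open>d\<close>.\<close>

lemma thin_power:
  assumes X: "thin X"
  shows "\<exists>P. thin P \<and> (\<forall>C. C \<subseteq>\<^sub>c X --> (\<exists>p. p \<in>\<^sub>c P \<and> p \<inter>\<^sub>c X = C))"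
proof -
  obtain P where P: "thin P" "\<And>y. is_set y ==> \<exists>p. p \<in>\<^sub>c P \<and> y \<inter>\<^sub>c X = p \<inter>\<^sub>c X"
    using Exp X by blast
  have "\<exists>p. p \<in>\<^sub>c P \<and> p \<inter>\<^sub>c X = C" if C: "C \<subseteq>\<^sub>c X" for C
  proof -
    have sd: "dft True (\<lambda>s. sing (s 0))" by (intro dfn_intros)
    have tK: "thin (img sing (dif X C))"
      by (rule thin_img[OF sd thin_subcls[OF X]]) (simp add: subcls_def)
    have "\<exists>d. is_set d \<and> C \<subseteq>\<^sub>c d \<and> (\<forall>k z. k \<in>\<^sub>c img sing (dif X C) --> z \<in>\<^sub>c k --> \<not> z \<in>\<^sub>c d)"
      by (rule separate[OF thin_subcls[OF X C] tK]) (auto simp: mem_img[OF sd] mem_upair)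
    then obtain d where d: "is_set d" "C \<subseteq>\<^sub>c d" and K: "\<And>k z. k \<in>\<^sub>c img sing (dif X C) ==> z \<in>\<^sub>c k ==> \<not> z \<in>\<^sub>c d"
      by blast
    have "d \<inter>\<^sub>c X = C"
    proof (rule cext)
      fix z assume z: "is_set z"
      have "\<not> z \<in>\<^sub>c d" if "z \<in>\<^sub>c X" "\<not> z \<in>\<^sub>c C"
        by (rule K[of "sing z"]) (use that z in \<open>auto simp: mem_img[OF sd] mem_upair\<close>)
      then show "z \<in>\<^sub>c d \<inter>\<^sub>c X \<longleftrightarrow> z \<in>\<^sub>c C" using subclsD[OF C, of z] subclsD[OF d(2), of z] by auto
    qed
    with P(2)[OF d(1)] show ?thesis by auto
  qed
  with P(1) show ?thesis by blast
qed

text \<open>Application given by the elements of the value: it is total, its graph is a set formula,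
  and it agrees with \<open>ap\<close> on the domain of a function.\<close>

definition apx :: "'a \<Rightarrow> 'a \<Rightarrow> 'a" where
  "apx F a = cls (\<lambda>z. \<exists>b. is_set b \<and> related F a b \<and> z \<in>\<^sub>c b)"

lemma mem_apx: "z \<in>\<^sub>c apx F a \<longleftrightarrow> (\<exists>b. related F a b \<and> z \<in>\<^sub>c b)"
  unfolding apx_def
  by (rule mem_cls_iff) (intro dfn_intros dft_const_True, auto simp: related_def dest: mem_set)

lemma apx_eq: "is_function F ==> related F a b ==> apx F a = b"
  by (rule cext) (unfold mem_apx is_function_def, blast)

text \<open>(Choice) applied to the relation \<open>?R\<close>, whose domain is all of
  \<open>D\<close>. The choice function is returned as a definable HOL function, ready for use in
  images and comprehension.\<close>

lemma choice_function:
  assumes D: "thin D" and Q: "dfn True (\<lambda>s. Q (s 0) (s (Suc 0)))"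
    and ex: "\<And>a. a \<in>\<^sub>c D ==> \<exists>c. is_set c \<and> Q a c"
  shows "\<exists>f. dft True (\<lambda>s. f (s 0)) \<and> (\<forall>a. a \<in>\<^sub>c D --> is_set (f a) \<and> Q a (f a))"
proof -
  let ?R = "cls (\<lambda>q. \<exists>a. a \<in>\<^sub>c D \<and> (\<exists>c. is_set c \<and> Q a c \<and> q = pair a c))"
  have R: "q \<in>\<^sub>c ?R \<longleftrightarrow> (\<exists>a. a \<in>\<^sub>c D \<and> (\<exists>c. is_set c \<and> Q a c \<and> q = pair a c))" for q
    by (rule mem_cls_iff) (intro dfn_intros dft_const_True dfn_comp2[OF Q], auto)
  have rel: "a \<in>\<^sub>c D \<and> is_set c \<and> Q a c" if "related ?R a c" for a c
  proof -
    have ac: "is_set a" "is_set c" "pair a c \<in>\<^sub>c ?R" using that by (simp_all only: related_def)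
    then obtain a' c' where "a' \<in>\<^sub>c D" "is_set c'" "Q a' c'" "pair a c = pair a' c'" unfolding R by blast
    then show ?thesis using ac mem_set[of a' D] by simp
  qed
  have Dom: "Dom ?R = D"
  proof (rule subcls_antisym)
    show "Dom ?R \<subseteq>\<^sub>c D" by (rule subclsI) (use rel in \<open>unfold mem_Dom, blast\<close>)
    show "D \<subseteq>\<^sub>c Dom ?R"
    proof (rule subclsI)
      fix a assume a: "a \<in>\<^sub>c D"
      then obtain c where "is_set c" "Q a c" using ex by blast
      then have "related ?R a c" unfolding related_def R using a mem_set[OF a] by blast
      then show "a \<in>\<^sub>c Dom ?R" unfolding mem_Dom by blast
    qed
  qed
  then obtain F where F: "is_function F" "F \<subseteq>\<^sub>c ?R" "Dom F = D" using Choice[of ?R] D by auto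
  have "dft True (\<lambda>s. apx F (s 0))" unfolding apx_def by (intro dfn_intros dft_const_True)
  moreover have "is_set (apx F a) \<and> Q a (apx F a)" if a: "a \<in>\<^sub>c D" for a
  proof -
    obtain c where c: "related F a c" using a F(3) mem_Dom by blast
    then have "related ?R a c" using F(2) unfolding related_def subcls_def by blast
    with rel apx_eq[OF F(1) c] show ?thesis by blast
  qed
  ultimately show ?thesis by (intro exI[of _ "apx F"]) blast
qed


subsection \<open>Iteration along the standard natural numbers\<close>

lemma iteration:
  assumes I: "dfn True (\<lambda>s. I (s 0))" and R: "dfn True (\<lambda>s. R (s 0) (s (Suc 0)))"
    and step: "\<And>X. I X ==> \<exists>Y. I Y \<and> R X Y" and X: "I X"
  shows "\<exists>S. dft True (\<lambda>s. S (s 0)) \<and> S emp = X \<and> (\<forall>n. n \<in>\<^sub>c SN --> I (S n) \<and> R (S n) (S (suc n)))"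
proof -
  \<comment> \<open>(DC) wants a relation defined everywhere. Guarding it by the invariant makes it
    total; the invariant is then recovered by induction along \<open>SN\<close>, and stage
    \<open>n\<close> is the section of \<open>Z\<close> at \<open>n\<close>.\<close>
  have "\<exists>Z. Z ``\<^sub>c sing emp = X \<and> (\<forall>n. n \<in>\<^sub>c SN -->
      (I (Z ``\<^sub>c sing n) --> I (Z ``\<^sub>c sing (suc n)) \<and> R (Z ``\<^sub>c sing n) (Z ``\<^sub>c sing (suc n))))"
    by (rule dependent_choice[where R = "\<lambda>X Y. I X --> I Y \<and> R X Y"])
      (intro dfn_intros dfn_comp1[OF I] R, use step in blast)
  then obtain Z where Z: "Z ``\<^sub>c sing emp = X" and
    step: "\<And>n. n \<in>\<^sub>c SN ==> I (Z ``\<^sub>c sing n) ==> I (Z ``\<^sub>c sing (suc n)) \<and> R (Z ``\<^sub>c sing n) (Z ``\<^sub>c sing (suc n))"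
    by blast
  have "I (Z ``\<^sub>c sing n)" if "n \<in>\<^sub>c SN" for n
    by (rule SN_induct[OF _ that]) (intro dfn_comp1[OF I] dfn_intros dft_const_True, use Z X step in auto)
  with step have "\<forall>n. n \<in>\<^sub>c SN --> I (Z ``\<^sub>c sing n) \<and> R (Z ``\<^sub>c sing n) (Z ``\<^sub>c sing (suc n))" by blast
  moreover have "dft True (\<lambda>s. Z ``\<^sub>c sing (s 0))" by (intro dfn_intros dft_const_True)
  ultimately show ?thesis using Z by (intro exI[of _ "\<lambda>n. Z ``\<^sub>c sing n"]) simp
qed

definition lim :: "('a \<Rightarrow> 'a) \<Rightarrow> 'a" where
  "lim S = cls (\<lambda>z. \<exists>n. n \<in>\<^sub>c SN \<and> z \<in>\<^sub>c S n)"

context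
  fixes S :: "'a \<Rightarrow> 'a"
  assumes S: "dft True (\<lambda>s. S (s 0))"
    and mono: "\<forall>n. n \<in>\<^sub>c SN --> S n \<subseteq>\<^sub>c S (suc n)"
begin

lemma mem_lim: "z \<in>\<^sub>c lim S \<longleftrightarrow> (\<exists>n. n \<in>\<^sub>c SN \<and> z \<in>\<^sub>c S n)"
  unfolding lim_def by (rule mem_Union_family[OF S])

lemma chain_mono:
  assumes "n \<in>\<^sub>c SN" "m \<in>\<^sub>c n" shows "S m \<subseteq>\<^sub>c S n"
proof -
  have "\<forall>m. m \<in>\<^sub>c n --> S m \<subseteq>\<^sub>c S n"
  proof (rule SN_induct[OF _ assms(1)])
    show "dfn True (\<lambda>s. \<forall>m. m \<in>\<^sub>c s 0 --> S m \<subseteq>\<^sub>c S (s 0))"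
      by (intro dfn_intros dft_comp1[OF S])
  next
    fix n assume n: "n \<in>\<^sub>c SN" and IH: "\<forall>m. m \<in>\<^sub>c n --> S m \<subseteq>\<^sub>c S n"
    have "S m \<subseteq>\<^sub>c S n" if "m \<in>\<^sub>c suc n" for m
    proof (cases "m = n")
      case False
      then have "m \<in>\<^sub>c n" using that mem_suc[OF mem_set[OF n]] by blast
      then show ?thesis using IH by blast
    qed simp
    then show "\<forall>m. m \<in>\<^sub>c suc n --> S m \<subseteq>\<^sub>c S (suc n)" using subcls_trans mono n by blast
  qed simp
  with assms(2) show ?thesis by blast
qed

lemma chain_join:
  assumes "m \<in>\<^sub>c SN" "n \<in>\<^sub>c SN"
  shows "\<exists>k. k \<in>\<^sub>c SN \<and> S m \<subseteq>\<^sub>c S k \<and> S n \<subseteq>\<^sub>c S k"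
  using nat_linear[OF SN_nat[OF assms(1)] SN_nat[OF assms(2)]] assms chain_mono subcls_refl by metis

text \<open>Adjoining one element costs at most a passage to a later stage, so small induction keeps
  the class within a single stage.\<close>

lemma small_subcls_lim:
  assumes x: "small x" "x \<subseteq>\<^sub>c lim S"
  shows "\<exists>n. n \<in>\<^sub>c SN \<and> x \<subseteq>\<^sub>c S n"
proof (rule small_induct[OF _ x(1)])
  show "dfn True (\<lambda>s. \<exists>n. n \<in>\<^sub>c SN \<and> s 0 \<subseteq>\<^sub>c S n)"
    by (intro dfn_intros dft_const_True dft_comp1[OF S])
  show "\<exists>n. n \<in>\<^sub>c SN \<and> emp \<subseteq>\<^sub>c S n" by (intro exI[of _ emp]) (simp add: subcls_def)
next
  fix y z assume z: "z \<in>\<^sub>c x" and "\<exists>n. n \<in>\<^sub>c SN \<and> y \<subseteq>\<^sub>c S n"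
  then obtain n where n: "n \<in>\<^sub>c SN" "y \<subseteq>\<^sub>c S n" by blast
  obtain m where m: "m \<in>\<^sub>c SN" "z \<in>\<^sub>c S m" using subclsD[OF x(2) z] unfolding mem_lim by blast
  obtain k where k: "k \<in>\<^sub>c SN" "S m \<subseteq>\<^sub>c S k" "S n \<subseteq>\<^sub>c S k" using chain_join[OF m(1) n(1)] by blast
  have "adj y z \<subseteq>\<^sub>c S k"
    by (rule subclsI) (use n m k in \<open>unfold mem_adj subcls_def, blast\<close>)
  with k(1) show "\<exists>n. n \<in>\<^sub>c SN \<and> adj y z \<subseteq>\<^sub>c S n" by blast
qed

lemma thin_lim: "(\<And>n. n \<in>\<^sub>c SN ==> thin (S n)) ==> thin (lim S)"
  unfolding lim_def by (rule thin_Union_family[OF S thin_SN])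

lemma subcls_lim: "n \<in>\<^sub>c SN ==> S n \<subseteq>\<^sub>c lim S"
  by (rule subclsI) (unfold mem_lim, blast)

end

section \<open>Closed and extensional thin classes\<close>

definition fin_closed :: "'a \<Rightarrow> bool" where
  "fin_closed X \<longleftrightarrow> (\<forall>x. is_set x --> x \<subseteq>\<^sub>c X --> x \<in>\<^sub>c X)"

definition extensional :: "'a \<Rightarrow> bool" where
  "extensional X \<longleftrightarrow> (\<forall>a. a \<in>\<^sub>c X --> (\<forall>b. b \<in>\<^sub>c X -->
     a \<noteq> b --> (\<exists>c. c \<in>\<^sub>c X \<and> \<not> (c \<in>\<^sub>c a \<longleftrightarrow> c \<in>\<^sub>c b))))"

lemma fin_closedI: "(\<And>x. is_set x ==> x \<subseteq>\<^sub>c X ==> x \<in>\<^sub>c X) ==> fin_closed X"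
  by (simp add: fin_closed_def)

lemma fin_closedD: "fin_closed X ==> is_set x ==> x \<subseteq>\<^sub>c X ==> x \<in>\<^sub>c X"
  by (simp add: fin_closed_def)

lemma extensionalD:
  "extensional X ==> a \<in>\<^sub>c X ==> b \<in>\<^sub>c X ==> a \<noteq> b ==> \<exists>c. c \<in>\<^sub>c X \<and> \<not> (c \<in>\<^sub>c a \<longleftrightarrow> c \<in>\<^sub>c b)"
  unfolding extensional_def by blast

lemma neq_witness:
  assumes "a \<noteq> b" shows "\<exists>c. is_set c \<and> \<not> (c \<in>\<^sub>c a \<longleftrightarrow> c \<in>\<^sub>c b)"
proof (rule ccontr)
  assume "\<not> ?thesis"
  then have "a = b" by (intro cext) simp
  with assms show False ..
qed

lemma dfn_fin_closed [dfn_intros]: "dft True t ==> dfn True (\<lambda>s. fin_closed (t s))"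
  by (rule dfn_comp1[where P = fin_closed]) (unfold fin_closed_def, intro dfn_intros)

lemma dfn_extensional [dfn_intros]: "dft True t ==> dfn True (\<lambda>s. extensional (t s))"
  by (rule dfn_comp1[where P = extensional]) (unfold extensional_def, intro dfn_intros)

text \<open>One pass adds all sets included in the current class and, by choice, a separating
  element for each pair of distinct elements. After \<open>SN\<close> passes both requirements are
  met, since a small subclass as well as any two elements lie in a single stage. Thinness of the
  union turns its subsets into small classes.\<close>

lemma extensional_extension:
  assumes "thin A"
  shows "\<exists>Y. thin Y \<and> A \<subseteq>\<^sub>c Y \<and> fin_closed Y \<and> extensional Y"
proof -
  let ?R = "\<lambda>W V. W \<subseteq>\<^sub>c V \<and> (\<forall>x. is_set x --> x \<subseteq>\<^sub>c W --> x \<in>\<^sub>c V) \<and>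
     (\<forall>a. a \<in>\<^sub>c W --> (\<forall>b. b \<in>\<^sub>c W --> a \<noteq> b --> (\<exists>c. c \<in>\<^sub>c V \<and> \<not> (c \<in>\<^sub>c a \<longleftrightarrow> c \<in>\<^sub>c b))))"
  have step: "\<exists>V. thin V \<and> ?R W V" if W: "thin W" for W
  proof -
    \<comment> \<open>\<open>Q\<close> is stated for every way of writing \<open>q\<close> as a pair
      from \<open>W\<close>, so that it can be used without projections.\<close>
    define Q where "Q q c \<longleftrightarrow> (\<forall>a. a \<in>\<^sub>c W --> (\<forall>b. b \<in>\<^sub>c W --> q = pair a b --> a \<noteq> b --> \<not> (c \<in>\<^sub>c a \<longleftrightarrow> c \<in>\<^sub>c b)))" for q c
    have Qd: "dfn True (\<lambda>s. Q (s 0) (s (Suc 0)))" unfolding Q_def by (intro dfn_intros dft_const_True)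
    have Qe: "\<exists>c. is_set c \<and> Q q c" if qW: "q \<in>\<^sub>c prd W W" for q
    proof -
      obtain a b where ab: "a \<in>\<^sub>c W" "b \<in>\<^sub>c W" "q = pair a b" using qW unfolding mem_prd by blast
      obtain c where "is_set c" "a \<noteq> b --> \<not> (c \<in>\<^sub>c a \<longleftrightarrow> c \<in>\<^sub>c b)"
      proof (cases "a = b")
        case True
        \<comment> \<open>Nothing is demanded on the diagonal; \<open>emp\<close> serves as a
          default.\<close>
        then show ?thesis using that[of emp] by simp
      next
        case False
        then show ?thesis using that neq_witness by metis
      qed
      moreover have "Q q c"
        unfolding Q_def
      proof (intro allI impI)
        fix a' b' assume *: "a' \<in>\<^sub>c W" "b' \<in>\<^sub>c W" "q = pair a' b'" "a' \<noteq> b'"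
        then have "a' = a \<and> b' = b" using ab mem_set[OF ab(1)] mem_set[OF ab(2)] mem_set[OF *(1)] mem_set[OF *(2)] by simp
        with * \<open>a \<noteq> b --> \<not> (c \<in>\<^sub>c a \<longleftrightarrow> c \<in>\<^sub>c b)\<close> show "\<not> (c \<in>\<^sub>c a' \<longleftrightarrow> c \<in>\<^sub>c b')" by simp
      qed
      ultimately show ?thesis by blast
    qed
    from choice_function[OF thin_prd[OF W W] Qd Qe] obtain f where f: "dft True (\<lambda>s. f (s 0))"
      and Q: "\<And>q. q \<in>\<^sub>c prd W W ==> is_set (f q) \<and> Q q (f q)" by blast
    let ?V = "bun W (bun (fin W) (img f (prd W W)))"
    have "thin ?V" using W thin_fin thin_img[OF f] thin_prd by simp
    moreover have "?R W ?V"
    proof (intro conjI allI impI)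
      fix a b assume ab: "a \<in>\<^sub>c W" "b \<in>\<^sub>c W" "a \<noteq> b"
      then have p: "pair a b \<in>\<^sub>c prd W W" unfolding mem_prd by blast
      have "\<not> (f (pair a b) \<in>\<^sub>c a \<longleftrightarrow> f (pair a b) \<in>\<^sub>c b)" using Q[OF p] ab unfolding Q_def by simp
      moreover have "f (pair a b) \<in>\<^sub>c ?V" unfolding mem_bun mem_img[OF f] using p Q by blast
      ultimately show "\<exists>c. c \<in>\<^sub>c ?V \<and> \<not> (c \<in>\<^sub>c a \<longleftrightarrow> c \<in>\<^sub>c b)" by (intro exI[of _ "f (pair a b)"] conjI)
    qed (auto simp: subcls_def mem_fin)
    ultimately show ?thesis by blast
  qed
  have "\<exists>S. dft True (\<lambda>s. S (s 0)) \<and> S emp = A \<and> (\<forall>n. n \<in>\<^sub>c SN --> thin (S n) \<and> ?R (S n) (S (suc n)))"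
    by (rule iteration[where I = thin and R = ?R]) (intro dfn_intros, intro dfn_intros, fact step, fact assms)
  then obtain S where S: "dft True (\<lambda>s. S (s 0))" "S emp = A"
    and T: "\<And>n. n \<in>\<^sub>c SN ==> thin (S n)" and R: "\<And>n. n \<in>\<^sub>c SN ==> ?R (S n) (S (suc n))"
    by (elim exE conjE) blast
  have mono: "\<forall>n. n \<in>\<^sub>c SN --> S n \<subseteq>\<^sub>c S (suc n)" using R by blast
  have tl: "thin (lim S)" by (rule thin_lim[OF S(1) mono T])
  have sl: "S n \<subseteq>\<^sub>c lim S" if "n \<in>\<^sub>c SN" for n by (rule subcls_lim[OF S(1) mono that])
  have "A \<subseteq>\<^sub>c lim S" using sl[OF emp_in_SN] S(2) by simp
  moreover have "fin_closed (lim S)"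
  proof (rule fin_closedI)
    fix x assume x: "is_set x" "x \<subseteq>\<^sub>c lim S"
    then obtain n where n: "n \<in>\<^sub>c SN" "x \<subseteq>\<^sub>c S n"
      using small_subcls_lim[OF S(1) mono thinD[OF tl x] x(2)] by blast
    then have "x \<in>\<^sub>c S (suc n)" using R x by blast
    then show "x \<in>\<^sub>c lim S" using subclsD[OF sl] suc_in_SN n by blast
  qed
  moreover have "extensional (lim S)" unfolding extensional_def
  proof (intro allI impI)
    fix a b assume ab: "a \<in>\<^sub>c lim S" "b \<in>\<^sub>c lim S" "a \<noteq> b"
    then obtain m n where m: "m \<in>\<^sub>c SN" "a \<in>\<^sub>c S m" and n: "n \<in>\<^sub>c SN" "b \<in>\<^sub>c S n"
      unfolding mem_lim[OF S(1) mono] by blast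
    obtain k where k: "k \<in>\<^sub>c SN" "S m \<subseteq>\<^sub>c S k" "S n \<subseteq>\<^sub>c S k" using chain_join[OF S(1) mono m(1) n(1)] by blast
    then have "\<exists>c. c \<in>\<^sub>c S (suc k) \<and> \<not> (c \<in>\<^sub>c a \<longleftrightarrow> c \<in>\<^sub>c b)"
      using conjunct2[OF conjunct2[OF R[OF k(1)]]] subclsD[OF k(2) m(2)] subclsD[OF k(3) n(2)] ab(3) by simp
    then show "\<exists>c. c \<in>\<^sub>c lim S \<and> \<not> (c \<in>\<^sub>c a \<longleftrightarrow> c \<in>\<^sub>c b)" using subclsD[OF sl[OF suc_in_SN[OF k(1)]]] by metis
  qed
  ultimately show ?thesis using tl by blast
qed

text \<open>The intersection of all closed classes above \<open>A\<close>; it is thin because some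
  thin closed class includes \<open>A\<close>. Minimality, applied to the class of elements that lie
  in \<open>A\<close> or are included in the closure, shows that nothing else was added. Both facts
  control the new elements in the power step.\<close>

lemma fin_closure:
  assumes A: "thin A"
  shows "\<exists>Y. thin Y \<and> A \<subseteq>\<^sub>c Y \<and> fin_closed Y \<and> (\<forall>y. y \<in>\<^sub>c Y --> y \<in>\<^sub>c A \<or> y \<subseteq>\<^sub>c Y) \<and>
    (\<forall>B. A \<subseteq>\<^sub>c B --> fin_closed B --> Y \<subseteq>\<^sub>c B)"
proof -
  let ?Y = "cls (\<lambda>y. \<forall>B. A \<subseteq>\<^sub>c B --> fin_closed B --> y \<in>\<^sub>c B)"
  have Y: "y \<in>\<^sub>c ?Y \<longleftrightarrow> is_set y \<and> (\<forall>B. A \<subseteq>\<^sub>c B --> fin_closed B --> y \<in>\<^sub>c B)" for y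
    by (rule mem_cls) (intro dfn_intros dft_const_True)
  have min: "?Y \<subseteq>\<^sub>c B" if "A \<subseteq>\<^sub>c B" "fin_closed B" for B
    by (rule subclsI) (use that in \<open>unfold Y, blast\<close>)
  have AY: "A \<subseteq>\<^sub>c ?Y" by (rule subclsI) (unfold Y, use mem_set subclsD in blast)
  have fY: "fin_closed ?Y"
  proof (rule fin_closedI)
    fix x assume x: "is_set x" "x \<subseteq>\<^sub>c ?Y"
    have "x \<in>\<^sub>c B" if B: "A \<subseteq>\<^sub>c B" "fin_closed B" for B
      using fin_closedD[OF B(2) x(1) subcls_trans[OF x(2) min[OF B]]] .
    then show "x \<in>\<^sub>c ?Y" unfolding Y using x(1) by blast
  qed
  obtain V where "thin V" "A \<subseteq>\<^sub>c V" "fin_closed V" using extensional_extension[OF A] by blast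
  then have tY: "thin ?Y" using thin_subcls min by blast
  let ?B = "cls (\<lambda>y. y \<in>\<^sub>c ?Y \<and> (y \<in>\<^sub>c A \<or> y \<subseteq>\<^sub>c ?Y))"
  have B: "y \<in>\<^sub>c ?B \<longleftrightarrow> y \<in>\<^sub>c ?Y \<and> (y \<in>\<^sub>c A \<or> y \<subseteq>\<^sub>c ?Y)" for y
    by (rule mem_cls_iff) (intro dfn_intros dft_const_True, use mem_set in blast)
  have BY: "?B \<subseteq>\<^sub>c ?Y" by (rule subclsI) (unfold B, blast)
  have "?Y \<subseteq>\<^sub>c ?B"
  proof (rule min)
    show "A \<subseteq>\<^sub>c ?B" by (rule subclsI) (unfold B, use subclsD[OF AY] in blast)
    show "fin_closed ?B"
    proof (rule fin_closedI)
      fix x assume x: "is_set x" "x \<subseteq>\<^sub>c ?B"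
      then have "x \<subseteq>\<^sub>c ?Y" using subcls_trans BY by blast
      then show "x \<in>\<^sub>c ?B" unfolding B using fin_closedD[OF fY x(1)] by blast
    qed
  qed
  then have "\<forall>y. y \<in>\<^sub>c ?Y --> y \<in>\<^sub>c A \<or> y \<subseteq>\<^sub>c ?Y" unfolding subcls_def[of ?Y ?B] B by blast
  then show ?thesis using tY AY fY min by blast
qed

lemma SN_subcls_fin_closed:
  assumes "fin_closed X" shows "SN \<subseteq>\<^sub>c X"
proof (rule subclsI)
  have f: "x \<in>\<^sub>c X" if "is_set x" "x \<subseteq>\<^sub>c X" for x using assms that unfolding fin_closed_def by blast
  fix n assume n: "n \<in>\<^sub>c SN"
  have "n \<in>\<^sub>c X \<and> n \<subseteq>\<^sub>c X"
  proof (rule SN_induct[OF _ n])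
    show "dfn True (\<lambda>s. s 0 \<in>\<^sub>c X \<and> s 0 \<subseteq>\<^sub>c X)" by (intro dfn_intros dft_const_True)
    have "emp \<subseteq>\<^sub>c X" by (simp add: subcls_def)
    then show "emp \<in>\<^sub>c X \<and> emp \<subseteq>\<^sub>c X" using f by simp
  next
    fix m assume m: "m \<in>\<^sub>c SN" "m \<in>\<^sub>c X \<and> m \<subseteq>\<^sub>c X"
    then have "suc m \<subseteq>\<^sub>c X" using mem_suc[OF mem_set[OF m(1)]] unfolding subcls_def by blast
    then show "suc m \<in>\<^sub>c X \<and> suc m \<subseteq>\<^sub>c X" using f is_set_suc[OF mem_set[OF m(1)]] by blast
  qed
  then show "n \<in>\<^sub>c X" by blast
qed

section \<open>The power step and the union of its iterates\<close>

definition good :: "'a \<Rightarrow> bool" where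
  "good X \<longleftrightarrow> thin X \<and> fin_closed X \<and> extensional X"

text \<open>The middle clause is the end extension property. The last one concerns the trace on
  \<open>Y\<close> rather than on \<open>X\<close>, so a representative acquires no further members
  among the new elements.\<close>

definition power_extension :: "'a \<Rightarrow> 'a \<Rightarrow> bool" where
  "power_extension X Y \<longleftrightarrow> X \<subseteq>\<^sub>c Y \<and> (\<forall>a. a \<in>\<^sub>c X --> a \<inter>\<^sub>c Y \<subseteq>\<^sub>c X) \<and>
     (\<forall>C. C \<subseteq>\<^sub>c X --> (\<exists>q. q \<in>\<^sub>c Y \<and> q \<inter>\<^sub>c Y = C))"

text \<open>
  The set \<open>d\<close> makes \<open>p \<inter> d\<close> depend on the trace \<open>p \<inter> X\<close> only.  Adding the non-small set \<open>u\<close>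
  keeps the new elements out of the transitive set \<open>u\<close>, so \<open>Y\<close> is an end extension of \<open>X\<close>.
\<close>

lemma good_power_extension:
  assumes "good X" shows "\<exists>Y. good Y \<and> power_extension X Y"
proof -
  have X: "thin X" and fX: "fin_closed X" and eX: "extensional X" using assms by (simp_all add: good_def)
  obtain u where u: "is_set u" "transitive u" and Xu: "X \<subseteq>\<^sub>c u"
    using Thin X transitive_superset subcls_trans by meson
  \<comment> \<open>The closed class \<open>X\<close> includes \<open>SN\<close>; a small
    \<open>u\<close> would therefore make \<open>SN\<close> a set.\<close>
  have uns: "\<not> small u"
  proof
    assume "small u"
    then have "small SN" by (rule small_subcls) (rule subcls_trans[OF SN_subcls_fin_closed[OF fX] Xu])
    then show False using small_is_set SN_not_set by blast
  qed
  obtain P where P: "thin P" "\<And>C. C \<subseteq>\<^sub>c X ==> \<exists>p. p \<in>\<^sub>c P \<and> p \<inter>\<^sub>c X = C"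
    using thin_power[OF X] by blast
  let ?D = "\<lambda>p q. bun (dif p q) (dif q p)"
  \<comment> \<open>Symmetric differences of members of \<open>P\<close> with equal traces. They
    avoid \<open>X\<close>, so \<open>separate\<close> yields a set \<open>d\<close> that includes
    \<open>X\<close> and avoids them all.\<close>
  let ?K = "cls (\<lambda>k. \<exists>p. p \<in>\<^sub>c P \<and> (\<exists>q. q \<in>\<^sub>c P \<and> p \<inter>\<^sub>c X = q \<inter>\<^sub>c X \<and> k = ?D p q))"
  have K: "k \<in>\<^sub>c ?K \<longleftrightarrow> is_set k \<and> (\<exists>p. p \<in>\<^sub>c P \<and> (\<exists>q. q \<in>\<^sub>c P \<and> p \<inter>\<^sub>c X = q \<inter>\<^sub>c X \<and> k = ?D p q))" for k
    by (rule mem_cls) (intro dfn_intros dft_const_True)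
  have Dp: "dft True (\<lambda>s. ?D p (s 0))" for p by (intro dfn_intros dft_const_True)
  have Di: "dft True (\<lambda>s. img (?D (s 0)) P)" unfolding img_def by (intro dfn_intros dft_const_True)
  have "thin (cls (\<lambda>k. \<exists>p. p \<in>\<^sub>c P \<and> k \<in>\<^sub>c img (?D p) P))"
    by (rule thin_Union_family[OF Di P(1)]) (rule thin_img[OF Dp P(1)])
  then have tK: "thin ?K"
    by (rule thin_subcls) (rule subclsI, unfold mem_Union_family[OF Di], unfold K mem_img[OF Dp], blast)
  have disj: "\<not> z \<in>\<^sub>c X" if k: "k \<in>\<^sub>c ?K" "z \<in>\<^sub>c k" for k z
  proof -
    obtain p q where "p \<inter>\<^sub>c X = q \<inter>\<^sub>c X" "k = ?D p q" using k(1) unfolding K by blast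
    then show ?thesis using k(2) mem_inter[of z p X] mem_inter[of z q X] by auto
  qed
  have "\<exists>d. is_set d \<and> X \<subseteq>\<^sub>c d \<and> (\<forall>k z. k \<in>\<^sub>c ?K --> z \<in>\<^sub>c k --> \<not> z \<in>\<^sub>c d)"
    by (rule separate[OF X tK]) (rule disj)
  then obtain d where Xd: "X \<subseteq>\<^sub>c d" and ds: "is_set d"
    and d: "\<And>k z. k \<in>\<^sub>c ?K ==> z \<in>\<^sub>c k ==> \<not> z \<in>\<^sub>c d" by blast
  let ?r = "\<lambda>p. adj ((p \<inter>\<^sub>c d) \<inter>\<^sub>c u) u"
  have r: "z \<in>\<^sub>c ?r p \<longleftrightarrow> z \<in>\<^sub>c p \<and> z \<in>\<^sub>c d \<and> z \<in>\<^sub>c u \<or> z = u" for z p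
    using u(1) by (auto simp: mem_adj)
  have rs: "is_set (?r p)" if "is_set p" for p using that ds u(1) by simp
  have rd: "dft True (\<lambda>s. ?r (s 0))" by (intro dfn_intros dft_const_True)
  have req: "?r p = ?r q" if "p \<in>\<^sub>c P" "q \<in>\<^sub>c P" "p \<inter>\<^sub>c X = q \<inter>\<^sub>c X" for p q
  proof (rule cext)
    fix z
    have "?D p q \<in>\<^sub>c ?K" unfolding K using that mem_set[OF that(1)] mem_set[OF that(2)] is_set_bun is_set_dif by blast
    from d[OF this, of z] show "z \<in>\<^sub>c ?r p \<longleftrightarrow> z \<in>\<^sub>c ?r q" unfolding r by auto
  qed
  \<comment> \<open>Traces already represented in \<open>X\<close> are left out; otherwise two
    elements of \<open>Y\<close> would have the same trace.\<close>
  let ?R = "cls (\<lambda>r. \<exists>p. p \<in>\<^sub>c P \<and> \<not> (\<exists>a. a \<in>\<^sub>c X \<and> a \<inter>\<^sub>c X = p \<inter>\<^sub>c X) \<and> r = ?r p)"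
  have R: "x \<in>\<^sub>c ?R \<longleftrightarrow> is_set x \<and> (\<exists>p. p \<in>\<^sub>c P \<and> \<not> (\<exists>a. a \<in>\<^sub>c X \<and> a \<inter>\<^sub>c X = p \<inter>\<^sub>c X) \<and> x = ?r p)" for x
    by (rule mem_cls) (intro dfn_intros dft_const_True)
  have tR: "thin ?R"
    by (rule thin_subcls[OF thin_img[OF rd P(1)]]) (rule subclsI, unfold R mem_img[OF rd], blast)
  have uR: "u \<in>\<^sub>c x" if "x \<in>\<^sub>c ?R" for x using that r unfolding R by blast
  obtain Y where tY: "thin Y" and AY: "bun X ?R \<subseteq>\<^sub>c Y" and fY: "fin_closed Y"
    and elim: "\<And>y. y \<in>\<^sub>c Y ==> y \<in>\<^sub>c bun X ?R \<or> y \<subseteq>\<^sub>c Y"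
    and ind: "\<And>B. bun X ?R \<subseteq>\<^sub>c B ==> fin_closed B ==> Y \<subseteq>\<^sub>c B"
    using fin_closure[of "bun X ?R"] X tR by (auto simp only: thin_bun)
  have XY: "X \<subseteq>\<^sub>c Y" and RY: "?R \<subseteq>\<^sub>c Y" using AY unfolding subcls_def mem_bun by blast+
  \<comment> \<open>The class of all \<open>y\<close> that belong to \<open>X\<close> if they belong
    to \<open>u\<close> is closed and includes \<open>X\<close>. It includes \<open>?R\<close> too,
    since members of \<open>?R\<close> contain \<open>u\<close> and \<open>u\<close> is transitive.
    By minimality it includes \<open>Y\<close>.\<close>
  have Yu: "z \<in>\<^sub>c X" if z: "z \<in>\<^sub>c Y" "z \<in>\<^sub>c u" for z
  proof -
    let ?B = "cls (\<lambda>y. y \<in>\<^sub>c u --> y \<in>\<^sub>c X)"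
    have B: "y \<in>\<^sub>c ?B \<longleftrightarrow> is_set y \<and> (y \<in>\<^sub>c u --> y \<in>\<^sub>c X)" for y
      by (rule mem_cls) (intro dfn_intros dft_const_True)
    have "Y \<subseteq>\<^sub>c ?B"
    proof (rule ind)
      show "bun X ?R \<subseteq>\<^sub>c ?B"
      proof (rule subclsI)
        fix y assume y: "y \<in>\<^sub>c bun X ?R"
        have "\<not> y \<in>\<^sub>c u" if "y \<in>\<^sub>c ?R" using transitiveD[OF u(2) _ uR[OF that]] mem_irrefl[of u] by blast
        then show "y \<in>\<^sub>c ?B" unfolding B using y mem_set[OF y] unfolding mem_bun by blast
      qed
      show "fin_closed ?B"
      proof (rule fin_closedI)
        fix x assume x: "is_set x" "x \<subseteq>\<^sub>c ?B"
        have "x \<in>\<^sub>c X" if xu: "x \<in>\<^sub>c u"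
        proof -
          have "x \<subseteq>\<^sub>c X" by (rule subclsI) (use subclsD[OF x(2)] transitiveD[OF u(2) xu] in \<open>unfold B, blast\<close>)
          then show ?thesis using fX x(1) unfolding fin_closed_def by blast
        qed
        then show "x \<in>\<^sub>c ?B" unfolding B using x(1) by blast
      qed
    qed
    then have "z \<in>\<^sub>c ?B" using z(1) by (rule subclsD)
    then show ?thesis using z(2) unfolding B by blast
  qed
  \<comment> \<open>Foundation keeps \<open>u\<close> out of \<open>X\<close> and \<open>?R\<close>,
    and as a subset of the thin class \<open>Y\<close> the set \<open>u\<close> would be
    small.\<close>
  have uY: "\<not> u \<in>\<^sub>c Y"
  proof
    assume "u \<in>\<^sub>c Y"
    then consider "u \<in>\<^sub>c X" | "u \<in>\<^sub>c ?R" | "u \<subseteq>\<^sub>c Y" using elim unfolding mem_bun by blast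
    then show False
    proof cases
      case 1
      then show False using subclsD[OF Xu] mem_irrefl by blast
    next
      case 2
      then show False using uR mem_irrefl by blast
    next
      case 3
      then show False using thinD[OF tY u(1)] uns by blast
    qed
  qed
  have trX: "a \<inter>\<^sub>c Y = a \<inter>\<^sub>c X" if a: "a \<in>\<^sub>c X" for a
  proof (rule cext)
    fix z
    show "z \<in>\<^sub>c a \<inter>\<^sub>c Y \<longleftrightarrow> z \<in>\<^sub>c a \<inter>\<^sub>c X"
      unfolding mem_inter using Yu transitiveD[OF u(2) subclsD[OF Xu a]] subclsD[OF XY] by blast
  qed
  have trR: "?r p \<inter>\<^sub>c Y = p \<inter>\<^sub>c X" for p
  proof (rule cext)
    fix z
    show "z \<in>\<^sub>c ?r p \<inter>\<^sub>c Y \<longleftrightarrow> z \<in>\<^sub>c p \<inter>\<^sub>c X"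
      unfolding mem_inter r using Yu uY subclsD[OF XY] subclsD[OF Xu] subclsD[OF Xd] by blast
  qed
  have trS: "a \<inter>\<^sub>c Y = a" if "a \<subseteq>\<^sub>c Y" for a
    by (rule cext) (unfold mem_inter, use subclsD[OF that] in blast)
  have X_if: "a \<in>\<^sub>c X" if "a \<subseteq>\<^sub>c Y" "a \<inter>\<^sub>c Y \<subseteq>\<^sub>c X" "is_set a" for a
    using fX that trS[OF that(1)] unfolding fin_closed_def by simp
  have ext: "a = b" if ab: "a \<in>\<^sub>c Y" "b \<in>\<^sub>c Y" "a \<inter>\<^sub>c Y = b \<inter>\<^sub>c Y" for a b
  proof -
    have X_eq: "a = b" if "a \<in>\<^sub>c X" "b \<in>\<^sub>c X" "a \<inter>\<^sub>c Y = b \<inter>\<^sub>c Y" for a b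
    proof (rule ccontr)
      assume "a \<noteq> b"
      then obtain c where c: "c \<in>\<^sub>c X" "\<not> (c \<in>\<^sub>c a \<longleftrightarrow> c \<in>\<^sub>c b)"
        using extensionalD[OF eX \<open>a \<in>\<^sub>c X\<close> \<open>b \<in>\<^sub>c X\<close>] by metis
      have "c \<in>\<^sub>c a \<inter>\<^sub>c Y \<longleftrightarrow> c \<in>\<^sub>c b \<inter>\<^sub>c Y" using that by simp
      with c subclsD[OF XY c(1)] show False by simp
    qed
    have not_XR: False if "a \<in>\<^sub>c X" "b \<in>\<^sub>c ?R" "a \<inter>\<^sub>c Y = b \<inter>\<^sub>c Y" for a b
      using that trX[OF that(1)] trR unfolding R by metis
    have RX: "b \<inter>\<^sub>c Y \<subseteq>\<^sub>c X" if "b \<in>\<^sub>c ?R" for b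
    proof -
      obtain p where "b = ?r p" using \<open>b \<in>\<^sub>c ?R\<close> unfolding R by blast
      then show ?thesis using trR[of p] by (simp add: subcls_def)
    qed
    have XX: "b \<inter>\<^sub>c Y \<subseteq>\<^sub>c X" if "b \<in>\<^sub>c X" for b
      using trX[OF that] by (simp add: subcls_def)
    \<comment> \<open>A subset of \<open>Y\<close> whose trace equals that of an element of
      \<open>X\<close> or \<open>?R\<close> is included in \<open>X\<close>, hence an element of
      \<open>X\<close> by closedness.\<close>
    have SX: "a \<in>\<^sub>c X" if "a \<in>\<^sub>c Y" "a \<subseteq>\<^sub>c Y" "b \<in>\<^sub>c bun X ?R" "a \<inter>\<^sub>c Y = b \<inter>\<^sub>c Y" for a b
      by (rule X_if[OF that(2)]) (use that RX XX mem_set in \<open>auto simp only: mem_bun\<close>)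
    have main: "a = b" if a: "a \<in>\<^sub>c bun X ?R" and b: "b \<in>\<^sub>c bun X ?R" and eq: "a \<inter>\<^sub>c Y = b \<inter>\<^sub>c Y" for a b
    proof -
      consider "a \<in>\<^sub>c X" "b \<in>\<^sub>c X" | "a \<in>\<^sub>c X" "b \<in>\<^sub>c ?R" | "a \<in>\<^sub>c ?R" "b \<in>\<^sub>c X" | "a \<in>\<^sub>c ?R" "b \<in>\<^sub>c ?R"
        using a b unfolding mem_bun by blast
      then show ?thesis
      proof cases
        case 1
        then show ?thesis using X_eq eq by blast
      next
        case 2
        then show ?thesis using not_XR eq by blast
      next
        case 3
        then show ?thesis using not_XR eq[symmetric] by blast
      next
        case 4
        then obtain p q where pq: "p \<in>\<^sub>c P" "a = ?r p" "q \<in>\<^sub>c P" "b = ?r q" unfolding R by blast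
        then have "p \<inter>\<^sub>c X = q \<inter>\<^sub>c X" using trR[of p] trR[of q] eq by simp
        then show ?thesis unfolding pq(2,4) by (rule req[OF pq(1,3)])
      qed
    qed
    have "a \<in>\<^sub>c bun X ?R \<or> a \<subseteq>\<^sub>c Y" "b \<in>\<^sub>c bun X ?R \<or> b \<subseteq>\<^sub>c Y" using elim ab by blast+
    then consider "a \<in>\<^sub>c bun X ?R" "b \<in>\<^sub>c bun X ?R" | "a \<subseteq>\<^sub>c Y" "b \<subseteq>\<^sub>c Y"
      | "a \<subseteq>\<^sub>c Y" "b \<in>\<^sub>c bun X ?R" | "a \<in>\<^sub>c bun X ?R" "b \<subseteq>\<^sub>c Y" by blast
    then show "a = b"
    proof cases
      case 1
      then show ?thesis using main ab by blast
    next
      case 2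
      then show ?thesis using trS ab(3) by metis
    next
      case 3
      then have "a \<in>\<^sub>c X" using SX ab by blast
      then show ?thesis using main[OF _ 3(2) ab(3)] unfolding mem_bun by blast
    next
      case 4
      then have "b \<in>\<^sub>c X" using SX ab(1,2) ab(3)[symmetric] by blast
      then show ?thesis using main[OF 4(1) _ ab(3)] unfolding mem_bun by blast
    qed
  qed
  have eY: "extensional Y" unfolding extensional_def
  proof (intro allI impI)
    fix a b assume ab: "a \<in>\<^sub>c Y" "b \<in>\<^sub>c Y" "a \<noteq> b"
    then have "a \<inter>\<^sub>c Y \<noteq> b \<inter>\<^sub>c Y" using ext by blast
    then obtain c where "\<not> (c \<in>\<^sub>c a \<inter>\<^sub>c Y \<longleftrightarrow> c \<in>\<^sub>c b \<inter>\<^sub>c Y)" using neq_witness by metis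
    then show "\<exists>c. c \<in>\<^sub>c Y \<and> \<not> (c \<in>\<^sub>c a \<longleftrightarrow> c \<in>\<^sub>c b)" by (intro exI[of _ c]) auto
  qed
  have "\<exists>q. q \<in>\<^sub>c Y \<and> q \<inter>\<^sub>c Y = C" if C: "C \<subseteq>\<^sub>c X" for C
  proof -
    obtain p where p: "p \<in>\<^sub>c P" "p \<inter>\<^sub>c X = C" using P(2)[OF C] by blast
    show ?thesis
    proof (cases "\<exists>a. a \<in>\<^sub>c X \<and> a \<inter>\<^sub>c X = p \<inter>\<^sub>c X")
      case True
      then show ?thesis using trX p(2) subclsD[OF XY] by metis
    next
      case False
      then have "?r p \<in>\<^sub>c ?R" unfolding R using p(1) rs[OF mem_set[OF p(1)]] by blast
      then show ?thesis using subclsD[OF RY] trR p(2) by blast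
    qed
  qed
  moreover have "a \<inter>\<^sub>c Y \<subseteq>\<^sub>c X" if "a \<in>\<^sub>c X" for a using trX[OF that] by (simp add: subcls_def)
  ultimately show ?thesis using tY fY eY XY unfolding good_def power_extension_def by blast
qed

text \<open>The predicate \<open>B\<close> singles out the subclasses of \<open>Z\<close> bounded by a stage of its construction.\<close>

definition bounded_universe :: "'a \<Rightarrow> ('a \<Rightarrow> bool) \<Rightarrow> bool" where
  "bounded_universe Z B \<longleftrightarrow> thin Z \<and> fin_closed Z \<and> extensional Z \<and> B SN \<and>
    (\<forall>C. B C --> C \<subseteq>\<^sub>c Z \<and> (\<exists>q. q \<in>\<^sub>c Z \<and> q \<inter>\<^sub>c Z = C)) \<and>
    (\<forall>C D. B C --> D \<subseteq>\<^sub>c C --> B D) \<and>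
    (\<forall>a. a \<in>\<^sub>c Z --> B (a \<inter>\<^sub>c Z)) \<and>
    (\<forall>C D. B C --> (\<forall>z. z \<in>\<^sub>c D --> z \<in>\<^sub>c Z \<and> (\<exists>y. y \<in>\<^sub>c C \<and> z \<in>\<^sub>c y)) --> B D) \<and>
    (\<forall>C D. B C --> (\<forall>y. y \<in>\<^sub>c D --> y \<in>\<^sub>c Z \<and> y \<inter>\<^sub>c Z \<subseteq>\<^sub>c C) --> B D)"

text \<open>Each clause of \<open>bounded_universe\<close> is a closure property of the stages:
  subclasses stay within a stage, traces and unions do so by the end extension property, and power
  classes cost one further stage. \<open>B\<close> is used only outside the structure, so a HOL
  predicate suffices.\<close>

lemma universe:
  assumes "thin X" shows "\<exists>Z B. bounded_universe Z B \<and> B X"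
proof -
  obtain A where A: "thin A" "X \<subseteq>\<^sub>c A" "fin_closed A" "extensional A"
    using extensional_extension[OF assms] by blast
  have "\<exists>S. dft True (\<lambda>s. S (s 0)) \<and> S emp = A \<and> (\<forall>n. n \<in>\<^sub>c SN --> good (S n) \<and> power_extension (S n) (S (suc n)))"
  proof (rule iteration)
    show "dfn True (\<lambda>s. good (s 0))" unfolding good_def by (intro dfn_intros)
    show "dfn True (\<lambda>s. power_extension (s 0) (s (Suc 0)))" unfolding power_extension_def by (intro dfn_intros)
  qed (use A good_power_extension in \<open>auto simp: good_def\<close>)
  then obtain S where S: "dft True (\<lambda>s. S (s 0))" "S emp = A"
    and G: "\<And>n. n \<in>\<^sub>c SN ==> good (S n)" and E: "\<And>n. n \<in>\<^sub>c SN ==> power_extension (S n) (S (suc n))" by blast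
  have mono: "\<forall>n. n \<in>\<^sub>c SN --> S n \<subseteq>\<^sub>c S (suc n)" using E by (simp add: power_extension_def)
  note lim = mem_lim[OF S(1) mono] and join = chain_join[OF S(1) mono] and sub = subcls_lim[OF S(1) mono]
  define B where "B C \<longleftrightarrow> (\<exists>n. n \<in>\<^sub>c SN \<and> C \<subseteq>\<^sub>c S n)" for C
  have tZ: "thin (lim S)" by (rule thin_lim[OF S(1) mono]) (use G in \<open>simp_all add: good_def\<close>)
  have fZ: "fin_closed (lim S)"
  proof (rule fin_closedI)
    fix x assume x: "is_set x" "x \<subseteq>\<^sub>c lim S"
    then obtain n where n: "n \<in>\<^sub>c SN" "x \<subseteq>\<^sub>c S n"
      using small_subcls_lim[OF S(1) mono thinD[OF tZ x] x(2)] by blast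
    then have "x \<in>\<^sub>c S n" using G[OF n(1)] x unfolding good_def fin_closed_def by blast
    then show "x \<in>\<^sub>c lim S" using subclsD[OF sub[OF n(1)]] by blast
  qed
  have eZ: "extensional (lim S)" unfolding extensional_def
  proof (intro allI impI)
    fix a b assume ab: "a \<in>\<^sub>c lim S" "b \<in>\<^sub>c lim S" "a \<noteq> b"
    then obtain m n where m: "m \<in>\<^sub>c SN" "a \<in>\<^sub>c S m" and n: "n \<in>\<^sub>c SN" "b \<in>\<^sub>c S n"
      unfolding lim by blast
    obtain k where k: "k \<in>\<^sub>c SN" "S m \<subseteq>\<^sub>c S k" "S n \<subseteq>\<^sub>c S k" using join[OF m(1) n(1)] by blast
    then obtain c where "c \<in>\<^sub>c S k" "\<not> (c \<in>\<^sub>c a \<longleftrightarrow> c \<in>\<^sub>c b)"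
      using extensionalD[OF _ subclsD[OF k(2) m(2)] subclsD[OF k(3) n(2)] ab(3)] G[OF k(1)] unfolding good_def by metis
    then show "\<exists>c. c \<in>\<^sub>c lim S \<and> \<not> (c \<in>\<^sub>c a \<longleftrightarrow> c \<in>\<^sub>c b)" using subclsD[OF sub[OF k(1)]] by metis
  qed
  \<comment> \<open>A member of an old element is old: every step of the chain above stage
    \<open>m\<close> is an end extension, so \<open>z\<close> can be pulled down from stage
    \<open>k\<close> to stage \<open>m\<close>.\<close>
  have end_ext: "z \<in>\<^sub>c S m" if m: "m \<in>\<^sub>c SN" "a \<in>\<^sub>c S m" "z \<in>\<^sub>c a" and k: "k \<in>\<^sub>c SN" "z \<in>\<^sub>c S k" for m a z k
  proof -
    have "z \<in>\<^sub>c S k --> z \<in>\<^sub>c S m"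
    proof (rule SN_induct[OF _ k(1)])
      show "dfn True (\<lambda>s. z \<in>\<^sub>c S (s 0) --> z \<in>\<^sub>c S m)" by (intro dfn_intros dft_const_True dft_comp1[OF S(1)])
      show "z \<in>\<^sub>c S emp --> z \<in>\<^sub>c S m"
        using chain_mono[OF S(1) mono m(1), of emp] nat_linear[OF nat_emp SN_nat[OF m(1)]]
        by (auto dest: subclsD)
    next
      fix k assume k: "k \<in>\<^sub>c SN" and IH: "z \<in>\<^sub>c S k --> z \<in>\<^sub>c S m"
      show "z \<in>\<^sub>c S (suc k) --> z \<in>\<^sub>c S m"
      proof
        assume z: "z \<in>\<^sub>c S (suc k)"
        consider "suc k \<in>\<^sub>c m" | "suc k = m" | "m \<in>\<^sub>c suc k"
          using nat_linear[OF SN_nat[OF suc_in_SN[OF k]] SN_nat[OF m(1)]] by blast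
        then show "z \<in>\<^sub>c S m"
        proof cases
          case 1
          then show ?thesis using chain_mono[OF S(1) mono m(1)] z subclsD by blast
        next
          case 2
          then show ?thesis using z by simp
        next
          case 3
          then have "m \<in>\<^sub>c k \<or> m = k" using mem_suc[OF mem_set[OF k]] by blast
          then have "a \<in>\<^sub>c S k" using chain_mono[OF S(1) mono k] m(2) subclsD by blast
          then have "a \<inter>\<^sub>c S (suc k) \<subseteq>\<^sub>c S k" using E[OF k] unfolding power_extension_def by blast
          then have "z \<in>\<^sub>c S k" using subclsD[of "a \<inter>\<^sub>c S (suc k)"] z m(3) by simp
          then show ?thesis using IH by blast
        qed
      qed
    qed
    with k(2) show ?thesis by blast
  qed
  have rep: "\<exists>q. q \<in>\<^sub>c S (suc n) \<and> q \<inter>\<^sub>c lim S = C" if n: "n \<in>\<^sub>c SN" "C \<subseteq>\<^sub>c S n" for C n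
  proof -
    obtain q where q: "q \<in>\<^sub>c S (suc n)" "q \<inter>\<^sub>c S (suc n) = C"
      using E[OF n(1)] n(2) unfolding power_extension_def by blast
    have "q \<inter>\<^sub>c lim S = q \<inter>\<^sub>c S (suc n)"
    proof (rule cext)
      fix z
      show "z \<in>\<^sub>c q \<inter>\<^sub>c lim S \<longleftrightarrow> z \<in>\<^sub>c q \<inter>\<^sub>c S (suc n)"
        unfolding mem_inter lim using end_ext[OF suc_in_SN[OF n(1)] q(1)] suc_in_SN[OF n(1)] by blast
    qed
    then show ?thesis using q by auto
  qed
  have f1: "B X" unfolding B_def using emp_in_SN S(2) A(2) by metis
  have f2: "B SN" unfolding B_def using emp_in_SN S(2) SN_subcls_fin_closed[OF A(3)] by metis
  have f3: "C \<subseteq>\<^sub>c lim S \<and> (\<exists>q. q \<in>\<^sub>c lim S \<and> q \<inter>\<^sub>c lim S = C)" if BC: "B C" for C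
  proof -
    obtain n where n: "n \<in>\<^sub>c SN" "C \<subseteq>\<^sub>c S n" using BC unfolding B_def by blast
    then show ?thesis using rep[OF n] subcls_trans[OF n(2) sub[OF n(1)]] subclsD[OF sub[OF suc_in_SN[OF n(1)]]] by blast
  qed
  have f4: "B D" if "B C" "D \<subseteq>\<^sub>c C" for C D using that subcls_trans unfolding B_def by blast
  have f5: "B (a \<inter>\<^sub>c lim S)" if aZ: "a \<in>\<^sub>c lim S" for a
  proof -
    obtain n where n: "n \<in>\<^sub>c SN" "a \<in>\<^sub>c S n" using aZ unfolding lim by blast
    have "a \<inter>\<^sub>c lim S \<subseteq>\<^sub>c S n" by (rule subclsI) (use end_ext[OF n] in \<open>unfold mem_inter lim, blast\<close>)
    then show ?thesis using n(1) unfolding B_def by blast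
  qed
  have f6: "B D" if C: "B C" and D: "\<forall>z. z \<in>\<^sub>c D --> z \<in>\<^sub>c lim S \<and> (\<exists>y. y \<in>\<^sub>c C \<and> z \<in>\<^sub>c y)" for C D
  proof -
    obtain n where n: "n \<in>\<^sub>c SN" "C \<subseteq>\<^sub>c S n" using C unfolding B_def by blast
    have "D \<subseteq>\<^sub>c S n"
    proof (rule subclsI)
      fix z assume "z \<in>\<^sub>c D"
      then obtain y k where "y \<in>\<^sub>c C" "z \<in>\<^sub>c y" "k \<in>\<^sub>c SN" "z \<in>\<^sub>c S k" using D unfolding lim by blast
      then show "z \<in>\<^sub>c S n" using end_ext[OF n(1) subclsD[OF n(2)]] by blast
    qed
    then show ?thesis using n(1) unfolding B_def by blast
  qed
  have f7: "B D" if C: "B C" and D: "\<forall>y. y \<in>\<^sub>c D --> y \<in>\<^sub>c lim S \<and> y \<inter>\<^sub>c lim S \<subseteq>\<^sub>c C" for C D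
  proof -
    obtain n where n: "n \<in>\<^sub>c SN" "C \<subseteq>\<^sub>c S n" using C unfolding B_def by blast
    have "D \<subseteq>\<^sub>c S (suc n)"
    proof (rule subclsI)
      fix y assume y: "y \<in>\<^sub>c D"
      then have yZ: "y \<in>\<^sub>c lim S" and "y \<inter>\<^sub>c lim S \<subseteq>\<^sub>c S n" using D subcls_trans[OF _ n(2)] by blast+
      \<comment> \<open>The trace of \<open>y\<close> has a representative \<open>q\<close> in the
        next stage, and extensionality of \<open>Z\<close> identifies \<open>q\<close> with
        \<open>y\<close>.\<close>
      then obtain q where q: "q \<in>\<^sub>c S (suc n)" "q \<inter>\<^sub>c lim S = y \<inter>\<^sub>c lim S" using rep[OF n(1)] by blast
      have qZ: "q \<in>\<^sub>c lim S" using q(1) subclsD[OF sub[OF suc_in_SN[OF n(1)]]] by blast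
      have "q = y"
      proof (rule ccontr)
        assume "q \<noteq> y"
        then obtain c where c: "c \<in>\<^sub>c lim S" "\<not> (c \<in>\<^sub>c q \<longleftrightarrow> c \<in>\<^sub>c y)"
          using extensionalD[OF eZ qZ yZ] by metis
        have "c \<in>\<^sub>c q \<inter>\<^sub>c lim S \<longleftrightarrow> c \<in>\<^sub>c y \<inter>\<^sub>c lim S" using q(2) by simp
        with c show False by simp
      qed
      then show "y \<in>\<^sub>c S (suc n)" using q(1) by simp
    qed
    then show ?thesis using suc_in_SN[OF n(1)] unfolding B_def by blast
  qed
  show ?thesis unfolding bounded_universe_def
  proof (rule exI[of _ "lim S"], rule exI[of _ B], intro conjI allI impI)
    show "C \<subseteq>\<^sub>c lim S" if "B C" for C using f3[OF that] ..
    show "\<exists>q. q \<in>\<^sub>c lim S \<and> q \<inter>\<^sub>c lim S = C" if "B C" for C using f3[OF that] ..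
    show "B D" if "B C" "\<forall>z. z \<in>\<^sub>c D --> z \<in>\<^sub>c lim S \<and> (\<exists>y. y \<in>\<^sub>c C \<and> z \<in>\<^sub>c y)" for C D by (rule f6[OF that])
    show "B D" if "B C" "\<forall>y. y \<in>\<^sub>c D --> y \<in>\<^sub>c lim S \<and> y \<inter>\<^sub>c lim S \<subseteq>\<^sub>c C" for C D by (rule f7[OF that])
  qed (fact tZ, fact fZ, fact eZ, fact f2, fact f4, fact f5, fact f1)
qed


subsection \<open>Finite sequences\<close>

text \<open>For operations given by a description: a definable relation \<open>G\<close> that pins
  down the value replaces the graph.\<close>

lemma dft_rel:
  assumes "\<And>s. \<forall>i. s i \<in> dm b ==> t s \<in> dm b"
    and "dfn b (\<lambda>s. G (\<lambda>i. s (Suc i)) (s 0))"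
    and "\<And>s x. \<forall>i. s i \<in> dm b ==> x \<in> dm b ==> G s x \<longleftrightarrow> x = t s"
  shows "dft b t"
  unfolding dft_def
proof (intro conjI allI impI)
  show "dfn b (\<lambda>s. s 0 = t (\<lambda>i. s (Suc i)))"
    by (rule dfn_cong[OF assms(2)]) (rule assms(3), simp_all)
qed (rule assms(1))

lemma dft_Dom [dfn_intros]: "dft b t ==> dft b (\<lambda>s. Dom (t s))"
proof (rule dft_comp1[where F = Dom])
  show "dft b (\<lambda>s. Dom (s 0))"
  proof (rule dftI_ext)
    show "Dom (s 0) \<in> dm b" if "\<forall>i. s i \<in> dm b" for s using that by (cases b) (simp_all add: dm_def)
    show "y \<in>\<^sub>c Dom (s 0) \<longleftrightarrow> is_set y \<and> (\<exists>b. is_set b \<and> related (s 0) y b)" for s y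
      by (auto simp: mem_Dom related_def)
  qed (intro dfn_intros)
qed

lemma dfn_is_function [dfn_intros]: "dft b t ==> dfn b (\<lambda>s. is_function (t s))"
proof (rule dfn_comp1[where P = is_function])
  have "is_function F \<longleftrightarrow> (\<forall>p. p \<in>\<^sub>c F --> (\<exists>a. is_set a \<and> (\<exists>b. is_set b \<and> p = pair a b))) \<and>
    (\<forall>a. is_set a --> (\<forall>b. is_set b --> (\<forall>c. is_set c --> related F a b \<and> related F a c --> b = c)))" for F
    unfolding is_function_def related_def by blast
  then show "dfn b (\<lambda>s. is_function (s 0))" by (simp only:) (intro dfn_intros)
qed

lemma is_set_apx:
  assumes "is_set F" "is_set a" shows "is_set (apx F a)"
  unfolding apx_def
proof (rule is_set_clsI)
  show "is_set (\<Union>\<^sub>c (\<Union>\<^sub>c (\<Union>\<^sub>c F)))" using assms by simp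
  show "dfn True (\<lambda>s. \<exists>b. is_set b \<and> related F a b \<and> s 0 \<in>\<^sub>c b)" by (intro dfn_intros dft_const_True)
  show "dfn False (\<lambda>s. \<exists>b. is_set b \<and> related F a b \<and> s 0 \<in>\<^sub>c b)" by (intro dfn_intros dft_const_set assms)
  fix z assume "\<exists>b. is_set b \<and> related F a b \<and> z \<in>\<^sub>c b"
  then obtain b where b: "related F a b" "z \<in>\<^sub>c b" by blast
  have "b \<in>\<^sub>c \<Union>\<^sub>c (\<Union>\<^sub>c F)" using related_mem2[OF b(1)] ..
  then show "z \<in>\<^sub>c \<Union>\<^sub>c (\<Union>\<^sub>c (\<Union>\<^sub>c F))" unfolding mem_union_of[of _ "\<Union>\<^sub>c (\<Union>\<^sub>c F)"] using b(2) by blast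
qed

lemma dft_apx [dfn_intros]: "dft b t ==> dft b u ==> dft b (\<lambda>s. apx (t s) (u s))"
proof (rule dft_comp2[where F = apx])
  show "dft b (\<lambda>s. apx (s 0) (s (Suc 0)))"
  proof (rule dftI_ext)
    show "apx (s 0) (s (Suc 0)) \<in> dm b" if "\<forall>i. s i \<in> dm b" for s using that is_set_apx by (cases b) (simp_all add: dm_def)
    show "y \<in>\<^sub>c apx (s 0) (s (Suc 0)) \<longleftrightarrow> is_set y \<and> (\<exists>b. is_set b \<and> related (s 0) (s (Suc 0)) b \<and> y \<in>\<^sub>c b)" for s y
      unfolding mem_apx by (auto simp: related_def mem_set)
  qed (intro dfn_intros)
qed

lemma ap_eq: "is_function F ==> related F a b ==> ap F a = b"
  unfolding ap_def is_function_def by (rule the_equality) blast+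

lemma related_ap: "is_function F ==> a \<in>\<^sub>c Dom F ==> related F a (ap F a)"
  unfolding mem_Dom using ap_eq by blast

lemma ap_apx: "is_function F ==> a \<in>\<^sub>c Dom F ==> ap F a = apx F a"
  using related_ap apx_eq by metis

lemma related_iff: "is_function F ==> related F a b \<longleftrightarrow> a \<in>\<^sub>c Dom F \<and> b = ap F a"
  unfolding mem_Dom using ap_eq related_ap[unfolded mem_Dom] by blast

lemma dfn_is_seq [dfn_intros]: "dft b t ==> dfn b (\<lambda>s. is_seq (t s))"
  by (rule dfn_comp1[where P = is_seq]) (unfold is_seq_def, intro dfn_intros)

lemma seq_is_set: "is_seq s ==> is_set s" by (simp add: is_seq_def)
lemma seq_fun: "is_seq s ==> is_function s" by (simp add: is_seq_def)
lemma seq_Dom [simp]: "is_seq s ==> is_nat (Dom s)" by (simp add: is_seq_def)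
lemma Dom_set [simp]: "is_seq s ==> is_set (Dom s)" by (simp add: is_seq_def)

lemma seq_ap_set: "is_seq s ==> i \<in>\<^sub>c Dom s ==> is_set (ap s i)"
  using related_ap[OF seq_fun] by (auto simp: related_def)

lemma Dom_emp [simp]: "Dom emp = emp"
  by (rule cext) (simp add: mem_Dom related_def)

lemma seq_emp [simp]: "is_seq emp"
  by (simp add: is_seq_def is_function_def related_def)

definition snoc :: "'a \<Rightarrow> 'a \<Rightarrow> 'a" where
  "snoc s a = adj s (pair (Dom s) a)"

context
  fixes s a assumes s: "is_seq s" and a: "is_set a"
begin

lemma related_snoc: "related (snoc s a) i b \<longleftrightarrow> related s i b \<or> i = Dom s \<and> b = a"
  using a s unfolding related_def snoc_def by (auto simp: mem_adj)

lemma Dom_snoc [simp]: "Dom (snoc s a) = suc (Dom s)"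
  by (rule cext) (auto simp: mem_Dom related_snoc mem_suc s)

lemma seq_snoc [simp]: "is_seq (snoc s a)"
proof -
  have "is_function (snoc s a)" unfolding is_function_def
  proof (intro conjI allI impI, goal_cases)
    case (1 p)
    then have "p \<in>\<^sub>c s \<or> p = pair (Dom s) a" by (auto simp: snoc_def mem_adj)
    then show ?case using seq_fun[OF s] a Dom_set[OF s] unfolding is_function_def by blast
  next
    case (2 i b c)
    have "\<not> related s (Dom s) b" for b using mem_irrefl[of "Dom s"] unfolding mem_Dom by blast
    then show ?case using 2 seq_fun[OF s] unfolding related_snoc is_function_def by blast
  qed
  then show ?thesis using s a by (simp add: is_seq_def) (simp add: snoc_def is_seq_def)
qed

lemma ap_snoc_last [simp]: "ap (snoc s a) (Dom s) = a"
  by (rule ap_eq[OF seq_fun[OF seq_snoc]]) (simp add: related_snoc)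

lemma ap_snoc: "i \<in>\<^sub>c Dom s ==> ap (snoc s a) i = ap s i"
  by (rule ap_eq[OF seq_fun[OF seq_snoc]]) (simp add: related_snoc related_ap[OF seq_fun[OF s]])

lemma snoc_neq_emp [simp]: "snoc s a \<noteq> emp"
  unfolding snoc_def by (metis mem_adj is_set_pair not_mem_emp)

end

lemma seq_ext:
  assumes s: "is_seq s" and t: "is_seq t" and D: "Dom s = Dom t"
    and "\<And>i. i \<in>\<^sub>c Dom s ==> ap s i = ap t i"
  shows "s = t"
proof -
  have *: "p \<in>\<^sub>c u \<longleftrightarrow> (\<exists>i. i \<in>\<^sub>c Dom u \<and> p = pair i (ap u i))" if u: "is_seq u" for u p
  proof
    assume p: "p \<in>\<^sub>c u"
    then obtain i b where ib: "is_set i" "is_set b" "p = pair i b"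
      using seq_fun[OF u] unfolding is_function_def by blast
    then have "related u i b" using p by (simp add: related_def)
    then have "i \<in>\<^sub>c Dom u \<and> b = ap u i" using related_iff[OF seq_fun[OF u]] by simp
    then show "\<exists>i. i \<in>\<^sub>c Dom u \<and> p = pair i (ap u i)" using ib(3) by blast
  next
    assume "\<exists>i. i \<in>\<^sub>c Dom u \<and> p = pair i (ap u i)"
    then obtain i where i: "i \<in>\<^sub>c Dom u" "p = pair i (ap u i)" by blast
    have "related u i (ap u i)" by (rule related_ap[OF seq_fun[OF u] i(1)])
    then show "p \<in>\<^sub>c u" using i(2) by (simp add: related_def)
  qed
  show ?thesis by (rule cext) (use *[OF s] *[OF t] D assms(4) in metis)
qed

lemma seq_cases:
  assumes s: "is_seq s"
  obtains "s = emp" | t a where "is_seq t" "is_set a" "s = snoc t a"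
proof -
  from seq_Dom[OF s] consider "Dom s = emp" | m where "is_nat m" "Dom s = suc m"
    by (cases rule: nat_cases) auto
  then show ?thesis
  proof cases
    case 1
    have "s = emp" by (rule seq_ext[OF s seq_emp]) (simp_all add: 1)
    then show ?thesis by (rule that)
  next
    case (2 m)
    have ms: "is_set m" using 2(1) by (rule nat_is_set)
    have mD: "m \<in>\<^sub>c Dom s" using 2 by (simp add: mem_suc ms)
    let ?a = "ap s m"
    let ?t = "dif s (sing (pair m ?a))"
    have a: "is_set ?a" by (rule seq_ap_set[OF s mD])
    have rel: "related ?t i b \<longleftrightarrow> i \<in>\<^sub>c m \<and> b = ap s i" for i b
    proof -
      have "related ?t i b \<longleftrightarrow> related s i b \<and> \<not> (i = m \<and> b = ?a)"
        unfolding related_def using ms a by (auto simp: mem_upair)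
      then show ?thesis unfolding related_iff[OF seq_fun[OF s]] 2(2) mem_suc[OF ms] by auto
    qed
    have D: "Dom ?t = m" by (rule cext) (simp add: mem_Dom rel)
    have "is_function ?t" unfolding is_function_def
      using seq_fun[OF s] unfolding is_function_def by (auto simp: rel)
    then have t: "is_seq ?t" using s D 2(1) by (simp add: is_seq_def)
    have "s = snoc ?t ?a"
    proof (rule seq_ext[OF s seq_snoc[OF t a]])
      fix i assume "i \<in>\<^sub>c Dom s"
      then consider "i = m" | "i \<in>\<^sub>c m" using 2(2) mem_suc[OF ms] by auto
      then show "ap s i = ap (snoc ?t ?a) i"
      proof cases
        case 1
        then show ?thesis using ap_snoc_last[OF t a] by (simp add: D)
      next
        case i: 2
        then have "ap ?t i = ap s i" by (intro ap_eq[OF seq_fun[OF t]]) (simp add: rel)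
        then show ?thesis using ap_snoc[OF t a, of i] i by (simp add: D)
      qed
    qed (simp add: Dom_snoc[OF t a] D 2(2))
    with t a show ?thesis by (rule that(2))
  qed
qed

lemma snoc_inj:
  assumes s: "is_seq s" and t: "is_seq t" and a: "is_set a" and b: "is_set b" and eq: "snoc s a = snoc t b"
  shows "s = t \<and> a = b"
proof -
  have D: "Dom s = Dom t"
    using suc_inj[of "Dom s" "Dom t"] Dom_snoc[OF s a] Dom_snoc[OF t b] eq s t by simp
  have "ap s i = ap t i" if "i \<in>\<^sub>c Dom s" for i
    using ap_snoc[OF s a, of i] ap_snoc[OF t b, of i] that D eq by simp
  then have "s = t" using D by (intro seq_ext[OF s t])
  moreover have "a = b" using ap_snoc_last[OF s a] ap_snoc_last[OF t b] D eq by simp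
  ultimately show ?thesis ..
qed

text \<open>The statement of interest, \<open>P\<close>, mentions partial operations such as
  concatenation and is not visibly a set formula. It is replaced by a definable \<open>Q\<close>
  that agrees with it on sequences; the induction itself is on the length.\<close>

lemma seq_induct:
  assumes Q: "dfn False (\<lambda>s. Q (s 0))" and QP: "\<And>s. is_seq s ==> Q s \<longleftrightarrow> P s"
    and s: "is_seq s" and 0: "P emp"
    and step: "\<And>t a. is_seq t ==> is_set a ==> P t ==> P (snoc t a)"
  shows "P s"
proof -
  have "\<forall>s. is_set s --> is_seq s --> Dom s = n --> Q s" if "is_nat n" for n
  proof (rule nat_induct_set[OF _ that])
    show "dfn False (\<lambda>s'. \<forall>s. is_set s --> is_seq s --> Dom s = s' 0 --> Q s)"
      by (intro dfn_intros dfn_comp1[OF Q])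
    show "\<forall>s. is_set s --> is_seq s --> Dom s = emp --> Q s"
    proof (intro allI impI)
      fix s assume s: "is_seq s" and D: "Dom s = emp"
      have "s = emp" by (rule seq_ext[OF s seq_emp]) (simp_all add: D)
      then show "Q s" using 0 QP by simp
    qed
  next
    fix m assume m: "is_nat m" and IH: "\<forall>s. is_set s --> is_seq s --> Dom s = m --> Q s"
    show "\<forall>s. is_set s --> is_seq s --> Dom s = suc m --> Q s"
    proof (intro allI impI)
      fix s assume s: "is_seq s" and D: "Dom s = suc m"
      from s show "Q s"
      proof (cases rule: seq_cases)
        case 1
        then show ?thesis using D suc_not_emp[OF nat_is_set[OF m]] by simp
      next
        case (2 t a)
        then have "Dom t = m" using D m by (rule_tac suc_inj) simp_all
        then have "P t" using IH 2 seq_is_set QP by blast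
        then show ?thesis using step 2 QP[OF s] by simp
      qed
    qed
  qed
  then show ?thesis using s QP[OF s] seq_is_set[OF s] seq_Dom[OF s] by blast
qed


subsection \<open>Concatenation\<close>

definition cat_map :: "'a \<Rightarrow> 'a \<Rightarrow> 'a \<Rightarrow> 'a \<Rightarrow> bool" where
  "cat_map s t r h \<longleftrightarrow> is_function h \<and> Dom h = Dom t \<and>
     (\<forall>k. k \<in>\<^sub>c Dom r \<and> \<not> k \<in>\<^sub>c Dom s \<longleftrightarrow> (\<exists>i. i \<in>\<^sub>c Dom t \<and> k = ap h i)) \<and>
     (\<forall>i j. i \<in>\<^sub>c Dom t \<and> j \<in>\<^sub>c Dom t --> (i \<in>\<^sub>c j \<longleftrightarrow> ap h i \<in>\<^sub>c ap h j)) \<and>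
     (\<forall>i. i \<in>\<^sub>c Dom t --> ap r (ap h i) = ap t i)"

definition is_cat :: "'a \<Rightarrow> 'a \<Rightarrow> 'a \<Rightarrow> bool" where
  "is_cat s t r \<longleftrightarrow> is_seq r \<and> s \<subseteq>\<^sub>c r \<and> (\<exists>h. is_set h \<and> cat_map s t r h)"

lemma cat_is_cat: "s \<frown> t = (THE r. is_cat s t r)"
  unfolding cat_def is_cat_def cat_map_def ..

text \<open>\<open>cat_map\<close> with the total \<open>apx\<close> in place of \<open>ap\<close>
  and with guarded quantifiers, hence a set formula.\<close>

definition cat_mapx :: "'a \<Rightarrow> 'a \<Rightarrow> 'a \<Rightarrow> 'a \<Rightarrow> bool" where
  "cat_mapx s t r h \<longleftrightarrow> is_function h \<and> Dom h = Dom t \<and>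
     (\<forall>k. is_set k --> (k \<in>\<^sub>c Dom r \<and> \<not> k \<in>\<^sub>c Dom s \<longleftrightarrow> (\<exists>i. i \<in>\<^sub>c Dom t \<and> k = apx h i))) \<and>
     (\<forall>i. i \<in>\<^sub>c Dom t --> (\<forall>j. j \<in>\<^sub>c Dom t --> (i \<in>\<^sub>c j \<longleftrightarrow> apx h i \<in>\<^sub>c apx h j))) \<and>
     (\<forall>i. i \<in>\<^sub>c Dom t --> apx r (apx h i) = apx t i)"

lemma cat_map_iff:
  assumes t: "is_seq t" and r: "is_seq r" and h: "is_set h"
  shows "cat_map s t r h \<longleftrightarrow> cat_mapx s t r h"
proof (cases "is_function h \<and> Dom h = Dom t")
  case True
  then have a: "ap h i = apx h i" if "i \<in>\<^sub>c Dom t" for i using that ap_apx by simp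
  have as: "is_set (apx h i)" if "i \<in>\<^sub>c Dom t" for i using is_set_apx h mem_set[OF that] by simp
  have at: "ap t i = apx t i" if "i \<in>\<^sub>c Dom t" for i using that ap_apx seq_fun[OF t] by simp
  have ar: "ap r i = apx r i" if "i \<in>\<^sub>c Dom r" for i using that ap_apx seq_fun[OF r] by simp
  have ex: "(\<exists>i. i \<in>\<^sub>c Dom t \<and> k = ap h i) \<longleftrightarrow> (\<exists>i. i \<in>\<^sub>c Dom t \<and> k = apx h i)" for k using a by metis
  have 1: "(\<forall>k. k \<in>\<^sub>c Dom r \<and> \<not> k \<in>\<^sub>c Dom s \<longleftrightarrow> (\<exists>i. i \<in>\<^sub>c Dom t \<and> k = ap h i)) \<longleftrightarrow>
    (\<forall>k. is_set k --> (k \<in>\<^sub>c Dom r \<and> \<not> k \<in>\<^sub>c Dom s \<longleftrightarrow> (\<exists>i. i \<in>\<^sub>c Dom t \<and> k = apx h i)))" (is "?A = ?B")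
  proof
    assume ?A then show ?B unfolding ex by blast
  next
    assume B: ?B
    show ?A
    proof
      fix k
      show "k \<in>\<^sub>c Dom r \<and> \<not> k \<in>\<^sub>c Dom s \<longleftrightarrow> (\<exists>i. i \<in>\<^sub>c Dom t \<and> k = ap h i)"
      proof (cases "is_set k")
        case True
        then show ?thesis using B unfolding ex by blast
      next
        case False
        then have "\<not> k \<in>\<^sub>c Dom r" "\<not> (\<exists>i. i \<in>\<^sub>c Dom t \<and> k = apx h i)" using mem_set as by metis+
        then show ?thesis unfolding ex by blast
      qed
    qed
  qed
  have 2: "(\<forall>i j. i \<in>\<^sub>c Dom t \<and> j \<in>\<^sub>c Dom t --> (i \<in>\<^sub>c j \<longleftrightarrow> ap h i \<in>\<^sub>c ap h j)) \<longleftrightarrow>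
    (\<forall>i. i \<in>\<^sub>c Dom t --> (\<forall>j. j \<in>\<^sub>c Dom t --> (i \<in>\<^sub>c j \<longleftrightarrow> apx h i \<in>\<^sub>c apx h j)))" by (simp add: a imp_conjL)
  have 3: "(\<forall>i. i \<in>\<^sub>c Dom t --> ap r (ap h i) = ap t i) \<longleftrightarrow> (\<forall>i. i \<in>\<^sub>c Dom t --> apx r (apx h i) = apx t i)"
    if B: ?B
  proof -
    have "ap r (ap h i) = apx r (apx h i)" if i: "i \<in>\<^sub>c Dom t" for i
    proof -
      have "apx h i \<in>\<^sub>c Dom r" using B as[OF i] i by blast
      then show ?thesis using ar a[OF i] by simp
    qed
    then show ?thesis using at by simp
  qed
  show ?thesis unfolding cat_map_def cat_mapx_def 1 2 using 3 by blast
next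
  case False
  then show ?thesis unfolding cat_map_def cat_mapx_def by blast
qed

text \<open>The conjuncts \<open>is_seq\<close> belong to the formula because
  \<open>cat_map_iff\<close> identifies the two versions of the shift condition for
  sequences.\<close>

lemma dfn_is_cat:
  "dfn b (\<lambda>s. is_seq (s 0) \<and> is_seq (s (Suc 0)) \<and> is_cat (s 0) (s (Suc 0)) (s (Suc (Suc 0))))"
proof -
  have "is_seq s \<and> is_seq t \<and> is_cat s t r \<longleftrightarrow>
    is_seq s \<and> is_seq t \<and> is_seq r \<and> s \<subseteq>\<^sub>c r \<and> (\<exists>h. is_set h \<and> cat_mapx s t r h)" for s t r
    unfolding is_cat_def using cat_map_iff by blast
  then show ?thesis by (simp only:) (unfold cat_mapx_def, intro dfn_intros)
qed

lemma is_cat_emp: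
  assumes s: "is_seq s" shows "is_cat s emp r \<longleftrightarrow> r = s"
proof
  assume r: "is_cat s emp r"
  then have rs: "is_seq r" and sub: "s \<subseteq>\<^sub>c r" and D: "\<And>k. k \<in>\<^sub>c Dom r ==> k \<in>\<^sub>c Dom s"
    unfolding is_cat_def cat_map_def by auto
  have rel: "related r i b" if "related s i b" for i b using that sub by (simp add: related_def subcls_def)
  have "Dom r = Dom s"
  proof (rule cext)
    fix z
    show "z \<in>\<^sub>c Dom r \<longleftrightarrow> z \<in>\<^sub>c Dom s" using D[of z] rel unfolding mem_Dom by blast
  qed
  then show "r = s"
    using ap_eq[OF seq_fun[OF rs]] rel related_ap[OF seq_fun[OF s]] by (intro seq_ext[OF rs s]) simp_all
next
  assume "r = s"
  then show "is_cat s emp r" unfolding is_cat_def cat_map_def using s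
    by (auto intro!: exI[of _ emp] simp: is_function_def related_def)
qed

lemma is_cat_Dom:
  assumes "is_cat s t r" "i \<in>\<^sub>c Dom s" shows "i \<in>\<^sub>c Dom r"
  using assms unfolding is_cat_def mem_Dom related_def subcls_def by blast

lemma is_cat_snoc:
  assumes s: "is_seq s" and t: "is_seq t" and a: "is_set a" and c: "is_cat s t r"
  shows "is_cat s (snoc t a) (snoc r a)"
proof -
  have r: "is_seq r" and sr: "s \<subseteq>\<^sub>c r" using c by (simp_all add: is_cat_def)
  obtain h where hs: "is_set h" and hf: "is_function h" and hD: "Dom h = Dom t"
    and h1: "\<And>k. k \<in>\<^sub>c Dom r \<and> \<not> k \<in>\<^sub>c Dom s \<longleftrightarrow> (\<exists>i. i \<in>\<^sub>c Dom t \<and> k = ap h i)"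
    and h2: "\<And>i j. i \<in>\<^sub>c Dom t ==> j \<in>\<^sub>c Dom t ==> i \<in>\<^sub>c j \<longleftrightarrow> ap h i \<in>\<^sub>c ap h j"
    and h3: "\<And>i. i \<in>\<^sub>c Dom t ==> ap r (ap h i) = ap t i"
    using c unfolding is_cat_def cat_map_def by blast
  have h: "is_seq h" using hs hf hD t by (simp add: is_seq_def)
  \<comment> \<open>The extended shift sends the new last position of \<open>t\<close> to the new
    last position of \<open>r\<close>.\<close>
  let ?h = "snoc h (Dom r)"
  have Dr: "is_set (Dom r)" using r by simp
  have app: "ap ?h i = ap h i" if "i \<in>\<^sub>c Dom t" for i using ap_snoc[OF h Dr, of i] that by (simp add: hD)
  have apl: "ap ?h (Dom t) = Dom r" using ap_snoc_last[OF h Dr] by (simp add: hD)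
  note m = mem_suc[OF Dom_set[OF t]] and mr = mem_suc[OF Dr]
  have hr: "ap h i \<in>\<^sub>c Dom r" if "i \<in>\<^sub>c Dom t" for i using h1 that by blast
  have "cat_map s (snoc t a) (snoc r a) ?h"
    unfolding cat_map_def Dom_snoc[OF t a] Dom_snoc[OF r a] m mr
  proof (intro conjI allI impI)
    show "is_function ?h" by (rule seq_fun[OF seq_snoc[OF h Dr]])
    show "Dom ?h = suc (Dom t)" using Dom_snoc[OF h Dr] hD by simp
    show "(k \<in>\<^sub>c Dom r \<or> k = Dom r) \<and> \<not> k \<in>\<^sub>c Dom s \<longleftrightarrow> (\<exists>i. (i \<in>\<^sub>c Dom t \<or> i = Dom t) \<and> k = ap ?h i)" for k
    proof -
      have E: "(\<exists>i. (i \<in>\<^sub>c Dom t \<or> i = Dom t) \<and> k = ap ?h i) \<longleftrightarrow> (\<exists>i. i \<in>\<^sub>c Dom t \<and> k = ap h i) \<or> k = Dom r"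
        using app apl by metis
      have "\<not> Dom r \<in>\<^sub>c Dom s" using is_cat_Dom[OF c] mem_irrefl by blast
      then show ?thesis unfolding E h1[symmetric] by blast
    qed
    fix i j assume ij: "(i \<in>\<^sub>c Dom t \<or> i = Dom t) \<and> (j \<in>\<^sub>c Dom t \<or> j = Dom t)"
    show "i \<in>\<^sub>c j \<longleftrightarrow> ap ?h i \<in>\<^sub>c ap ?h j"
    proof (cases "i = Dom t"; cases "j = Dom t")
      assume "i \<noteq> Dom t" "j \<noteq> Dom t"
      then show ?thesis using ij h2 app by simp
    next
      assume *: "i \<noteq> Dom t" "j = Dom t"
      then show ?thesis using ij app[of i] apl hr[of i] by simp
    next
      assume *: "i = Dom t" "j \<noteq> Dom t"
      then show ?thesis using ij app[of j] apl mem_asym[OF hr[of j]] mem_asym[of j "Dom t"] by simp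
    next
      assume "i = Dom t" "j = Dom t"
      then show ?thesis by simp
    qed
  next
    fix i assume "i \<in>\<^sub>c Dom t \<or> i = Dom t"
    then consider "i \<in>\<^sub>c Dom t" | "i = Dom t" by blast
    then show "ap (snoc r a) (ap ?h i) = ap (snoc t a) i"
    proof cases
      case 1
      then show ?thesis using app h3 ap_snoc[OF t a] ap_snoc[OF r a] hr by simp
    next
      case 2
      then show ?thesis using apl ap_snoc_last[OF t a] ap_snoc_last[OF r a] by simp
    qed
  qed
  moreover have "is_set ?h" by (rule seq_is_set[OF seq_snoc[OF h Dr]])
  moreover have "s \<subseteq>\<^sub>c snoc r a" using sr by (simp add: subcls_def snoc_def mem_adj)
  ultimately show ?thesis using seq_snoc[OF r a] unfolding is_cat_def by blast
qed

lemma is_cat_snoc_inv: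
  assumes s: "is_seq s" and t: "is_seq t" and a: "is_set a" and c: "is_cat s (snoc t a) q"
  shows "\<exists>r. is_cat s t r \<and> q = snoc r a"
proof -
  have q: "is_seq q" and sq: "s \<subseteq>\<^sub>c q" using c by (simp_all add: is_cat_def)
  obtain h where hs: "is_set h" and hf: "is_function h" and hD: "Dom h = Dom (snoc t a)"
    and h1: "\<And>k. k \<in>\<^sub>c Dom q \<and> \<not> k \<in>\<^sub>c Dom s \<longleftrightarrow> (\<exists>i. i \<in>\<^sub>c Dom (snoc t a) \<and> k = ap h i)"
    and h2: "\<And>i j. i \<in>\<^sub>c Dom (snoc t a) ==> j \<in>\<^sub>c Dom (snoc t a) ==> i \<in>\<^sub>c j \<longleftrightarrow> ap h i \<in>\<^sub>c ap h j"
    and h3: "\<And>i. i \<in>\<^sub>c Dom (snoc t a) ==> ap q (ap h i) = ap (snoc t a) i"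
    using c unfolding is_cat_def cat_map_def by blast
  note D = Dom_snoc[OF t a] and m = mem_suc[OF Dom_set[OF t]]
  have h: "is_seq h" using hs hf hD t D by (simp add: is_seq_def)
  from h obtain h' l where h': "is_seq h'" "is_set l" "h = snoc h' l"
  proof (cases rule: seq_cases)
    case 1
    then have "suc (Dom t) = emp" using hD D by simp
    then show ?thesis using suc_not_emp[OF Dom_set[OF t]] by simp
  qed (rule that)
  have Dh': "Dom h' = Dom t" using hD D Dom_snoc[OF h'(1,2)] h'(3) t h'(1) by (rule_tac suc_inj) simp_all
  have app: "ap h i = ap h' i" if "i \<in>\<^sub>c Dom t" for i using ap_snoc[OF h'(1,2), of i] that h'(3) Dh' by simp
  have apl: "ap h (Dom t) = l" using ap_snoc_last[OF h'(1,2)] h'(3) Dh' by simp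
  have l: "l \<in>\<^sub>c Dom q" "\<not> l \<in>\<^sub>c Dom s" using h1[of l] apl D m by auto
  from q obtain r b where r: "is_seq r" "is_set b" "q = snoc r b"
  proof (cases rule: seq_cases)
    case 1
    then show ?thesis using l by simp
  qed (rule that)
  have Dq: "Dom q = suc (Dom r)" using r by simp
  note mr = mem_suc[OF Dom_set[OF r(1)]]
  \<comment> \<open>The shift is increasing, so its last value \<open>l\<close> must be the last
    position \<open>Dom r\<close> of \<open>q\<close>: otherwise that position would be the image of
    an earlier index and hence lie below \<open>l\<close>.\<close>
  have "Dom r = l"
  proof (rule ccontr)
    assume ne: "Dom r \<noteq> l"
    then have lr: "l \<in>\<^sub>c Dom r" using l(1) Dq mr by auto
    have "\<not> Dom r \<in>\<^sub>c Dom s" using nat_trans[OF seq_Dom[OF s], of "Dom r" l] lr l(2) by blast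
    then obtain i where i: "i \<in>\<^sub>c suc (Dom t)" "Dom r = ap h i" using h1[of "Dom r"] Dq mr D by auto
    have "i \<noteq> Dom t" using i(2) apl ne by auto
    then have it: "i \<in>\<^sub>c Dom t" using i(1) m by simp
    then have "ap h i \<in>\<^sub>c l" using h2[of i "Dom t"] apl D m by simp
    then show False using i(2) lr mem_asym by simp
  qed
  have ba: "b = a"
  proof -
    have "ap q l = a" using h3[of "Dom t"] apl D m ap_snoc_last[OF t a] by simp
    then show ?thesis using r \<open>Dom r = l\<close> ap_snoc_last[OF r(1,2)] by simp
  qed
  have h'r: "ap h' i \<in>\<^sub>c Dom r" if "i \<in>\<^sub>c Dom t" for i
    using h2[of i "Dom t"] that apl app[OF that] D m \<open>Dom r = l\<close> by simp
  have "cat_map s t r h'" unfolding cat_map_def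
  proof (intro conjI allI impI)
    show "is_function h'" by (rule seq_fun[OF h'(1)])
    show "Dom h' = Dom t" by (rule Dh')
    show "k \<in>\<^sub>c Dom r \<and> \<not> k \<in>\<^sub>c Dom s \<longleftrightarrow> (\<exists>i. i \<in>\<^sub>c Dom t \<and> k = ap h' i)" for k
    proof
      assume k: "k \<in>\<^sub>c Dom r \<and> \<not> k \<in>\<^sub>c Dom s"
      then obtain i where i: "i \<in>\<^sub>c suc (Dom t)" "k = ap h i" using h1[of k] Dq mr D by auto
      have "k \<noteq> Dom r" using k mem_irrefl by metis
      then have "i \<noteq> Dom t" using i(2) apl \<open>Dom r = l\<close> by auto
      then have "i \<in>\<^sub>c Dom t" using i(1) m by simp
      then show "\<exists>i. i \<in>\<^sub>c Dom t \<and> k = ap h' i" using i(2) app by blast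
    next
      assume "\<exists>i. i \<in>\<^sub>c Dom t \<and> k = ap h' i"
      then obtain i where i: "i \<in>\<^sub>c Dom t" "k = ap h' i" by blast
      then have "\<not> k \<in>\<^sub>c Dom s" using h1[of k] app[OF i(1)] D m by auto
      then show "k \<in>\<^sub>c Dom r \<and> \<not> k \<in>\<^sub>c Dom s" using h'r[OF i(1)] i(2) by simp
    qed
    fix i j assume ij: "i \<in>\<^sub>c Dom t \<and> j \<in>\<^sub>c Dom t"
    then show "i \<in>\<^sub>c j \<longleftrightarrow> ap h' i \<in>\<^sub>c ap h' j" using h2[of i j] app D m by simp
  next
    fix i assume i: "i \<in>\<^sub>c Dom t"
    have "ap q (ap h i) = ap (snoc t a) i" using h3[of i] i D m by simp
    then show "ap r (ap h' i) = ap t i"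
      using app[OF i] ap_snoc[OF t a i] ap_snoc[OF r(1,2) h'r[OF i]] r(3) by simp
  qed
  moreover have "s \<subseteq>\<^sub>c r"
  proof (rule subclsI)
    fix p assume p: "p \<in>\<^sub>c s"
    then obtain i c where ic: "is_set i" "is_set c" "p = pair i c" using seq_fun[OF s] unfolding is_function_def by blast
    then have "i \<in>\<^sub>c Dom s" using p unfolding mem_Dom related_def by blast
    then have "i \<noteq> Dom r" using l(2) \<open>Dom r = l\<close> by auto
    moreover have "p \<in>\<^sub>c r \<or> p = pair (Dom r) b" using subclsD[OF sq p] r(3) by (auto simp: snoc_def mem_adj)
    ultimately show "p \<in>\<^sub>c r" using ic r by auto
  qed
  ultimately have "is_cat s t r" using r(1) seq_is_set[OF h'(1)] unfolding is_cat_def by blast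
  then show ?thesis using r(3) ba by blast
qed

text \<open>The last letter of the second word can be added and removed on both sides, so induction
  on that word fixes the result. This justifies the description in \<open>cat\<close>.\<close>

lemma is_cat_ex1:
  assumes s: "is_seq s" and t: "is_seq t"
  shows "\<exists>r. is_set r \<and> is_cat s t r \<and> (\<forall>r'. is_set r' --> is_cat s t r' --> r' = r)"
proof (rule seq_induct[OF _ _ t])
  show "dfn False (\<lambda>u. \<exists>r. is_set r \<and> (is_seq s \<and> is_seq (u 0) \<and> is_cat s (u 0) r) \<and>
      (\<forall>r'. is_set r' --> (is_seq s \<and> is_seq (u 0) \<and> is_cat s (u 0) r') --> r' = r))"
    by (intro dfn_ex_set dfn_conj[of _ "\<lambda>u. is_seq s \<and> is_seq (u (Suc 0)) \<and> is_cat s (u (Suc 0)) (u 0)"]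
        dfn_comp3[OF dfn_is_cat, of _ "\<lambda>u. s"] dfn_intros dft_const_set seq_is_set s dfn_imp)
next
  fix u assume "is_seq u"
  then show "(\<exists>r. is_set r \<and> (is_seq s \<and> is_seq u \<and> is_cat s u r) \<and>
      (\<forall>r'. is_set r' --> (is_seq s \<and> is_seq u \<and> is_cat s u r') --> r' = r)) \<longleftrightarrow>
    (\<exists>r. is_set r \<and> is_cat s u r \<and> (\<forall>r'. is_set r' --> is_cat s u r' --> r' = r))" using s by simp
next
  show "\<exists>r. is_set r \<and> is_cat s emp r \<and> (\<forall>r'. is_set r' --> is_cat s emp r' --> r' = r)"
    using s seq_is_set by (simp add: is_cat_emp)
next
  fix t a assume ta: "is_seq t" "is_set a"
    and "\<exists>r. is_set r \<and> is_cat s t r \<and> (\<forall>r'. is_set r' --> is_cat s t r' --> r' = r)"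
  then obtain r where r: "is_cat s t r" "\<And>r'. is_set r' ==> is_cat s t r' ==> r' = r" by blast
  have "is_cat s (snoc t a) (snoc r a)" by (rule is_cat_snoc[OF s ta r(1)])
  moreover have "q = snoc r a" if "is_cat s (snoc t a) q" for q
  proof -
    obtain r' where r': "is_cat s t r'" "q = snoc r' a" using is_cat_snoc_inv[OF s ta \<open>is_cat s (snoc t a) q\<close>] by blast
    then have "is_set r'" using seq_is_set unfolding is_cat_def by blast
    then show ?thesis using r r' by simp
  qed
  moreover have "is_set (snoc r a)" using r(1) ta unfolding is_cat_def by (simp add: seq_is_set)
  ultimately show "\<exists>r. is_set r \<and> is_cat s (snoc t a) r \<and> (\<forall>r'. is_set r' --> is_cat s (snoc t a) r' --> r' = r)"
    by blast
qed

lemma is_cat_iff: "is_seq s ==> is_seq t ==> is_cat s t r \<longleftrightarrow> r = s \<frown> t"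
proof -
  assume st: "is_seq s" "is_seq t"
  obtain r0 where r0: "is_cat s t r0" "\<And>r'. is_set r' ==> is_cat s t r' ==> r' = r0"
    using is_cat_ex1[OF st] by blast
  have u: "r' = r0" if "is_cat s t r'" for r' using r0(2)[OF _ that] that seq_is_set unfolding is_cat_def by blast
  then have "s \<frown> t = r0" unfolding cat_is_cat using r0(1) by (intro the_equality)
  then show ?thesis using u r0(1) by blast
qed

lemma cat_seq [simp]: "is_seq s ==> is_seq t ==> is_seq (s \<frown> t)"
  using is_cat_iff is_cat_def by blast

lemma cat_emp [simp]: "is_seq s ==> s \<frown> emp = s"
  using is_cat_iff[of s emp s] is_cat_emp[of s s] by simp

lemma cat_snoc: "is_seq s ==> is_seq t ==> is_set a ==> s \<frown> snoc t a = snoc (s \<frown> t) a"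
  using is_cat_snoc[of s t a "s \<frown> t"] is_cat_iff[of s t "s \<frown> t"] is_cat_iff[of s "snoc t a" "snoc (s \<frown> t) a"] by simp

text \<open>Total, hence definable, version of concatenation.\<close>

definition catx :: "'a \<Rightarrow> 'a \<Rightarrow> 'a" where
  "catx s t = (if is_seq s \<and> is_seq t then s \<frown> t else emp)"

lemma catx_cat [simp]: "is_seq s ==> is_seq t ==> catx s t = s \<frown> t"
  by (simp add: catx_def)

lemma seq_catx [simp]: "is_seq (catx s t)"
  by (simp add: catx_def)

lemma dft_catx [dfn_intros]: "dft b t ==> dft b u ==> dft b (\<lambda>s. catx (t s) (u s))"
proof (rule dft_comp2[where F = catx])
  show "dft b (\<lambda>s. catx (s 0) (s (Suc 0)))"
  proof (rule dft_rel)
    show "catx (s 0) (s (Suc 0)) \<in> dm b" for s by (simp add: dm_def seq_is_set)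
    let ?G = "\<lambda>s t x. is_seq s \<and> is_seq t \<and> is_cat s t x \<or> \<not> (is_seq s \<and> is_seq t) \<and> x = emp"
    show "dfn b (\<lambda>s. ?G (s (Suc 0)) (s (Suc (Suc 0))) (s 0))"
      by (rule dfn_disj, rule dfn_comp3[OF dfn_is_cat]) (intro dfn_intros)+
    show "?G (s 0) (s (Suc 0)) x \<longleftrightarrow> x = catx (s 0) (s (Suc 0))" for s x
      unfolding catx_def using is_cat_iff by auto
  qed
qed


subsection \<open>The monoid of words\<close>

definition lt :: "'a \<Rightarrow> 'a" where
  "lt a = sing (pair emp a)"

lemma dft_lt [dfn_intros]: "dft b t ==> dft b (\<lambda>s. lt (t s))"
  unfolding lt_def by (intro dfn_intros)

lemma lt_snoc: "is_set a ==> lt a = snoc emp a"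
  unfolding lt_def snoc_def by (rule cext) (auto simp: mem_upair mem_adj)

lemma seq_lt [simp]: "is_set a ==> is_seq (lt a)"
  by (simp add: lt_snoc)

lemma Dom_lt [simp]: "is_set a ==> Dom (lt a) = suc emp"
  by (simp add: lt_snoc)

lemma cat_lt: "is_seq s ==> is_set a ==> s \<frown> lt a = snoc s a"
  using cat_snoc[of s emp a] by (simp add: lt_snoc)

lemma emp_cat [simp]:
  assumes "is_seq t" shows "emp \<frown> t = t"
proof (rule seq_induct[where Q = "\<lambda>t. catx emp t = t" and P = "\<lambda>t. emp \<frown> t = t", OF _ _ assms])
  show "dfn False (\<lambda>s. catx emp (s 0) = s 0)" by (intro dfn_intros)
qed (simp_all add: cat_snoc)

lemma cat_assoc [simp]:
  assumes s: "is_seq s" and t: "is_seq t" and u: "is_seq u"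
  shows "(s \<frown> t) \<frown> u = s \<frown> t \<frown> u"
proof (rule seq_induct[where Q = "\<lambda>u. catx (catx s t) u = catx s (catx t u)"
      and P = "\<lambda>u. (s \<frown> t) \<frown> u = s \<frown> t \<frown> u", OF _ _ u])
  show "dfn False (\<lambda>u. catx (catx s t) (u 0) = catx s (catx t (u 0)))"
    by (intro dfn_intros dft_const_set seq_is_set s t)
qed (use s t in \<open>simp_all add: cat_snoc\<close>)

lemma Dom_eq_emp: "is_seq s ==> Dom s = emp \<longleftrightarrow> s = emp"
  using seq_ext[of s emp] by auto

lemma nat_suc_less: "is_nat n ==> is_set m ==> suc m \<in>\<^sub>c suc n ==> m \<in>\<^sub>c n"
proof -
  assume *: "is_nat n" "is_set m" "suc m \<in>\<^sub>c suc n"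
  have m: "m \<in>\<^sub>c suc m" by (simp add: mem_suc *(2))
  have "suc m \<in>\<^sub>c n \<or> suc m = n" using *(3) by (simp add: mem_suc[OF nat_is_set[OF *(1)]])
  then show "m \<in>\<^sub>c n" using m nat_trans[OF *(1)] by auto
qed

text \<open>Lengths are compared by membership: \<open>m \<in>\<^sub>c suc n\<close> means that
  \<open>m\<close> is at most \<open>n\<close>. No addition of internal natural numbers is
  introduced; lemmas on \<open>Dom\<close> take its place.\<close>

lemma Dom_prefix:
  assumes s: "is_seq s" and t: "is_seq t" shows "Dom s \<in>\<^sub>c suc (Dom (s \<frown> t))"
proof (rule seq_induct[where Q = "\<lambda>t. Dom s \<in>\<^sub>c suc (Dom (catx s t))" and P = "\<lambda>t. Dom s \<in>\<^sub>c suc (Dom (s \<frown> t))", OF _ _ t])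
  show "dfn False (\<lambda>t. Dom s \<in>\<^sub>c suc (Dom (catx s (t 0))))"
    by (intro dfn_intros dft_const_set seq_is_set s)
qed (use s in \<open>simp_all add: cat_snoc mem_suc\<close>)

lemma Dom_suffix:
  assumes s: "is_seq s" and t: "is_seq t" shows "Dom t \<in>\<^sub>c suc (Dom (s \<frown> t))"
proof (rule seq_induct[where Q = "\<lambda>t. Dom t \<in>\<^sub>c suc (Dom (catx s t))" and P = "\<lambda>t. Dom t \<in>\<^sub>c suc (Dom (s \<frown> t))", OF _ _ t])
  show "dfn False (\<lambda>t. Dom (t 0) \<in>\<^sub>c suc (Dom (catx s (t 0))))"
    by (intro dfn_intros dft_const_set seq_is_set s)
qed (use s in \<open>simp_all add: cat_snoc emp_mem_suc nat_suc_mono\<close>)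

lemma Dom_suffix_lt:
  assumes c: "is_set c" and t: "is_seq t" shows "Dom t \<in>\<^sub>c Dom (lt c \<frown> t)"
proof (rule seq_induct[where Q = "\<lambda>t. Dom t \<in>\<^sub>c Dom (catx (lt c) t)" and P = "\<lambda>t. Dom t \<in>\<^sub>c Dom (lt c \<frown> t)", OF _ _ t])
  show "dfn False (\<lambda>t. Dom (t 0) \<in>\<^sub>c Dom (catx (lt c) (t 0)))"
    by (intro dfn_intros dft_const_set c)
qed (use c in \<open>simp_all add: cat_snoc nat_suc_mono emp_mem_suc\<close>)

lemma Dom_prefix_lt:
  assumes "is_seq s" "is_set c" "is_seq t" shows "Dom s \<in>\<^sub>c Dom (s \<frown> lt c \<frown> t)"
proof (rule nat_suc_less)
  have "Dom (s \<frown> lt c) = suc (Dom s)" using assms by (simp add: cat_lt)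
  then show "suc (Dom s) \<in>\<^sub>c suc (Dom (s \<frown> lt c \<frown> t))"
    using Dom_prefix[of "s \<frown> lt c" t] assms by simp
qed (use assms in simp_all)

text \<open>Stands in for the additivity of length; the induction removes the last letters of
  \<open>t\<close> and \<open>t'\<close> in parallel.\<close>

lemma Dom_cat_cong:
  assumes s: "is_seq s" "is_seq s'" "Dom s = Dom s'" and t: "is_seq t" "is_seq t'" "Dom t = Dom t'"
  shows "Dom (s \<frown> t) = Dom (s' \<frown> t')"
proof -
  have "\<forall>t'. is_set t' --> is_seq t' --> Dom t = Dom t' --> Dom (s \<frown> t) = Dom (s' \<frown> t')"
  proof (rule seq_induct[where Q = "\<lambda>t. \<forall>t'. is_set t' --> is_seq t' --> Dom t = Dom t' --> Dom (catx s t) = Dom (catx s' t')"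
      and P = "\<lambda>t. \<forall>t'. is_set t' --> is_seq t' --> Dom t = Dom t' --> Dom (s \<frown> t) = Dom (s' \<frown> t')", OF _ _ t(1)])
    show "dfn False (\<lambda>t. \<forall>t'. is_set t' --> is_seq t' --> Dom (t 0) = Dom t' --> Dom (catx s (t 0)) = Dom (catx s' t'))"
      by (intro dfn_intros dft_const_set seq_is_set s(1,2))
    show "\<forall>t'. is_set t' --> is_seq t' --> Dom emp = Dom t' --> Dom (s \<frown> emp) = Dom (s' \<frown> t')"
    proof (intro allI impI)
      fix t' assume "is_seq t'" "Dom emp = Dom t'"
      then have "t' = emp" using Dom_eq_emp[of t'] by simp
      then show "Dom (s \<frown> emp) = Dom (s' \<frown> t')" using s by simp
    qed
  next
    fix t a assume ta: "is_seq t" "is_set a"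
      and IH: "\<forall>t'. is_set t' --> is_seq t' --> Dom t = Dom t' --> Dom (s \<frown> t) = Dom (s' \<frown> t')"
    show "\<forall>t'. is_set t' --> is_seq t' --> Dom (snoc t a) = Dom t' --> Dom (s \<frown> snoc t a) = Dom (s' \<frown> t')"
    proof (intro allI impI)
      fix t' assume t': "is_seq t'" and D: "Dom (snoc t a) = Dom t'"
      from t' show "Dom (s \<frown> snoc t a) = Dom (s' \<frown> t')"
      proof (cases rule: seq_cases)
        case 1
        then show ?thesis using D ta suc_not_emp by simp
      next
        case (2 u c)
        then have "suc (Dom t) = suc (Dom u)" using D ta by simp
        then have "Dom t = Dom u" using ta 2 by (rule_tac suc_inj) simp_all
        then have "Dom (s \<frown> t) = Dom (s' \<frown> u)" using IH 2(1) seq_is_set by blast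
        then show ?thesis using 2 ta s by (simp add: cat_snoc)
      qed
    qed
  qed (use s in simp_all)
  then show ?thesis using t seq_is_set by blast
qed

lemma cat_eq_emp [simp]:
  assumes "is_seq s" "is_seq t" shows "s \<frown> t = emp \<longleftrightarrow> s = emp \<and> t = emp"
proof
  assume e: "s \<frown> t = emp"
  have "Dom s \<in>\<^sub>c suc emp" "Dom t \<in>\<^sub>c suc emp"
    using Dom_prefix[OF assms] Dom_suffix[OF assms] e by simp_all
  then show "s = emp \<and> t = emp" using assms Dom_eq_emp by (simp add: mem_suc)
qed simp

lemma lt_neq_emp [simp]: "is_set a ==> lt a \<noteq> emp"
  by (simp add: lt_snoc)

lemma cat_self:
  assumes s: "is_seq s" and t: "is_seq t" and e: "s \<frown> t = s" shows "t = emp"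
  using t
proof (cases rule: seq_cases)
  case (2 u a)
  have "Dom s \<in>\<^sub>c Dom (s \<frown> t)" using Dom_prefix[OF s 2(1)] 2 s by (simp add: cat_snoc)
  with e show ?thesis by simp
qed

lemma cat_right_cancel:
  assumes s: "is_seq s" and u: "is_seq u" and t: "is_seq t" and eq: "s \<frown> t = u \<frown> t"
  shows "s = u"
proof -
  have "s \<frown> t = u \<frown> t --> s = u"
  proof (rule seq_induct[where Q = "\<lambda>t. catx s t = catx u t --> s = u" and P = "\<lambda>t. s \<frown> t = u \<frown> t --> s = u", OF _ _ t])
    show "dfn False (\<lambda>t. catx s (t 0) = catx u (t 0) --> s = u)"
      by (intro dfn_intros dft_const_set seq_is_set s u)
  next
    fix t a assume "is_seq t" "is_set a" and IH: "s \<frown> t = u \<frown> t --> s = u"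
    then show "s \<frown> snoc t a = u \<frown> snoc t a --> s = u"
      using snoc_inj[of "s \<frown> t" "u \<frown> t" a a] s u by (simp add: cat_snoc)
  qed (use s u in simp_all)
  with eq show ?thesis by blast
qed

text \<open>Levi's lemma. Last letters are removed from \<open>t\<close> and \<open>v\<close> in
  parallel until one of the two words is exhausted. The splitting lemmas below rest on it.\<close>

lemma levi:
  assumes s: "is_seq s" and u: "is_seq u" and t: "is_seq t" and v: "is_seq v" and eq: "s \<frown> t = u \<frown> v"
  shows "(\<exists>w. is_seq w \<and> u = s \<frown> w \<and> t = w \<frown> v) \<or> (\<exists>w. is_seq w \<and> s = u \<frown> w \<and> v = w \<frown> t)"
proof -
  let ?P = "\<lambda>t. \<forall>v. is_set v --> is_seq v --> s \<frown> t = u \<frown> v -->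
    (\<exists>w. is_set w \<and> is_seq w \<and> u = s \<frown> w \<and> t = w \<frown> v) \<or> (\<exists>w. is_set w \<and> is_seq w \<and> s = u \<frown> w \<and> v = w \<frown> t)"
  have "?P t"
  proof (rule seq_induct[where Q = "\<lambda>t. \<forall>v. is_set v --> is_seq v --> catx s t = catx u v -->
    (\<exists>w. is_set w \<and> is_seq w \<and> u = catx s w \<and> t = catx w v) \<or> (\<exists>w. is_set w \<and> is_seq w \<and> s = catx u w \<and> v = catx w t)"
    and P = ?P, OF _ _ t])
    show "dfn False (\<lambda>z. \<forall>v. is_set v --> is_seq v --> catx s (z 0) = catx u v -->
    (\<exists>w. is_set w \<and> is_seq w \<and> u = catx s w \<and> z 0 = catx w v) \<or> (\<exists>w. is_set w \<and> is_seq w \<and> s = catx u w \<and> v = catx w (z 0)))"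
      by (intro dfn_intros dft_const_set seq_is_set s u)
    show "?P emp"
    proof (intro allI impI)
      fix v assume v: "is_seq v" "s \<frown> emp = u \<frown> v"
      have "\<exists>w. is_set w \<and> is_seq w \<and> s = u \<frown> w \<and> v = w \<frown> emp"
        by (rule exI[of _ v]) (use v s seq_is_set in simp)
      then show "(\<exists>w. is_set w \<and> is_seq w \<and> u = s \<frown> w \<and> emp = w \<frown> v) \<or> (\<exists>w. is_set w \<and> is_seq w \<and> s = u \<frown> w \<and> v = w \<frown> emp)" ..
    qed
  next
    fix t a assume ta: "is_seq t" "is_set a" and IH: "?P t"
    show "?P (snoc t a)"
    proof (intro allI impI)
      fix v assume v: "is_seq v" and eq: "s \<frown> snoc t a = u \<frown> v"
      from v show "(\<exists>w. is_set w \<and> is_seq w \<and> u = s \<frown> w \<and> snoc t a = w \<frown> v) \<or> (\<exists>w. is_set w \<and> is_seq w \<and> s = u \<frown> w \<and> v = w \<frown> snoc t a)"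
      proof (cases rule: seq_cases)
        case 1
        have "\<exists>w. is_set w \<and> is_seq w \<and> u = s \<frown> w \<and> snoc t a = w \<frown> v"
          by (rule exI[of _ "snoc t a"]) (use 1 ta s u eq seq_is_set in simp)
        then show ?thesis ..
      next
        case (2 v' c)
        have "snoc (s \<frown> t) a = snoc (u \<frown> v') c" using eq 2 ta s u by (simp add: cat_snoc)
        then have e: "s \<frown> t = u \<frown> v'" "a = c" using snoc_inj[of "s \<frown> t" "u \<frown> v'" a c] 2 ta s u by simp_all
        then have "(\<exists>w. is_set w \<and> is_seq w \<and> u = s \<frown> w \<and> t = w \<frown> v') \<or> (\<exists>w. is_set w \<and> is_seq w \<and> s = u \<frown> w \<and> v' = w \<frown> t)"
          using IH 2(1) seq_is_set by blast
        then show ?thesis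
        proof
          assume "\<exists>w. is_set w \<and> is_seq w \<and> u = s \<frown> w \<and> t = w \<frown> v'"
          then obtain w where "is_set w" "is_seq w" "u = s \<frown> w" "t = w \<frown> v'" by blast
          then have "\<exists>w. is_set w \<and> is_seq w \<and> u = s \<frown> w \<and> snoc t a = w \<frown> v"
            using 2 e(2) by (intro exI[of _ w]) (simp add: cat_snoc)
          then show ?thesis ..
        next
          assume "\<exists>w. is_set w \<and> is_seq w \<and> s = u \<frown> w \<and> v' = w \<frown> t"
          then obtain w where "is_set w" "is_seq w" "s = u \<frown> w" "v' = w \<frown> t" by blast
          then have "\<exists>w. is_set w \<and> is_seq w \<and> s = u \<frown> w \<and> v = w \<frown> snoc t a"
            using 2 e(2) ta by (intro exI[of _ w]) (simp add: cat_snoc)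
          then show ?thesis ..
        qed
      qed
    qed
  qed (use s u in \<open>simp cong: conj_cong\<close>)
  then show ?thesis using v eq seq_is_set[OF v] by blast
qed

lemma cat_left_cancel:
  assumes s: "is_seq s" and t: "is_seq t" and u: "is_seq u" and eq: "s \<frown> t = s \<frown> u"
  shows "t = u"
  using levi[OF s s t u eq]
proof (elim disjE exE conjE)
  fix w assume w: "is_seq w" "s = s \<frown> w" "t = w \<frown> u"
  have "w = emp" by (rule cat_self[OF s w(1) w(2)[symmetric]])
  then show ?thesis using w u by simp
next
  fix w assume w: "is_seq w" "s = s \<frown> w" "u = w \<frown> t"
  have "w = emp" by (rule cat_self[OF s w(1) w(2)[symmetric]])
  then show ?thesis using w t by simp
qed

lemma cat_eq_lt:
  assumes u: "is_seq u" and w: "is_seq w" and a: "is_set a" and eq: "lt a = u \<frown> w" and ne: "u \<noteq> emp"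
  shows "w = emp"
  using w
proof (cases rule: seq_cases)
  case (2 v c)
  have "snoc emp a = snoc (u \<frown> v) c" using eq 2 a u by (simp add: lt_snoc cat_snoc)
  then have "emp = u \<frown> v" using snoc_inj[of emp "u \<frown> v" a c] a 2 u by simp
  then show ?thesis using ne u 2(1) by (metis cat_eq_emp)
qed

text \<open>As a simplification rule it decides equations between formulas by their leading
  symbols.\<close>

lemma cons_inj [simp]:
  assumes a: "is_set a" and b: "is_set b" and s: "is_seq s" and t: "is_seq t"
  shows "lt a \<frown> s = lt b \<frown> t \<longleftrightarrow> a = b \<and> s = t"
proof
  assume eq: "lt a \<frown> s = lt b \<frown> t"
  have sa: "is_seq (lt a)" and sb: "is_seq (lt b)" using a b by simp_all
  have lt_inj: "a = b" if "lt a = lt b"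
    using snoc_inj[of emp emp a b] that a b by (simp add: lt_snoc)
  from levi[OF sa sb s t eq] show "a = b \<and> s = t"
  proof (elim disjE exE conjE)
    fix w assume w: "is_seq w" "lt b = lt a \<frown> w" "s = w \<frown> t"
    then have "w = emp" using cat_eq_lt[OF sa w(1) b w(2)] lt_neq_emp[OF a] by blast
    then have "lt b = lt a" "s = t" using w(2,3) sa t by simp_all
    then show ?thesis using lt_inj by metis
  next
    fix w assume w: "is_seq w" "lt a = lt b \<frown> w" "t = w \<frown> s"
    then have "w = emp" using cat_eq_lt[OF sb w(1) a w(2)] lt_neq_emp[OF b] by blast
    then have "lt a = lt b" "t = s" using w(2,3) sb s by simp_all
    then show ?thesis using lt_inj by metis
  qed
qed simp

text \<open>Induction builds words at the right end; this case distinction reads them from the left,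
  as prefix notation requires.\<close>

lemma cons_cases:
  assumes s: "is_seq s"
  obtains "s = emp" | a t where "is_set a" "is_seq t" "s = lt a \<frown> t"
proof -
  have "s = emp \<or> (\<exists>a. is_set a \<and> (\<exists>t. is_set t \<and> is_seq t \<and> s = lt a \<frown> t))"
  proof (rule seq_induct[where Q = "\<lambda>s. s = emp \<or> (\<exists>a. is_set a \<and> (\<exists>t. is_set t \<and> is_seq t \<and> s = catx (lt a) t))"
    and P = "\<lambda>s. s = emp \<or> (\<exists>a. is_set a \<and> (\<exists>t. is_set t \<and> is_seq t \<and> s = lt a \<frown> t))", OF _ _ s])
    show "dfn False (\<lambda>s. s 0 = emp \<or> (\<exists>a. is_set a \<and> (\<exists>t. is_set t \<and> is_seq t \<and> s 0 = catx (lt a) t)))"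
      by (intro dfn_intros)
  next
    fix t a assume ta: "is_seq t" "is_set a" and IH: "t = emp \<or> (\<exists>a. is_set a \<and> (\<exists>u. is_set u \<and> is_seq u \<and> t = lt a \<frown> u))"
    from IH show "snoc t a = emp \<or> (\<exists>c. is_set c \<and> (\<exists>u. is_set u \<and> is_seq u \<and> snoc t a = lt c \<frown> u))"
    proof
      assume "t = emp"
      then have "snoc t a = lt a \<frown> emp" using ta by (simp add: lt_snoc)
      then show ?thesis using ta(2) is_set_emp seq_emp by blast
    next
      assume "\<exists>c. is_set c \<and> (\<exists>u. is_set u \<and> is_seq u \<and> t = lt c \<frown> u)"
      then obtain c u where "is_set c" "is_seq u" "t = lt c \<frown> u" by blast
      then have "snoc t a = lt c \<frown> snoc u a" "is_seq (snoc u a)" using ta by (simp_all add: cat_snoc)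
      then show ?thesis using \<open>is_set c\<close> seq_is_set by blast
    qed
  qed (simp_all cong: conj_cong)
  then show ?thesis using that by blast
qed

text \<open>Levi's lemma together with the observation that the border between the two factors
  cannot cut a single letter.\<close>

lemma split_lt:
  assumes s: "is_seq s" and t: "is_seq t" and a: "is_seq \<alpha>" and b: "is_seq \<beta>" and c: "is_set c"
    and eq: "s \<frown> t = \<alpha> \<frown> lt c \<frown> \<beta>"
  obtains \<gamma> where "is_seq \<gamma>" "s = \<alpha> \<frown> lt c \<frown> \<gamma>" "\<beta> = \<gamma> \<frown> t"
    | \<delta> where "is_seq \<delta>" "\<alpha> = s \<frown> \<delta>" "t = \<delta> \<frown> lt c \<frown> \<beta>"
proof -
  have cb: "is_seq (lt c \<frown> \<beta>)" using b c by simp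
  from levi[OF s a t cb eq] show ?thesis
  proof (elim disjE exE conjE)
    fix w assume w: "is_seq w" "\<alpha> = s \<frown> w" "t = w \<frown> lt c \<frown> \<beta>"
    then show ?thesis by (rule that(2))
  next
    fix w assume w: "is_seq w" "s = \<alpha> \<frown> w" "lt c \<frown> \<beta> = w \<frown> t"
    from w(1) show ?thesis
    proof (cases rule: cons_cases)
      case 1
      then have "\<alpha> = s \<frown> emp" "t = emp \<frown> lt c \<frown> \<beta>" using w s t a cb by simp_all
      then show ?thesis by (rule that(2)[OF seq_emp])
    next
      case (2 d w')
      then have "c = d \<and> \<beta> = w' \<frown> t" using w(3) c b t by simp
      then show ?thesis using that(1)[OF 2(2)] w(2) 2(3) by simp
    qed
  qed
qed

text \<open>The lengths decide which alternative of Levi's lemma holds.\<close>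

lemma prefix_compare:
  assumes a: "is_seq \<alpha>" and b: "is_seq \<beta>" and a': "is_seq \<alpha>'" and b': "is_seq \<beta>'"
    and eq: "\<alpha> \<frown> \<beta> = \<alpha>' \<frown> \<beta>'" and D: "Dom \<alpha> \<in>\<^sub>c suc (Dom \<alpha>')"
  obtains \<gamma> where "is_seq \<gamma>" "\<alpha>' = \<alpha> \<frown> \<gamma>" "\<beta> = \<gamma> \<frown> \<beta>'"
proof -
  from levi[OF a a' b b' eq] show ?thesis
  proof (elim disjE exE conjE)
    fix w assume "is_seq w" "\<alpha>' = \<alpha> \<frown> w" "\<beta> = w \<frown> \<beta>'"
    then show ?thesis by (rule that)
  next
    fix w assume w: "is_seq w" "\<alpha> = \<alpha>' \<frown> w" "\<beta>' = w \<frown> \<beta>"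
    from w(1) have "w = emp"
    proof (cases rule: cons_cases)
      case (2 c w')
      then have "Dom \<alpha>' \<in>\<^sub>c Dom \<alpha>" using Dom_prefix_lt[OF a' 2(1,2)] w(2) by simp
      then show ?thesis using D mem_asym[of "Dom \<alpha>'" "Dom \<alpha>"] mem_irrefl[of "Dom \<alpha>"] a' by (auto simp: mem_suc)
    qed
    then show ?thesis using that[OF seq_emp] w a a' b b' by simp
  qed
qed

lemma ap_position [simp]:
  assumes a: "is_seq \<alpha>" and c: "is_set c" and b: "is_seq \<beta>"
  shows "ap (\<alpha> \<frown> lt c \<frown> \<beta>) (Dom \<alpha>) = c"
proof -
  have Q: "apx (catx (catx \<alpha> (lt c)) t) (Dom \<alpha>) = ap ((\<alpha> \<frown> lt c) \<frown> t) (Dom \<alpha>)" if "is_seq t" for t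
  proof -
    have "Dom \<alpha> \<in>\<^sub>c Dom ((\<alpha> \<frown> lt c) \<frown> t)" using Dom_prefix_lt[OF a c that] a c that by simp
    then show ?thesis using ap_apx[OF seq_fun] a c that by simp
  qed
  have "ap ((\<alpha> \<frown> lt c) \<frown> \<beta>) (Dom \<alpha>) = c"
  proof (rule seq_induct[where Q = "\<lambda>\<beta>. apx (catx (catx \<alpha> (lt c)) \<beta>) (Dom \<alpha>) = c" and P = "\<lambda>\<beta>. ap ((\<alpha> \<frown> lt c) \<frown> \<beta>) (Dom \<alpha>) = c", OF _ _ b])
    show "dfn False (\<lambda>s. apx (catx (catx \<alpha> (lt c)) (s 0)) (Dom \<alpha>) = c)"
      by (intro dfn_intros dft_const_set seq_is_set a c)
    show "ap ((\<alpha> \<frown> lt c) \<frown> emp) (Dom \<alpha>) = c" using a c by (simp add: cat_lt)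
  next
    fix t d assume td: "is_seq t" "is_set d" and IH: "ap ((\<alpha> \<frown> lt c) \<frown> t) (Dom \<alpha>) = c"
    have "Dom \<alpha> \<in>\<^sub>c Dom ((\<alpha> \<frown> lt c) \<frown> t)" using Dom_prefix_lt[OF a c td(1)] a c td by simp
    then show "ap ((\<alpha> \<frown> lt c) \<frown> snoc t d) (Dom \<alpha>) = c"
      using ap_snoc[of "(\<alpha> \<frown> lt c) \<frown> t" d "Dom \<alpha>"] IH a c td cat_snoc[of "\<alpha> \<frown> lt c" t d] by simp
  qed (simp only: Q)
  then show ?thesis using a c b by simp
qed

text \<open>Translates an index into a factorization. From here on positions are mostly handled as
  factorizations \<open>\<alpha> \<frown> lt c \<frown> \<beta>\<close>, for which the laws of the
  monoid are available.\<close>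

lemma position:
  assumes s: "is_seq s" and i: "i \<in>\<^sub>c Dom s"
  obtains \<alpha> \<beta> where "is_seq \<alpha>" "is_set (ap s i)" "is_seq \<beta>" "s = \<alpha> \<frown> lt (ap s i) \<frown> \<beta>" "Dom \<alpha> = i"
proof -
  let ?P = "\<lambda>s. \<forall>i. i \<in>\<^sub>c Dom s --> (\<exists>\<alpha>. is_set \<alpha> \<and> is_seq \<alpha> \<and> (\<exists>c. is_set c \<and> (\<exists>\<beta>. is_set \<beta> \<and> is_seq \<beta> \<and> s = \<alpha> \<frown> lt c \<frown> \<beta> \<and> Dom \<alpha> = i)))"
  have "?P s"
  proof (rule seq_induct[where Q = "\<lambda>s. \<forall>i. i \<in>\<^sub>c Dom s --> (\<exists>\<alpha>. is_set \<alpha> \<and> is_seq \<alpha> \<and> (\<exists>c. is_set c \<and> (\<exists>\<beta>. is_set \<beta> \<and> is_seq \<beta> \<and> s = catx \<alpha> (catx (lt c) \<beta>) \<and> Dom \<alpha> = i)))"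
      and P = ?P, OF _ _ s])
    show "dfn False (\<lambda>s. \<forall>i. i \<in>\<^sub>c Dom (s 0) --> (\<exists>\<alpha>. is_set \<alpha> \<and> is_seq \<alpha> \<and> (\<exists>c. is_set c \<and> (\<exists>\<beta>. is_set \<beta> \<and> is_seq \<beta> \<and> s 0 = catx \<alpha> (catx (lt c) \<beta>) \<and> Dom \<alpha> = i))))"
      by (intro dfn_intros)
  next
    fix t a assume ta: "is_seq t" "is_set a" and IH: "?P t"
    show "?P (snoc t a)"
    proof (intro allI impI)
      fix i assume "i \<in>\<^sub>c Dom (snoc t a)"
      then consider "i \<in>\<^sub>c Dom t" | "i = Dom t" using ta by (auto simp: mem_suc)
      then show "\<exists>\<alpha>. is_set \<alpha> \<and> is_seq \<alpha> \<and> (\<exists>c. is_set c \<and> (\<exists>\<beta>. is_set \<beta> \<and> is_seq \<beta> \<and> snoc t a = \<alpha> \<frown> lt c \<frown> \<beta> \<and> Dom \<alpha> = i))"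
      proof cases
        case 1
        then obtain \<alpha> c \<beta> where "is_set \<alpha>" "is_seq \<alpha>" "is_set c" "is_seq \<beta>" "t = \<alpha> \<frown> lt c \<frown> \<beta>" "Dom \<alpha> = i" using IH by blast
        moreover from this have "snoc t a = \<alpha> \<frown> lt c \<frown> snoc \<beta> a" "is_seq (snoc \<beta> a)" using ta by (simp_all add: cat_snoc)
        ultimately show ?thesis using seq_is_set by blast
      next
        case 2
        have "snoc t a = t \<frown> lt a \<frown> emp" using ta by (simp add: cat_lt)
        then show ?thesis using 2 ta seq_is_set is_set_emp seq_emp by blast
      qed
    qed
  qed (simp_all cong: conj_cong)
  then obtain \<alpha> c \<beta> where *: "is_seq \<alpha>" "is_set c" "is_seq \<beta>" "s = \<alpha> \<frown> lt c \<frown> \<beta>" "Dom \<alpha> = i" using i by blast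
  then have "ap s i = c" by auto
  then show ?thesis using that * by simp
qed

lemma prefix_eq:
  assumes "is_seq \<alpha>" "is_seq \<beta>" "is_seq \<alpha>'" "is_seq \<beta>'" "\<alpha> \<frown> \<beta> = \<alpha>' \<frown> \<beta>'" "Dom \<alpha> = Dom \<alpha>'"
  shows "\<alpha> = \<alpha>' \<and> \<beta> = \<beta>'"
proof -
  have "Dom \<alpha> \<in>\<^sub>c suc (Dom \<alpha>')" using assms by (simp add: mem_suc)
  from prefix_compare[OF assms(1-5) this] obtain \<gamma> where g: "is_seq \<gamma>" "\<alpha>' = \<alpha> \<frown> \<gamma>" "\<beta> = \<gamma> \<frown> \<beta>'" .
  from g(1) have "\<gamma> = emp"
  proof (cases rule: cons_cases)
    case (2 c w)
    then show ?thesis using Dom_prefix_lt[OF assms(1) 2(1,2)] g(2) assms(6) by simp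
  qed
  then show ?thesis using g assms by simp
qed

definition occ :: "'a \<Rightarrow> 'a \<Rightarrow> bool" where
  "occ c s \<longleftrightarrow> (\<exists>\<alpha> \<beta>. is_seq \<alpha> \<and> is_seq \<beta> \<and> s = \<alpha> \<frown> lt c \<frown> \<beta>)"

lemma occI: "is_seq \<alpha> ==> is_seq \<beta> ==> s = \<alpha> \<frown> lt c \<frown> \<beta> ==> occ c s"
  unfolding occ_def by blast

lemma occ_cat [simp]:
  assumes s: "is_seq s" and t: "is_seq t" and c: "is_set c"
  shows "occ c (s \<frown> t) \<longleftrightarrow> occ c s \<or> occ c t"
proof
  assume "occ c (s \<frown> t)"
  then obtain \<alpha> \<beta> where ab: "is_seq \<alpha>" "is_seq \<beta>" "s \<frown> t = \<alpha> \<frown> lt c \<frown> \<beta>" unfolding occ_def by blast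
  from s t ab(1,2) c ab(3) show "occ c s \<or> occ c t"
    by (rule split_lt) (rule disjI1, erule (1) occI[OF ab(1)], rule disjI2, erule occI[OF _ ab(2)], assumption)
next
  assume "occ c s \<or> occ c t"
  then show "occ c (s \<frown> t)"
  proof
    assume "occ c s"
    then obtain \<alpha> \<beta> where ab: "is_seq \<alpha>" "is_seq \<beta>" "s = \<alpha> \<frown> lt c \<frown> \<beta>" unfolding occ_def by blast
    then have "s \<frown> t = \<alpha> \<frown> lt c \<frown> (\<beta> \<frown> t)" "is_seq (\<beta> \<frown> t)" using t c by simp_all
    then show ?thesis unfolding occ_def using ab(1) by blast
  next
    assume "occ c t"
    then obtain \<alpha> \<beta> where ab: "is_seq \<alpha>" "is_seq \<beta>" "t = \<alpha> \<frown> lt c \<frown> \<beta>" unfolding occ_def by blast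
    then have "s \<frown> t = (s \<frown> \<alpha>) \<frown> lt c \<frown> \<beta>" "is_seq (s \<frown> \<alpha>)" using s c by simp_all
    then show ?thesis unfolding occ_def using ab(2) by blast
  qed
qed

lemma occ_lt [simp]:
  assumes c: "is_set c" and a: "is_set a" shows "occ c (lt a) \<longleftrightarrow> c = a"
proof
  assume "occ c (lt a)"
  then obtain \<alpha> \<beta> where ab: "is_seq \<alpha>" "is_seq \<beta>" "lt a = \<alpha> \<frown> lt c \<frown> \<beta>" unfolding occ_def by blast
  have "\<alpha> = emp"
  proof (rule ccontr)
    assume "\<alpha> \<noteq> emp"
    from cat_eq_lt[OF ab(1) _ a ab(3) this] show False using ab c by simp
  qed
  then have "lt a \<frown> emp = lt c \<frown> \<beta>" using ab a c by simp
  then show "c = a" using a c ab(2) by (simp del: cat_emp)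
next
  assume "c = a"
  then have "lt a = emp \<frown> lt c \<frown> emp" using a by simp
  then show "occ c (lt a)" unfolding occ_def using seq_emp by blast
qed

lemma occ_ap:
  assumes s: "is_seq s" and c: "is_set c" shows "occ c s \<longleftrightarrow> (\<exists>i. i \<in>\<^sub>c Dom s \<and> ap s i = c)"
proof
  assume "occ c s"
  then obtain \<alpha> \<beta> where ab: "is_seq \<alpha>" "is_seq \<beta>" "s = \<alpha> \<frown> lt c \<frown> \<beta>" unfolding occ_def by blast
  then show "\<exists>i. i \<in>\<^sub>c Dom s \<and> ap s i = c"
    using Dom_prefix_lt[OF ab(1) c ab(2)] ap_position[OF ab(1) c ab(2)] by blast
next
  assume "\<exists>i. i \<in>\<^sub>c Dom s \<and> ap s i = c"
  then obtain i where i: "i \<in>\<^sub>c Dom s" "ap s i = c" by blast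
  from s i(1) show "occ c s" by (rule position) (use i(2) in \<open>unfold occ_def, blast\<close>)
qed

lemma word_Cons: "word (a # as) = lt a \<frown> word as"
  by (simp add: lt_def)


subsection \<open>Symbols\<close>

lemma num_set [simp]: "is_set (num k)" by (induction k) simp_all

lemma num_mem: "i < j ==> num i \<in>\<^sub>c num j"
proof (induction j)
  case (Suc j)
  then show ?case by (cases "i = j") (simp_all add: mem_suc)
qed simp

lemma num_eq [simp]: "num i = num j \<longleftrightarrow> i = j"
  using num_mem[of i j] num_mem[of j i] mem_irrefl[of "num j"] by (cases i j rule: linorder_cases) auto

lemma sym_set [simp]: "is_set (sym_code k)" by (simp add: sym_code_def)

lemma sym_eq [simp]: "sym_code i = sym_code j \<longleftrightarrow> i = j"
  unfolding sym_code_def by (subst pair_eq_iff) (simp_all del: num.simps)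

lemma var_set [simp]: "is_set (var n)" by (simp add: var_def)
lemma par_set [simp]: "is_set (par x)" by (simp add: par_def)

lemma var_eq [simp]: "is_set m ==> is_set n ==> var m = var n \<longleftrightarrow> m = n"
  unfolding var_def by (subst pair_eq_iff) (simp_all del: num.simps)

lemma par_eq [simp]: "is_set m ==> is_set n ==> par m = par n \<longleftrightarrow> m = n"
  unfolding par_def by (subst pair_eq_iff) (simp_all del: num.simps)

lemma is_var_set: "is_var v ==> is_set v" by (auto simp: is_var_def)
lemma is_term_set: "is_term a ==> is_set a" by (auto simp: is_term_def is_var_set)

lemma var_neq: "is_set n ==> var n \<noteq> sym_code k" "is_set n ==> is_set x ==> var n \<noteq> par x"
  "is_set x ==> par x \<noteq> sym_code k"
  unfolding var_def par_def sym_code_def by (subst pair_eq_iff; simp del: num.simps)+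

lemma is_var_neq: 
  assumes "is_var v" shows "v \<noteq> sym_code k" "sym_code k \<noteq> v" "is_set x ==> v \<noteq> par x" "is_set x ==> par x \<noteq> v"
proof -
  obtain n where "is_nat n" "v = var n" using assms unfolding is_var_def by blast
  then show "v \<noteq> sym_code k" "sym_code k \<noteq> v" "is_set x ==> v \<noteq> par x" "is_set x ==> par x \<noteq> v"
    using var_neq nat_is_set by metis+
qed

lemma is_term_neq: "is_term a ==> a \<noteq> sym_code k" "is_term a ==> sym_code k \<noteq> a"
  unfolding is_term_def using is_var_neq var_neq(3) by metis+

lemma par_neq_sym [simp]: "is_set x ==> par x \<noteq> sym_code k" "is_set x ==> sym_code k \<noteq> par x"
  using var_neq(3) by metis+

lemma is_term_var: "is_var v ==> is_term v" by (simp add: is_term_def)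
lemma is_term_par: "is_set x ==> is_term (par x)" by (auto simp: is_term_def)

lemma dft_num [dfn_intros]: "dft b (\<lambda>s. num k)" by (rule dft_const_set) simp
lemma dft_sym [dfn_intros]: "dft b (\<lambda>s. sym_code k)" by (rule dft_const_set) simp
lemma dft_par [dfn_intros]: "dft b t ==> dft b (\<lambda>s. par (t s))" unfolding par_def by (intro dfn_intros)

lemma dfn_is_var [dfn_intros]: "dft b t ==> dfn b (\<lambda>s. is_var (t s))"
proof (rule dfn_comp1[where P = is_var])
  have "is_var v \<longleftrightarrow> (\<exists>n. is_set n \<and> (is_nat n \<and> v = pair (num 1) n))" for v
    unfolding is_var_def var_def using nat_is_set by blast
  then show "dfn b (\<lambda>s. is_var (s 0))" by (simp only:) (intro dfn_intros)
qed

lemma dfn_is_term [dfn_intros]: "dft b t ==> dfn b (\<lambda>s. is_term (t s))"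
  by (rule dfn_comp1[where P = is_term]) (unfold is_term_def, intro dfn_intros)


subsection \<open>Formal formulas\<close>

lemma fEq_word: "is_set a ==> is_set b ==> fEq a b = lt (sym_code 0) \<frown> lt a \<frown> lt b"
  by (simp add: fEq_def word_Cons del: word.simps(2))

lemma fMem_word: "is_set a ==> is_set b ==> fMem a b = lt (sym_code 1) \<frown> lt a \<frown> lt b"
  by (simp add: fMem_def word_Cons del: word.simps(2))

lemma fNeg_word: "is_seq \<phi> ==> fNeg \<phi> = lt (sym_code 2) \<frown> \<phi>"
  by (simp add: fNeg_def word_Cons del: word.simps(2))

lemma fOr_word: "is_seq \<phi> ==> is_seq \<psi> ==> fOr \<phi> \<psi> = lt (sym_code 3) \<frown> \<phi> \<frown> \<psi>"
  by (simp add: fOr_def word_Cons del: word.simps(2))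

lemma fEx_word: "is_set v ==> is_seq \<phi> ==> fEx v \<phi> = lt (sym_code 4) \<frown> lt v \<frown> \<phi>"
  by (simp add: fEx_def word_Cons del: word.simps(2))

lemma seq_formulas [simp]:
  "is_set a ==> is_set b ==> is_seq (fEq a b)" "is_set a ==> is_set b ==> is_seq (fMem a b)"
  "is_seq \<phi> ==> is_seq (fNeg \<phi>)" "is_seq \<phi> ==> is_seq \<psi> ==> is_seq (fOr \<phi> \<psi>)"
  "is_set v ==> is_seq \<phi> ==> is_seq (fEx v \<phi>)"
  by (simp_all add: fEq_word fMem_word fNeg_word fOr_word fEx_word)

text \<open>Total versions of the formula constructors, whose value is a word at every
  argument.\<close>

definition xEq where "xEq a b = catx (lt (sym_code 0)) (catx (lt a) (lt b))"
definition xMem where "xMem a b = catx (lt (sym_code 1)) (catx (lt a) (lt b))"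
definition xNeg where "xNeg \<phi> = catx (lt (sym_code 2)) \<phi>"
definition xOr where "xOr \<phi> \<psi> = catx (lt (sym_code 3)) (catx \<phi> \<psi>)"
definition xEx where "xEx v \<phi> = catx (lt (sym_code 4)) (catx (lt v) \<phi>)"

lemmas x_defs = xEq_def xMem_def xNeg_def xOr_def xEx_def

lemma x_eq [simp]:
  "is_set a ==> is_set b ==> xEq a b = fEq a b" "is_set a ==> is_set b ==> xMem a b = fMem a b"
  "is_seq \<phi> ==> xNeg \<phi> = fNeg \<phi>" "is_seq \<phi> ==> is_seq \<psi> ==> xOr \<phi> \<psi> = fOr \<phi> \<psi>"
  "is_set v ==> is_seq \<phi> ==> xEx v \<phi> = fEx v \<phi>"
  by (simp_all add: x_defs fEq_word fMem_word fNeg_word fOr_word fEx_word)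

lemma seq_x [simp]: "is_seq (xEq a b)" "is_seq (xMem a b)" "is_seq (xNeg \<phi>)" "is_seq (xOr \<phi> \<psi>)" "is_seq (xEx v \<phi>)"
  by (simp_all add: x_defs)

lemma dft_x [dfn_intros]:
  assumes t: "dft b t"
  shows "dft b (\<lambda>s. xNeg (t s))"
    and "dft b u ==> dft b (\<lambda>s. xEq (t s) (u s))"
    and "dft b u ==> dft b (\<lambda>s. xMem (t s) (u s))"
    and "dft b u ==> dft b (\<lambda>s. xOr (t s) (u s))"
    and "dft b u ==> dft b (\<lambda>s. xEx (t s) (u s))"
  unfolding x_defs by (intro dfn_intros t; assumption)+

text \<open>The condition on a single entry of a formation sequence, isolated so that it can be
  transported between sequences.\<close>

definition formed :: "'a \<Rightarrow> 'a \<Rightarrow> 'a \<Rightarrow> bool" where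
  "formed f i \<theta> \<longleftrightarrow>
     (\<exists>a b. is_term a \<and> is_term b \<and> (\<theta> = fEq a b \<or> \<theta> = fMem a b)) \<or>
     (\<exists>j. j \<in>\<^sub>c i \<and> \<theta> = fNeg (ap f j)) \<or>
     (\<exists>j k. j \<in>\<^sub>c i \<and> k \<in>\<^sub>c i \<and> \<theta> = fOr (ap f j) (ap f k)) \<or>
     (\<exists>v j. is_var v \<and> j \<in>\<^sub>c i \<and> \<theta> = fEx v (ap f j))"

lemma formation_seq_formed:
  "formation_seq f \<longleftrightarrow> is_seq f \<and> (\<forall>i. i \<in>\<^sub>c Dom f --> formed f i (ap f i))"
  unfolding formation_seq_def formed_def ..

definition formedx :: "'a \<Rightarrow> 'a \<Rightarrow> 'a \<Rightarrow> bool" where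
  "formedx f i \<theta> \<longleftrightarrow>
     (\<exists>a. is_set a \<and> (\<exists>b. is_set b \<and> is_term a \<and> is_term b \<and> (\<theta> = xEq a b \<or> \<theta> = xMem a b))) \<or>
     (\<exists>j. j \<in>\<^sub>c i \<and> \<theta> = xNeg (apx f j)) \<or>
     (\<exists>j. j \<in>\<^sub>c i \<and> (\<exists>k. k \<in>\<^sub>c i \<and> \<theta> = xOr (apx f j) (apx f k))) \<or>
     (\<exists>v. is_set v \<and> is_var v \<and> (\<exists>j. j \<in>\<^sub>c i \<and> \<theta> = xEx v (apx f j)))"

lemma formed_seq:
  assumes "formed f i \<theta>" "\<And>j. j \<in>\<^sub>c i ==> is_seq (ap f j)" shows "is_seq \<theta>"
  using assms unfolding formed_def by (auto simp: is_term_set is_var_set)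

lemma formedx_seq: "formedx f i \<theta> ==> is_seq \<theta>"
  unfolding formedx_def by auto

lemma formed_iff_formedx:
  assumes f: "\<And>j. j \<in>\<^sub>c i ==> is_seq (ap f j) \<and> apx f j = ap f j"
  shows "formed f i \<theta> \<longleftrightarrow> formedx f i \<theta>"
proof -
  have 1: "(\<exists>a b. is_term a \<and> is_term b \<and> (\<theta> = fEq a b \<or> \<theta> = fMem a b)) \<longleftrightarrow>
    (\<exists>a. is_set a \<and> (\<exists>b. is_set b \<and> is_term a \<and> is_term b \<and> (\<theta> = xEq a b \<or> \<theta> = xMem a b)))"
    using is_term_set by (metis x_eq(1,2))
  have 2: "(\<exists>j. j \<in>\<^sub>c i \<and> \<theta> = fNeg (ap f j)) \<longleftrightarrow> (\<exists>j. j \<in>\<^sub>c i \<and> \<theta> = xNeg (apx f j))"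
    using f by (simp cong: conj_cong)
  have 3: "(\<exists>j k. j \<in>\<^sub>c i \<and> k \<in>\<^sub>c i \<and> \<theta> = fOr (ap f j) (ap f k)) \<longleftrightarrow>
    (\<exists>j. j \<in>\<^sub>c i \<and> (\<exists>k. k \<in>\<^sub>c i \<and> \<theta> = xOr (apx f j) (apx f k)))"
    using f by (simp cong: conj_cong) 
  have 4: "(\<exists>v j. is_var v \<and> j \<in>\<^sub>c i \<and> \<theta> = fEx v (ap f j)) \<longleftrightarrow>
    (\<exists>v. is_set v \<and> is_var v \<and> (\<exists>j. j \<in>\<^sub>c i \<and> \<theta> = xEx v (apx f j)))"
    using f is_var_set by (metis x_eq(5))
  show ?thesis unfolding formed_def formedx_def 1 2 3 4 ..
qed

text \<open>A constructor is known to yield a word only if its arguments are words, so strong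
  induction along the positions is required. Only afterwards can the total constructors replace the
  original ones.\<close>

lemma formation_seq_entries:
  assumes f: "formation_seq f" and i: "i \<in>\<^sub>c Dom f" shows "is_seq (ap f i)"
proof -
  have fs: "is_seq f" using f by (simp add: formation_seq_formed)
  have ax: "apx f i = ap f i" if "i \<in>\<^sub>c Dom f" for i using ap_apx[OF seq_fun[OF fs] that] ..
  have "i \<in>\<^sub>c Dom f --> is_seq (apx f i)"
  proof (rule nat_strong_induct[of False _ i])
    show "dfn False (\<lambda>s. s 0 \<in>\<^sub>c Dom f --> is_seq (apx f (s 0)))"
      by (intro dfn_intros dft_const_set seq_is_set fs)
    show "is_nat i" using nat_mem[OF seq_Dom[OF fs] i] .
  next
    fix m assume IH: "\<And>k. k \<in>\<^sub>c m ==> k \<in>\<^sub>c Dom f --> is_seq (apx f k)"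
    show "m \<in>\<^sub>c Dom f --> is_seq (apx f m)"
    proof
      assume m: "m \<in>\<^sub>c Dom f"
      have "is_seq (ap f k)" if "k \<in>\<^sub>c m" for k
        using IH[OF that] nat_trans[OF seq_Dom[OF fs] m that] ax by simp
      moreover have "formed f m (ap f m)" using f m by (simp add: formation_seq_formed)
      ultimately show "is_seq (apx f m)" unfolding ax[OF m] by (rule_tac formed_seq)
    qed
  qed simp
  then show ?thesis using i ax by simp
qed

lemma formation_seq_iff:
  "formation_seq f \<longleftrightarrow> is_seq f \<and> (\<forall>i. i \<in>\<^sub>c Dom f --> formedx f i (apx f i))"
proof (cases "is_seq f")
  case True
  have ax: "apx f i = ap f i" if "i \<in>\<^sub>c Dom f" for i using ap_apx[OF seq_fun[OF True] that] ..
  have tr: "j \<in>\<^sub>c Dom f" if "i \<in>\<^sub>c Dom f" "j \<in>\<^sub>c i" for i j using nat_trans[OF seq_Dom[OF True]] that by blast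
  show ?thesis
  proof
    assume f: "formation_seq f"
    have "formedx f i (apx f i)" if i: "i \<in>\<^sub>c Dom f" for i
    proof -
      have "formed f i (ap f i)" using f i by (simp add: formation_seq_formed)
      moreover have "is_seq (ap f j) \<and> apx f j = ap f j" if "j \<in>\<^sub>c i" for j
        using formation_seq_entries[OF f] tr[OF i that] ax by blast
      ultimately show ?thesis unfolding ax[OF i] using formed_iff_formedx by metis
    qed
    with True show "is_seq f \<and> (\<forall>i. i \<in>\<^sub>c Dom f --> formedx f i (apx f i))" by blast
  next
    assume f: "is_seq f \<and> (\<forall>i. i \<in>\<^sub>c Dom f --> formedx f i (apx f i))"
    then have s: "is_seq (ap f i)" if "i \<in>\<^sub>c Dom f" for i using formedx_seq ax that by metis
    have "formed f i (ap f i)" if i: "i \<in>\<^sub>c Dom f" for i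
    proof -
      have "formedx f i (ap f i)" using f i ax by metis
      moreover have "is_seq (ap f j) \<and> apx f j = ap f j" if "j \<in>\<^sub>c i" for j
        using s tr[OF i that] ax by blast
      ultimately show ?thesis using formed_iff_formedx by metis
    qed
    then show "formation_seq f" using True by (simp add: formation_seq_formed)
  qed
qed (simp add: formation_seq_formed)

lemma dfn_formation_seq [dfn_intros]: "dft b t ==> dfn b (\<lambda>s. formation_seq (t s))"
  by (rule dfn_comp1[where P = formation_seq]) (unfold formation_seq_iff formedx_def, intro dfn_intros)

lemma dfn_formal_formula [dfn_intros]: "dft b t ==> dfn b (\<lambda>s. formal_formula (t s))"
proof (rule dfn_comp1[where P = formal_formula])
  have "formal_formula \<theta> \<longleftrightarrow> (\<exists>f. is_set f \<and> formation_seq f \<and> (\<exists>i. i \<in>\<^sub>c Dom f \<and> \<theta> = apx f i))" for \<theta>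
    unfolding formal_formula_def formation_seq_formed using seq_is_set seq_fun ap_apx by metis
  then show "dfn b (\<lambda>s. formal_formula (s 0))" by (simp only:) (intro dfn_intros)
qed

lemma ff_seq: "formal_formula \<theta> ==> is_seq \<theta>"
  unfolding formal_formula_def using formation_seq_entries by blast

lemma ff_set: "formal_formula \<theta> ==> is_set \<theta>"
  using ff_seq seq_is_set by blast

lemma ff_inv:
  assumes "formal_formula \<theta>"
  shows "(\<exists>a b. is_term a \<and> is_term b \<and> (\<theta> = fEq a b \<or> \<theta> = fMem a b)) \<or>
     (\<exists>\<phi>. formal_formula \<phi> \<and> \<theta> = fNeg \<phi>) \<or>
     (\<exists>\<phi> \<psi>. formal_formula \<phi> \<and> formal_formula \<psi> \<and> \<theta> = fOr \<phi> \<psi>) \<or>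
     (\<exists>v \<phi>. is_var v \<and> formal_formula \<phi> \<and> \<theta> = fEx v \<phi>)"
proof -
  obtain f i where f: "formation_seq f" "i \<in>\<^sub>c Dom f" "\<theta> = ap f i" using assms formal_formula_def by metis
  then have F: "formed f i \<theta>" by (simp add: formation_seq_formed)
  have ff: "formal_formula (ap f j)" if "j \<in>\<^sub>c i" for j
    unfolding formal_formula_def using f nat_trans[OF seq_Dom _ that] formation_seq_formed by metis
  from F consider (A) "\<exists>a b. is_term a \<and> is_term b \<and> (\<theta> = fEq a b \<or> \<theta> = fMem a b)"
    | (N) j where "j \<in>\<^sub>c i" "\<theta> = fNeg (ap f j)"
    | (O) j k where "j \<in>\<^sub>c i" "k \<in>\<^sub>c i" "\<theta> = fOr (ap f j) (ap f k)"
    | (E) v j where "is_var v" "j \<in>\<^sub>c i" "\<theta> = fEx v (ap f j)"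
    unfolding formed_def by metis
  then show ?thesis
  proof cases
    case A
    then show ?thesis ..
  next
    case N
    have "\<exists>\<phi>. formal_formula \<phi> \<and> \<theta> = fNeg \<phi>" using ff[OF N(1)] N(2) by (intro exI conjI)
    then show ?thesis by simp
  next
    case O
    have "\<exists>\<phi> \<psi>. formal_formula \<phi> \<and> formal_formula \<psi> \<and> \<theta> = fOr \<phi> \<psi>"
      using ff[OF O(1)] ff[OF O(2)] O(3) by (intro exI conjI)
    then show ?thesis by simp
  next
    case E
    have "\<exists>v \<phi>. is_var v \<and> formal_formula \<phi> \<and> \<theta> = fEx v \<phi>" using E(1) ff[OF E(2)] E(3) by (intro exI conjI)
    then show ?thesis by simp
  qed
qed

lemma ff_cases:
  assumes "formal_formula \<theta>"
  obtains a b where "is_term a" "is_term b" "\<theta> = fEq a b" | a b where "is_term a" "is_term b" "\<theta> = fMem a b"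
    | \<phi> where "formal_formula \<phi>" "\<theta> = fNeg \<phi>" | \<phi> \<psi> where "formal_formula \<phi>" "formal_formula \<psi>" "\<theta> = fOr \<phi> \<psi>"
    | v \<phi> where "is_var v" "formal_formula \<phi>" "\<theta> = fEx v \<phi>"
  using ff_inv[OF assms] by metis

text \<open>The map \<open>g\<close> of positions is the identity when a sequence is extended, and
  the shift when it is the second factor of a concatenation.\<close>

lemma formed_mono:
  assumes "formed f i \<theta>" "\<And>j. j \<in>\<^sub>c i ==> g j \<in>\<^sub>c i' \<and> ap f' (g j) = ap f j"
  shows "formed f' i' \<theta>"
  using assms unfolding formed_def by metis

lemma formation_snoc:
  assumes f: "formation_seq f" and \<theta>: "formed f (Dom f) \<theta>"
  shows "formation_seq (snoc f \<theta>)" and "formal_formula \<theta>"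
proof -
  have fs: "is_seq f" using f by (simp add: formation_seq_formed)
  have ts: "is_set \<theta>" using formed_seq[OF \<theta>] formation_seq_entries[OF f] seq_is_set by blast
  note a = ap_snoc[OF fs ts]
  show *: "formation_seq (snoc f \<theta>)" unfolding formation_seq_formed
  proof (intro conjI allI impI)
    fix i assume "i \<in>\<^sub>c Dom (snoc f \<theta>)"
    then consider "i \<in>\<^sub>c Dom f" | "i = Dom f" using fs ts by (auto simp: mem_suc)
    then show "formed (snoc f \<theta>) i (ap (snoc f \<theta>) i)"
    proof cases
      case 1
      then have "formed f i (ap f i)" using f by (simp add: formation_seq_formed)
      then show ?thesis unfolding a[OF 1]
        by (rule formed_mono[where g = "\<lambda>j. j"]) (use a nat_trans[OF seq_Dom[OF fs] 1] in blast)
    next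
      case 2
      have "formed (snoc f \<theta>) (Dom f) \<theta>"
        by (rule formed_mono[OF \<theta>, where g = "\<lambda>j. j"]) (use a in blast)
      then show ?thesis using 2 fs ts by simp
    qed
  qed (use fs ts in simp)
  show "formal_formula \<theta>" unfolding formal_formula_def
    using * Dom_snoc[OF fs ts] ap_snoc_last[OF fs ts] mem_suc[OF Dom_set[OF fs]] by metis
qed

text \<open>The shift supplied by concatenation preserves order, so references of the second
  sequence to earlier entries still point backwards. This serves to form disjunctions of separately
  given formulas.\<close>

lemma formation_cat:
  assumes f: "formation_seq f" and g: "formation_seq g"
  shows "formation_seq (f \<frown> g) \<and> (\<forall>i. i \<in>\<^sub>c Dom f --> i \<in>\<^sub>c Dom (f \<frown> g) \<and> ap (f \<frown> g) i = ap f i) \<and>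
    (\<forall>i. i \<in>\<^sub>c Dom g --> (\<exists>k. k \<in>\<^sub>c Dom (f \<frown> g) \<and> ap (f \<frown> g) k = ap g i))"
proof -
  have fs: "is_seq f" and gs: "is_seq g" using f g by (simp_all add: formation_seq_formed)
  have c: "is_cat f g (f \<frown> g)" using is_cat_iff[OF fs gs] by blast
  have rs: "is_seq (f \<frown> g)" using fs gs by simp
  obtain h where h1: "\<And>k. k \<in>\<^sub>c Dom (f \<frown> g) \<and> \<not> k \<in>\<^sub>c Dom f \<longleftrightarrow> (\<exists>i. i \<in>\<^sub>c Dom g \<and> k = ap h i)"
    and h2: "\<And>i j. i \<in>\<^sub>c Dom g ==> j \<in>\<^sub>c Dom g ==> i \<in>\<^sub>c j \<longleftrightarrow> ap h i \<in>\<^sub>c ap h j"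
    and h3: "\<And>i. i \<in>\<^sub>c Dom g ==> ap (f \<frown> g) (ap h i) = ap g i"
    using c unfolding is_cat_def cat_map_def by blast
  have sub: "f \<subseteq>\<^sub>c f \<frown> g" using c by (simp add: is_cat_def)
  have F: "i \<in>\<^sub>c Dom (f \<frown> g) \<and> ap (f \<frown> g) i = ap f i" if "i \<in>\<^sub>c Dom f" for i
  proof -
    have "related f i (ap f i)" by (rule related_ap[OF seq_fun[OF fs] that])
    then have "related (f \<frown> g) i (ap f i)" using sub unfolding related_def subcls_def by blast
    then show ?thesis using related_iff[OF seq_fun[OF rs]] by simp
  qed
  have "formed (f \<frown> g) k (ap (f \<frown> g) k)" if k: "k \<in>\<^sub>c Dom (f \<frown> g)" for k
  proof (cases "k \<in>\<^sub>c Dom f")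
    case True
    then have "formed f k (ap f k)" using f by (simp add: formation_seq_formed)
    then have "formed (f \<frown> g) k (ap f k)"
      by (rule formed_mono[where g = "\<lambda>j. j"]) (use F nat_trans[OF seq_Dom[OF fs] True] in blast)
    then show ?thesis using F[OF True] by simp
  next
    case False
    then obtain i where i: "i \<in>\<^sub>c Dom g" "k = ap h i" using h1[of k] k by auto
    then have "formed g i (ap g i)" using g by (simp add: formation_seq_formed)
    then have "formed (f \<frown> g) k (ap g i)"
      by (rule formed_mono[where g = "ap h"]) (use h2 h3 i nat_trans[OF seq_Dom[OF gs] i(1)] in blast)
    then show ?thesis using h3[OF i(1)] i(2) by simp
  qed
  then have "formation_seq (f \<frown> g)" using rs by (simp add: formation_seq_formed)
  moreover have "\<exists>k. k \<in>\<^sub>c Dom (f \<frown> g) \<and> ap (f \<frown> g) k = ap g i" if "i \<in>\<^sub>c Dom g" for i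
    using h1[of "ap h i"] h3[OF that] that by blast
  ultimately show ?thesis using F by blast
qed

lemma ff_atom:
  assumes "is_term a" "is_term b" shows "formal_formula (fEq a b)" "formal_formula (fMem a b)"
proof -
  have "formation_seq emp" by (simp add: formation_seq_formed)
  from formation_snoc(2)[OF this] show "formal_formula (fEq a b)" "formal_formula (fMem a b)"
    using assms unfolding formed_def by metis+
qed

lemma ff_Neg: "formal_formula \<phi> ==> formal_formula (fNeg \<phi>)"
proof -
  assume "formal_formula \<phi>"
  then obtain f i where f: "formation_seq f" "i \<in>\<^sub>c Dom f" "\<phi> = ap f i" using formal_formula_def by metis
  from f(1) show ?thesis by (rule formation_snoc(2)) (use f in \<open>unfold formed_def, metis\<close>)
qed

lemma ff_Ex: "is_var v ==> formal_formula \<phi> ==> formal_formula (fEx v \<phi>)"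
proof -
  assume v: "is_var v" and "formal_formula \<phi>"
  then obtain f i where f: "formation_seq f" "i \<in>\<^sub>c Dom f" "\<phi> = ap f i" using formal_formula_def by metis
  from f(1) show ?thesis by (rule formation_snoc(2)) (use f v in \<open>unfold formed_def, metis\<close>)
qed

lemma ff_Or: "formal_formula \<phi> ==> formal_formula \<psi> ==> formal_formula (fOr \<phi> \<psi>)"
proof -
  assume "formal_formula \<phi>" "formal_formula \<psi>"
  then obtain f i g j where f: "formation_seq f" "i \<in>\<^sub>c Dom f" "\<phi> = ap f i"
    and g: "formation_seq g" "j \<in>\<^sub>c Dom g" "\<psi> = ap g j" using formal_formula_def by metis
  note c = formation_cat[OF f(1) g(1)]
  obtain k where k: "k \<in>\<^sub>c Dom (f \<frown> g)" "ap (f \<frown> g) k = \<psi>" using c g by metis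
  have "i \<in>\<^sub>c Dom (f \<frown> g)" "ap (f \<frown> g) i = \<phi>" using c f by metis+
  with k have "formed (f \<frown> g) (Dom (f \<frown> g)) (fOr \<phi> \<psi>)" unfolding formed_def by metis
  with conjunct1[OF c] show ?thesis by (rule formation_snoc(2))
qed

lemma Dom_sub:
  assumes "is_seq \<phi>"
  shows "Dom \<phi> \<in>\<^sub>c Dom (fNeg \<phi>)" "is_seq \<psi> ==> Dom \<phi> \<in>\<^sub>c Dom (fOr \<phi> \<psi>)"
    "is_seq \<psi> ==> Dom \<phi> \<in>\<^sub>c Dom (fOr \<psi> \<phi>)" "is_set v ==> Dom \<phi> \<in>\<^sub>c Dom (fEx v \<phi>)"
proof -
  have tr: "i \<in>\<^sub>c Dom w" if "i \<in>\<^sub>c suc j" "j \<in>\<^sub>c Dom w" "is_seq w" for i j w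
    using nat_trans[OF seq_Dom[OF that(3)] that(2)] that mem_suc[OF mem_set[OF that(2)]] by blast
  show "Dom \<phi> \<in>\<^sub>c Dom (fNeg \<phi>)" using assms by (simp add: fNeg_word Dom_suffix_lt)
  show "Dom \<phi> \<in>\<^sub>c Dom (fOr \<phi> \<psi>)" if p: "is_seq \<psi>"
    unfolding fOr_word[OF assms p]
    by (rule tr[OF Dom_prefix[OF assms p]]) (use assms p in \<open>simp_all add: Dom_suffix_lt\<close>)
  show "Dom \<phi> \<in>\<^sub>c Dom (fOr \<psi> \<phi>)" if p: "is_seq \<psi>"
    unfolding fOr_word[OF p assms]
    by (rule tr[OF Dom_suffix[OF p assms]]) (use assms p in \<open>simp_all add: Dom_suffix_lt\<close>)
  show "Dom \<phi> \<in>\<^sub>c Dom (fEx v \<phi>)" if v: "is_set v"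
    unfolding fEx_word[OF v assms]
    by (rule tr[OF _ Dom_suffix_lt]) (use assms v Dom_suffix[of "lt v" \<phi>] in simp_all)
qed

text \<open>Induction on formulas is induction on their length. With \<open>False\<close> it covers
  formulas of every length and asks for a set formula; with \<open>True\<close> it admits class
  formulas, but the length must be small.\<close>

lemma ff_induct:
  assumes Q: "dfn b (\<lambda>s. Q (s 0))" and QP: "\<And>\<theta>. formal_formula \<theta> ==> Q \<theta> \<longleftrightarrow> P \<theta>"
    and b: "b ==> small (Dom \<theta>)" and \<theta>: "formal_formula \<theta>"
    and Eq: "\<And>a b. is_term a ==> is_term b ==> P (fEq a b)"
    and Mem: "\<And>a b. is_term a ==> is_term b ==> P (fMem a b)"
    and Neg: "\<And>\<phi>. formal_formula \<phi> ==> P \<phi> ==> P (fNeg \<phi>)"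
    and Or: "\<And>\<phi> \<psi>. formal_formula \<phi> ==> formal_formula \<psi> ==> P \<phi> ==> P \<psi> ==> P (fOr \<phi> \<psi>)"
    and Ex: "\<And>v \<phi>. is_var v ==> formal_formula \<phi> ==> P \<phi> ==> P (fEx v \<phi>)"
  shows "P \<theta>"
proof -
  have "\<forall>\<theta>'. is_set \<theta>' --> formal_formula \<theta>' --> Dom \<theta>' = Dom \<theta> --> Q \<theta>'"
  proof (rule nat_strong_induct[of b "\<lambda>n. \<forall>\<theta>'. is_set \<theta>' --> formal_formula \<theta>' --> Dom \<theta>' = n --> Q \<theta>'"])
    show "dfn b (\<lambda>s. \<forall>\<theta>'. is_set \<theta>' --> formal_formula \<theta>' --> Dom \<theta>' = s 0 --> Q \<theta>')"
      by (intro dfn_intros dfn_comp1[OF Q])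
    show "is_nat (Dom \<theta>)" using ff_seq[OF \<theta>] by simp
  next
    fix m assume "\<And>k. k \<in>\<^sub>c m ==> \<forall>\<theta>'. is_set \<theta>' --> formal_formula \<theta>' --> Dom \<theta>' = k --> Q \<theta>'"
    then have IH: "P \<phi>" if "formal_formula \<phi>" "Dom \<phi> \<in>\<^sub>c m" for \<phi> using that ff_set QP by blast
    show "\<forall>\<theta>'. is_set \<theta>' --> formal_formula \<theta>' --> Dom \<theta>' = m --> Q \<theta>'"
    proof (intro allI impI)
      fix \<theta>' assume t: "formal_formula \<theta>'" and D: "Dom \<theta>' = m"
      from t have "P \<theta>'"
      proof (cases rule: ff_cases)
        case (3 \<phi>)
        then show ?thesis using Neg IH Dom_sub(1)[OF ff_seq[OF 3(1)]] D by blast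
      next
        case (4 \<phi> \<psi>)
        then show ?thesis using Or IH Dom_sub(2)[OF ff_seq[OF 4(1)] ff_seq[OF 4(2)]] Dom_sub(3)[OF ff_seq[OF 4(2)] ff_seq[OF 4(1)]] D by blast
      next
        case (5 v \<phi>)
        then show ?thesis using Ex IH Dom_sub(4)[OF ff_seq[OF 5(2)] is_var_set[OF 5(1)]] D by blast
      qed (use Eq Mem in blast)+
      then show "Q \<theta>'" using QP[OF t] by blast
    qed
  qed (rule b)
  then show ?thesis using \<theta> ff_set QP by blast
qed

section \<open>Unique readability\<close>

lemmas formula_words = fEq_word fMem_word fNeg_word fOr_word fEx_word

text \<open>In prefix notation the leading symbol determines the constructor. The remainders
  \<open>s\<close> and \<open>t\<close> are arbitrary so that the hypothesis for the first disjunct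
  can absorb the second disjunct into the remainder.\<close>

lemma ff_prefix:
  assumes "formal_formula \<theta>" "formal_formula \<chi>" "is_seq s" "is_seq t" "\<theta> \<frown> s = \<chi> \<frown> t"
  shows "\<theta> = \<chi> \<and> s = t"
proof -
  let ?P = "\<lambda>\<theta>. \<forall>\<chi>. is_set \<chi> --> formal_formula \<chi> --> (\<forall>s. is_set s --> is_seq s --> (\<forall>t. is_set t --> is_seq t -->
    \<theta> \<frown> s = \<chi> \<frown> t --> \<theta> = \<chi> \<and> s = t))"
  have "?P \<theta>"
  proof (rule ff_induct[where b = False and Q = "\<lambda>\<theta>. \<forall>\<chi>. is_set \<chi> --> formal_formula \<chi> --> (\<forall>s. is_set s --> is_seq s --> (\<forall>t. is_set t --> is_seq t -->
    catx \<theta> s = catx \<chi> t --> \<theta> = \<chi> \<and> s = t))" and P = ?P])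
    show "dfn False (\<lambda>z. \<forall>\<chi>. is_set \<chi> --> formal_formula \<chi> --> (\<forall>s. is_set s --> is_seq s --> (\<forall>t. is_set t --> is_seq t -->
      catx (z 0) s = catx \<chi> t --> z 0 = \<chi> \<and> s = t)))" by (intro dfn_intros)
    show "(\<forall>\<chi>. is_set \<chi> --> formal_formula \<chi> --> (\<forall>s. is_set s --> is_seq s --> (\<forall>t. is_set t --> is_seq t -->
      catx \<theta> s = catx \<chi> t --> \<theta> = \<chi> \<and> s = t))) = ?P \<theta>" if "formal_formula \<theta>" for \<theta>
      using ff_seq[OF that] by (simp add: ff_seq cong: imp_cong)
  next
    fix a b assume ab: "is_term a" "is_term b"
    show "?P (fEq a b)"
    proof (intro allI impI)
      fix \<chi> s t assume c: "formal_formula \<chi>" and st: "is_seq s" "is_seq t" and eq: "fEq a b \<frown> s = \<chi> \<frown> t"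
      from c show "fEq a b = \<chi> \<and> s = t"
        by (cases rule: ff_cases) (use eq ab st in \<open>auto simp: formula_words is_term_set is_var_set ff_seq\<close>)
    qed
    show "?P (fMem a b)"
    proof (intro allI impI)
      fix \<chi> s t assume c: "formal_formula \<chi>" and st: "is_seq s" "is_seq t" and eq: "fMem a b \<frown> s = \<chi> \<frown> t"
      from c show "fMem a b = \<chi> \<and> s = t"
        by (cases rule: ff_cases) (use eq ab st in \<open>auto simp: formula_words is_term_set is_var_set ff_seq\<close>)
    qed
  next
    fix \<phi> assume p: "formal_formula \<phi>" and IH: "?P \<phi>"
    show "?P (fNeg \<phi>)"
    proof (intro allI impI)
      fix \<chi> s t assume c: "formal_formula \<chi>" and st: "is_seq s" "is_seq t" and eq: "fNeg \<phi> \<frown> s = \<chi> \<frown> t"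
      from c show "fNeg \<phi> = \<chi> \<and> s = t"
      proof (cases rule: ff_cases)
        case (3 \<phi>')
        then have "\<phi> \<frown> s = \<phi>' \<frown> t" using eq p st by (simp add: formula_words ff_seq)
        then have "\<phi> = \<phi>' \<and> s = t" using IH 3(1) st ff_set seq_is_set by blast
        then show ?thesis using 3 by simp
      qed (use eq p st in \<open>auto simp: formula_words is_term_set is_var_set ff_seq\<close>)
    qed
  next
    fix \<phi> \<psi> assume p: "formal_formula \<phi>" "formal_formula \<psi>" and IH: "?P \<phi>" "?P \<psi>"
    show "?P (fOr \<phi> \<psi>)"
    proof (intro allI impI)
      fix \<chi> s t assume c: "formal_formula \<chi>" and st: "is_seq s" "is_seq t" and eq: "fOr \<phi> \<psi> \<frown> s = \<chi> \<frown> t"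
      from c show "fOr \<phi> \<psi> = \<chi> \<and> s = t"
      proof (cases rule: ff_cases)
        case (4 \<phi>' \<psi>')
        then have e: "\<phi> \<frown> \<psi> \<frown> s = \<phi>' \<frown> \<psi>' \<frown> t" using eq p st by (simp add: formula_words ff_seq)
        have "is_seq (\<psi> \<frown> s)" "is_seq (\<psi>' \<frown> t)" using p st 4 by (simp_all add: ff_seq)
        then have e1: "\<phi> = \<phi>' \<and> \<psi> \<frown> s = \<psi>' \<frown> t" using IH(1) 4(1) e ff_set seq_is_set by blast
        then have "\<psi> = \<psi>' \<and> s = t" using IH(2) 4(2) st ff_set seq_is_set by blast
        then show ?thesis using 4 e1 by simp
      qed (use eq p st in \<open>auto simp: formula_words is_term_set is_var_set ff_seq\<close>)
    qed
  next
    fix v \<phi> assume v: "is_var v" and p: "formal_formula \<phi>" and IH: "?P \<phi>"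
    show "?P (fEx v \<phi>)"
    proof (intro allI impI)
      fix \<chi> s t assume c: "formal_formula \<chi>" and st: "is_seq s" "is_seq t" and eq: "fEx v \<phi> \<frown> s = \<chi> \<frown> t"
      from c show "fEx v \<phi> = \<chi> \<and> s = t"
      proof (cases rule: ff_cases)
        case (5 v' \<phi>')
        then have "v = v' \<and> \<phi> \<frown> s = \<phi>' \<frown> t" using eq v p st by (simp add: formula_words ff_seq is_var_set)
        moreover from this have "\<phi> = \<phi>' \<and> s = t" using IH 5(2) st ff_set seq_is_set by blast
        ultimately show ?thesis using 5 by simp
      qed (use eq v p st in \<open>auto simp: formula_words is_term_set is_var_set ff_seq\<close>)
    qed
  qed (use assms in simp_all)
  then show ?thesis using assms ff_set seq_is_set by blast
qed

lemma fNeg_inj: "formal_formula \<phi> ==> formal_formula \<psi> ==> fNeg \<phi> = fNeg \<psi> ==> \<phi> = \<psi>"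
  by (simp add: fNeg_word ff_seq)

lemma fOr_inj:
  "formal_formula a ==> formal_formula b ==> formal_formula c ==> formal_formula d ==> fOr a b = fOr c d ==> a = c \<and> b = d"
  using ff_prefix[of a c b d] by (simp add: fOr_word ff_seq)

lemma fEx_inj:
  "is_var v ==> is_var w ==> formal_formula \<phi> ==> formal_formula \<psi> ==> fEx v \<phi> = fEx w \<psi> ==> v = w \<and> \<phi> = \<psi>"
  by (simp add: fEx_word ff_seq is_var_set)

text \<open>In prefix notation every occurrence of a logical symbol starts a subformula; this is the
  case of the quantifier. The symbol does not occur in atoms, and inside a disjunction
  \<open>split_lt\<close> tells in which disjunct it lies.\<close>

lemma ff_subpos:
  assumes "formal_formula \<theta>" "is_seq \<alpha>" "is_seq t" "\<theta> = \<alpha> \<frown> lt (sym_code 4) \<frown> t"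
  obtains \<chi> \<beta> where "formal_formula \<chi>" "is_seq \<beta>" "lt (sym_code 4) \<frown> t = \<chi> \<frown> \<beta>"
proof -
  let ?P = "\<lambda>\<theta>. \<forall>\<alpha>. is_set \<alpha> --> is_seq \<alpha> --> (\<forall>t. is_set t --> is_seq t --> \<theta> = \<alpha> \<frown> lt (sym_code 4) \<frown> t -->
    (\<exists>\<chi>. is_set \<chi> \<and> formal_formula \<chi> \<and> (\<exists>\<beta>. is_set \<beta> \<and> is_seq \<beta> \<and> lt (sym_code 4) \<frown> t = \<chi> \<frown> \<beta>)))"
  let ?G = "\<lambda>t. \<exists>\<chi>. is_set \<chi> \<and> formal_formula \<chi> \<and> (\<exists>\<beta>. is_set \<beta> \<and> is_seq \<beta> \<and> lt (sym_code 4) \<frown> t = \<chi> \<frown> \<beta>)"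
  \<comment> \<open>If nothing precedes the symbol, the subformula is the whole formula; so each
    case has to treat a nonempty prefix only.\<close>
  have PI: "?P \<theta>" if "formal_formula \<theta>" and
    H: "\<And>c \<alpha> t. is_set c ==> is_seq \<alpha> ==> is_seq t ==> \<theta> = lt c \<frown> \<alpha> \<frown> lt (sym_code 4) \<frown> t ==> ?G t" for \<theta>
  proof (intro allI impI)
    fix \<alpha> t assume at: "is_seq \<alpha>" "is_seq t" and e: "\<theta> = \<alpha> \<frown> lt (sym_code 4) \<frown> t"
    from at(1) show "?G t"
    proof (cases rule: cons_cases)
      case 1
      then have "lt (sym_code 4) \<frown> t = \<theta> \<frown> emp" using e at ff_seq[OF that(1)] by simp
      then show ?thesis using that(1) ff_set seq_emp is_set_emp by blast
    next
      case (2 c \<alpha>')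
      then show ?thesis using H[OF 2(1,2) at(2)] e at by simp
    qed
  qed
  have "?P \<theta>"
  proof (rule ff_induct[where b = False and P = ?P and Q = "\<lambda>\<theta>. \<forall>\<alpha>. is_set \<alpha> --> is_seq \<alpha> --> (\<forall>t. is_set t --> is_seq t --> \<theta> = catx \<alpha> (catx (lt (sym_code 4)) t) -->
    (\<exists>\<chi>. is_set \<chi> \<and> formal_formula \<chi> \<and> (\<exists>\<beta>. is_set \<beta> \<and> is_seq \<beta> \<and> catx (lt (sym_code 4)) t = catx \<chi> \<beta>)))"])
    show "dfn False (\<lambda>s. \<forall>\<alpha>. is_set \<alpha> --> is_seq \<alpha> --> (\<forall>t. is_set t --> is_seq t --> s 0 = catx \<alpha> (catx (lt (sym_code 4)) t) -->
    (\<exists>\<chi>. is_set \<chi> \<and> formal_formula \<chi> \<and> (\<exists>\<beta>. is_set \<beta> \<and> is_seq \<beta> \<and> catx (lt (sym_code 4)) t = catx \<chi> \<beta>))))"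
      by (intro dfn_intros)
    show "(\<forall>\<alpha>. is_set \<alpha> --> is_seq \<alpha> --> (\<forall>t. is_set t --> is_seq t --> \<theta> = catx \<alpha> (catx (lt (sym_code 4)) t) -->
    (\<exists>\<chi>. is_set \<chi> \<and> formal_formula \<chi> \<and> (\<exists>\<beta>. is_set \<beta> \<and> is_seq \<beta> \<and> catx (lt (sym_code 4)) t = catx \<chi> \<beta>)))) = ?P \<theta>" for \<theta>
      by (simp add: ff_seq cong: imp_cong conj_cong)
  next
    fix a b assume ab: "is_term a" "is_term b"
    note s = is_term_set[OF ab(1)] is_term_set[OF ab(2)]
    have no: "\<not> occ (sym_code 4) (lt a \<frown> lt b)" using s ab by (simp add: is_term_neq)
    have F: False if "is_set c" "is_seq \<alpha>" "is_seq t" "lt (sym_code k) \<frown> lt a \<frown> lt b = lt c \<frown> \<alpha> \<frown> lt (sym_code 4) \<frown> t" for c \<alpha> t k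
    proof -
      have "lt a \<frown> lt b = \<alpha> \<frown> lt (sym_code 4) \<frown> t" using that s by simp
      then show False using no occI[OF that(2,3)] by blast
    qed
    show "?P (fEq a b)"
      by (rule PI[OF ff_atom(1)[OF ab]]) (use F fEq_word[OF s] in metis)
    show "?P (fMem a b)"
      by (rule PI[OF ff_atom(2)[OF ab]]) (use F fMem_word[OF s] in metis)
  next
    fix \<phi> assume p: "formal_formula \<phi>" and IH: "?P \<phi>"
    show "?P (fNeg \<phi>)"
    proof (rule PI[OF ff_Neg[OF p]])
      fix c \<alpha> t assume *: "is_set c" "is_seq \<alpha>" "is_seq t" "fNeg \<phi> = lt c \<frown> \<alpha> \<frown> lt (sym_code 4) \<frown> t"
      then have "\<phi> = \<alpha> \<frown> lt (sym_code 4) \<frown> t" using p by (simp add: fNeg_word ff_seq)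
      then show "?G t" using IH * seq_is_set by blast
    qed
  next
    fix \<phi> \<psi> assume p: "formal_formula \<phi>" "formal_formula \<psi>" and IH: "?P \<phi>" "?P \<psi>"
    show "?P (fOr \<phi> \<psi>)"
    proof (rule PI[OF ff_Or[OF p]])
      fix c \<alpha> t assume *: "is_set c" "is_seq \<alpha>" "is_seq t" "fOr \<phi> \<psi> = lt c \<frown> \<alpha> \<frown> lt (sym_code 4) \<frown> t"
      then have e: "\<phi> \<frown> \<psi> = \<alpha> \<frown> lt (sym_code 4) \<frown> t" using p by (simp add: fOr_word ff_seq)
      from ff_seq[OF p(1)] ff_seq[OF p(2)] *(2,3) sym_set e show "?G t"
      proof (rule split_lt)
        fix \<gamma> assume g: "is_seq \<gamma>" "\<phi> = \<alpha> \<frown> lt (sym_code 4) \<frown> \<gamma>" "t = \<gamma> \<frown> \<psi>"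
        then have "?G \<gamma>" using IH(1) *(2) seq_is_set by blast
        then obtain \<chi> \<beta> where cb: "formal_formula \<chi>" "is_seq \<beta>" "lt (sym_code 4) \<frown> \<gamma> = \<chi> \<frown> \<beta>" by blast
        have "lt (sym_code 4) \<frown> t = (lt (sym_code 4) \<frown> \<gamma>) \<frown> \<psi>" using g ff_seq[OF p(2)] by simp
        then have "lt (sym_code 4) \<frown> t = \<chi> \<frown> (\<beta> \<frown> \<psi>)" "is_seq (\<beta> \<frown> \<psi>)"
          unfolding cb(3) using cb ff_seq[OF p(2)] ff_seq[OF cb(1)] by simp_all
        then show "?G t" using cb(1) ff_set seq_is_set by blast
      next
        fix \<delta> assume "is_seq \<delta>" "\<psi> = \<delta> \<frown> lt (sym_code 4) \<frown> t"
        then show "?G t" using IH(2) *(3) seq_is_set by blast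
      qed
    qed
  next
    fix v \<phi> assume v: "is_var v" and p: "formal_formula \<phi>" and IH: "?P \<phi>"
    show "?P (fEx v \<phi>)"
    proof (rule PI[OF ff_Ex[OF v p]])
      fix c \<alpha> t assume *: "is_set c" "is_seq \<alpha>" "is_seq t" "fEx v \<phi> = lt c \<frown> \<alpha> \<frown> lt (sym_code 4) \<frown> t"
      then have e: "lt v \<frown> \<phi> = \<alpha> \<frown> lt (sym_code 4) \<frown> t" using p v by (simp add: fEx_word ff_seq is_var_set)
      from *(2) show "?G t"
      proof (cases rule: cons_cases)
        case 1
        then show ?thesis using e v p *(3) by (simp add: ff_seq is_var_set is_var_neq)
      next
        case (2 d \<alpha>')
        then have "\<phi> = \<alpha>' \<frown> lt (sym_code 4) \<frown> t" using e v p *(3) by (simp add: ff_seq is_var_set)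
        then show ?thesis using IH 2(2) *(3) seq_is_set by blast
      qed
    qed
  qed (use assms in simp_all)
  then show ?thesis using assms that seq_is_set by blast
qed

text \<open>By \<open>ff_subpos\<close> some formula starts at the same quantifier symbol and ends
  inside \<open>\<theta>\<close>; by \<open>ff_prefix\<close> it is
  \<open>fEx v \<chi>\<close>.\<close>

lemma ff_inside:
  assumes t: "formal_formula \<theta>" and r: "is_seq \<rho>" and v: "is_var v" and c: "formal_formula \<chi>"
    and g: "is_seq \<gamma>" and b: "is_seq \<beta>" and eq: "\<theta> \<frown> \<rho> = \<gamma> \<frown> fEx v \<chi> \<frown> \<beta>" and D: "Dom \<gamma> \<in>\<^sub>c Dom \<theta>"
  obtains \<delta> where "is_seq \<delta>" "\<theta> = \<gamma> \<frown> fEx v \<chi> \<frown> \<delta>" "\<beta> = \<delta> \<frown> \<rho>"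
proof -
  note ts = ff_seq[OF t] and Es = ff_seq[OF ff_Ex[OF v c]]
  have Ebs: "is_seq (fEx v \<chi> \<frown> \<beta>)" using Es b by simp
  have "Dom \<gamma> \<in>\<^sub>c suc (Dom \<theta>)" using D ts by (simp add: mem_suc)
  from prefix_compare[OF g Ebs ts r eq[symmetric] this] obtain w where w: "is_seq w" "\<theta> = \<gamma> \<frown> w" "fEx v \<chi> \<frown> \<beta> = w \<frown> \<rho>" .
  from w(1) show ?thesis
  proof (cases rule: cons_cases)
    case 1
    then show ?thesis using w(2) D g by simp
  next
    case (2 d w')
    have "lt (sym_code 4) \<frown> lt v \<frown> \<chi> \<frown> \<beta> = lt d \<frown> w' \<frown> \<rho>"
      using w(3) 2 r b v c by (simp add: fEx_word is_var_set ff_seq)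
    then have d: "d = sym_code 4" using 2 r b v c by (simp add: is_var_set ff_seq)
    from t g 2(2) w(2)[unfolded 2(3) d] obtain \<chi>' \<beta>' where c': "formal_formula \<chi>'" "is_seq \<beta>'" "lt (sym_code 4) \<frown> w' = \<chi>' \<frown> \<beta>'"
      by (rule ff_subpos)
    have wc: "w = \<chi>' \<frown> \<beta>'" using 2(3) d c'(3) by simp
    have "fEx v \<chi> \<frown> \<beta> = \<chi>' \<frown> (\<beta>' \<frown> \<rho>)" using w(3) wc c' r ff_seq[OF c'(1)] by simp
    then have "fEx v \<chi> = \<chi>' \<and> \<beta> = \<beta>' \<frown> \<rho>"
      using c'(1,2) r b by (intro ff_prefix[OF ff_Ex[OF v c]]) simp_all
    then show ?thesis using that[OF c'(2)] w(2) wc by simp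
  qed
qed


subsection \<open>Bound occurrences\<close>

text \<open>The definable form of \<open>bound_at\<close>, with the position given by a
  factorization: the quantified block consists of \<open>\<gamma>\<close>, the letter
  \<open>c\<close> and \<open>\<delta>\<close>, and it is surrounded by \<open>\<alpha>'\<close> and
  \<open>\<beta>'\<close>.\<close>

definition bnd :: "'a \<Rightarrow> 'a \<Rightarrow> 'a \<Rightarrow> 'a \<Rightarrow> bool" where
  "bnd v \<alpha> c \<beta> \<longleftrightarrow> (\<exists>\<alpha>'. is_set \<alpha>' \<and> is_seq \<alpha>' \<and> (\<exists>\<chi>. is_set \<chi> \<and> formal_formula \<chi> \<and> (\<exists>\<beta>'. is_set \<beta>' \<and> is_seq \<beta>' \<and>
     (\<exists>\<gamma>. is_set \<gamma> \<and> is_seq \<gamma> \<and> (\<exists>\<delta>. is_set \<delta> \<and> is_seq \<delta> \<and>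
       \<alpha> = catx \<alpha>' \<gamma> \<and> xEx v \<chi> = catx \<gamma> (catx (lt c) \<delta>) \<and> \<beta> = catx \<delta> \<beta>')))))"

lemma dfn_bnd [dfn_intros]:
  assumes "dft b t" "dft b u" "dft b v" "dft b w"
  shows "dfn b (\<lambda>s. bnd (t s) (u s) (v s) (w s))"
  \<comment> \<open>The four operations occur below five nested quantifiers, so their versions
    shifted by five are supplied explicitly.\<close>
  unfolding bnd_def by (intro dfn_intros dft_rename[where f = Suc] assms
    dft_rename[where f = "\<lambda>i. Suc (Suc (Suc (Suc (Suc i))))", OF assms(1)]
    dft_rename[where f = "\<lambda>i. Suc (Suc (Suc (Suc (Suc i))))", OF assms(2)]
    dft_rename[where f = "\<lambda>i. Suc (Suc (Suc (Suc (Suc i))))", OF assms(3)]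
    dft_rename[where f = "\<lambda>i. Suc (Suc (Suc (Suc (Suc i))))", OF assms(4)])

lemma bndI:
  assumes "is_seq \<alpha>'" "formal_formula \<chi>" "is_seq \<beta>'" "is_seq \<gamma>" "is_seq \<delta>" "is_var v" "is_set c"
    and "\<alpha> = \<alpha>' \<frown> \<gamma>" "fEx v \<chi> = \<gamma> \<frown> lt c \<frown> \<delta>" "\<beta> = \<delta> \<frown> \<beta>'"
  shows "bnd v \<alpha> c \<beta>"
proof -
  note seq_is_set[OF assms(1)] ff_set[OF assms(2)] seq_is_set[OF assms(3)] seq_is_set[OF assms(4)] seq_is_set[OF assms(5)]
  moreover have "\<alpha> = catx \<alpha>' \<gamma>" "xEx v \<chi> = catx \<gamma> (catx (lt c) \<delta>)" "\<beta> = catx \<delta> \<beta>'"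
    using assms by (simp_all add: ff_seq is_var_set)
  ultimately show ?thesis unfolding bnd_def using assms(1-5)
    by - (rule exI[of _ \<alpha>'], (rule conjI, assumption)+, rule exI[of _ \<chi>], (rule conjI, assumption)+,
      rule exI[of _ \<beta>'], (rule conjI, assumption)+, rule exI[of _ \<gamma>], (rule conjI, assumption)+,
      rule exI[of _ \<delta>], (rule conjI, assumption)+, assumption)
qed

lemma bndE:
  assumes "bnd v \<alpha> c \<beta>" "is_var v" "is_set c"
  obtains \<alpha>' \<chi> \<beta>' \<gamma> \<delta> where "is_seq \<alpha>'" "formal_formula \<chi>" "is_seq \<beta>'" "is_seq \<gamma>" "is_seq \<delta>"
    "\<alpha> = \<alpha>' \<frown> \<gamma>" "fEx v \<chi> = \<gamma> \<frown> lt c \<frown> \<delta>" "\<beta> = \<delta> \<frown> \<beta>'"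
proof -
  obtain \<alpha>' \<chi> \<beta>' \<gamma> \<delta> where *: "is_seq \<alpha>'" "formal_formula \<chi>" "is_seq \<beta>'" "is_seq \<gamma>" "is_seq \<delta>"
    "\<alpha> = catx \<alpha>' \<gamma>" "xEx v \<chi> = catx \<gamma> (catx (lt c) \<delta>)" "\<beta> = catx \<delta> \<beta>'"
    using assms(1) unfolding bnd_def by blast
  from *(1-5) show ?thesis
    by (rule that) (use * assms(2,3) in \<open>simp_all add: ff_seq is_var_set\<close>)
qed

lemma bound_at_iff:
  assumes v: "is_var v" and c: "is_set c" and a: "is_seq \<alpha>" and b: "is_seq \<beta>"
  shows "bound_at (\<alpha> \<frown> lt c \<frown> \<beta>) v (Dom \<alpha>) \<longleftrightarrow> bnd v \<alpha> c \<beta>"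
proof
  assume "bound_at (\<alpha> \<frown> lt c \<frown> \<beta>) v (Dom \<alpha>)"
  then obtain \<alpha>' \<chi> \<beta>' where s: "is_seq \<alpha>'" "formal_formula \<chi>" "is_seq \<beta>'"
    and eq: "\<alpha> \<frown> lt c \<frown> \<beta> = \<alpha>' \<frown> fEx v \<chi> \<frown> \<beta>'"
    and D: "\<not> Dom \<alpha> \<in>\<^sub>c Dom \<alpha>'" "Dom \<alpha> \<in>\<^sub>c Dom (\<alpha>' \<frown> fEx v \<chi>)" unfolding bound_at_def by metis
  have E: "is_seq (fEx v \<chi>)" using ff_seq[OF ff_Ex[OF v s(2)]] .
  have D': "Dom \<alpha>' \<in>\<^sub>c suc (Dom \<alpha>)" using nat_linear[OF seq_Dom[OF a] seq_Dom[OF s(1)]] D(1) a by (auto simp: mem_suc)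
  obtain \<gamma> where g: "is_seq \<gamma>" "\<alpha> = \<alpha>' \<frown> \<gamma>" "fEx v \<chi> \<frown> \<beta>' = \<gamma> \<frown> lt c \<frown> \<beta>"
    using prefix_compare[OF s(1) cat_seq[OF E s(3)] a _ eq[symmetric] D'] c b by auto
  from E s(3) g(1) b c g(3) show "bnd v \<alpha> c \<beta>"
  proof (rule split_lt)
    fix \<delta> assume "is_seq \<delta>" "fEx v \<chi> = \<gamma> \<frown> lt c \<frown> \<delta>" "\<beta> = \<delta> \<frown> \<beta>'"
    then show ?thesis using bndI[OF s g(1) _ v c g(2)] by blast
  next
    fix \<delta> assume d: "is_seq \<delta>" "\<gamma> = fEx v \<chi> \<frown> \<delta>"
    then have "\<alpha> = (\<alpha>' \<frown> fEx v \<chi>) \<frown> \<delta>" using g s E by simp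
    then have "Dom (\<alpha>' \<frown> fEx v \<chi>) \<in>\<^sub>c suc (Dom \<alpha>)" using Dom_prefix[OF cat_seq[OF s(1) E] d(1)] by simp
    then show ?thesis using D(2) a mem_asym mem_irrefl by (metis mem_suc Dom_set)
  qed
next
  assume "bnd v \<alpha> c \<beta>"
  from this v c obtain \<alpha>' \<chi> \<beta>' \<gamma> \<delta> where s: "is_seq \<alpha>'" "formal_formula \<chi>" "is_seq \<beta>'" "is_seq \<gamma>" "is_seq \<delta>"
    and e: "\<alpha> = \<alpha>' \<frown> \<gamma>" "fEx v \<chi> = \<gamma> \<frown> lt c \<frown> \<delta>" "\<beta> = \<delta> \<frown> \<beta>'" by (rule bndE)
  have E: "is_seq (fEx v \<chi>)" using ff_seq[OF ff_Ex[OF v s(2)]] .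
  have "\<alpha> \<frown> lt c \<frown> \<beta> = \<alpha>' \<frown> fEx v \<chi> \<frown> \<beta>'" unfolding e using s c by simp
  moreover have "Dom \<alpha> \<in>\<^sub>c Dom (\<alpha>' \<frown> fEx v \<chi>)" using Dom_prefix_lt[OF a c s(5)] unfolding e using s c by simp
  moreover have "\<not> Dom \<alpha> \<in>\<^sub>c Dom \<alpha>'" 
  proof
    assume *: "Dom \<alpha> \<in>\<^sub>c Dom \<alpha>'"
    have "Dom \<alpha>' \<in>\<^sub>c suc (Dom \<alpha>)" using Dom_prefix[OF s(1,4)] e(1) by simp
    then show False using * mem_asym[OF *] mem_irrefl[of "Dom \<alpha>"] a by (auto simp: mem_suc)
  qed
  ultimately show "bound_at (\<alpha> \<frown> lt c \<frown> \<beta>) v (Dom \<alpha>)" unfolding bound_at_def using s(1-3) by blast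
qed

text \<open>Used contrapositively: nothing is bound in an atom, which does not contain the
  quantifier symbol.\<close>

lemma bnd_occ:
  assumes "bnd v \<alpha> c \<beta>" "is_var v" "is_set c" shows "occ (sym_code 4) (\<alpha> \<frown> lt c \<frown> \<beta>)"
proof -
  from assms obtain \<alpha>' \<chi> \<beta>' \<gamma> \<delta> where s: "is_seq \<alpha>'" "formal_formula \<chi>" "is_seq \<beta>'" "is_seq \<gamma>" "is_seq \<delta>"
    and e: "\<alpha> = \<alpha>' \<frown> \<gamma>" "fEx v \<chi> = \<gamma> \<frown> lt c \<frown> \<delta>" "\<beta> = \<delta> \<frown> \<beta>'" by (rule bndE)
  have E: "is_seq (fEx v \<chi>)" using ff_seq[OF ff_Ex[OF assms(2) s(2)]] .
  have "\<alpha> \<frown> lt c \<frown> \<beta> = \<alpha>' \<frown> fEx v \<chi> \<frown> \<beta>'" unfolding e using s assms(3) by simp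
  moreover have "occ (sym_code 4) (fEx v \<chi>)" using s assms(2) by (simp add: fEx_word is_var_set ff_seq)
  ultimately show ?thesis using s E by simp
qed

lemma bnd_Ex:
  assumes "is_var v" "formal_formula \<chi>" "is_seq \<alpha>" "is_seq \<beta>" "is_set c" "fEx v \<chi> = \<alpha> \<frown> lt c \<frown> \<beta>"
  shows "bnd v \<alpha> c \<beta>"
  by (rule bndI[OF seq_emp assms(2) seq_emp assms(3,4,1,5) _ assms(6)]) (use assms in simp_all)

text \<open>No occurrence of a formula \<open>\<exists>v \<chi>\<close> starting in \<open>\<pi>\<close> extends beyond \<open>\<pi>\<close>.\<close>

definition no_escape :: "'a \<Rightarrow> 'a \<Rightarrow> 'a \<Rightarrow> bool" where
  "no_escape v \<pi> w \<longleftrightarrow> (\<forall>\<chi> \<alpha> \<beta>. formal_formula \<chi> --> is_seq \<alpha> --> is_seq \<beta> -->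
     \<pi> \<frown> w = \<alpha> \<frown> fEx v \<chi> \<frown> \<beta> --> Dom \<alpha> \<in>\<^sub>c Dom \<pi> --> Dom (\<alpha> \<frown> fEx v \<chi>) \<in>\<^sub>c suc (Dom \<pi>))"

text \<open>A block that binds the occurrence cannot start in \<open>\<pi>\<close>, by
  \<open>no_escape\<close>, and one that starts in \<open>\<theta>\<close> ends there, by
  \<open>ff_inside\<close>. This locality of binding is the reason why substitution commutes with
  the connectives.\<close>

lemma bnd_context:
  assumes v: "is_var v" and c: "is_set c" and a: "formal_formula \<theta>" and p: "is_seq \<pi>" and r: "is_seq \<rho>"
    and ne: "no_escape v \<pi> (\<theta> \<frown> \<rho>)" and al: "is_seq \<alpha>" and be: "is_seq \<beta>" and eq: "\<theta> = \<alpha> \<frown> lt c \<frown> \<beta>"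
  shows "bnd v (\<pi> \<frown> \<alpha>) c (\<beta> \<frown> \<rho>) \<longleftrightarrow> bnd v \<alpha> c \<beta>"
proof
  assume "bnd v \<alpha> c \<beta>"
  from this v c obtain \<alpha>' \<chi> \<beta>' \<gamma> \<delta> where s: "is_seq \<alpha>'" "formal_formula \<chi>" "is_seq \<beta>'" "is_seq \<gamma>" "is_seq \<delta>"
    and e: "\<alpha> = \<alpha>' \<frown> \<gamma>" "fEx v \<chi> = \<gamma> \<frown> lt c \<frown> \<delta>" "\<beta> = \<delta> \<frown> \<beta>'" by (rule bndE)
  show "bnd v (\<pi> \<frown> \<alpha>) c (\<beta> \<frown> \<rho>)"
    by (rule bndI[OF cat_seq[OF p s(1)] s(2) cat_seq[OF s(3) r] s(4,5) v c _ e(2)]) (use e s p r in simp_all)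
next
  assume "bnd v (\<pi> \<frown> \<alpha>) c (\<beta> \<frown> \<rho>)"
  from this v c obtain \<alpha>' \<chi> \<beta>' \<gamma> \<delta> where s: "is_seq \<alpha>'" "formal_formula \<chi>" "is_seq \<beta>'" "is_seq \<gamma>" "is_seq \<delta>"
    and e: "\<pi> \<frown> \<alpha> = \<alpha>' \<frown> \<gamma>" "fEx v \<chi> = \<gamma> \<frown> lt c \<frown> \<delta>" "\<beta> \<frown> \<rho> = \<delta> \<frown> \<beta>'" by (rule bndE)
  have E: "is_seq (fEx v \<chi>)" using ff_seq[OF ff_Ex[OF v s(2)]] .
  note ts = ff_seq[OF a]
  have "\<pi> \<frown> \<theta> \<frown> \<rho> = (\<pi> \<frown> \<alpha>) \<frown> lt c \<frown> (\<beta> \<frown> \<rho>)" using eq p r al be c by simp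
  then have whole: "\<pi> \<frown> \<theta> \<frown> \<rho> = \<alpha>' \<frown> fEx v \<chi> \<frown> \<beta>'" unfolding e using s c by simp
  \<comment> \<open>A block that starts in \<open>\<pi>\<close> and covers the letter
    \<open>c\<close> would end beyond \<open>\<pi>\<close>.\<close>
  have "\<not> Dom \<alpha>' \<in>\<^sub>c Dom \<pi>"
  proof
    assume "Dom \<alpha>' \<in>\<^sub>c Dom \<pi>"
    then have 1: "Dom (\<alpha>' \<frown> fEx v \<chi>) \<in>\<^sub>c suc (Dom \<pi>)" using ne s whole unfolding no_escape_def by blast
    have "\<alpha>' \<frown> fEx v \<chi> = (\<pi> \<frown> \<alpha>) \<frown> lt c \<frown> \<delta>" unfolding e(1,2) using s c by simp
    then have "\<alpha>' \<frown> fEx v \<chi> = \<pi> \<frown> \<alpha> \<frown> lt c \<frown> \<delta>" using s c p al by simp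
    moreover have "Dom (\<pi> \<frown> \<alpha>) \<in>\<^sub>c Dom ((\<pi> \<frown> \<alpha>) \<frown> lt c \<frown> \<delta>)" using Dom_prefix_lt[OF _ c s(5)] p al by simp
    moreover have "Dom \<pi> \<in>\<^sub>c suc (Dom (\<pi> \<frown> \<alpha>))" by (rule Dom_prefix[OF p al])
    ultimately have "Dom \<pi> \<in>\<^sub>c Dom (\<alpha>' \<frown> fEx v \<chi>)"
      using nat_trans[OF seq_Dom[OF cat_seq[OF s(1) E]]] p al s c by (auto simp: mem_suc)
    then show False using 1 mem_asym mem_irrefl p by (metis mem_suc Dom_set)
  qed
  then have D: "Dom \<pi> \<in>\<^sub>c suc (Dom \<alpha>')" using nat_linear[OF seq_Dom[OF s(1)] seq_Dom[OF p]] s(1) by (auto simp: mem_suc)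
  obtain \<epsilon> where ep: "is_seq \<epsilon>" "\<alpha>' = \<pi> \<frown> \<epsilon>" "\<theta> \<frown> \<rho> = \<epsilon> \<frown> fEx v \<chi> \<frown> \<beta>'"
    using prefix_compare[OF p cat_seq[OF ts r] s(1) cat_seq[OF E s(3)] whole D] by metis
  have ag: "\<alpha> = \<epsilon> \<frown> \<gamma>" using cat_left_cancel[OF p al, of "\<epsilon> \<frown> \<gamma>"] e(1) ep p s by simp
  have "Dom \<epsilon> \<in>\<^sub>c suc (Dom \<alpha>)" using Dom_prefix[OF ep(1) s(4)] ag by simp
  then have "Dom \<epsilon> \<in>\<^sub>c Dom \<theta>"
    using Dom_prefix_lt[OF al c be] eq nat_trans[OF seq_Dom[OF ts]] al by (auto simp: mem_suc)
  from a r v s(2) ep(1) s(3) ep(3) this obtain \<beta>'' where b: "is_seq \<beta>''" "\<theta> = \<epsilon> \<frown> fEx v \<chi> \<frown> \<beta>''" "\<beta>' = \<beta>'' \<frown> \<rho>"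
    by (rule ff_inside)
  have "\<beta> = \<delta> \<frown> \<beta>''" using cat_right_cancel[OF be _ r, of "\<delta> \<frown> \<beta>''"] e(3) b s r by simp
  then show "bnd v \<alpha> c \<beta>" by (intro bndI[OF ep(1) s(2) b(1) s(4,5) v c ag e(2)])
qed


subsection \<open>Pointwise substitution and free variables in a context\<close>

text \<open>Substitution restricted to the segment \<open>a\<close> of a word with the context
  \<open>\<pi>\<close>, \<open>\<rho>\<close>, where boundness is judged in the whole word. In this
  form it is compatible with concatenation, whereas \<open>subst\<close> is defined position by
  position for whole formulas. Two implications replace the conditional to suit the definability
  rules.\<close>

definition PW :: "'a \<Rightarrow> 'a \<Rightarrow> 'a \<Rightarrow> 'a \<Rightarrow> 'a \<Rightarrow> 'a \<Rightarrow> bool" where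
  "PW v x \<pi> \<rho> a a' \<longleftrightarrow> is_seq a \<and> is_seq a' \<and> Dom a = Dom a' \<and>
    (\<forall>\<alpha>. is_set \<alpha> --> (\<forall>c. is_set c --> (\<forall>\<beta>. is_set \<beta> --> (\<forall>\<alpha>'. is_set \<alpha>' --> (\<forall>c'. is_set c' --> (\<forall>\<beta>'. is_set \<beta>' -->
      is_seq \<alpha> \<and> is_seq \<beta> \<and> is_seq \<alpha>' \<and> is_seq \<beta>' \<and> a = catx \<alpha> (catx (lt c) \<beta>) \<and> a' = catx \<alpha>' (catx (lt c') \<beta>') \<and> Dom \<alpha> = Dom \<alpha>' -->
      (c = v \<and> \<not> bnd v (catx \<pi> \<alpha>) c (catx \<beta> \<rho>) --> c' = par x) \<and> (\<not> (c = v \<and> \<not> bnd v (catx \<pi> \<alpha>) c (catx \<beta> \<rho>)) --> c' = c)))))))"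

lemma PWI:
  assumes "is_seq a" "is_seq a'" "Dom a = Dom a'" "is_seq \<pi>" "is_seq \<rho>"
    and "\<And>\<alpha> c \<beta> \<alpha>' c' \<beta>'. is_seq \<alpha> ==> is_set c ==> is_seq \<beta> ==> is_seq \<alpha>' ==> is_set c' ==> is_seq \<beta>' ==>
      a = \<alpha> \<frown> lt c \<frown> \<beta> ==> a' = \<alpha>' \<frown> lt c' \<frown> \<beta>' ==> Dom \<alpha> = Dom \<alpha>' ==>
      c' = (if c = v \<and> \<not> bnd v (\<pi> \<frown> \<alpha>) c (\<beta> \<frown> \<rho>) then par x else c)"
  shows "PW v x \<pi> \<rho> a a'"
  unfolding PW_def
proof (intro conjI allI impI)
  fix \<alpha> c \<beta> \<alpha>' c' \<beta>'
  assume s: "is_set c" "is_set c'" and *: "is_seq \<alpha> \<and> is_seq \<beta> \<and> is_seq \<alpha>' \<and> is_seq \<beta>' \<and> a = catx \<alpha> (catx (lt c) \<beta>) \<and> a' = catx \<alpha>' (catx (lt c') \<beta>') \<and> Dom \<alpha> = Dom \<alpha>'"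
  then have "c' = (if c = v \<and> \<not> bnd v (\<pi> \<frown> \<alpha>) c (\<beta> \<frown> \<rho>) then par x else c)"
    by (intro assms(6)) auto
  then have "c' = (if c = v \<and> \<not> bnd v (catx \<pi> \<alpha>) c (catx \<beta> \<rho>) then par x else c)"
    using * assms(4,5) by simp
  then show "c = v \<and> \<not> bnd v (catx \<pi> \<alpha>) c (catx \<beta> \<rho>) ==> c' = par x"
    "\<not> (c = v \<and> \<not> bnd v (catx \<pi> \<alpha>) c (catx \<beta> \<rho>)) ==> c' = c" by metis+
qed (use assms(1-3) in simp_all)

lemma PW_seq: "PW v x \<pi> \<rho> a a' ==> is_seq a \<and> is_seq a' \<and> Dom a = Dom a'"
  by (simp add: PW_def)

lemma PWD:
  assumes "PW v x \<pi> \<rho> a a'" "is_seq \<alpha>" "is_set c" "is_seq \<beta>" "is_seq \<alpha>'" "is_set c'" "is_seq \<beta>'"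
    "is_seq \<pi>" "is_seq \<rho>" "a = \<alpha> \<frown> lt c \<frown> \<beta>" "a' = \<alpha>' \<frown> lt c' \<frown> \<beta>'" "Dom \<alpha> = Dom \<alpha>'"
  shows "c' = (if c = v \<and> \<not> bnd v (\<pi> \<frown> \<alpha>) c (\<beta> \<frown> \<rho>) then par x else c)"
proof -
  have s: "is_set \<alpha>" "is_set \<beta>" "is_set \<alpha>'" "is_set \<beta>'" using assms seq_is_set by blast+
  have "is_seq \<alpha> \<and> is_seq \<beta> \<and> is_seq \<alpha>' \<and> is_seq \<beta>' \<and> a = catx \<alpha> (catx (lt c) \<beta>) \<and> a' = catx \<alpha>' (catx (lt c') \<beta>') \<and> Dom \<alpha> = Dom \<alpha>'"
    using assms by simp
  with assms(1) s assms(3,6) have "(c = v \<and> \<not> bnd v (catx \<pi> \<alpha>) c (catx \<beta> \<rho>) --> c' = par x) \<and> (\<not> (c = v \<and> \<not> bnd v (catx \<pi> \<alpha>) c (catx \<beta> \<rho>)) --> c' = c)"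
    unfolding PW_def by (elim conjE) metis
  moreover have "catx \<pi> \<alpha> = \<pi> \<frown> \<alpha>" "catx \<beta> \<rho> = \<beta> \<frown> \<rho>" using assms by simp_all
  ultimately show ?thesis by metis
qed

text \<open>If \<open>t\<close> were shorter than \<open>t'\<close>, a proper prefix of
  \<open>t'\<close> of the same length as \<open>t\<close> would make the two products differ in
  length.\<close>

lemma Dom_cat_cancel:
  assumes "is_seq s" "is_seq s'" "is_seq t" "is_seq t'" "Dom s = Dom s'" "Dom (s \<frown> t) = Dom (s' \<frown> t')"
  shows "Dom t = Dom t'"
proof -
  have no: "\<not> Dom t \<in>\<^sub>c Dom t'"
    if s: "is_seq s" "is_seq s'" "Dom s = Dom s'" and t: "is_seq t" "is_seq t'" and D: "Dom (s \<frown> t) = Dom (s' \<frown> t')" for s s' t t'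
  proof
    assume "Dom t \<in>\<^sub>c Dom t'"
    with t(2) obtain \<epsilon> \<zeta> where e: "is_seq \<epsilon>" "is_set (ap t' (Dom t))" "is_seq \<zeta>" "t' = \<epsilon> \<frown> lt (ap t' (Dom t)) \<frown> \<zeta>" "Dom \<epsilon> = Dom t"
      by (rule position)
    have "Dom (s' \<frown> \<epsilon>) = Dom (s \<frown> t)" using Dom_cat_cong[of s' s \<epsilon> t] s t e by simp
    moreover have "s' \<frown> t' = (s' \<frown> \<epsilon>) \<frown> lt (ap t' (Dom t)) \<frown> \<zeta>" using e s by (subst e(4)) simp
    then have "Dom (s' \<frown> \<epsilon>) \<in>\<^sub>c Dom (s' \<frown> t')" using Dom_prefix_lt[of "s' \<frown> \<epsilon>" "ap t' (Dom t)" \<zeta>] e s by simp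
    ultimately show False using D by simp
  qed
  show ?thesis
    using no[OF assms(1,2,5,3,4,6)] no[OF assms(2,1) assms(5)[symmetric] assms(4,3) assms(6)[symmetric]]
      nat_linear[OF seq_Dom[OF assms(3)] seq_Dom[OF assms(4)]] by blast
qed

lemma not_Dom_le:
  assumes "is_seq a" "is_seq \<delta>" "Dom \<alpha> = Dom (a \<frown> \<delta>)" "Dom \<alpha> \<in>\<^sub>c Dom a" shows False
  using Dom_prefix[OF assms(1,2)] assms(3,4) mem_asym mem_irrefl assms(1,2) by (metis mem_suc Dom_set cat_seq)

text \<open>Equal lengths guarantee that a position of the product falls into the same factor before
  and after substitution.\<close>

lemma PW_cat:
  assumes p: "is_seq \<pi>" and r: "is_seq \<rho>" and A: "PW v x \<pi> (b \<frown> \<rho>) a a'" and B: "PW v x (\<pi> \<frown> a) \<rho> b b'"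
  shows "PW v x \<pi> \<rho> (a \<frown> b) (a' \<frown> b')"
proof (rule PWI[OF _ _ _ p r])
  have s: "is_seq a" "is_seq a'" "is_seq b" "is_seq b'" and D: "Dom a = Dom a'" "Dom b = Dom b'"
    using PW_seq[OF A] PW_seq[OF B] by blast+
  show "is_seq (a \<frown> b)" "is_seq (a' \<frown> b')" using s by simp_all
  show "Dom (a \<frown> b) = Dom (a' \<frown> b')" by (rule Dom_cat_cong[OF s(1,2) D(1) s(3,4) D(2)])
  fix \<alpha> c \<beta> \<alpha>' c' \<beta>'
  assume q: "is_seq \<alpha>" "is_set c" "is_seq \<beta>" "is_seq \<alpha>'" "is_set c'" "is_seq \<beta>'"
    and e: "a \<frown> b = \<alpha> \<frown> lt c \<frown> \<beta>" and e': "a' \<frown> b' = \<alpha>' \<frown> lt c' \<frown> \<beta>'" and Da: "Dom \<alpha> = Dom \<alpha>'"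
  from s(1,3) q(1,3,2) e show "c' = (if c = v \<and> \<not> bnd v (\<pi> \<frown> \<alpha>) c (\<beta> \<frown> \<rho>) then par x else c)"
  proof (rule split_lt)
    fix \<gamma> assume g: "is_seq \<gamma>" "a = \<alpha> \<frown> lt c \<frown> \<gamma>" "\<beta> = \<gamma> \<frown> b"
    have Dl: "Dom \<alpha>' \<in>\<^sub>c Dom a'" using Dom_prefix_lt[OF q(1,2) g(1)] g(2) D Da by simp
    from s(2,4) q(4,6,5) e' show ?thesis
    proof (rule split_lt)
      fix \<gamma>' assume g': "is_seq \<gamma>'" "a' = \<alpha>' \<frown> lt c' \<frown> \<gamma>'"
      have "c' = (if c = v \<and> \<not> bnd v (\<pi> \<frown> \<alpha>) c (\<gamma> \<frown> b \<frown> \<rho>) then par x else c)"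
        by (rule PWD[OF A q(1,2) g(1) q(4,5) g'(1) p _ g(2) g'(2) Da]) (use s r in simp)
      then show ?thesis using g s r by simp
    next
      fix \<delta> assume "is_seq \<delta>" "\<alpha>' = a' \<frown> \<delta>"
      then show ?thesis using not_Dom_le[OF s(2) _ _ Dl] by blast
    qed
  next
    fix \<delta> assume d: "is_seq \<delta>" "\<alpha> = a \<frown> \<delta>" "b = \<delta> \<frown> lt c \<frown> \<beta>"
    from s(2,4) q(4,6,5) e' show ?thesis
    proof (rule split_lt)
      fix \<gamma>' assume g': "is_seq \<gamma>'" "a' = \<alpha>' \<frown> lt c' \<frown> \<gamma>'"
      have "Dom \<alpha> \<in>\<^sub>c Dom a" using Dom_prefix_lt[OF q(4,5) g'(1)] g'(2) D Da by simp
      then show ?thesis using not_Dom_le[OF s(1) d(1) _ ] d(2) by blast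
    next
      fix \<delta>' assume d': "is_seq \<delta>'" "\<alpha>' = a' \<frown> \<delta>'" "b' = \<delta>' \<frown> lt c' \<frown> \<beta>'"
      have "Dom \<delta> = Dom \<delta>'" by (rule Dom_cat_cancel[OF s(1,2) d(1) d'(1) D(1)]) (use Da d d' in simp)
      from PWD[OF B d(1) q(2,3) d'(1) q(5,6) cat_seq[OF p s(1)] r d(3) d'(3) this]
      show ?thesis using d p s by simp
    qed
  qed
qed

lemma lt_split:
  assumes "is_seq \<alpha>" "is_set c" "is_seq \<beta>" "is_set a" "lt a = \<alpha> \<frown> lt c \<frown> \<beta>"
  shows "\<alpha> = emp \<and> c = a \<and> \<beta> = emp"
proof -
  have "\<alpha> = emp"
  proof (rule ccontr)
    assume "\<alpha> \<noteq> emp"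
    from cat_eq_lt[OF assms(1) _ assms(4,5) this] show False using assms by simp
  qed
  then have "lt a \<frown> emp = lt c \<frown> \<beta>" using assms by simp
  then have "a = c \<and> emp = \<beta>" using assms(2,3,4) by (simp del: cat_emp)
  with \<open>\<alpha> = emp\<close> show ?thesis by simp
qed

lemma PW_lt:
  assumes "is_seq \<pi>" "is_seq \<rho>" "is_set a" "is_set a'" "a' = (if a = v \<and> \<not> bnd v \<pi> a \<rho> then par x else a)"
  shows "PW v x \<pi> \<rho> (lt a) (lt a')"
proof (rule PWI[OF _ _ _ assms(1,2)])
  fix \<alpha> c \<beta> \<alpha>' c' \<beta>'
  assume q: "is_seq \<alpha>" "is_set c" "is_seq \<beta>" "is_seq \<alpha>'" "is_set c'" "is_seq \<beta>'"
    and e: "lt a = \<alpha> \<frown> lt c \<frown> \<beta>" and e': "lt a' = \<alpha>' \<frown> lt c' \<frown> \<beta>'"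
  have "\<alpha> = emp" "c = a" "\<beta> = emp" "c' = a'"
    using lt_split[OF q(1-3) assms(3) e] lt_split[OF q(4-6) assms(4) e'] by blast+
  then show "c' = (if c = v \<and> \<not> bnd v (\<pi> \<frown> \<alpha>) c (\<beta> \<frown> \<rho>) then par x else c)"
    using assms by (cases "a = v") simp_all
qed (use assms in simp_all)

lemma PW_refl:
  assumes "is_seq \<pi>" "is_seq \<rho>" "is_seq a"
    and "\<And>\<alpha> \<beta>. is_seq \<alpha> ==> is_seq \<beta> ==> a = \<alpha> \<frown> lt v \<frown> \<beta> ==> bnd v (\<pi> \<frown> \<alpha>) v (\<beta> \<frown> \<rho>)"
  shows "PW v x \<pi> \<rho> a a"
proof (rule PWI[OF assms(3,3) _ assms(1,2)])
  fix \<alpha> c \<beta> \<alpha>' c' \<beta>'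
  assume q: "is_seq \<alpha>" "is_set c" "is_seq \<beta>" "is_seq \<alpha>'" "is_set c'" "is_seq \<beta>'"
    and e: "a = \<alpha> \<frown> lt c \<frown> \<beta>" and e': "a = \<alpha>' \<frown> lt c' \<frown> \<beta>'" and D: "Dom \<alpha> = Dom \<alpha>'"
  have "lt c \<frown> \<beta> = lt c' \<frown> \<beta>'"
    using prefix_eq[OF q(1) _ q(4), of "lt c \<frown> \<beta>" "lt c' \<frown> \<beta>'"] q e e' D by simp
  then have "c' = c" using q by simp
  then show "c' = (if c = v \<and> \<not> bnd v (\<pi> \<frown> \<alpha>) c (\<beta> \<frown> \<rho>) then par x else c)"
    using assms(4)[OF q(1,3)] e by auto
qed simp

lemma PW_context:
  assumes v: "is_var v" and a: "formal_formula \<theta>" and p: "is_seq \<pi>" and r: "is_seq \<rho>"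
    and ne: "no_escape v \<pi> (\<theta> \<frown> \<rho>)" and A: "PW v x emp emp \<theta> \<theta>'"
  shows "PW v x \<pi> \<rho> \<theta> \<theta>'"
proof (rule PWI[OF _ _ _ p r])
  fix \<alpha> c \<beta> \<alpha>' c' \<beta>'
  assume q: "is_seq \<alpha>" "is_set c" "is_seq \<beta>" "is_seq \<alpha>'" "is_set c'" "is_seq \<beta>'"
    and e: "\<theta> = \<alpha> \<frown> lt c \<frown> \<beta>" and e': "\<theta>' = \<alpha>' \<frown> lt c' \<frown> \<beta>'" and D: "Dom \<alpha> = Dom \<alpha>'"
  have "c' = (if c = v \<and> \<not> bnd v (emp \<frown> \<alpha>) c (\<beta> \<frown> emp) then par x else c)"
    by (rule PWD[OF A q seq_emp seq_emp e e' D])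
  then show "c' = (if c = v \<and> \<not> bnd v (\<pi> \<frown> \<alpha>) c (\<beta> \<frown> \<rho>) then par x else c)"
    unfolding bnd_context[OF v q(2) a p r ne q(1,3) e] using q by simp
qed (use PW_seq[OF A] in simp_all)

text \<open>A free occurrence of \<open>v\<close> in the segment \<open>a\<close>, judged in the
  context \<open>\<pi>\<close>, \<open>\<rho>\<close>; like \<open>PW\<close> it decomposes along
  concatenation.\<close>

definition FR :: "'a \<Rightarrow> 'a \<Rightarrow> 'a \<Rightarrow> 'a \<Rightarrow> bool" where
  "FR v \<pi> \<rho> a \<longleftrightarrow> (\<exists>\<alpha> \<beta>. is_seq \<alpha> \<and> is_seq \<beta> \<and> a = \<alpha> \<frown> lt v \<frown> \<beta> \<and> \<not> bnd v (\<pi> \<frown> \<alpha>) v (\<beta> \<frown> \<rho>))"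

lemma FR_cat:
  assumes v: "is_set v" and p: "is_seq \<pi>" and r: "is_seq \<rho>" and a: "is_seq a" and b: "is_seq b"
  shows "FR v \<pi> \<rho> (a \<frown> b) \<longleftrightarrow> FR v \<pi> (b \<frown> \<rho>) a \<or> FR v (\<pi> \<frown> a) \<rho> b"
proof
  assume "FR v \<pi> \<rho> (a \<frown> b)"
  then obtain \<alpha> \<beta> where q: "is_seq \<alpha>" "is_seq \<beta>" and e: "a \<frown> b = \<alpha> \<frown> lt v \<frown> \<beta>" and n: "\<not> bnd v (\<pi> \<frown> \<alpha>) v (\<beta> \<frown> \<rho>)"
    unfolding FR_def by blast
  from a b q v e show "FR v \<pi> (b \<frown> \<rho>) a \<or> FR v (\<pi> \<frown> a) \<rho> b"
  proof (rule split_lt)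
    fix \<gamma> assume g: "is_seq \<gamma>" "a = \<alpha> \<frown> lt v \<frown> \<gamma>" "\<beta> = \<gamma> \<frown> b"
    then have "\<not> bnd v (\<pi> \<frown> \<alpha>) v (\<gamma> \<frown> b \<frown> \<rho>)" using n b r by simp
    then have "FR v \<pi> (b \<frown> \<rho>) a" unfolding FR_def using q(1) g(1,2) by blast
    then show ?thesis ..
  next
    fix \<delta> assume d: "is_seq \<delta>" "\<alpha> = a \<frown> \<delta>" "b = \<delta> \<frown> lt v \<frown> \<beta>"
    then have "\<not> bnd v ((\<pi> \<frown> a) \<frown> \<delta>) v (\<beta> \<frown> \<rho>)" using n p a by simp
    then have "FR v (\<pi> \<frown> a) \<rho> b" unfolding FR_def using d(1,3) q(2) by blast
    then show ?thesis ..
  qed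
next
  assume "FR v \<pi> (b \<frown> \<rho>) a \<or> FR v (\<pi> \<frown> a) \<rho> b"
  then show "FR v \<pi> \<rho> (a \<frown> b)"
  proof
    assume "FR v \<pi> (b \<frown> \<rho>) a"
    then obtain \<alpha> \<beta> where q: "is_seq \<alpha>" "is_seq \<beta>" "a = \<alpha> \<frown> lt v \<frown> \<beta>" "\<not> bnd v (\<pi> \<frown> \<alpha>) v (\<beta> \<frown> b \<frown> \<rho>)"
      unfolding FR_def by blast
    then have "a \<frown> b = \<alpha> \<frown> lt v \<frown> (\<beta> \<frown> b)" "\<not> bnd v (\<pi> \<frown> \<alpha>) v ((\<beta> \<frown> b) \<frown> \<rho>)" "is_seq (\<beta> \<frown> b)"
      using b r v by simp_all
    then show ?thesis unfolding FR_def using q(1) by blast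
  next
    assume "FR v (\<pi> \<frown> a) \<rho> b"
    then obtain \<alpha> \<beta> where q: "is_seq \<alpha>" "is_seq \<beta>" "b = \<alpha> \<frown> lt v \<frown> \<beta>" "\<not> bnd v ((\<pi> \<frown> a) \<frown> \<alpha>) v (\<beta> \<frown> \<rho>)"
      unfolding FR_def by blast
    then have "a \<frown> b = (a \<frown> \<alpha>) \<frown> lt v \<frown> \<beta>" "\<not> bnd v (\<pi> \<frown> a \<frown> \<alpha>) v (\<beta> \<frown> \<rho>)" "is_seq (a \<frown> \<alpha>)"
      using a p v by simp_all
    then show ?thesis unfolding FR_def using q(2) by blast
  qed
qed

lemma FR_lt:
  assumes "is_set v" "is_set a" "is_seq \<pi>" "is_seq \<rho>" shows "FR v \<pi> \<rho> (lt a) \<longleftrightarrow> a = v \<and> \<not> bnd v \<pi> v \<rho>"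
proof
  assume "FR v \<pi> \<rho> (lt a)"
  then obtain \<alpha> \<beta> where q: "is_seq \<alpha>" "is_seq \<beta>" "lt a = \<alpha> \<frown> lt v \<frown> \<beta>" "\<not> bnd v (\<pi> \<frown> \<alpha>) v (\<beta> \<frown> \<rho>)"
    unfolding FR_def by blast
  with lt_split[OF q(1) assms(1) q(2) assms(2) q(3)] assms show "a = v \<and> \<not> bnd v \<pi> v \<rho>" by simp
next
  assume *: "a = v \<and> \<not> bnd v \<pi> v \<rho>"
  show "FR v \<pi> \<rho> (lt a)" unfolding FR_def
    by (rule exI[of _ emp], rule exI[of _ emp]) (use * assms in simp)
qed

lemma FR_context:
  assumes v: "is_var v" and a: "formal_formula \<theta>" and p: "is_seq \<pi>" and r: "is_seq \<rho>"
    and ne: "no_escape v \<pi> (\<theta> \<frown> \<rho>)"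
  shows "FR v \<pi> \<rho> \<theta> \<longleftrightarrow> FR v emp emp \<theta>"
proof -
  have "bnd v (\<pi> \<frown> \<alpha>) v (\<beta> \<frown> \<rho>) \<longleftrightarrow> bnd v (emp \<frown> \<alpha>) v (\<beta> \<frown> emp)" if "is_seq \<alpha>" "is_seq \<beta>" "\<theta> = \<alpha> \<frown> lt v \<frown> \<beta>" for \<alpha> \<beta>
    using bnd_context[OF v is_var_set[OF v] a p r ne that] that by simp
  then show ?thesis unfolding FR_def by metis
qed

section \<open>Connectives as contexts from which no quantifier escapes\<close>

lemma no_escape_lt:
  assumes c: "is_set c" "c \<noteq> sym_code 4" and v: "is_var v" and w: "is_seq w" shows "no_escape v (lt c) w"
  unfolding no_escape_def
proof (intro allI impI)
  fix \<chi> \<alpha> \<beta> assume ch: "formal_formula \<chi>" and q: "is_seq \<alpha>" "is_seq \<beta>" and e: "lt c \<frown> w = \<alpha> \<frown> fEx v \<chi> \<frown> \<beta>"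
    and D: "Dom \<alpha> \<in>\<^sub>c Dom (lt c)"
  have "\<alpha> = emp" using D c q Dom_eq_emp[of \<alpha>] by (simp add: mem_suc)
  then have "lt c \<frown> w = lt (sym_code 4) \<frown> (lt v \<frown> \<chi> \<frown> \<beta>)" using e ch v q by (simp add: fEx_word ff_seq is_var_set)
  then have False using c w q v ch by (simp add: ff_seq is_var_set)
  then show "Dom (\<alpha> \<frown> fEx v \<chi>) \<in>\<^sub>c suc (Dom (lt c))" ..
qed

text \<open>The leading symbol is not a quantifier, and a block that starts in the first disjunct
  ends in it by \<open>ff_inside\<close>.\<close>

lemma no_escape_Or:
  assumes v: "is_var v" and a: "formal_formula a" and b: "is_seq b" shows "no_escape v (lt (sym_code 3) \<frown> a) b"
  unfolding no_escape_def
proof (intro allI impI)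
  fix \<chi> \<alpha> \<beta> assume ch: "formal_formula \<chi>" and q: "is_seq \<alpha>" "is_seq \<beta>"
    and e: "(lt (sym_code 3) \<frown> a) \<frown> b = \<alpha> \<frown> fEx v \<chi> \<frown> \<beta>" and D: "Dom \<alpha> \<in>\<^sub>c Dom (lt (sym_code 3) \<frown> a)"
  note as = ff_seq[OF a] and E = ff_seq[OF ff_Ex[OF v ch]]
  from q(1) show "Dom (\<alpha> \<frown> fEx v \<chi>) \<in>\<^sub>c suc (Dom (lt (sym_code 3) \<frown> a))"
  proof (cases rule: cons_cases)
    case 1
    then have "lt (sym_code 3) \<frown> a \<frown> b = lt (sym_code 4) \<frown> (lt v \<frown> \<chi> \<frown> \<beta>)"
      using e ch v q as b by (simp add: fEx_word ff_seq is_var_set)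
    then have False using as b q v ch by (simp add: ff_seq is_var_set)
    then show ?thesis ..
  next
    case (2 d \<alpha>')
    then have "lt (sym_code 3) \<frown> a \<frown> b = lt d \<frown> (\<alpha>' \<frown> fEx v \<chi> \<frown> \<beta>)" using e as b q E by simp
    then have d: "d = sym_code 3" and e': "a \<frown> b = \<alpha>' \<frown> fEx v \<chi> \<frown> \<beta>" using 2 as b q E by simp_all
    have "Dom \<alpha>' \<in>\<^sub>c Dom a"
    proof -
      have "Dom \<alpha>' \<noteq> Dom a" 
      proof
        assume "Dom \<alpha>' = Dom a"
        then have "Dom (lt d \<frown> \<alpha>') = Dom (lt (sym_code 3) \<frown> a)" using 2 d as by (rule_tac Dom_cat_cong) simp_all
        then show False using D 2(3) by simp
      qed
      moreover have "\<not> Dom a \<in>\<^sub>c Dom \<alpha>'"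
      proof
        assume "Dom a \<in>\<^sub>c Dom \<alpha>'"
        with 2(2) obtain \<epsilon> \<zeta> where ez: "is_seq \<epsilon>" "is_set (ap \<alpha>' (Dom a))" "is_seq \<zeta>" "\<alpha>' = \<epsilon> \<frown> lt (ap \<alpha>' (Dom a)) \<frown> \<zeta>" "Dom \<epsilon> = Dom a"
          by (rule position)
        have 1: "\<alpha> = (lt (sym_code 3) \<frown> \<epsilon>) \<frown> (lt (ap \<alpha>' (Dom a)) \<frown> \<zeta>)"
          unfolding 2(3) d by (subst ez(4)) (use ez in simp)
        have "Dom (lt (sym_code 3) \<frown> \<epsilon>) = Dom (lt (sym_code 3) \<frown> a)" using ez as by (rule_tac Dom_cat_cong) simp_all
        moreover have "Dom (lt (sym_code 3) \<frown> \<epsilon>) \<in>\<^sub>c Dom \<alpha>"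
          using Dom_prefix_lt[of "lt (sym_code 3) \<frown> \<epsilon>" "ap \<alpha>' (Dom a)" \<zeta>] ez 1 by simp
        ultimately show False using D mem_asym by metis
      qed
      ultimately show ?thesis using nat_linear[OF seq_Dom[OF 2(2)] seq_Dom[OF as]] by blast
    qed
    from a b v ch 2(2) q(2) e' this obtain \<delta> where "is_seq \<delta>" "a = \<alpha>' \<frown> fEx v \<chi> \<frown> \<delta>" by (rule ff_inside)
    then have "lt (sym_code 3) \<frown> a = (\<alpha> \<frown> fEx v \<chi>) \<frown> \<delta>" using 2 d E by simp
    then show ?thesis using Dom_prefix[OF cat_seq[OF q(1) E] \<open>is_seq \<delta>\<close>] by simp
  qed
qed

text \<open>The only quantifier symbol in the prefix is followed by \<open>w\<close>, so it does not
  start a block for the different variable \<open>v\<close>.\<close>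

lemma no_escape_Ex:
  assumes v: "is_var v" and w: "is_var w" and vw: "v \<noteq> w" and a: "is_seq a" shows "no_escape v (lt (sym_code 4) \<frown> lt w) a"
  unfolding no_escape_def
proof (intro allI impI)
  fix \<chi> \<alpha> \<beta> assume ch: "formal_formula \<chi>" and q: "is_seq \<alpha>" "is_seq \<beta>"
    and e: "(lt (sym_code 4) \<frown> lt w) \<frown> a = \<alpha> \<frown> fEx v \<chi> \<frown> \<beta>" and D: "Dom \<alpha> \<in>\<^sub>c Dom (lt (sym_code 4) \<frown> lt w)"
  note sets = is_var_set[OF v] is_var_set[OF w] ff_seq[OF ch]
  from q(1) have False
  proof (cases rule: cons_cases)
    case 1
    then have "lt (sym_code 4) \<frown> lt w \<frown> a = lt (sym_code 4) \<frown> lt v \<frown> (\<chi> \<frown> \<beta>)"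
      using e q a sets by (simp add: fEx_word)
    then show ?thesis using vw a q sets by simp
  next
    case (2 d \<alpha>')
    have e1: "lt (sym_code 4) \<frown> lt w \<frown> a = lt d \<frown> (\<alpha>' \<frown> lt (sym_code 4) \<frown> lt v \<frown> \<chi> \<frown> \<beta>)"
      using e 2 q a sets by (simp add: fEx_word)
    then have e2: "lt w \<frown> a = \<alpha>' \<frown> lt (sym_code 4) \<frown> lt v \<frown> \<chi> \<frown> \<beta>" using 2 a q sets by simp
    from 2(2) show ?thesis
    proof (cases rule: cons_cases)
      case 1
      then show ?thesis using e2 a q sets is_var_neq(1)[OF w] by simp
    next
      case (2 d' \<alpha>'')
      have "Dom (lt (sym_code 4) \<frown> lt w) \<in>\<^sub>c suc (Dom ((lt d \<frown> lt d') \<frown> \<alpha>''))"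
        using Dom_prefix[of "lt d \<frown> lt d'" \<alpha>''] Dom_cat_cong[of "lt (sym_code 4)" "lt d" "lt w" "lt d'"] 2 \<open>is_set d\<close> sets by simp
      moreover have "(lt d \<frown> lt d') \<frown> \<alpha>'' = \<alpha>" using 2 \<open>\<alpha> = lt d \<frown> \<alpha>'\<close> \<open>is_set d\<close> by simp
      ultimately show ?thesis using D mem_asym mem_irrefl q(1) by (metis mem_suc Dom_set)
    qed
  qed
  then show "Dom (\<alpha> \<frown> fEx v \<chi>) \<in>\<^sub>c suc (Dom (lt (sym_code 4) \<frown> lt w))" ..
qed


subsection \<open>Substitution\<close>

abbreviation PW0 :: "'a \<Rightarrow> 'a \<Rightarrow> 'a \<Rightarrow> 'a \<Rightarrow> bool" where
  "PW0 v x \<equiv> PW v x emp emp"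

abbreviation repl :: "'a \<Rightarrow> 'a \<Rightarrow> 'a \<Rightarrow> 'a" where
  "repl v x a \<equiv> (if a = v then par x else a)"

lemma PW0_atom:
  assumes v: "is_var v" and a: "is_term a" and b: "is_term b" and k: "k \<noteq> 4"
  shows "PW0 v x (lt (sym_code k) \<frown> lt a \<frown> lt b) (lt (sym_code k) \<frown> lt (repl v x a) \<frown> lt (repl v x b))"
proof -
  note s = is_var_set[OF v] is_term_set[OF a] is_term_set[OF b]
  note n = is_term_neq(2)[OF a] is_term_neq(2)[OF b] is_var_neq[OF v]
  let ?k = "lt (sym_code k)"
  have nb: "\<not> bnd v \<alpha> c \<beta>" if "is_set c" "\<alpha> \<frown> lt c \<frown> \<beta> = ?k \<frown> lt a \<frown> lt b" for \<alpha> c \<beta>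
  proof
    assume "bnd v \<alpha> c \<beta>"
    from bnd_occ[OF this v that(1)] have "occ (sym_code 4) (?k \<frown> lt a \<frown> lt b)" unfolding that(2) .
    then show False using s n k by simp
  qed
  have 1: "PW v x emp ((lt a \<frown> lt b) \<frown> emp) ?k ?k"
    by (rule PW_lt) (use s n in simp_all)
  have 2: "PW v x ?k (lt b \<frown> emp) (lt a) (lt (repl v x a))"
    by (rule PW_lt) (use s nb[of a ?k "lt b"] in auto)
  have 3: "PW v x (?k \<frown> lt a) emp (lt b) (lt (repl v x b))"
    by (rule PW_lt) (use s nb[of b "?k \<frown> lt a" emp] in auto)
  have "PW v x ?k emp (lt a \<frown> lt b) (lt (repl v x a) \<frown> lt (repl v x b))"
    by (rule PW_cat[OF _ _ 2 3]) simp_all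
  then show ?thesis by (intro PW_cat[OF seq_emp seq_emp 1]) simp
qed

lemma PW0_Neg:
  assumes v: "is_var v" and a: "formal_formula \<phi>" and A: "PW0 v x \<phi> \<phi>'"
  shows "PW0 v x (fNeg \<phi>) (fNeg \<phi>')"
proof -
  have s: "is_seq \<phi>" "is_seq \<phi>'" using PW_seq[OF A] by blast+
  have 1: "PW v x emp (\<phi> \<frown> emp) (lt (sym_code 2)) (lt (sym_code 2))"
    by (rule PW_lt) (use s is_var_neq[OF v] in simp_all)
  have "PW v x (lt (sym_code 2)) emp \<phi> \<phi>'"
    by (rule PW_context[OF v a _ _ no_escape_lt A]) (use s v in simp_all)
  then show ?thesis unfolding fNeg_word[OF s(1)] fNeg_word[OF s(2)] by (intro PW_cat[OF seq_emp seq_emp 1]) simp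
qed

lemma PW0_Or:
  assumes v: "is_var v" and a: "formal_formula \<phi>" and b: "formal_formula \<psi>" and A: "PW0 v x \<phi> \<phi>'" and B: "PW0 v x \<psi> \<psi>'"
  shows "PW0 v x (fOr \<phi> \<psi>) (fOr \<phi>' \<psi>')"
proof -
  have s: "is_seq \<phi>" "is_seq \<phi>'" "is_seq \<psi>" "is_seq \<psi>'" using PW_seq[OF A] PW_seq[OF B] by blast+
  have 1: "PW v x emp ((\<phi> \<frown> \<psi>) \<frown> emp) (lt (sym_code 3)) (lt (sym_code 3))"
    by (rule PW_lt) (use s is_var_neq[OF v] in simp_all)
  have 2: "PW v x (lt (sym_code 3)) (\<psi> \<frown> emp) \<phi> \<phi>'"
    by (rule PW_context[OF v a _ _ no_escape_lt A]) (use s v in simp_all)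
  have "PW v x (lt (sym_code 3) \<frown> \<phi>) emp \<psi> \<psi>'"
    by (rule PW_context[OF v b _ _ no_escape_Or[OF v a] B]) (use s v in simp_all)
  then have "PW v x (lt (sym_code 3)) emp (\<phi> \<frown> \<psi>) (\<phi>' \<frown> \<psi>')" by (intro PW_cat[OF _ seq_emp 2]) simp_all
  then show ?thesis unfolding fOr_word[OF s(1,3)] fOr_word[OF s(2,4)] by (intro PW_cat[OF seq_emp seq_emp 1]) simp
qed

lemma PW0_Ex:
  assumes v: "is_var v" and w: "is_var w" and ne: "v \<noteq> w" and a: "formal_formula \<phi>" and A: "PW0 v x \<phi> \<phi>'"
  shows "PW0 v x (fEx w \<phi>) (fEx w \<phi>')"
proof -
  have s: "is_seq \<phi>" "is_seq \<phi>'" using PW_seq[OF A] by blast+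
  note ws = is_var_set[OF w]
  have 1: "PW v x emp ((lt w \<frown> \<phi>) \<frown> emp) (lt (sym_code 4)) (lt (sym_code 4))"
    by (rule PW_lt) (use s ws is_var_neq[OF v] in simp_all)
  have 2: "PW v x (lt (sym_code 4)) (\<phi> \<frown> emp) (lt w) (lt w)"
    by (rule PW_lt) (use s ws ne in auto)
  have "PW v x (lt (sym_code 4) \<frown> lt w) emp \<phi> \<phi>'"
    by (rule PW_context[OF v a _ _ no_escape_Ex[OF v w ne] A]) (use s ws in simp_all)
  then have "PW v x (lt (sym_code 4)) emp (lt w \<frown> \<phi>) (lt w \<frown> \<phi>')" by (intro PW_cat[OF _ seq_emp 2]) simp_all
  then show ?thesis unfolding fEx_word[OF ws s(1)] fEx_word[OF ws s(2)] by (intro PW_cat[OF seq_emp seq_emp 1]) simp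
qed

text \<open>Every occurrence of \<open>v\<close> lies inside the block and is bound, so the formula
  is merely copied.\<close>

lemma PW0_Ex_same:
  assumes v: "is_var v" and a: "formal_formula \<phi>" shows "PW0 v x (fEx v \<phi>) (fEx v \<phi>)"
  by (rule PW_refl) (use bnd_Ex[OF v a _ _ is_var_set[OF v]] ff_seq[OF ff_Ex[OF v a]] in auto)

lemma dfn_PW0 [dfn_intros]:
  assumes "dft b t" "dft b u" "is_set v" "is_set x" shows "dfn b (\<lambda>s. PW0 v x (t s) (u s))"
proof (rule dfn_comp2[where P = "PW0 v x", OF _ assms(1,2)])
  show "dfn b (\<lambda>s. PW0 v x (s 0) (s (Suc 0)))"
    unfolding PW_def by (intro dfn_intros dft_const_set assms)
qed

text \<open>The description in \<open>subst\<close> presupposes a result that is a set. It is built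
  along the formula, which shows at the same time that the result is again a formula.\<close>

lemma PW0_exists:
  assumes "formal_formula \<theta>" and v: "is_var v" and x: "is_set x"
  shows "\<exists>\<theta>'. is_set \<theta>' \<and> formal_formula \<theta>' \<and> PW0 v x \<theta> \<theta>'"
proof (rule ff_induct[where b = False and Q = "\<lambda>\<theta>. \<exists>\<theta>'. is_set \<theta>' \<and> formal_formula \<theta>' \<and> PW0 v x \<theta> \<theta>'"])
  show "dfn False (\<lambda>s. \<exists>\<theta>'. is_set \<theta>' \<and> formal_formula \<theta>' \<and> PW0 v x (s 0) \<theta>')"
    by (intro dfn_intros is_var_set v x)
next
  fix a b assume ab: "is_term a" "is_term b"
  have r: "is_term (repl v x a)" "is_term (repl v x b)" using ab x is_term_par by auto
  note s = is_term_set[OF ab(1)] is_term_set[OF ab(2)] is_term_set[OF r(1)] is_term_set[OF r(2)]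
  have "PW0 v x (fEq a b) (fEq (repl v x a) (repl v x b))"
    using PW0_atom[OF v ab, of 0 x] unfolding fEq_word[OF s(1,2)] fEq_word[OF s(3,4)] by simp
  then show "\<exists>\<theta>'. is_set \<theta>' \<and> formal_formula \<theta>' \<and> PW0 v x (fEq a b) \<theta>'"
    using ff_atom(1)[OF r] ff_set by blast
  have "PW0 v x (fMem a b) (fMem (repl v x a) (repl v x b))"
    using PW0_atom[OF v ab, of 1 x] unfolding fMem_word[OF s(1,2)] fMem_word[OF s(3,4)] by simp
  then show "\<exists>\<theta>'. is_set \<theta>' \<and> formal_formula \<theta>' \<and> PW0 v x (fMem a b) \<theta>'"
    using ff_atom(2)[OF r] ff_set by blast
next
  fix \<phi> assume p: "formal_formula \<phi>" and "\<exists>\<theta>'. is_set \<theta>' \<and> formal_formula \<theta>' \<and> PW0 v x \<phi> \<theta>'"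
  then show "\<exists>\<theta>'. is_set \<theta>' \<and> formal_formula \<theta>' \<and> PW0 v x (fNeg \<phi>) \<theta>'"
    using PW0_Neg[OF v p] ff_Neg ff_set by blast
next
  fix \<phi> \<psi> assume p: "formal_formula \<phi>" "formal_formula \<psi>" and "\<exists>\<theta>'. is_set \<theta>' \<and> formal_formula \<theta>' \<and> PW0 v x \<phi> \<theta>'"
    "\<exists>\<theta>'. is_set \<theta>' \<and> formal_formula \<theta>' \<and> PW0 v x \<psi> \<theta>'"
  then show "\<exists>\<theta>'. is_set \<theta>' \<and> formal_formula \<theta>' \<and> PW0 v x (fOr \<phi> \<psi>) \<theta>'"
  proof (elim exE conjE)
    fix \<phi>' \<psi>' assume "formal_formula \<phi>'" "PW0 v x \<phi> \<phi>'" "formal_formula \<psi>'" "PW0 v x \<psi> \<psi>'"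
    then have "formal_formula (fOr \<phi>' \<psi>')" "PW0 v x (fOr \<phi> \<psi>) (fOr \<phi>' \<psi>')" using PW0_Or[OF v p] ff_Or by simp_all
    then show ?thesis using ff_set by blast
  qed
next
  fix w \<phi> assume w: "is_var w" and p: "formal_formula \<phi>" and IH: "\<exists>\<theta>'. is_set \<theta>' \<and> formal_formula \<theta>' \<and> PW0 v x \<phi> \<theta>'"
  show "\<exists>\<theta>'. is_set \<theta>' \<and> formal_formula \<theta>' \<and> PW0 v x (fEx w \<phi>) \<theta>'"
  proof (cases "v = w")
    case True
    then show ?thesis using PW0_Ex_same[OF v p] ff_Ex[OF v p] ff_set by blast
  next
    case False
    from IH obtain \<phi>' where "formal_formula \<phi>'" "PW0 v x \<phi> \<phi>'" by blast
    then have "formal_formula (fEx w \<phi>')" "PW0 v x (fEx w \<phi>) (fEx w \<phi>')" using PW0_Ex[OF v w False p] ff_Ex[OF w] by simp_all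
    then show ?thesis using ff_set by blast
  qed
qed (use assms in simp_all)

text \<open>Reduces computations of \<open>subst\<close> to the compositional relation; the
  commutation rules below follow from the corresponding facts about \<open>PW0\<close>.\<close>

lemma subst_eqI:
  assumes v: "is_var v" and A: "PW0 v x \<theta> \<theta>'" shows "subst \<theta> v x = \<theta>'"
proof -
  have t: "is_seq \<theta>" "is_seq \<theta>'" "Dom \<theta> = Dom \<theta>'" using PW_seq[OF A] by blast+
  have val: "ap \<theta>' i = (if free_at \<theta> v i then par x else ap \<theta> i)" if i: "i \<in>\<^sub>c Dom \<theta>" for i
  proof -
    let ?c = "ap \<theta> i" and ?c' = "ap \<theta>' i"
    from t(1) i obtain \<alpha> \<beta> where p: "is_seq \<alpha>" "is_set ?c" "is_seq \<beta>" "\<theta> = \<alpha> \<frown> lt ?c \<frown> \<beta>" "Dom \<alpha> = i"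
      by (rule position)
    from t(2) i[unfolded t(3)] obtain \<alpha>' \<beta>' where p': "is_seq \<alpha>'" "is_set ?c'" "is_seq \<beta>'" "\<theta>' = \<alpha>' \<frown> lt ?c' \<frown> \<beta>'" "Dom \<alpha>' = i"
      by (rule position)
    have "?c' = (if ?c = v \<and> \<not> bnd v (emp \<frown> \<alpha>) ?c (\<beta> \<frown> emp) then par x else ?c)"
      by (rule PWD[OF A p(1-3) p'(1-3) seq_emp seq_emp p(4) p'(4)]) (simp add: p(5) p'(5))
    moreover have "bound_at \<theta> v i \<longleftrightarrow> bnd v \<alpha> ?c \<beta>"
      using bound_at_iff[OF v p(2,1,3)] p(4,5) by metis
    ultimately show ?thesis unfolding free_at_def using i p by simp
  qed
  show ?thesis unfolding subst_def
  proof (rule the_equality)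
    show "is_seq \<theta>' \<and> Dom \<theta>' = Dom \<theta> \<and> (\<forall>i. i \<in>\<^sub>c Dom \<theta> --> ap \<theta>' i = (if free_at \<theta> v i then par x else ap \<theta> i))"
      using t val by simp
    fix r assume r: "is_seq r \<and> Dom r = Dom \<theta> \<and> (\<forall>i. i \<in>\<^sub>c Dom \<theta> --> ap r i = (if free_at \<theta> v i then par x else ap \<theta> i))"
    show "r = \<theta>'"
      by (rule seq_ext[OF _ t(2)]) (use r t val in simp_all)
  qed
qed

context
  fixes v x assumes v: "is_var v" and x: "is_set x"
begin

lemma subst_PW0: "formal_formula \<theta> ==> formal_formula (subst \<theta> v x) \<and> PW0 v x \<theta> (subst \<theta> v x)"
  using PW0_exists[OF _ v x, of \<theta>] subst_eqI[OF v] by blast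

lemma subst_ff [simp]: "formal_formula \<theta> ==> formal_formula (subst \<theta> v x)"
  using subst_PW0 by blast

lemma Dom_subst: "formal_formula \<theta> ==> Dom (subst \<theta> v x) = Dom \<theta>"
  using subst_PW0 PW_seq by metis

lemma subst_Eq: "is_term a ==> is_term b ==> subst (fEq a b) v x = fEq (repl v x a) (repl v x b)"
proof (rule subst_eqI[OF v])
  assume ab: "is_term a" "is_term b"
  have r: "is_term (repl v x a)" "is_term (repl v x b)" using ab x is_term_par by auto
  note s = is_term_set[OF ab(1)] is_term_set[OF ab(2)] is_term_set[OF r(1)] is_term_set[OF r(2)]
  show "PW0 v x (fEq a b) (fEq (repl v x a) (repl v x b))"
    using PW0_atom[OF v ab, of 0 x] unfolding fEq_word[OF s(1,2)] fEq_word[OF s(3,4)] by simp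
qed

lemma subst_Mem: "is_term a ==> is_term b ==> subst (fMem a b) v x = fMem (repl v x a) (repl v x b)"
proof (rule subst_eqI[OF v])
  assume ab: "is_term a" "is_term b"
  have r: "is_term (repl v x a)" "is_term (repl v x b)" using ab x is_term_par by auto
  note s = is_term_set[OF ab(1)] is_term_set[OF ab(2)] is_term_set[OF r(1)] is_term_set[OF r(2)]
  show "PW0 v x (fMem a b) (fMem (repl v x a) (repl v x b))"
    using PW0_atom[OF v ab, of 1 x] unfolding fMem_word[OF s(1,2)] fMem_word[OF s(3,4)] by simp
qed

lemma subst_Neg: "formal_formula \<phi> ==> subst (fNeg \<phi>) v x = fNeg (subst \<phi> v x)"
  by (rule subst_eqI[OF v PW0_Neg[OF v]]) (simp_all add: subst_PW0)

lemma subst_Or: "formal_formula \<phi> ==> formal_formula \<psi> ==> subst (fOr \<phi> \<psi>) v x = fOr (subst \<phi> v x) (subst \<psi> v x)"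
  by (rule subst_eqI[OF v PW0_Or[OF v]]) (simp_all add: subst_PW0)

lemma subst_Ex: "is_var w ==> formal_formula \<phi> ==> subst (fEx w \<phi>) v x = (if w = v then fEx w \<phi> else fEx w (subst \<phi> v x))"
proof (cases "w = v")
  case True
  assume "formal_formula \<phi>"
  then show ?thesis using True subst_eqI[OF v PW0_Ex_same[OF v]] by simp
next
  case False
  assume "is_var w" "formal_formula \<phi>"
  then have "subst (fEx w \<phi>) v x = fEx w (subst \<phi> v x)"
    by (intro subst_eqI[OF v PW0_Ex[OF v]]) (use False in \<open>simp_all add: subst_PW0\<close>)
  then show ?thesis using False by simp
qed

lemma occ_subst:
  assumes "formal_formula \<theta>" "is_set y" "occ (par y) (subst \<theta> v x)" shows "y = x \<or> occ (par y) \<theta>"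
proof -
  note A = conjunct2[OF subst_PW0[OF assms(1)]]
  have t: "is_seq \<theta>" "is_seq (subst \<theta> v x)" "Dom \<theta> = Dom (subst \<theta> v x)" using PW_seq[OF A] by blast+
  obtain i where i: "i \<in>\<^sub>c Dom \<theta>" "ap (subst \<theta> v x) i = par y" using assms(3) occ_ap[OF t(2)] t(3) by auto
  from t(1) i(1) obtain \<alpha> \<beta> where p: "is_seq \<alpha>" "is_set (ap \<theta> i)" "is_seq \<beta>" "\<theta> = \<alpha> \<frown> lt (ap \<theta> i) \<frown> \<beta>" "Dom \<alpha> = i"
    by (rule position)
  from t(2) i(1)[unfolded t(3)] obtain \<alpha>' \<beta>' where p': "is_seq \<alpha>'" "is_set (ap (subst \<theta> v x) i)" "is_seq \<beta>'"
      "subst \<theta> v x = \<alpha>' \<frown> lt (ap (subst \<theta> v x) i) \<frown> \<beta>'" "Dom \<alpha>' = i"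
    by (rule position)
  have "ap (subst \<theta> v x) i = (if ap \<theta> i = v \<and> \<not> bnd v (emp \<frown> \<alpha>) (ap \<theta> i) (\<beta> \<frown> emp) then par x else ap \<theta> i)"
    by (rule PWD[OF A p(1-3) p'(1-3) seq_emp seq_emp p(4) p'(4)]) (simp add: p(5) p'(5))
  then have "par y = par x \<or> ap \<theta> i = par y" using i(2) by (auto split: if_splits)
  then show ?thesis using assms(2) x i(1) occ_ap[OF t(1)] by auto
qed

end

definition substx :: "'a \<Rightarrow> 'a \<Rightarrow> 'a \<Rightarrow> 'a" where
  "substx \<theta> v x = (if formal_formula \<theta> \<and> is_var v \<and> is_set x then subst \<theta> v x else emp)"

lemma dfn_PW0_vars:
  "dfn b (\<lambda>s. PW0 (s i) (s j) (s k) (s l))"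
  unfolding PW_def by (intro dfn_intros)

lemma dft_substx [dfn_intros]:
  "dft b t ==> dft b u ==> dft b w ==> dft b (\<lambda>s. substx (t s) (u s) (w s))"
proof (rule dft_comp3[where F = substx])
  let ?t = "\<lambda>s :: nat \<Rightarrow> 'a. substx (s 0) (s (Suc 0)) (s (Suc (Suc 0)))"
  show "dft b ?t"
  proof (rule dft_rel)
    show "?t s \<in> dm b" for s using ff_set by (simp add: substx_def dm_def)
    let ?G = "\<lambda>\<theta> v x y. formal_formula \<theta> \<and> is_var v \<and> is_set x \<and> PW0 v x \<theta> y \<or> \<not> (formal_formula \<theta> \<and> is_var v \<and> is_set x) \<and> y = emp"
    show "dfn b (\<lambda>s. ?G (s (Suc 0)) (s (Suc (Suc 0))) (s (Suc (Suc (Suc 0)))) (s 0))"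
      by (intro dfn_intros dfn_PW0_vars)
    show "?G (s 0) (s (Suc 0)) (s (Suc (Suc 0))) y \<longleftrightarrow> y = ?t s" for s y
    proof (cases "formal_formula (s 0) \<and> is_var (s (Suc 0)) \<and> is_set (s (Suc (Suc 0)))")
      case True
      then have "PW0 (s (Suc 0)) (s (Suc (Suc 0))) (s 0) y \<longleftrightarrow> y = subst (s 0) (s (Suc 0)) (s (Suc (Suc 0)))"
        using subst_PW0[of "s (Suc 0)" "s (Suc (Suc 0))" "s 0"] subst_eqI[of "s (Suc 0)" "s (Suc (Suc 0))" "s 0" y] by metis
      then show ?thesis using True by (simp add: substx_def)
    qed (unfold substx_def, auto)
  qed
qed


subsection \<open>Free variables\<close>

definition frx :: "'a \<Rightarrow> 'a \<Rightarrow> bool" where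
  "frx v \<theta> \<longleftrightarrow> (\<exists>\<alpha>. is_set \<alpha> \<and> is_seq \<alpha> \<and> (\<exists>\<beta>. is_set \<beta> \<and> is_seq \<beta> \<and> \<theta> = catx \<alpha> (catx (lt v) \<beta>) \<and> \<not> bnd v \<alpha> v \<beta>))"

lemma dfn_frx [dfn_intros]: "dft b t ==> dft b u ==> dfn b (\<lambda>s. frx (t s) (u s))"
  by (rule dfn_comp2[where P = frx]) (unfold frx_def, intro dfn_intros)

lemma FR_frx: "is_set v ==> FR v emp emp \<theta> \<longleftrightarrow> frx v \<theta>"
proof
  assume v: "is_set v" and "FR v emp emp \<theta>"
  then obtain \<alpha> \<beta> where "is_seq \<alpha>" "is_seq \<beta>" "\<theta> = catx \<alpha> (catx (lt v) \<beta>)" "\<not> bnd v \<alpha> v \<beta>"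
    unfolding FR_def by auto
  then show "frx v \<theta>" unfolding frx_def using seq_is_set by blast
next
  assume v: "is_set v" and "frx v \<theta>"
  then obtain \<alpha> \<beta> where *: "is_seq \<alpha>" "is_seq \<beta>" "\<theta> = catx \<alpha> (catx (lt v) \<beta>)" "\<not> bnd v \<alpha> v \<beta>"
    unfolding frx_def by blast
  then have "\<theta> = \<alpha> \<frown> lt v \<frown> \<beta>" "\<not> bnd v (emp \<frown> \<alpha>) v (\<beta> \<frown> emp)" using v by simp_all
  then show "FR v emp emp \<theta>" unfolding FR_def using * by blast
qed

lemma free_in_FR:
  assumes v: "is_var v" and t: "is_seq \<theta>" shows "free_in v \<theta> \<longleftrightarrow> FR v emp emp \<theta>"
proof
  assume "free_in v \<theta>"
  then obtain i where i: "i \<in>\<^sub>c Dom \<theta>" "ap \<theta> i = v" "\<not> bound_at \<theta> v i" unfolding free_in_def free_at_def by blast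
  from t i(1) obtain \<alpha> \<beta> where p: "is_seq \<alpha>" "is_set (ap \<theta> i)" "is_seq \<beta>" "\<theta> = \<alpha> \<frown> lt (ap \<theta> i) \<frown> \<beta>" "Dom \<alpha> = i"
    by (rule position)
  then have "\<not> bnd v \<alpha> v \<beta>" using bound_at_iff[OF v p(2,1,3)] i by metis
  then have "\<not> bnd v (emp \<frown> \<alpha>) v (\<beta> \<frown> emp)" using p by simp
  then show "FR v emp emp \<theta>" unfolding FR_def using p i(2) by metis
next
  assume "FR v emp emp \<theta>"
  then obtain \<alpha> \<beta> where p: "is_seq \<alpha>" "is_seq \<beta>" "\<theta> = \<alpha> \<frown> lt v \<frown> \<beta>" "\<not> bnd v (emp \<frown> \<alpha>) v (\<beta> \<frown> emp)"
    unfolding FR_def by blast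
  note vs = is_var_set[OF v]
  have "\<not> bnd v \<alpha> v \<beta>" using p by simp
  then have "\<not> bound_at \<theta> v (Dom \<alpha>)" using bound_at_iff[OF v vs p(1,2)] p(3) by metis
  moreover have "Dom \<alpha> \<in>\<^sub>c Dom \<theta>" "ap \<theta> (Dom \<alpha>) = v" using p vs Dom_prefix_lt[OF p(1) vs p(2)] by simp_all
  ultimately show "free_in v \<theta>" unfolding free_in_def free_at_def by blast
qed

context
  fixes v assumes v: "is_var v"
begin

lemma free_in_atom_word:
  assumes a: "is_term a" and b: "is_term b" and k: "k \<noteq> 4"
  shows "FR v emp emp (lt (sym_code k) \<frown> lt a \<frown> lt b) \<longleftrightarrow> v = a \<or> v = b"
proof -
  note s = is_var_set[OF v] is_term_set[OF a] is_term_set[OF b]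
  note n = is_term_neq(2)[OF a] is_term_neq(2)[OF b] is_var_neq[OF v]
  let ?k = "lt (sym_code k)"
  have nb: "\<not> bnd v \<alpha> c \<beta>" if "is_set c" "\<alpha> \<frown> lt c \<frown> \<beta> = ?k \<frown> lt a \<frown> lt b" for \<alpha> c \<beta>
  proof
    assume "bnd v \<alpha> c \<beta>"
    from bnd_occ[OF this v that(1)] have "occ (sym_code 4) (?k \<frown> lt a \<frown> lt b)" unfolding that(2) .
    then show False using s n k by simp
  qed
  have "FR v emp emp (?k \<frown> lt a \<frown> lt b) \<longleftrightarrow> FR v emp (lt a \<frown> lt b) ?k \<or> FR v ?k (lt b) (lt a) \<or> FR v (?k \<frown> lt a) emp (lt b)"
    using s by (simp add: FR_cat)
  then show ?thesis using s n nb[of a ?k "lt b"] nb[of b "?k \<frown> lt a" emp] by (auto simp: FR_lt)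
qed

lemma free_in_Eq: "is_term a ==> is_term b ==> free_in v (fEq a b) \<longleftrightarrow> v = a \<or> v = b"
  using free_in_atom_word[of a b 0] free_in_FR[OF v ff_seq[OF ff_atom(1)]] by (simp add: fEq_word is_term_set)

lemma free_in_Mem: "is_term a ==> is_term b ==> free_in v (fMem a b) \<longleftrightarrow> v = a \<or> v = b"
  using free_in_atom_word[of a b 1] free_in_FR[OF v ff_seq[OF ff_atom(2)]] by (simp add: fMem_word is_term_set)

lemma free_in_Neg:
  assumes a: "formal_formula \<phi>" shows "free_in v (fNeg \<phi>) \<longleftrightarrow> free_in v \<phi>"
proof -
  note s = ff_seq[OF a] is_var_set[OF v]
  have "FR v emp emp (fNeg \<phi>) \<longleftrightarrow> FR v (lt (sym_code 2)) emp \<phi>"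
    using s is_var_neq[OF v] by (simp add: fNeg_word FR_cat FR_lt)
  also have "\<dots> \<longleftrightarrow> FR v emp emp \<phi>"
    by (rule FR_context[OF v a _ _ no_escape_lt]) (use s v in simp_all)
  finally show ?thesis using free_in_FR[OF v ff_seq[OF ff_Neg[OF a]]] free_in_FR[OF v s(1)] by simp
qed

lemma free_in_Or:
  assumes a: "formal_formula \<phi>" and b: "formal_formula \<psi>" shows "free_in v (fOr \<phi> \<psi>) \<longleftrightarrow> free_in v \<phi> \<or> free_in v \<psi>"
proof -
  note s = ff_seq[OF a] ff_seq[OF b] is_var_set[OF v]
  have "FR v emp emp (fOr \<phi> \<psi>) \<longleftrightarrow> FR v (lt (sym_code 3)) \<psi> \<phi> \<or> FR v (lt (sym_code 3) \<frown> \<phi>) emp \<psi>"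
    using s is_var_neq[OF v] by (simp add: fOr_word FR_cat FR_lt)
  moreover have "FR v (lt (sym_code 3)) \<psi> \<phi> \<longleftrightarrow> FR v emp emp \<phi>"
    by (rule FR_context[OF v a _ _ no_escape_lt]) (use s v in simp_all)
  moreover have "FR v (lt (sym_code 3) \<frown> \<phi>) emp \<psi> \<longleftrightarrow> FR v emp emp \<psi>"
    by (rule FR_context[OF v b _ _ no_escape_Or[OF v a]]) (use s v in simp_all)
  ultimately show ?thesis
    using free_in_FR[OF v ff_seq[OF ff_Or[OF a b]]] free_in_FR[OF v s(1)] free_in_FR[OF v s(2)] by simp
qed

lemma free_in_Ex:
  assumes w: "is_var w" and a: "formal_formula \<phi>" shows "free_in v (fEx w \<phi>) \<longleftrightarrow> v \<noteq> w \<and> free_in v \<phi>"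
proof (cases "v = w")
  case True
  have "\<not> FR v emp emp (fEx v \<phi>)"
  proof
    assume "FR v emp emp (fEx v \<phi>)"
    then obtain \<alpha> \<beta> where "is_seq \<alpha>" "is_seq \<beta>" "fEx v \<phi> = \<alpha> \<frown> lt v \<frown> \<beta>" "\<not> bnd v (emp \<frown> \<alpha>) v (\<beta> \<frown> emp)"
      unfolding FR_def by blast
    then show False using bnd_Ex[OF v a _ _ is_var_set[OF v]] by simp
  qed
  then show ?thesis using True free_in_FR[OF v ff_seq[OF ff_Ex[OF v a]]] by simp
next
  case False
  note s = ff_seq[OF a] is_var_set[OF v] is_var_set[OF w]
  have "FR v emp emp (fEx w \<phi>) \<longleftrightarrow> FR v (lt (sym_code 4) \<frown> lt w) emp \<phi>"
    using s is_var_neq[OF v] False by (simp add: fEx_word FR_cat FR_lt)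
  also have "\<dots> \<longleftrightarrow> FR v emp emp \<phi>"
    by (rule FR_context[OF v a _ _ no_escape_Ex[OF v w False]]) (use s in simp_all)
  finally show ?thesis using False free_in_FR[OF v ff_seq[OF ff_Ex[OF w a]]] free_in_FR[OF v s(1)] by simp
qed

end

lemma free_in_frx: "is_var v ==> formal_formula \<theta> ==> free_in v \<theta> \<longleftrightarrow> frx v \<theta>"
  using free_in_FR FR_frx is_var_set ff_seq by blast

lemma free_in_subst:
  assumes t: "formal_formula \<theta>" and v: "is_var v" and w: "is_var w" and x: "is_set x"
  shows "free_in w (subst \<theta> v x) \<longleftrightarrow> w \<noteq> v \<and> free_in w \<theta>"
proof (rule ff_induct[where b = False and Q = "\<lambda>\<theta>. frx w (substx \<theta> v x) \<longleftrightarrow> w \<noteq> v \<and> frx w \<theta>"])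
  show "dfn False (\<lambda>s. frx w (substx (s 0) v x) \<longleftrightarrow> w \<noteq> v \<and> frx w (s 0))"
    by (intro dfn_intros dft_const_set is_var_set v w x)
  show "(frx w (substx \<theta> v x) \<longleftrightarrow> w \<noteq> v \<and> frx w \<theta>) \<longleftrightarrow> (free_in w (subst \<theta> v x) \<longleftrightarrow> w \<noteq> v \<and> free_in w \<theta>)"
    if "formal_formula \<theta>" for \<theta>
    using that v w x by (simp add: substx_def free_in_frx)
next
  fix a b assume ab: "is_term a" "is_term b"
  have r: "is_term (repl v x a)" "is_term (repl v x b)" using ab x is_term_par by auto
  have n: "w \<noteq> par x" using is_var_neq[OF w] x by simp
  show "free_in w (subst (fEq a b) v x) \<longleftrightarrow> w \<noteq> v \<and> free_in w (fEq a b)"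
    unfolding subst_Eq[OF v x ab] free_in_Eq[OF w r] free_in_Eq[OF w ab] using n by auto
  show "free_in w (subst (fMem a b) v x) \<longleftrightarrow> w \<noteq> v \<and> free_in w (fMem a b)"
    unfolding subst_Mem[OF v x ab] free_in_Mem[OF w r] free_in_Mem[OF w ab] using n by auto
next
  fix u \<phi> assume u: "is_var u" and p: "formal_formula \<phi>" and "free_in w (subst \<phi> v x) \<longleftrightarrow> w \<noteq> v \<and> free_in w \<phi>"
  then show "free_in w (subst (fEx u \<phi>) v x) \<longleftrightarrow> w \<noteq> v \<and> free_in w (fEx u \<phi>)"
    using v w x by (auto simp: subst_Ex free_in_Ex)
qed (use t v w x in \<open>auto simp: subst_Neg subst_Or free_in_Neg free_in_Or\<close>)


subsection \<open>Formulas of small length\<close>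

text \<open>For the second direction, the positions of the product are those of \<open>s\<close>
  together with the image of those of \<open>t\<close> under the shift, and images of small sets are
  small.\<close>

lemma small_Dom_cat [simp]:
  assumes s: "is_seq s" and t: "is_seq t" shows "small (Dom (s \<frown> t)) \<longleftrightarrow> small (Dom s) \<and> small (Dom t)"
proof
  assume sm: "small (Dom (s \<frown> t))"
  have le: "small m" if "m \<in>\<^sub>c suc (Dom (s \<frown> t))" for m
  proof (rule small_subcls[OF sm])
    have "m \<in>\<^sub>c Dom (s \<frown> t) \<or> m = Dom (s \<frown> t)" using that s t by (simp add: mem_suc)
    then show "m \<subseteq>\<^sub>c Dom (s \<frown> t)" using nat_trans[OF seq_Dom[OF cat_seq[OF s t]]] subclsI subcls_refl by metis
  qed
  show "small (Dom s) \<and> small (Dom t)" using le[OF Dom_prefix[OF s t]] le[OF Dom_suffix[OF s t]] ..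
next
  assume sm: "small (Dom s) \<and> small (Dom t)"
  have "is_cat s t (s \<frown> t)" using is_cat_iff[OF s t] by blast
  then obtain h where h: "cat_map s t (s \<frown> t) h" unfolding is_cat_def by blast
  have d: "dft True (\<lambda>s. apx h (s 0))" by (intro dfn_intros dft_const_True)
  have "Dom (s \<frown> t) \<subseteq>\<^sub>c bun (Dom s) (img (apx h) (Dom t))"
  proof (rule subclsI)
    fix k assume k: "k \<in>\<^sub>c Dom (s \<frown> t)"
    have "\<exists>i. i \<in>\<^sub>c Dom t \<and> k = apx h i" if "\<not> k \<in>\<^sub>c Dom s"
    proof -
      have "\<exists>i. i \<in>\<^sub>c Dom t \<and> k = ap h i" using h k that unfolding cat_map_def by blast
      then show ?thesis using h ap_apx unfolding cat_map_def by metis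
    qed
    then show "k \<in>\<^sub>c bun (Dom s) (img (apx h) (Dom t))" unfolding mem_bun mem_img[OF d] using mem_set[OF k] by blast
  qed
  then show "small (Dom (s \<frown> t))" by (rule small_subcls[rotated]) (use sm small_img[OF d] in simp)
qed

lemma small_suc_emp [simp]: "small (suc emp)"
  by (simp add: small_suc)

text \<open>Parameters are expressed by occurrences, which by \<open>occ_cat\<close> distribute over
  concatenation.\<close>

lemma SL_iff: "SL P \<theta> \<longleftrightarrow> formal_formula \<theta> \<and> small (Dom \<theta>) \<and> (\<forall>y. is_set y --> occ (par y) \<theta> --> y \<in>\<^sub>c P)"
  unfolding SL_def using occ_ap[OF ff_seq par_set] by metis

lemma SL_ff: "SL P \<theta> ==> formal_formula \<theta>" by (simp add: SL_def)

lemma SL_mono: "SL P \<theta> ==> P \<subseteq>\<^sub>c Q ==> SL Q \<theta>"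
  unfolding SL_iff subcls_def by blast

lemma SL_Neg: "formal_formula \<phi> ==> SL P (fNeg \<phi>) \<longleftrightarrow> SL P \<phi>"
  unfolding SL_iff by (simp add: ff_Neg) (simp add: fNeg_word ff_seq)

lemma SL_Or: "formal_formula \<phi> ==> formal_formula \<psi> ==> SL P (fOr \<phi> \<psi>) \<longleftrightarrow> SL P \<phi> \<and> SL P \<psi>"
  unfolding SL_iff by (auto simp add: ff_Or) (auto simp: fOr_word ff_seq)

lemma SL_Ex: "is_var v ==> formal_formula \<phi> ==> SL P (fEx v \<phi>) \<longleftrightarrow> SL P \<phi>"
  unfolding SL_iff by (simp add: ff_Ex) (simp add: fEx_word ff_seq is_var_set is_var_neq)

lemma SL_atom:
  assumes "is_term a" "is_term b"
  shows "SL P (fEq a b) \<longleftrightarrow> (\<forall>y. is_set y --> a = par y \<or> b = par y --> y \<in>\<^sub>c P)"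
    and "SL P (fMem a b) \<longleftrightarrow> (\<forall>y. is_set y --> a = par y \<or> b = par y --> y \<in>\<^sub>c P)"
  unfolding SL_iff using assms ff_atom[OF assms] by (auto simp: fEq_word fMem_word is_term_set)

lemma SL_subst: "SL P \<theta> ==> is_var v ==> x \<in>\<^sub>c P ==> SL P (subst \<theta> v x)"
  unfolding SL_iff using subst_ff Dom_subst occ_subst mem_set by metis

lemma dfn_closed [dfn_intros]: "dft b t ==> dfn b (\<lambda>s. closed_formula (t s))"
proof (rule dfn_comp1[where P = closed_formula])
  have "closed_formula \<theta> \<longleftrightarrow> formal_formula \<theta> \<and> (\<forall>v. is_set v --> is_var v --> \<not> frx v \<theta>)" for \<theta>
    unfolding closed_formula_def using free_in_frx is_var_set by blast
  then show "dfn b (\<lambda>s. closed_formula (s 0))" by (simp only:) (intro dfn_intros)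
qed

lemma dfn_SL [dfn_intros]: "dft True t ==> dft True u ==> dfn True (\<lambda>s. SL (t s) (u s))"
proof (rule dfn_comp2[where P = SL])
  have "SL P \<theta> \<longleftrightarrow> formal_formula \<theta> \<and> small (Dom \<theta>) \<and> (\<forall>i. i \<in>\<^sub>c Dom \<theta> --> (\<forall>x. is_set x --> apx \<theta> i = par x --> x \<in>\<^sub>c P))" for P \<theta>
    unfolding SL_def using ap_apx[OF seq_fun[OF ff_seq]] by metis
  then show "dfn True (\<lambda>s. SL (s 0) (s (Suc 0)))" by (simp only:) (intro dfn_intros)
qed

lemma closed_Neg: "formal_formula \<phi> ==> closed_formula (fNeg \<phi>) \<longleftrightarrow> closed_formula \<phi>"
  unfolding closed_formula_def by (auto simp: ff_Neg free_in_Neg)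

lemma closed_Or: "formal_formula \<phi> ==> formal_formula \<psi> ==> closed_formula (fOr \<phi> \<psi>) \<longleftrightarrow> closed_formula \<phi> \<and> closed_formula \<psi>"
  unfolding closed_formula_def by (auto simp: ff_Or free_in_Or)

lemma closed_subst:
  "is_var v ==> formal_formula \<phi> ==> is_set x ==> closed_formula (fEx v \<phi>) \<longleftrightarrow> closed_formula (subst \<phi> v x)"
  unfolding closed_formula_def by (simp add: ff_Ex free_in_Ex free_in_subst)


subsection \<open>Truth\<close>

text \<open>The formulas on which truth in \<open>X\<close> is determined by Tarski's
  clauses.\<close>

definition csl :: "'a \<Rightarrow> 'a \<Rightarrow> bool" where
  "csl X \<theta> \<longleftrightarrow> SL X \<theta> \<and> closed_formula \<theta>"

lemma csl_ff: "csl X \<theta> ==> formal_formula \<theta>"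
  unfolding csl_def by (blast intro: SL_ff)

lemma csl_Neg: "formal_formula \<phi> ==> csl X (fNeg \<phi>) \<longleftrightarrow> csl X \<phi>"
  by (simp add: csl_def SL_Neg closed_Neg)

lemma csl_Or: "formal_formula \<phi> ==> formal_formula \<psi> ==> csl X (fOr \<phi> \<psi>) \<longleftrightarrow> csl X \<phi> \<and> csl X \<psi>"
  by (auto simp add: csl_def SL_Or closed_Or)

lemma csl_Ex: "is_var v ==> formal_formula \<phi> ==> csl X (fEx v \<phi>) \<longleftrightarrow> SL X \<phi> \<and> closed_formula (fEx v \<phi>)"
  by (simp add: csl_def SL_Ex)

lemma csl_subst: "is_var v ==> formal_formula \<phi> ==> csl X (fEx v \<phi>) ==> x \<in>\<^sub>c X ==> csl X (subst \<phi> v x)"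
  using SL_subst closed_subst[OF _ _ mem_set] by (simp add: csl_def SL_Ex)

lemma closed_atom:
  assumes ab: "is_term a" "is_term b" and cl: "closed_formula (fEq a b) \<or> closed_formula (fMem a b)"
  obtains x y where "is_set x" "is_set y" "a = par x" "b = par y"
proof -
  have "\<not> is_var a" "\<not> is_var b" using cl free_in_Eq[OF _ ab] free_in_Mem[OF _ ab] unfolding closed_formula_def by blast+
  with ab show thesis unfolding is_term_def using that by blast
qed

lemma csl_atom:
  assumes "is_set x" "is_set y"
  shows "csl X (fEq (par x) (par y)) \<longleftrightarrow> x \<in>\<^sub>c X \<and> y \<in>\<^sub>c X" "csl X (fMem (par x) (par y)) \<longleftrightarrow> x \<in>\<^sub>c X \<and> y \<in>\<^sub>c X"
proof -
  note t = is_term_par[OF assms(1)] is_term_par[OF assms(2)]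
  have "closed_formula (fEq (par x) (par y))" "closed_formula (fMem (par x) (par y))"
    unfolding closed_formula_def using free_in_Eq[OF _ t] free_in_Mem[OF _ t] ff_atom[OF t] is_var_neq assms by metis+
  then show "csl X (fEq (par x) (par y)) \<longleftrightarrow> x \<in>\<^sub>c X \<and> y \<in>\<^sub>c X" "csl X (fMem (par x) (par y)) \<longleftrightarrow> x \<in>\<^sub>c X \<and> y \<in>\<^sub>c X"
    using assms by (auto simp: csl_def SL_atom[OF t])
qed

text \<open>Tarski's clauses as an operator: \<open>tarski X T \<theta>\<close> refers to \<open>T\<close> at formulas shorter than \<open>\<theta>\<close> only.\<close>

definition tarski :: "'a \<Rightarrow> 'a \<Rightarrow> 'a \<Rightarrow> bool" where
  "tarski X T \<theta> \<longleftrightarrow>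
     (\<exists>x. x \<in>\<^sub>c X \<and> \<theta> = xEq (par x) (par x)) \<or>
     (\<exists>x. x \<in>\<^sub>c X \<and> (\<exists>y. y \<in>\<^sub>c X \<and> x \<in>\<^sub>c y \<and> \<theta> = xMem (par x) (par y))) \<or>
     (\<exists>\<phi>. is_set \<phi> \<and> formal_formula \<phi> \<and> \<not> \<phi> \<in>\<^sub>c T \<and> \<theta> = xNeg \<phi>) \<or>
     (\<exists>\<phi>. is_set \<phi> \<and> formal_formula \<phi> \<and> (\<exists>\<psi>. is_set \<psi> \<and> formal_formula \<psi> \<and> (\<phi> \<in>\<^sub>c T \<or> \<psi> \<in>\<^sub>c T) \<and> \<theta> = xOr \<phi> \<psi>)) \<or>
     (\<exists>v. is_set v \<and> is_var v \<and> (\<exists>\<phi>. is_set \<phi> \<and> formal_formula \<phi> \<and> (\<exists>x. x \<in>\<^sub>c X \<and> substx \<phi> v x \<in>\<^sub>c T) \<and> \<theta> = xEx v \<phi>))"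

lemma dfn_tarski [dfn_intros]:
  "dft True t ==> dft True u ==> dft True w ==> dfn True (\<lambda>s. tarski (t s) (u s) (w s))"
  by (rule dfn_comp3[where P = tarski]) (unfold tarski_def, intro dfn_intros)

lemma tarski_plain:
  "tarski X T \<theta> \<longleftrightarrow>
     (\<exists>x. x \<in>\<^sub>c X \<and> \<theta> = fEq (par x) (par x)) \<or>
     (\<exists>x y. x \<in>\<^sub>c X \<and> y \<in>\<^sub>c X \<and> x \<in>\<^sub>c y \<and> \<theta> = fMem (par x) (par y)) \<or>
     (\<exists>\<phi>. formal_formula \<phi> \<and> \<not> \<phi> \<in>\<^sub>c T \<and> \<theta> = fNeg \<phi>) \<or>
     (\<exists>\<phi> \<psi>. formal_formula \<phi> \<and> formal_formula \<psi> \<and> (\<phi> \<in>\<^sub>c T \<or> \<psi> \<in>\<^sub>c T) \<and> \<theta> = fOr \<phi> \<psi>) \<or>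
     (\<exists>v \<phi>. is_var v \<and> formal_formula \<phi> \<and> (\<exists>x. x \<in>\<^sub>c X \<and> subst \<phi> v x \<in>\<^sub>c T) \<and> \<theta> = fEx v \<phi>)"
proof -
  have 1: "(\<exists>x. x \<in>\<^sub>c X \<and> \<theta> = xEq (par x) (par x)) \<longleftrightarrow> (\<exists>x. x \<in>\<^sub>c X \<and> \<theta> = fEq (par x) (par x))"
    by simp
  have 2: "(\<exists>x. x \<in>\<^sub>c X \<and> (\<exists>y. y \<in>\<^sub>c X \<and> x \<in>\<^sub>c y \<and> \<theta> = xMem (par x) (par y)))
     \<longleftrightarrow> (\<exists>x y. x \<in>\<^sub>c X \<and> y \<in>\<^sub>c X \<and> x \<in>\<^sub>c y \<and> \<theta> = fMem (par x) (par y))"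
    by simp
  have 3: "is_set \<phi> \<and> formal_formula \<phi> \<and> \<not> \<phi> \<in>\<^sub>c T \<and> \<theta> = xNeg \<phi> \<longleftrightarrow> formal_formula \<phi> \<and> \<not> \<phi> \<in>\<^sub>c T \<and> \<theta> = fNeg \<phi>" for \<phi>
    using ff_set x_eq(3)[OF ff_seq] by metis
  have 4: "(is_set \<phi> \<and> formal_formula \<phi> \<and> (\<exists>\<psi>. is_set \<psi> \<and> formal_formula \<psi> \<and> (\<phi> \<in>\<^sub>c T \<or> \<psi> \<in>\<^sub>c T) \<and> \<theta> = xOr \<phi> \<psi>))
     \<longleftrightarrow> (\<exists>\<psi>. formal_formula \<phi> \<and> formal_formula \<psi> \<and> (\<phi> \<in>\<^sub>c T \<or> \<psi> \<in>\<^sub>c T) \<and> \<theta> = fOr \<phi> \<psi>)" for \<phi>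
    using ff_set x_eq(4)[OF ff_seq ff_seq] by metis
  have 5: "is_set v \<and> is_var v \<and> (\<exists>\<phi>. is_set \<phi> \<and> formal_formula \<phi> \<and> (\<exists>x. x \<in>\<^sub>c X \<and> substx \<phi> v x \<in>\<^sub>c T) \<and> \<theta> = xEx v \<phi>)
     \<longleftrightarrow> (\<exists>\<phi>. is_var v \<and> formal_formula \<phi> \<and> (\<exists>x. x \<in>\<^sub>c X \<and> subst \<phi> v x \<in>\<^sub>c T) \<and> \<theta> = fEx v \<phi>)" for v
  proof (cases "is_var v")
    case True
    have "is_set \<phi> \<and> formal_formula \<phi> \<and> (\<exists>x. x \<in>\<^sub>c X \<and> substx \<phi> v x \<in>\<^sub>c T) \<and> \<theta> = xEx v \<phi>
      \<longleftrightarrow> formal_formula \<phi> \<and> (\<exists>x. x \<in>\<^sub>c X \<and> subst \<phi> v x \<in>\<^sub>c T) \<and> \<theta> = fEx v \<phi>" for \<phi>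
    proof (cases "formal_formula \<phi>")
      case p: True
      have "substx \<phi> v x \<in>\<^sub>c T \<longleftrightarrow> subst \<phi> v x \<in>\<^sub>c T" if "x \<in>\<^sub>c X" for x
        using True p mem_set[OF that] by (simp add: substx_def)
      then show ?thesis using x_eq(5)[OF is_var_set[OF True] ff_seq[OF p]] p ff_set[OF p] by auto
    qed simp
    then show ?thesis using True is_var_set[OF True] by simp
  qed simp
  show ?thesis unfolding tarski_def 1 2 3 4 5 ..
qed

lemma
  shows tarski_Eq: "is_set x ==> is_set y ==> tarski X T (fEq (par x) (par y)) \<longleftrightarrow> x \<in>\<^sub>c X \<and> x = y" (is "_ ==> _ ==> ?E")
    and tarski_Mem: "is_set x ==> is_set y ==> tarski X T (fMem (par x) (par y)) \<longleftrightarrow> x \<in>\<^sub>c X \<and> y \<in>\<^sub>c X \<and> x \<in>\<^sub>c y" (is "_ ==> _ ==> ?M")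
    and tarski_Neg: "formal_formula \<phi> ==> tarski X T (fNeg \<phi>) \<longleftrightarrow> \<not> \<phi> \<in>\<^sub>c T" (is "_ ==> ?N")
    and tarski_Or: "formal_formula \<phi> ==> formal_formula \<psi> ==> tarski X T (fOr \<phi> \<psi>) \<longleftrightarrow> \<phi> \<in>\<^sub>c T \<or> \<psi> \<in>\<^sub>c T" (is "_ ==> _ ==> ?O")
    and tarski_Ex: "is_var v ==> formal_formula \<phi> ==> tarski X T (fEx v \<phi>) \<longleftrightarrow> (\<exists>x. x \<in>\<^sub>c X \<and> subst \<phi> v x \<in>\<^sub>c T)" (is "_ ==> _ ==> ?X")
proof -
  have ne: "\<And>a b c d. fEq (par a) (par b) \<noteq> fMem (par c) (par d)" "\<And>a b \<phi>. formal_formula \<phi> ==> fEq (par a) (par b) \<noteq> fNeg \<phi>"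
    "\<And>a b \<phi> \<psi>. formal_formula \<phi> ==> formal_formula \<psi> ==> fEq (par a) (par b) \<noteq> fOr \<phi> \<psi>"
    "\<And>a b v \<phi>. is_var v ==> formal_formula \<phi> ==> fEq (par a) (par b) \<noteq> fEx v \<phi>"
    "\<And>a b \<phi>. formal_formula \<phi> ==> fMem (par a) (par b) \<noteq> fNeg \<phi>"
    "\<And>a b \<phi> \<psi>. formal_formula \<phi> ==> formal_formula \<psi> ==> fMem (par a) (par b) \<noteq> fOr \<phi> \<psi>"
    "\<And>a b v \<phi>. is_var v ==> formal_formula \<phi> ==> fMem (par a) (par b) \<noteq> fEx v \<phi>"
    "\<And>\<chi> \<phi> \<psi>. formal_formula \<chi> ==> formal_formula \<phi> ==> formal_formula \<psi> ==> fNeg \<chi> \<noteq> fOr \<phi> \<psi>"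
    "\<And>v \<phi> \<chi>. formal_formula \<chi> ==> is_var v ==> formal_formula \<phi> ==> fNeg \<chi> \<noteq> fEx v \<phi>"
    "\<And>v \<phi> \<chi> \<rho>. formal_formula \<chi> ==> formal_formula \<rho> ==> is_var v ==> formal_formula \<phi> ==> fOr \<chi> \<rho> \<noteq> fEx v \<phi>"
    by (simp_all add: formula_words ff_seq is_var_set)
  have inj: "x = z \<and> y = w" if "fEq (par x) (par y) = fEq (par z) (par w) \<or> fMem (par x) (par y) = fMem (par z) (par w)"
      "is_set x" "is_set y" "is_set z" "is_set w" for x y z w
    using that cons_inj[of "par y" "par w" emp emp] by (auto simp: fEq_word fMem_word)
  show ?E if p: "is_set x" "is_set y"
  proof
    assume "tarski X T (fEq (par x) (par y))"
    then show "x \<in>\<^sub>c X \<and> x = y"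
      unfolding tarski_plain by (elim disjE exE conjE) (use p in \<open>auto simp: ne ne[symmetric] dest: mem_set dest!: inj[OF disjI1]\<close>)
  next
    assume "x \<in>\<^sub>c X \<and> x = y"
    then show "tarski X T (fEq (par x) (par y))" unfolding tarski_plain using p by blast
  qed
  show ?M if p: "is_set x" "is_set y"
  proof
    assume "tarski X T (fMem (par x) (par y))"
    then show "x \<in>\<^sub>c X \<and> y \<in>\<^sub>c X \<and> x \<in>\<^sub>c y"
      unfolding tarski_plain by (elim disjE exE conjE) (use p in \<open>auto simp: ne ne[symmetric] dest: mem_set dest!: inj[OF disjI2]\<close>)
  next
    assume "x \<in>\<^sub>c X \<and> y \<in>\<^sub>c X \<and> x \<in>\<^sub>c y"
    then show "tarski X T (fMem (par x) (par y))" unfolding tarski_plain using p by blast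
  qed
  show ?N if p: "formal_formula \<phi>"
  proof
    assume "tarski X T (fNeg \<phi>)"
    then show "\<not> \<phi> \<in>\<^sub>c T"
      unfolding tarski_plain by (elim disjE exE conjE) (use p in \<open>auto simp: ne ne[symmetric] dest: mem_set dest: fNeg_inj\<close>)
  next
    assume "\<not> \<phi> \<in>\<^sub>c T"
    then show "tarski X T (fNeg \<phi>)" unfolding tarski_plain using p by blast
  qed
  show ?O if p: "formal_formula \<phi>" "formal_formula \<psi>"
  proof
    assume "tarski X T (fOr \<phi> \<psi>)"
    then show "\<phi> \<in>\<^sub>c T \<or> \<psi> \<in>\<^sub>c T"
      unfolding tarski_plain by (elim disjE exE conjE) (use p in \<open>auto simp: ne ne[symmetric] dest: mem_set dest: fOr_inj\<close>)
  next
    assume "\<phi> \<in>\<^sub>c T \<or> \<psi> \<in>\<^sub>c T"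
    then show "tarski X T (fOr \<phi> \<psi>)" unfolding tarski_plain using p by blast
  qed
  show ?X if p: "is_var v" "formal_formula \<phi>"
  proof
    assume "tarski X T (fEx v \<phi>)"
    then show "\<exists>x. x \<in>\<^sub>c X \<and> subst \<phi> v x \<in>\<^sub>c T"
      unfolding tarski_plain by (elim disjE exE conjE) (use p in \<open>auto simp: ne ne[symmetric] dest: mem_set dest: fEx_inj\<close>)
  next
    assume "\<exists>x. x \<in>\<^sub>c X \<and> subst \<phi> v x \<in>\<^sub>c T"
    then show "tarski X T (fEx v \<phi>)" unfolding tarski_plain using p by blast
  qed
qed

text \<open>The recursion descends in length, in the quantifier case because substitution replaces
  single letters by single letters and so keeps the length.\<close>

lemma tarski_cong:
  assumes t: "csl X \<theta>" and eq: "\<And>\<eta>. csl X \<eta> ==> Dom \<eta> \<in>\<^sub>c Dom \<theta> ==> \<eta> \<in>\<^sub>c T \<longleftrightarrow> \<eta> \<in>\<^sub>c T'"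
  shows "tarski X T \<theta> \<longleftrightarrow> tarski X T' \<theta>"
  using csl_ff[OF t]
proof (cases rule: ff_cases)
  case (1 a b)
  then obtain x y where "is_set x" "is_set y" "a = par x" "b = par y" using t closed_atom unfolding csl_def by metis
  then show ?thesis using 1 by (simp add: tarski_Eq)
next
  case (2 a b)
  then obtain x y where "is_set x" "is_set y" "a = par x" "b = par y" using t closed_atom unfolding csl_def by metis
  then show ?thesis using 2 by (simp add: tarski_Mem)
next
  case (3 \<phi>)
  then show ?thesis using eq[of \<phi>] t Dom_sub(1)[OF ff_seq[OF 3(1)]] by (simp add: tarski_Neg csl_Neg)
next
  case (4 \<phi> \<psi>)
  note s = ff_seq[OF 4(1)] ff_seq[OF 4(2)]
  have "csl X \<phi>" "csl X \<psi>" "Dom \<phi> \<in>\<^sub>c Dom \<theta>" "Dom \<psi> \<in>\<^sub>c Dom \<theta>"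
    using 4 t Dom_sub(2)[OF s] Dom_sub(3)[OF s(2,1)] by (simp_all add: csl_Or)
  then have "\<phi> \<in>\<^sub>c T \<longleftrightarrow> \<phi> \<in>\<^sub>c T'" "\<psi> \<in>\<^sub>c T \<longleftrightarrow> \<psi> \<in>\<^sub>c T'" using eq by blast+
  then show ?thesis using 4 by (simp add: tarski_Or)
next
  case (5 v \<phi>)
  have "subst \<phi> v x \<in>\<^sub>c T \<longleftrightarrow> subst \<phi> v x \<in>\<^sub>c T'" if "x \<in>\<^sub>c X" for x
  proof (rule eq)
    show "csl X (subst \<phi> v x)" using csl_subst 5 t that by blast
    show "Dom (subst \<phi> v x) \<in>\<^sub>c Dom \<theta>"
      unfolding Dom_subst[OF 5(1) mem_set[OF that] 5(2)] 5(3) by (rule Dom_sub(4)[OF ff_seq[OF 5(2)] is_var_set[OF 5(1)]])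
  qed
  then show ?thesis using 5 by (auto simp add: tarski_Ex)
qed

section \<open>Existence and uniqueness of the truth class\<close>

definition truth_upto :: "'a \<Rightarrow> 'a \<Rightarrow> 'a \<Rightarrow> bool" where
  "truth_upto X D T \<longleftrightarrow> (\<forall>\<theta>. is_set \<theta> --> csl X \<theta> \<and> Dom \<theta> \<in>\<^sub>c D --> (\<theta> \<in>\<^sub>c T \<longleftrightarrow> tarski X T \<theta>))"

lemma truth_uptoI: "(\<And>\<theta>. csl X \<theta> ==> Dom \<theta> \<in>\<^sub>c D ==> \<theta> \<in>\<^sub>c T \<longleftrightarrow> tarski X T \<theta>) ==> truth_upto X D T"
  unfolding truth_upto_def by blast

lemma truth_uptoD: "truth_upto X D T ==> csl X \<theta> ==> Dom \<theta> \<in>\<^sub>c D ==> \<theta> \<in>\<^sub>c T \<longleftrightarrow> tarski X T \<theta>"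
  unfolding truth_upto_def using ff_set[OF csl_ff] by blast

lemma dfn_csl [dfn_intros]: "dft True t ==> dft True u ==> dfn True (\<lambda>s. csl (t s) (u s))"
  unfolding csl_def by (intro dfn_intros)

lemma dfn_truth_upto [dfn_intros]: "dft True t ==> dft True u ==> dft True w ==> dfn True (\<lambda>s. truth_upto (t s) (u s) (w s))"
  by (rule dfn_comp3[where P = truth_upto]) (unfold truth_upto_def, intro dfn_intros)

lemma csl_Dom: "csl X \<theta> ==> Dom \<theta> \<in>\<^sub>c SN"
  unfolding csl_def SN_iff by (simp add: SL_iff seq_Dom ff_seq)

text \<open>Strong induction on the length. The formula has class parameters, and the induction is
  available because the formulas concerned have small length. The bounds are later natural numbers
  or \<open>SN\<close>, all of them transitive.\<close>

lemma truth_upto_unique: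
  assumes T: "truth_upto X D T" "truth_upto X D' T'" and t: "csl X \<theta>" "Dom \<theta> \<in>\<^sub>c D" "Dom \<theta> \<in>\<^sub>c D'"
    and D: "transitive D" "transitive D'"
  shows "\<theta> \<in>\<^sub>c T \<longleftrightarrow> \<theta> \<in>\<^sub>c T'"
proof -
  let ?P = "\<lambda>n. n \<in>\<^sub>c D --> n \<in>\<^sub>c D' --> (\<forall>\<theta>. is_set \<theta> --> csl X \<theta> --> Dom \<theta> = n --> (\<theta> \<in>\<^sub>c T \<longleftrightarrow> \<theta> \<in>\<^sub>c T'))"
  have "?P (Dom \<theta>)"
  proof (rule nat_strong_induct[where b = True and P = ?P])
    show "dfn True (\<lambda>s. ?P (s 0))" by (intro dfn_intros dft_const_True)
    show "small (Dom \<theta>)" "is_nat (Dom \<theta>)" using csl_Dom[OF t(1)] by (simp_all add: SN_iff)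
  next
    fix m assume IH: "\<And>k. k \<in>\<^sub>c m ==> ?P k"
    show "?P m"
    proof (intro allI impI)
      fix \<eta> assume m: "m \<in>\<^sub>c D" "m \<in>\<^sub>c D'" and e: "csl X \<eta>" "Dom \<eta> = m"
      have "tarski X T \<eta> \<longleftrightarrow> tarski X T' \<eta>"
      proof (rule tarski_cong[OF e(1)])
        fix \<zeta> assume z: "csl X \<zeta>" "Dom \<zeta> \<in>\<^sub>c Dom \<eta>"
        then have "Dom \<zeta> \<in>\<^sub>c D" "Dom \<zeta> \<in>\<^sub>c D'" using transitiveD D m e(2) by blast+
        then show "\<zeta> \<in>\<^sub>c T \<longleftrightarrow> \<zeta> \<in>\<^sub>c T'" using IH z e(2) ff_set[OF csl_ff[OF z(1)]] by blast
      qed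
      then show "\<eta> \<in>\<^sub>c T \<longleftrightarrow> \<eta> \<in>\<^sub>c T'" using truth_uptoD[OF T(1) e(1)] truth_uptoD[OF T(2) e(1)] m e(2) by blast
    qed
  qed
  then show ?thesis using t ff_set[OF csl_ff[OF t(1)]] by blast
qed

text \<open>Applying \<open>tarski\<close> once to a class that is correct below \<open>m\<close>
  yields one that is correct below \<open>suc m\<close>.\<close>

lemma truth_upto_exists:
  assumes "n \<in>\<^sub>c SN" shows "\<exists>T. truth_upto X n T"
proof (rule SN_induct[OF _ assms])
  show "dfn True (\<lambda>s. \<exists>T. truth_upto X (s 0) T)" by (intro dfn_intros dft_const_True)
  show "\<exists>T. truth_upto X emp T" by (simp add: truth_upto_def)
next
  fix m assume m: "m \<in>\<^sub>c SN" and "\<exists>T. truth_upto X m T"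
  then obtain T where T: "truth_upto X m T" by blast
  let ?T = "cls (\<lambda>\<theta>. tarski X T \<theta>)"
  have T': "\<theta> \<in>\<^sub>c ?T \<longleftrightarrow> is_set \<theta> \<and> tarski X T \<theta>" for \<theta>
    by (rule mem_cls) (intro dfn_intros dft_const_True)
  have "truth_upto X (suc m) ?T" unfolding truth_upto_def
  proof (intro allI impI, elim conjE)
    fix \<theta> assume t: "is_set \<theta>" "csl X \<theta>" "Dom \<theta> \<in>\<^sub>c suc m"
    have "tarski X T \<theta> \<longleftrightarrow> tarski X ?T \<theta>"
    proof (rule tarski_cong[OF t(2)])
      fix \<eta> assume e: "csl X \<eta>" "Dom \<eta> \<in>\<^sub>c Dom \<theta>"
      have "Dom \<eta> \<in>\<^sub>c m" using t(3) e(2) nat_trans[OF SN_nat[OF m]] mem_suc[OF mem_set[OF m]] by blast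
      then show "\<eta> \<in>\<^sub>c T \<longleftrightarrow> \<eta> \<in>\<^sub>c ?T" using truth_uptoD[OF T e(1)] ff_set[OF csl_ff[OF e(1)]] unfolding T' by blast
    qed
    then show "\<theta> \<in>\<^sub>c ?T \<longleftrightarrow> tarski X ?T \<theta>" using t(1) unfolding T' by blast
  qed
  then show "\<exists>T. truth_upto X (suc m) T" by blast
qed

text \<open>The approximations can be united because comprehension may quantify over classes; by
  uniqueness the union agrees with each of them below its bound.\<close>

lemma truth_exists: "\<exists>T. truth_upto X SN T \<and> (\<forall>\<theta>. \<theta> \<in>\<^sub>c T --> csl X \<theta>)"
proof -
  let ?T = "cls (\<lambda>\<theta>. csl X \<theta> \<and> (\<exists>n. n \<in>\<^sub>c SN \<and> (\<exists>T. truth_upto X n T \<and> Dom \<theta> \<in>\<^sub>c n \<and> \<theta> \<in>\<^sub>c T)))"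
  have T: "\<theta> \<in>\<^sub>c ?T \<longleftrightarrow> is_set \<theta> \<and> csl X \<theta> \<and> (\<exists>n. n \<in>\<^sub>c SN \<and> (\<exists>T. truth_upto X n T \<and> Dom \<theta> \<in>\<^sub>c n \<and> \<theta> \<in>\<^sub>c T))" for \<theta>
    by (rule mem_cls) (intro dfn_intros dft_const_True)
  have tr: "transitive n" if "n \<in>\<^sub>c SN" for n using SN_nat[OF that] by (simp add: is_nat_def)
  have agree: "\<theta> \<in>\<^sub>c ?T \<longleftrightarrow> \<theta> \<in>\<^sub>c S" if S: "n \<in>\<^sub>c SN" "truth_upto X n S" and t: "csl X \<theta>" "Dom \<theta> \<in>\<^sub>c n" for \<theta> n S
  proof -
    have "\<theta> \<in>\<^sub>c S' \<longleftrightarrow> \<theta> \<in>\<^sub>c S" if "n' \<in>\<^sub>c SN" "truth_upto X n' S'" "Dom \<theta> \<in>\<^sub>c n'" for n' S'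
      by (rule truth_upto_unique[OF that(2) S(2) t(1) that(3) t(2) tr[OF that(1)] tr[OF S(1)]])
    then show ?thesis unfolding T using S t ff_set[OF csl_ff[OF t(1)]] by blast
  qed
  have "truth_upto X SN ?T"
  proof (rule truth_uptoI)
    fix \<theta> assume t: "csl X \<theta>" "Dom \<theta> \<in>\<^sub>c SN"
    let ?n = "suc (Dom \<theta>)"
    have n: "?n \<in>\<^sub>c SN" using t(2) by (rule suc_in_SN)
    have Dt: "Dom \<theta> \<in>\<^sub>c ?n" using mem_set[OF t(2)] by (simp add: mem_suc)
    obtain S where S: "truth_upto X ?n S" using truth_upto_exists[OF n] by blast
    have "tarski X S \<theta> \<longleftrightarrow> tarski X ?T \<theta>"
    proof (rule tarski_cong[OF t(1)])
      fix \<eta> assume e: "csl X \<eta>" "Dom \<eta> \<in>\<^sub>c Dom \<theta>"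
      have "Dom \<eta> \<in>\<^sub>c ?n" using e(2) mem_set[OF t(2)] by (simp add: mem_suc)
      from agree[OF n S e(1) this] show "\<eta> \<in>\<^sub>c S \<longleftrightarrow> \<eta> \<in>\<^sub>c ?T" ..
    qed
    then show "\<theta> \<in>\<^sub>c ?T \<longleftrightarrow> tarski X ?T \<theta>"
      using agree[OF n S t(1) Dt] truth_uptoD[OF S t(1) Dt] by blast
  qed
  moreover have "\<forall>\<theta>. \<theta> \<in>\<^sub>c ?T --> csl X \<theta>" unfolding T by blast
  ultimately show ?thesis by blast
qed

text \<open>By \<open>csl_Dom\<close> the bound \<open>SN\<close> covers every length in question,
  so the clauses for the separate connectives amount to one fixed point equation.\<close>

lemma is_truth_class_iff:
  "is_truth_class X T \<longleftrightarrow> truth_upto X SN T \<and> (\<forall>\<theta>. \<theta> \<in>\<^sub>c T --> csl X \<theta>)"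
proof
  assume T: "truth_upto X SN T \<and> (\<forall>\<theta>. \<theta> \<in>\<^sub>c T --> csl X \<theta>)"
  have ti: "\<theta> \<in>\<^sub>c T \<longleftrightarrow> tarski X T \<theta>" if "csl X \<theta>" for \<theta> using truth_uptoD[of X SN T] T that csl_Dom by blast
  have sub: "\<theta> \<in>\<^sub>c T --> csl X \<theta>" for \<theta> using T by blast
  show "is_truth_class X T" unfolding is_truth_class_def csl_def[symmetric]
  proof (intro conjI allI impI)
    fix x y assume xy: "is_set x \<and> is_set y"
    have "fEq (par x) (par y) \<in>\<^sub>c T \<longleftrightarrow> csl X (fEq (par x) (par y)) \<and> tarski X T (fEq (par x) (par y))"
      using ti sub by blast
    then show "fEq (par x) (par y) \<in>\<^sub>c T \<longleftrightarrow> x \<in>\<^sub>c X \<and> y \<in>\<^sub>c X \<and> x = y" using xy by (auto simp: csl_atom tarski_Eq)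
    have "fMem (par x) (par y) \<in>\<^sub>c T \<longleftrightarrow> csl X (fMem (par x) (par y)) \<and> tarski X T (fMem (par x) (par y))"
      using ti sub by blast
    then show "fMem (par x) (par y) \<in>\<^sub>c T \<longleftrightarrow> x \<in>\<^sub>c X \<and> y \<in>\<^sub>c X \<and> x \<in>\<^sub>c y" using xy by (auto simp: csl_atom tarski_Mem)
  next
    fix \<theta> \<chi> assume "SL X \<theta> \<and> closed_formula \<theta> \<and> csl X \<chi>"
    then have a: "csl X \<theta>" "csl X \<chi>" by (simp_all add: csl_def)
    then show "fOr \<theta> \<chi> \<in>\<^sub>c T \<longleftrightarrow> \<theta> \<in>\<^sub>c T \<or> \<chi> \<in>\<^sub>c T"
      using ti[of "fOr \<theta> \<chi>"] a[THEN csl_ff] by (simp add: csl_Or tarski_Or)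
  next
    fix \<theta> assume a: "csl X \<theta>"
    then show "fNeg \<theta> \<in>\<^sub>c T \<longleftrightarrow> \<not> \<theta> \<in>\<^sub>c T"
      using ti[of "fNeg \<theta>"] a[THEN csl_ff] by (simp add: csl_Neg tarski_Neg)
  next
    fix v \<theta> assume a: "is_var v \<and> SL X \<theta> \<and> closed_formula (fEx v \<theta>)"
    then show "fEx v \<theta> \<in>\<^sub>c T \<longleftrightarrow> (\<exists>x. x \<in>\<^sub>c X \<and> subst \<theta> v x \<in>\<^sub>c T)"
      using ti[of "fEx v \<theta>"] SL_ff[of X \<theta>] by (simp add: csl_Ex tarski_Ex)
  qed (use sub in auto)
next
  assume T: "is_truth_class X T"
  note T' = T[unfolded is_truth_class_def csl_def[symmetric]]
  have "\<theta> \<in>\<^sub>c T \<longleftrightarrow> tarski X T \<theta>" if t: "csl X \<theta>" for \<theta>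
    using csl_ff[OF t]
  proof (cases rule: ff_cases)
    case (1 a b)
    then obtain x y where "is_set x" "is_set y" "a = par x" "b = par y" using t closed_atom unfolding csl_def by metis
    then show ?thesis using 1 T' by (auto simp: tarski_Eq)
  next
    case (2 a b)
    then obtain x y where "is_set x" "is_set y" "a = par x" "b = par y" using t closed_atom unfolding csl_def by metis
    then show ?thesis using 2 T' by (simp add: tarski_Mem)
  next
    case (3 \<phi>)
    then have "csl X \<phi>" using t by (simp add: csl_Neg)
    then have "fNeg \<phi> \<in>\<^sub>c T \<longleftrightarrow> \<not> \<phi> \<in>\<^sub>c T" using T' by blast
    then show ?thesis using 3 by (simp add: tarski_Neg)
  next
    case (4 \<phi> \<psi>)
    then have "csl X \<phi>" "csl X \<psi>" using t by (simp_all add: csl_Or)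
    then have "fOr \<phi> \<psi> \<in>\<^sub>c T \<longleftrightarrow> \<phi> \<in>\<^sub>c T \<or> \<psi> \<in>\<^sub>c T" using T' unfolding csl_def by blast
    then show ?thesis using 4 by (simp add: tarski_Or)
  next
    case (5 v \<phi>)
    then have "SL X \<phi>" "closed_formula (fEx v \<phi>)" using t by (simp_all add: csl_Ex)
    then have "fEx v \<phi> \<in>\<^sub>c T \<longleftrightarrow> (\<exists>x. x \<in>\<^sub>c X \<and> subst \<phi> v x \<in>\<^sub>c T)" using T' 5(1) by blast
    then show ?thesis using 5 by (simp add: tarski_Ex)
  qed
  then show "truth_upto X SN T \<and> (\<forall>\<theta>. \<theta> \<in>\<^sub>c T --> csl X \<theta>)" using conjunct1[OF T'] by (blast intro: truth_uptoI)
qed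

lemma True_class: "is_truth_class X (True_class X)"
proof -
  have "\<exists>!T. is_truth_class X T"
  proof (rule ex_ex1I)
    show "\<exists>T. is_truth_class X T" unfolding is_truth_class_iff by (rule truth_exists)
  next
    fix T T' assume "is_truth_class X T" "is_truth_class X T'"
    then have T: "truth_upto X SN T" "\<And>\<theta>. \<theta> \<in>\<^sub>c T ==> csl X \<theta>" and T': "truth_upto X SN T'" "\<And>\<theta>. \<theta> \<in>\<^sub>c T' ==> csl X \<theta>"
      unfolding is_truth_class_iff by blast+
    have "transitive SN" unfolding transitive_def using SN_mem subclsI by metis
    then have "\<theta> \<in>\<^sub>c T \<longleftrightarrow> \<theta> \<in>\<^sub>c T'" if "csl X \<theta>" for \<theta>
      using truth_upto_unique[OF T(1) T'(1) that] csl_Dom[OF that] by blast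
    then show "T = T'" using T(2) T'(2) by (intro cext) blast
  qed
  from theI'[OF this] show ?thesis unfolding True_class_def .
qed

lemma models_tarski: "csl X \<theta> ==> X \<Turnstile>\<^sub>f \<theta> \<longleftrightarrow> tarski X (True_class X) \<theta>"
  using True_class[of X] truth_uptoD csl_Dom unfolding models_f_def is_truth_class_iff by blast

lemma models_Eq: "x \<in>\<^sub>c X ==> y \<in>\<^sub>c X ==> X \<Turnstile>\<^sub>f fEq (par x) (par y) \<longleftrightarrow> x = y"
  using models_tarski[of X "fEq (par x) (par y)"] by (simp add: csl_atom tarski_Eq mem_set)

lemma models_Mem: "x \<in>\<^sub>c X ==> y \<in>\<^sub>c X ==> X \<Turnstile>\<^sub>f fMem (par x) (par y) \<longleftrightarrow> x \<in>\<^sub>c y"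
  using models_tarski[of X "fMem (par x) (par y)"] by (simp add: csl_atom tarski_Mem mem_set)

lemma models_Neg: "csl X \<phi> ==> X \<Turnstile>\<^sub>f fNeg \<phi> \<longleftrightarrow> \<not> X \<Turnstile>\<^sub>f \<phi>"
  using models_tarski[of X "fNeg \<phi>"] csl_ff by (simp add: csl_Neg tarski_Neg models_f_def)

lemma models_Or: "csl X \<phi> ==> csl X \<psi> ==> X \<Turnstile>\<^sub>f fOr \<phi> \<psi> \<longleftrightarrow> X \<Turnstile>\<^sub>f \<phi> \<or> X \<Turnstile>\<^sub>f \<psi>"
  using models_tarski[of X "fOr \<phi> \<psi>"] csl_ff by (simp add: csl_Or tarski_Or models_f_def)

lemma models_Ex:
  "is_var v ==> formal_formula \<phi> ==> csl X (fEx v \<phi>) ==> X \<Turnstile>\<^sub>f fEx v \<phi> \<longleftrightarrow> (\<exists>x. x \<in>\<^sub>c X \<and> X \<Turnstile>\<^sub>f subst \<phi> v x)"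
  using models_tarski[of X "fEx v \<phi>"] by (simp add: tarski_Ex models_f_def)

end

section \<open>Derived connectives of the metalanguage\<close>

definition And_fm where "And_fm \<phi> \<psi> = Neg_fm (Or_fm (Neg_fm \<phi>) (Neg_fm \<psi>))"
definition Imp_fm where "Imp_fm \<phi> \<psi> = Or_fm (Neg_fm \<phi>) \<psi>"
definition Iff_fm where "Iff_fm \<phi> \<psi> = And_fm (Imp_fm \<phi> \<psi>) (Imp_fm \<psi> \<phi>)"
definition All_fm where "All_fm i \<phi> = Neg_fm (Ex_fm i (Neg_fm \<phi>))"

lemmas fm_defs = And_fm_def Imp_fm_def Iff_fm_def All_fm_def

lemma fvs_derived [simp]:
  "fvs (And_fm \<phi> \<psi>) = fvs \<phi> \<union> fvs \<psi>" "fvs (Imp_fm \<phi> \<psi>) = fvs \<phi> \<union> fvs \<psi>"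
  "fvs (Iff_fm \<phi> \<psi>) = fvs \<phi> \<union> fvs \<psi>" "fvs (All_fm i \<phi>) = fvs \<phi> - {i}"
  by (auto simp: fm_defs)

context ths
begin

subsection \<open>Codes of metalanguage formulas\<close>

abbreviation tm :: "(nat \<Rightarrow> 'a option) \<Rightarrow> nat \<Rightarrow> 'a" where
  "tm e i \<equiv> (case e i of None \<Rightarrow> vr i | Some x \<Rightarrow> par x)"

text \<open>Variables with a value in \<open>e\<close> are coded as parameters, the others as formal
  variables, and a quantifier withdraws the value of its variable. In this way formal substitution
  becomes an update of \<open>e\<close>.\<close>

primrec code :: "fm \<Rightarrow> (nat \<Rightarrow> 'a option) \<Rightarrow> 'a" where
  "code (Mem_fm i j) e = fMem (tm e i) (tm e j)"
| "code (Eq_fm i j) e = fEq (tm e i) (tm e j)"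
| "code (Neg_fm \<phi>) e = fNeg (code \<phi> e)"
| "code (Or_fm \<phi> \<psi>) e = fOr (code \<phi> e) (code \<psi> e)"
| "code (Ex_fm i \<phi>) e = fEx (vr i) (code \<phi> (e(i := None)))"

lemma num_nat [simp]: "is_nat (num k)"
  by (induction k) simp_all

lemma is_var_vr [simp]: "is_var (vr k)"
  unfolding is_var_def using num_nat by blast

lemma ran_upd: "(\<forall>x\<in>ran e. P x) ==> \<forall>x\<in>ran (e(i := None)). P x"
  by (auto simp: ran_def)

lemma tm_cases:
  obtains "e i = None" "tm e i = vr i" | x where "e i = Some x" "x \<in> ran e" "tm e i = par x"
  by (cases "e i") (auto intro: ranI)

lemma is_term_tm: "\<forall>x\<in>ran e. is_set x ==> is_term (tm e i)"
  by (cases rule: tm_cases[of e i]) (auto intro: is_term_par is_term_var)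

lemma code_ff: "\<forall>x\<in>ran e. is_set x ==> formal_formula (code \<phi> e)"
proof (induction \<phi> arbitrary: e)
  case (Ex_fm i \<phi>)
  have "formal_formula (code \<phi> (e(i := None)))" by (rule Ex_fm.IH[OF ran_upd[OF Ex_fm.prems]])
  then show ?case unfolding code.simps by (rule ff_Ex[OF is_var_vr])
qed (auto intro!: ff_atom is_term_tm ff_Neg ff_Or)

lemma repl_tm:
  assumes "\<forall>x\<in>ran e. is_set x" "e i = None"
  shows "repl (vr i) x (tm e l) = tm (e(i := Some x)) l"
proof (cases "e l")
  case None
  have "is_set (num i)" "is_set (num l)" by simp_all
  then show ?thesis using None by simp
next
  case (Some y)
  then have "is_set y" using assms(1) by (blast intro: ranI)
  from is_var_neq(4)[OF is_var_vr this] show ?thesis using Some assms(2) by auto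
qed

lemma subst_code:
  "\<forall>x\<in>ran e. is_set x ==> is_set x ==> e i = None ==> subst (code \<phi> e) (vr i) x = code \<phi> (e(i := Some x))"
proof (induction \<phi> arbitrary: e)
  case (Mem_fm j k)
  note t = is_term_tm[OF Mem_fm(1)]
  show ?case unfolding code.simps subst_Mem[OF is_var_vr Mem_fm(2) t t] repl_tm[OF Mem_fm(1,3)] ..
next
  case (Eq_fm j k)
  note t = is_term_tm[OF Eq_fm(1)]
  show ?case unfolding code.simps subst_Eq[OF is_var_vr Eq_fm(2) t t] repl_tm[OF Eq_fm(1,3)] ..
next
  case (Neg_fm \<phi>)
  then show ?case using code_ff[of e] by (simp add: subst_Neg)
next
  case (Or_fm \<phi> \<psi>)
  then show ?case using code_ff[of e] by (simp add: subst_Or)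
next
  case (Ex_fm j \<phi>)
  note e = ran_upd[OF Ex_fm.prems(1), of j]
  have s: "subst (code (Ex_fm j \<phi>) e) (vr i) x = (if vr j = vr i then code (Ex_fm j \<phi>) e else fEx (vr j) (subst (code \<phi> (e(j := None))) (vr i) x))"
    unfolding code.simps by (rule subst_Ex[OF is_var_vr Ex_fm.prems(2) is_var_vr code_ff[OF e]])
  have eq: "vr j = vr i \<longleftrightarrow> j = i" by simp
  show ?case
  proof (cases "j = i")
    case True
    from s show ?thesis unfolding code.simps True fun_upd_upd by simp
  next
    case False
    have "subst (code \<phi> (e(j := None))) (vr i) x = code \<phi> (e(j := None, i := Some x))"
      by (rule Ex_fm.IH[OF e]) (use Ex_fm.prems in simp_all)
    with s show ?thesis unfolding eq fun_upd_twist[OF False] code.simps using False by simp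
  qed
qed

lemma code_SL: "\<forall>x\<in>ran e. x \<in>\<^sub>c X ==> SL X (code \<phi> e)"
proof (induction \<phi> arbitrary: e)
  case (Ex_fm i \<phi>)
  have "SL X (code \<phi> (e(i := None)))" by (rule Ex_fm.IH[OF ran_upd[OF Ex_fm.prems]])
  then show ?case using SL_ff by (simp add: SL_Ex)
next
  case (Mem_fm i j)
  have e: "\<forall>x\<in>ran e. is_set x" using Mem_fm mem_set by blast
  have "y \<in>\<^sub>c X" if "is_set y" "tm e k = par y" for k y
    using is_var_neq[OF is_var_vr] that Mem_fm e by (cases rule: tm_cases[of e k]) auto
  then show ?case unfolding code.simps SL_atom(2)[OF is_term_tm[OF e] is_term_tm[OF e]] by blast
next
  case (Eq_fm i j)
  have e: "\<forall>x\<in>ran e. is_set x" using Eq_fm mem_set by blast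
  have "y \<in>\<^sub>c X" if "is_set y" "tm e k = par y" for k y
    using is_var_neq[OF is_var_vr] that Eq_fm e by (cases rule: tm_cases[of e k]) auto
  then show ?case unfolding code.simps SL_atom(1)[OF is_term_tm[OF e] is_term_tm[OF e]] by blast
next
  case (Neg_fm \<phi>)
  then have "SL X (code \<phi> e)" by blast
  then show ?case using SL_ff by (simp add: SL_Neg)
next
  case (Or_fm \<phi> \<psi>)
  then have "SL X (code \<phi> e)" "SL X (code \<psi> e)" by blast+
  then show ?case using SL_ff by (simp add: SL_Or)
qed

lemma free_in_code:
  "\<forall>x\<in>ran e. is_set x ==> is_var v ==> free_in v (code \<phi> e) ==> \<exists>k. k \<in> fvs \<phi> \<and> e k = None \<and> v = vr k"
proof (induction \<phi> arbitrary: e)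
  case (Mem_fm i j)
  have "e k = None \<and> v = vr k" if "v = tm e k" for k
    using is_var_neq[OF Mem_fm(2)] that Mem_fm(1) by (cases rule: tm_cases[of e k]) auto
  moreover have "v = tm e i \<or> v = tm e j"
    using Mem_fm(3) unfolding code.simps free_in_Mem[OF Mem_fm(2) is_term_tm[OF Mem_fm(1)] is_term_tm[OF Mem_fm(1)]] .
  ultimately show ?case by (metis fvs.simps(1) insertI1 insertI2)
next
  case (Eq_fm i j)
  have "e k = None \<and> v = vr k" if "v = tm e k" for k
    using is_var_neq[OF Eq_fm(2)] that Eq_fm(1) by (cases rule: tm_cases[of e k]) auto
  moreover have "v = tm e i \<or> v = tm e j"
    using Eq_fm(3) unfolding code.simps free_in_Eq[OF Eq_fm(2) is_term_tm[OF Eq_fm(1)] is_term_tm[OF Eq_fm(1)]] .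
  ultimately show ?case by (metis fvs.simps(2) insertI1 insertI2)
next
  case (Neg_fm \<phi>)
  then show ?case using code_ff[of e] by (simp add: free_in_Neg)
next
  case (Or_fm \<phi> \<psi>)
  then have "free_in v (code \<phi> e) \<or> free_in v (code \<psi> e)" using code_ff[of e] by (simp add: free_in_Or)
  then show ?case using Or_fm.IH[OF Or_fm.prems(1,2)] by auto
next
  case (Ex_fm i \<phi>)
  note e = ran_upd[OF Ex_fm.prems(1), of i]
  have "v \<noteq> vr i" "free_in v (code \<phi> (e(i := None)))"
    using Ex_fm.prems(3) unfolding code.simps free_in_Ex[OF Ex_fm.prems(2) is_var_vr code_ff[OF e]] by blast+
  moreover from this(2) obtain k where "k \<in> fvs \<phi>" "(e(i := None)) k = None" "v = vr k"
    using Ex_fm.IH[OF e Ex_fm.prems(2)] by blast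
  ultimately show ?case by (intro exI[of _ k]) (auto split: if_splits)
qed

lemma csl_code:
  assumes a: "\<forall>x\<in>ran e. x \<in>\<^sub>c X" and d: "fvs \<phi> \<subseteq> dom e" shows "csl X (code \<phi> e)"
proof -
  have e: "\<forall>x\<in>ran e. is_set x" using a mem_set by blast
  have "\<not> free_in v (code \<phi> e)" if "is_var v" for v
  proof
    assume "free_in v (code \<phi> e)"
    from free_in_code[OF e that this] show False using d by auto
  qed
  then show "csl X (code \<phi> e)" unfolding csl_def closed_formula_def using code_SL[OF a] code_ff[OF e] by blast
qed

text \<open>For formulas of the metalanguage internal truth becomes HOL satisfaction with
  quantifiers over the elements of \<open>X\<close>, so the single axioms turn into statements about
  membership in \<open>Z\<close>. The separation scheme is not accessible in this way, its formulas
  being internal objects.\<close>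

lemma models_code:
  "\<forall>x\<in>ran e. x \<in>\<^sub>c X ==> fvs \<phi> \<subseteq> dom e ==> X \<Turnstile>\<^sub>f code \<phi> e \<longleftrightarrow> sat {z. z \<in>\<^sub>c X} \<phi> (\<lambda>i. the (e i))"
proof (induction \<phi> arbitrary: e)
  case (Mem_fm i j)
  then obtain x y where "e i = Some x" "e j = Some y" by auto
  then show ?case using Mem_fm ranI[of e] by (simp add: models_Mem)
next
  case (Eq_fm i j)
  then obtain x y where "e i = Some x" "e j = Some y" by auto
  then show ?case using Eq_fm ranI[of e] by (simp add: models_Eq)
next
  case (Neg_fm \<phi>)
  then show ?case using csl_code[of e X \<phi>] by (simp add: models_Neg)
next
  case (Or_fm \<phi> \<psi>)
  then show ?case using csl_code[of e X \<phi>] csl_code[of e X \<psi>] by (simp add: models_Or)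
next
  case (Ex_fm i \<phi>)
  have e: "\<forall>x\<in>ran (e(i := None)). is_set x" using ran_upd[OF Ex_fm.prems(1)] mem_set by blast
  have "X \<Turnstile>\<^sub>f code (Ex_fm i \<phi>) e \<longleftrightarrow> (\<exists>x. x \<in>\<^sub>c X \<and> X \<Turnstile>\<^sub>f subst (code \<phi> (e(i := None))) (vr i) x)"
    using models_Ex[OF is_var_vr code_ff[OF e]] csl_code[OF Ex_fm.prems] by simp
  also have "\<dots> \<longleftrightarrow> (\<exists>x. x \<in>\<^sub>c X \<and> sat {z. z \<in>\<^sub>c X} \<phi> ((\<lambda>i. the (e i))(i := x)))"
  proof -
    have "X \<Turnstile>\<^sub>f subst (code \<phi> (e(i := None))) (vr i) x \<longleftrightarrow> sat {z. z \<in>\<^sub>c X} \<phi> ((\<lambda>i. the (e i))(i := x))" if x: "x \<in>\<^sub>c X" for x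
    proof -
      have "X \<Turnstile>\<^sub>f code \<phi> (e(i := Some x)) \<longleftrightarrow> sat {z. z \<in>\<^sub>c X} \<phi> (\<lambda>k. the ((e(i := Some x)) k))"
        by (rule Ex_fm.IH) (use Ex_fm.prems x in \<open>auto simp: ran_def\<close>)
      moreover have "(\<lambda>k. the ((e(i := Some x)) k)) = (\<lambda>i. the (e i))(i := x)" by auto
      ultimately show ?thesis using subst_code[OF e mem_set[OF x], of i \<phi>] by simp
    qed
    then show ?thesis by blast
  qed
  finally show ?case by simp
qed

lemma models_sentence: "fvs \<phi> = {} ==> X \<Turnstile>\<^sub>f code \<phi> (\<lambda>_. None) \<longleftrightarrow> sat {z. z \<in>\<^sub>c X} \<phi> (\<lambda>i. the None)"
  by (rule models_code) simp_all

lemma sat_derived [simp]: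
  "sat D (And_fm \<phi> \<psi>) s \<longleftrightarrow> sat D \<phi> s \<and> sat D \<psi> s" "sat D (Imp_fm \<phi> \<psi>) s \<longleftrightarrow> (sat D \<phi> s --> sat D \<psi> s)"
  "sat D (Iff_fm \<phi> \<psi>) s \<longleftrightarrow> (sat D \<phi> s \<longleftrightarrow> sat D \<psi> s)" "sat D (All_fm i \<phi>) s \<longleftrightarrow> (\<forall>x\<in>D. sat D \<phi> (s(i := x)))"
  by (auto simp: fm_defs)

lemmas f_defs = fAll_def fIff_def fImp_def fAnd_def

lemma code_derived [simp]:
  "code (And_fm \<phi> \<psi>) e = fAnd (code \<phi> e) (code \<psi> e)" "code (Imp_fm \<phi> \<psi>) e = fImp (code \<phi> e) (code \<psi> e)"
  "code (Iff_fm \<phi> \<psi>) e = fIff (code \<phi> e) (code \<psi> e)" "code (All_fm i \<phi>) e = fAll (vr i) (code \<phi> (e(i := None)))"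
  by (simp_all add: fm_defs f_defs)

lemma extensionality_code: "ax_extensionality = code (All_fm 0 (All_fm 1
     (Imp_fm (All_fm 2 (Iff_fm (Mem_fm 2 0) (Mem_fm 2 1))) (Eq_fm 0 1)))) (\<lambda>_. None)"
  by (simp add: ax_extensionality_def)

lemma empty_set_code: "ax_empty_set = code (Ex_fm 0 (All_fm 1 (Neg_fm (Mem_fm 1 0)))) (\<lambda>_. None)"
  by (simp add: ax_empty_set_def)

lemma pairing_code: "ax_pairing = code (All_fm 0 (All_fm 1 (Ex_fm 2 (All_fm 3
     (Iff_fm (Mem_fm 3 2) (Or_fm (Eq_fm 3 0) (Eq_fm 3 1))))))) (\<lambda>_. None)"
  by (simp add: ax_pairing_def)

lemma union_code: "ax_union = code (All_fm 0 (Ex_fm 1 (All_fm 2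
     (Iff_fm (Mem_fm 2 1) (Ex_fm 3 (And_fm (Mem_fm 3 0) (Mem_fm 2 3))))))) (\<lambda>_. None)"
  by (simp add: ax_union_def)

lemma power_set_code: "ax_power_set = code (All_fm 0 (Ex_fm 1 (All_fm 2
     (Iff_fm (Mem_fm 2 1) (All_fm 3 (Imp_fm (Mem_fm 3 2) (Mem_fm 3 0))))))) (\<lambda>_. None)"
  by (simp add: ax_power_set_def)

lemma infinity_code: "ax_infinity = code (Ex_fm 0 (And_fm
     (Ex_fm 1 (And_fm (All_fm 2 (Neg_fm (Mem_fm 2 1))) (Mem_fm 1 0)))
     (All_fm 1 (Imp_fm (Mem_fm 1 0)
        (Ex_fm 2 (And_fm (Mem_fm 2 0)
           (All_fm 3 (Iff_fm (Mem_fm 3 2) (Or_fm (Mem_fm 3 1) (Eq_fm 3 1)))))))))) (\<lambda>_. None)"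
  by (simp add: ax_infinity_def)

lemma choice_code: "ax_choice = code (All_fm 0 (Imp_fm
     (And_fm
       (All_fm 1 (Imp_fm (Mem_fm 1 0) (Ex_fm 2 (Mem_fm 2 1))))
       (All_fm 1 (All_fm 2 (Imp_fm
          (And_fm (And_fm (Mem_fm 1 0) (Mem_fm 2 0))
                (Ex_fm 3 (And_fm (Mem_fm 3 1) (Mem_fm 3 2))))
          (Eq_fm 1 2)))))
     (Ex_fm 4 (All_fm 1 (Imp_fm (Mem_fm 1 0)
        (Ex_fm 2 (All_fm 3
           (Iff_fm (And_fm (Mem_fm 3 1) (Mem_fm 3 4)) (Eq_fm 3 2))))))))) (\<lambda>_. None)"
  by (simp add: ax_choice_def)

section \<open>The single axioms in a bounded universe\<close>

context
  fixes Z B assumes ZB: "bounded_universe Z B"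
begin

lemma
  shows Z_thin: "thin Z" and Z_fin: "fin_closed Z" and Z_ext: "extensional Z" and B_SN: "B SN"
    and B_rep: "B C ==> C \<subseteq>\<^sub>c Z \<and> (\<exists>q. q \<in>\<^sub>c Z \<and> q \<inter>\<^sub>c Z = C)"
    and B_down: "B C ==> D \<subseteq>\<^sub>c C ==> B D" and B_mem: "a \<in>\<^sub>c Z ==> B (a \<inter>\<^sub>c Z)"
    and B_union: "B C ==> (\<And>z. z \<in>\<^sub>c D ==> z \<in>\<^sub>c Z \<and> (\<exists>y. y \<in>\<^sub>c C \<and> z \<in>\<^sub>c y)) ==> B D"
    and B_power: "B C ==> (\<And>y. y \<in>\<^sub>c D ==> y \<in>\<^sub>c Z \<and> y \<inter>\<^sub>c Z \<subseteq>\<^sub>c C) ==> B D"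
proof -
  note u = ZB[unfolded bounded_universe_def]
  show "thin Z" "fin_closed Z" "extensional Z" "B SN" 
    by (rule conjunct1[OF u] conjunct2[OF u, THEN conjunct1] conjunct2[OF u, THEN conjunct2, THEN conjunct1]
      conjunct2[OF u, THEN conjunct2, THEN conjunct2, THEN conjunct1])+
  show "B C ==> C \<subseteq>\<^sub>c Z \<and> (\<exists>q. q \<in>\<^sub>c Z \<and> q \<inter>\<^sub>c Z = C)"
    by (rule u[THEN conjunct2, THEN conjunct2, THEN conjunct2, THEN conjunct2, THEN conjunct1, rule_format])
  show "B C ==> D \<subseteq>\<^sub>c C ==> B D"
    by (rule u[THEN conjunct2, THEN conjunct2, THEN conjunct2, THEN conjunct2, THEN conjunct2, THEN conjunct1, rule_format])
  show "a \<in>\<^sub>c Z ==> B (a \<inter>\<^sub>c Z)"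
    by (rule u[THEN conjunct2, THEN conjunct2, THEN conjunct2, THEN conjunct2, THEN conjunct2, THEN conjunct2, THEN conjunct1, rule_format])
  note w = u[THEN conjunct2, THEN conjunct2, THEN conjunct2, THEN conjunct2, THEN conjunct2, THEN conjunct2, THEN conjunct2]
  show "B C ==> (\<And>z. z \<in>\<^sub>c D ==> z \<in>\<^sub>c Z \<and> (\<exists>y. y \<in>\<^sub>c C \<and> z \<in>\<^sub>c y)) ==> B D"
    using conjunct1[OF w] by simp
  show "B C ==> (\<And>y. y \<in>\<^sub>c D ==> y \<in>\<^sub>c Z \<and> y \<inter>\<^sub>c Z \<subseteq>\<^sub>c C) ==> B D"
    using conjunct2[OF w] by simp
qed

lemma B_code: "B C ==> \<exists>q. q \<in>\<^sub>c Z \<and> (\<forall>z. z \<in>\<^sub>c Z --> (z \<in>\<^sub>c q \<longleftrightarrow> z \<in>\<^sub>c C))"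
proof -
  assume "B C"
  then obtain q where "q \<in>\<^sub>c Z" "q \<inter>\<^sub>c Z = C" using B_rep by blast
  then show ?thesis by (intro exI[of _ q]) auto
qed

lemma models_extensionality: "Z \<Turnstile>\<^sub>f ax_extensionality"
  unfolding extensionality_code by (rule models_sentence[THEN iffD2], simp add: insert_Diff_if, simp, use extensionalD[OF Z_ext] in blast)

lemma emp_Z: "emp \<in>\<^sub>c Z"
  by (rule fin_closedD[OF Z_fin]) (simp_all add: subcls_def)

lemma models_empty_set: "Z \<Turnstile>\<^sub>f ax_empty_set"
  unfolding empty_set_code by (rule models_sentence[THEN iffD2], simp add: insert_Diff_if, simp, use emp_Z not_mem_emp in blast)

lemma upair_Z: "a \<in>\<^sub>c Z ==> b \<in>\<^sub>c Z ==> upair a b \<in>\<^sub>c Z"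
  by (rule fin_closedD[OF Z_fin]) (auto simp: mem_upair subcls_def mem_set)

lemma models_pairing: "Z \<Turnstile>\<^sub>f ax_pairing"
proof -
  have F: "\<exists>p. p \<in>\<^sub>c Z \<and> (\<forall>z. z \<in>\<^sub>c Z --> (z \<in>\<^sub>c p \<longleftrightarrow> z = a \<or> z = b))" if "a \<in>\<^sub>c Z" "b \<in>\<^sub>c Z" for a b
    using upair_Z[OF that] by (intro exI[of _ "upair a b"]) (auto simp: mem_upair mem_set)
  show ?thesis unfolding pairing_code by (rule models_sentence[THEN iffD2], simp add: insert_Diff_if, simp, use F in blast)
qed

lemma models_union: "Z \<Turnstile>\<^sub>f ax_union"
proof -
  have F: "\<exists>p. p \<in>\<^sub>c Z \<and> (\<forall>z. z \<in>\<^sub>c Z --> (z \<in>\<^sub>c p \<longleftrightarrow> (\<exists>y. y \<in>\<^sub>c Z \<and> y \<in>\<^sub>c a \<and> z \<in>\<^sub>c y)))" if a: "a \<in>\<^sub>c Z" for a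
  proof -
    \<comment> \<open>The union is cut down to \<open>Z\<close>; its elements are then members of
      members of the bounded trace of \<open>a\<close>.\<close>
    have "B (\<Union>\<^sub>c (a \<inter>\<^sub>c Z) \<inter>\<^sub>c Z)" by (rule B_union[OF B_mem[OF a]]) auto
    from B_code[OF this] obtain q where "q \<in>\<^sub>c Z" "\<And>z. z \<in>\<^sub>c Z ==> z \<in>\<^sub>c q \<longleftrightarrow> (\<exists>y. y \<in>\<^sub>c a \<and> y \<in>\<^sub>c Z \<and> z \<in>\<^sub>c y)" by auto
    then show ?thesis by (intro exI[of _ q]) blast
  qed
  show ?thesis unfolding union_code by (rule models_sentence[THEN iffD2], simp add: insert_Diff_if, simp, use F in blast)
qed

lemma models_power_set: "Z \<Turnstile>\<^sub>f ax_power_set"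
proof -
  have F: "\<exists>p. p \<in>\<^sub>c Z \<and> (\<forall>z. z \<in>\<^sub>c Z --> (z \<in>\<^sub>c p \<longleftrightarrow> (\<forall>y. y \<in>\<^sub>c Z --> y \<in>\<^sub>c z --> y \<in>\<^sub>c a)))" if a: "a \<in>\<^sub>c Z" for a
  proof -
    \<comment> \<open>Inclusion is meant inside \<open>Z\<close>, so the condition compares traces
      on \<open>Z\<close>.\<close>
    let ?D = "cls (\<lambda>z. z \<in>\<^sub>c Z \<and> z \<inter>\<^sub>c Z \<subseteq>\<^sub>c a \<inter>\<^sub>c Z)"
    have D: "z \<in>\<^sub>c ?D \<longleftrightarrow> is_set z \<and> z \<in>\<^sub>c Z \<and> z \<inter>\<^sub>c Z \<subseteq>\<^sub>c a \<inter>\<^sub>c Z" for z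
      by (rule mem_cls) (intro dfn_intros dft_const_True)
    have "B ?D" by (rule B_power[OF B_mem[OF a]]) (simp add: D)
    from B_code[OF this] obtain q where q: "q \<in>\<^sub>c Z" "\<And>z. z \<in>\<^sub>c Z ==> z \<in>\<^sub>c q \<longleftrightarrow> z \<in>\<^sub>c ?D" by blast
    have "z \<in>\<^sub>c ?D \<longleftrightarrow> (\<forall>y. y \<in>\<^sub>c Z --> y \<in>\<^sub>c z --> y \<in>\<^sub>c a)" if "z \<in>\<^sub>c Z" for z
      unfolding D unfolding subcls_def mem_inter using that mem_set[OF that] by blast
    with q show ?thesis by (intro exI[of _ q]) simp
  qed
  show ?thesis unfolding power_set_code by (rule models_sentence[THEN iffD2], simp add: insert_Diff_if, simp, use F in blast)
qed

lemma SN_Z: "n \<in>\<^sub>c SN ==> n \<in>\<^sub>c Z"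
  using B_rep[OF B_SN] subclsD by blast

lemma models_infinity: "Z \<Turnstile>\<^sub>f ax_infinity"
proof -
  \<comment> \<open>The class \<open>SN\<close> is not a set; \<open>q\<close> merely has it as its
    trace on \<open>Z\<close>.\<close>
  obtain q where q: "q \<in>\<^sub>c Z" "\<And>z. z \<in>\<^sub>c Z ==> z \<in>\<^sub>c q \<longleftrightarrow> z \<in>\<^sub>c SN" using B_code[OF B_SN] by blast
  have e: "emp \<in>\<^sub>c q" using q(2)[OF emp_Z] emp_in_SN by simp
  have s: "\<exists>y. y \<in>\<^sub>c Z \<and> y \<in>\<^sub>c q \<and> (\<forall>z. z \<in>\<^sub>c Z --> (z \<in>\<^sub>c y \<longleftrightarrow> z \<in>\<^sub>c n \<or> z = n))" if n: "n \<in>\<^sub>c Z" "n \<in>\<^sub>c q" for n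
  proof (intro exI conjI)
    have "suc n \<in>\<^sub>c SN" using q(2) n suc_in_SN by blast
    then show "suc n \<in>\<^sub>c Z" "suc n \<in>\<^sub>c q" using q(2) SN_Z by simp_all
    show "\<forall>z. z \<in>\<^sub>c Z --> (z \<in>\<^sub>c suc n \<longleftrightarrow> z \<in>\<^sub>c n \<or> z = n)" using mem_suc[OF mem_set[OF n(1)]] by simp
  qed
  have F: "\<exists>q. q \<in>\<^sub>c Z \<and> (\<exists>x. x \<in>\<^sub>c Z \<and> (\<forall>y. y \<in>\<^sub>c Z --> \<not> y \<in>\<^sub>c x) \<and> x \<in>\<^sub>c q) \<and>
    (\<forall>n. n \<in>\<^sub>c Z --> n \<in>\<^sub>c q --> (\<exists>y. y \<in>\<^sub>c Z \<and> y \<in>\<^sub>c q \<and> (\<forall>z. z \<in>\<^sub>c Z --> (z \<in>\<^sub>c y \<longleftrightarrow> z \<in>\<^sub>c n \<or> z = n))))"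
    by (rule exI[of _ q], intro conjI q(1) exI[of _ emp] emp_Z e) (use s in auto)
  show ?thesis unfolding infinity_code by (rule models_sentence[THEN iffD2], simp add: insert_Diff_if, simp, use F in blast)
qed

text \<open>The chosen elements are members of members of \<open>a\<close>, so the class of their
  values is bounded and has a representative in \<open>Z\<close>. Disjointness ensures that it picks
  no second element from any member of \<open>a\<close>.\<close>

lemma transversal:
  assumes a: "a \<in>\<^sub>c Z" and ne: "\<And>x. x \<in>\<^sub>c Z ==> x \<in>\<^sub>c a ==> \<exists>y. y \<in>\<^sub>c Z \<and> y \<in>\<^sub>c x"
    and disj: "\<And>x y z. x \<in>\<^sub>c Z ==> y \<in>\<^sub>c Z ==> x \<in>\<^sub>c a ==> y \<in>\<^sub>c a ==> z \<in>\<^sub>c Z ==> z \<in>\<^sub>c x ==> z \<in>\<^sub>c y ==> x = y"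
  shows "\<exists>c. c \<in>\<^sub>c Z \<and> (\<forall>x. x \<in>\<^sub>c Z --> x \<in>\<^sub>c a --> (\<exists>y. y \<in>\<^sub>c Z \<and> (\<forall>z. z \<in>\<^sub>c Z --> (z \<in>\<^sub>c x \<and> z \<in>\<^sub>c c \<longleftrightarrow> z = y))))"
proof -
  have "\<exists>f. dft True (\<lambda>s. f (s 0)) \<and> (\<forall>x. x \<in>\<^sub>c a \<inter>\<^sub>c Z --> is_set (f x) \<and> f x \<in>\<^sub>c Z \<and> f x \<in>\<^sub>c x)"
  proof (rule choice_function)
    show "thin (a \<inter>\<^sub>c Z)" using Z_thin by (rule thin_subcls) (simp add: subcls_def)
    show "dfn True (\<lambda>s. s (Suc 0) \<in>\<^sub>c Z \<and> s (Suc 0) \<in>\<^sub>c s 0)" by (intro dfn_intros dft_const_True)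
    show "\<exists>c. is_set c \<and> c \<in>\<^sub>c Z \<and> c \<in>\<^sub>c x" if "x \<in>\<^sub>c a \<inter>\<^sub>c Z" for x using ne[of x] that mem_set by auto
  qed
  then obtain f where f: "dft True (\<lambda>s. f (s 0))" "\<And>x. x \<in>\<^sub>c a ==> x \<in>\<^sub>c Z ==> is_set (f x) \<and> f x \<in>\<^sub>c Z \<and> f x \<in>\<^sub>c x" by auto
  let ?C = "img f (a \<inter>\<^sub>c Z)"
  have C: "z \<in>\<^sub>c ?C \<longleftrightarrow> (\<exists>x. x \<in>\<^sub>c a \<and> x \<in>\<^sub>c Z \<and> z = f x)" for z unfolding mem_img[OF f(1)] using f(2) by auto
  have "B ?C" by (rule B_union[OF B_mem[OF a]]) (use C f(2) in auto)
  from B_code[OF this] obtain c where c: "c \<in>\<^sub>c Z" "\<And>z. z \<in>\<^sub>c Z ==> z \<in>\<^sub>c c \<longleftrightarrow> z \<in>\<^sub>c ?C" by blast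
  show ?thesis
  proof (rule exI[of _ c], intro conjI allI impI c(1))
    fix x assume x: "x \<in>\<^sub>c Z" "x \<in>\<^sub>c a"
    have "z = f x" if "z \<in>\<^sub>c Z" "z \<in>\<^sub>c x" "z \<in>\<^sub>c c" for z
    proof -
      have "z \<in>\<^sub>c ?C" using c(2)[OF that(1)] that(3) by simp
      then obtain x' where x': "x' \<in>\<^sub>c a" "x' \<in>\<^sub>c Z" "z = f x'" unfolding C by blast
      then have "x = x'" using disj[OF x(1) x'(2) x(2) x'(1) that(1,2)] f(2)[OF x'(1,2)] by simp
      then show ?thesis using x'(3) by simp
    qed
    then show "\<exists>y. y \<in>\<^sub>c Z \<and> (\<forall>z. z \<in>\<^sub>c Z --> (z \<in>\<^sub>c x \<and> z \<in>\<^sub>c c \<longleftrightarrow> z = y))"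
      
    proof (intro exI[of _ "f x"] conjI allI impI iffI)
      show "f x \<in>\<^sub>c Z" using f(2)[OF x(2,1)] by blast
      moreover have "f x \<in>\<^sub>c ?C" unfolding C using x by blast
      ultimately have "f x \<in>\<^sub>c c" using c(2) by simp
      then show "z \<in>\<^sub>c x" "z \<in>\<^sub>c c" if "z = f x" for z using f(2)[OF x(2,1)] that by blast+
    qed blast
  qed
qed

lemma models_choice: "Z \<Turnstile>\<^sub>f ax_choice"
  unfolding choice_code
proof (rule models_sentence[THEN iffD2], simp add: insert_Diff_if, simp, intro allI impI, elim conjE)
  fix a assume "a \<in>\<^sub>c Z" "\<forall>x. x \<in>\<^sub>c Z --> x \<in>\<^sub>c a --> (\<exists>y. y \<in>\<^sub>c Z \<and> y \<in>\<^sub>c x)"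
    and "\<forall>x. x \<in>\<^sub>c Z --> (\<forall>y. y \<in>\<^sub>c Z --> x \<in>\<^sub>c a \<and> y \<in>\<^sub>c a \<and> (\<exists>z. z \<in>\<^sub>c Z \<and> z \<in>\<^sub>c x \<and> z \<in>\<^sub>c y) --> x = y)"
  with transversal[of a]
  show "\<exists>c. c \<in>\<^sub>c Z \<and> (\<forall>x. x \<in>\<^sub>c Z --> x \<in>\<^sub>c a --> (\<exists>y. y \<in>\<^sub>c Z \<and> (\<forall>z. z \<in>\<^sub>c Z --> (z \<in>\<^sub>c x \<and> z \<in>\<^sub>c c \<longleftrightarrow> z = y))))"
    by blast
qed

end


subsection \<open>The separation scheme\<close>

lemma subst_not_free:
  assumes t: "formal_formula \<theta>" and "\<not> free_in v \<theta>" shows "subst \<theta> v x = \<theta>"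
proof -
  have n: "\<not> free_at \<theta> v i" for i using assms(2) unfolding free_in_def by blast
  show ?thesis unfolding subst_def
  proof (rule the_equality)
    show "is_seq \<theta> \<and> Dom \<theta> = Dom \<theta> \<and> (\<forall>i. i \<in>\<^sub>c Dom \<theta> --> ap \<theta> i = (if free_at \<theta> v i then par x else ap \<theta> i))"
      using n ff_seq[OF t] by simp
    fix r assume "is_seq r \<and> Dom r = Dom \<theta> \<and> (\<forall>i. i \<in>\<^sub>c Dom \<theta> --> ap r i = (if free_at \<theta> v i then par x else ap \<theta> i))"
    then show "r = \<theta>" using n by (intro seq_ext[OF _ ff_seq[OF t]]) simp_all
  qed
qed

lemma ff_derived:
  "formal_formula \<phi> ==> formal_formula \<psi> ==> formal_formula (fAnd \<phi> \<psi>)"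
  "formal_formula \<phi> ==> formal_formula \<psi> ==> formal_formula (fIff \<phi> \<psi>)"
  "is_var v ==> formal_formula \<phi> ==> formal_formula (fAll v \<phi>)"
  by (simp_all add: f_defs ff_Neg ff_Or ff_Ex)

lemma subst_derived:
  assumes "is_var v" "is_set x" "formal_formula \<phi>"
  shows "formal_formula \<psi> ==> subst (fAnd \<phi> \<psi>) v x = fAnd (subst \<phi> v x) (subst \<psi> v x)"
    and "formal_formula \<psi> ==> subst (fIff \<phi> \<psi>) v x = fIff (subst \<phi> v x) (subst \<psi> v x)"
    and "is_var w ==> subst (fAll w \<phi>) v x = (if w = v then fAll w \<phi> else fAll w (subst \<phi> v x))"
  using assms by (simp_all add: f_defs ff_Neg ff_Or ff_Ex subst_Neg subst_Or subst_Ex)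

lemma csl_derived:
  assumes "formal_formula \<phi>" "formal_formula \<psi>"
  shows "csl X (fAnd \<phi> \<psi>) \<longleftrightarrow> csl X \<phi> \<and> csl X \<psi>" "csl X (fIff \<phi> \<psi>) \<longleftrightarrow> csl X \<phi> \<and> csl X \<psi>"
  using assms by (auto simp add: f_defs ff_Neg ff_Or csl_Neg csl_Or)

lemma models_derived:
  assumes "csl X \<phi>" "csl X \<psi>"
  shows "X \<Turnstile>\<^sub>f fAnd \<phi> \<psi> \<longleftrightarrow> X \<Turnstile>\<^sub>f \<phi> \<and> X \<Turnstile>\<^sub>f \<psi>" "X \<Turnstile>\<^sub>f fIff \<phi> \<psi> \<longleftrightarrow> (X \<Turnstile>\<^sub>f \<phi> \<longleftrightarrow> X \<Turnstile>\<^sub>f \<psi>)"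
  using assms assms[THEN csl_ff] by (auto simp add: f_defs ff_Neg ff_Or csl_Neg csl_Or models_Neg models_Or)

context
  fixes v \<phi> X assumes v: "is_var v" and p: "formal_formula \<phi>" and c: "csl X (fAll v \<phi>)"
begin

lemma csl_All_Ex: "csl X (fEx v (fNeg \<phi>))"
  using c p v by (simp add: fAll_def csl_Neg ff_Neg ff_Ex)

lemma csl_All_subst: "x \<in>\<^sub>c X ==> csl X (subst \<phi> v x)"
  using csl_subst[OF v ff_Neg[OF p] csl_All_Ex] subst_Neg[OF v mem_set p] subst_ff[OF v mem_set p] by (simp add: csl_Neg)

lemma models_All: "X \<Turnstile>\<^sub>f fAll v \<phi> \<longleftrightarrow> (\<forall>x. x \<in>\<^sub>c X --> X \<Turnstile>\<^sub>f subst \<phi> v x)"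
proof -
  have "X \<Turnstile>\<^sub>f subst (fNeg \<phi>) v x \<longleftrightarrow> \<not> X \<Turnstile>\<^sub>f subst \<phi> v x" if x: "x \<in>\<^sub>c X" for x
    using models_Neg[OF csl_All_subst[OF x]] subst_Neg[OF v mem_set[OF x] p] by simp
  then show ?thesis unfolding fAll_def models_Neg[OF csl_All_Ex] models_Ex[OF v ff_Neg[OF p] csl_All_Ex] by blast
qed

end

section \<open>Instances and validity of formal formulas\<close>

definition xAll where "xAll v \<phi> = xNeg (xEx v (xNeg \<phi>))"
definition xAnd where "xAnd \<phi> \<psi> = xNeg (xOr (xNeg \<phi>) (xNeg \<psi>))"
definition xIff where "xIff \<phi> \<psi> = xAnd (xOr (xNeg \<phi>) \<psi>) (xOr (xNeg \<psi>) \<phi>)"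

lemmas xd_defs = xAll_def xAnd_def xIff_def

lemma xd_eq:
  "is_set v ==> is_seq \<phi> ==> xAll v \<phi> = fAll v \<phi>"
  "is_seq \<phi> ==> is_seq \<psi> ==> xAnd \<phi> \<psi> = fAnd \<phi> \<psi>" "is_seq \<phi> ==> is_seq \<psi> ==> xIff \<phi> \<psi> = fIff \<phi> \<psi>"
  by (simp_all add: xd_defs f_defs)

lemma dft_xd [dfn_intros]:
  assumes "dft b t" "dft b u"
  shows "dft b (\<lambda>s. xAll (t s) (u s))" "dft b (\<lambda>s. xAnd (t s) (u s))" "dft b (\<lambda>s. xIff (t s) (u s))"
  unfolding xd_defs by (intro dfn_intros assms)+

text \<open>
  \<open>inst X \<eta> \<zeta>\<close>: \<open>\<zeta>\<close> is obtained from \<open>\<eta>\<close> by substituting elements of \<open>X\<close> any number of times, one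
  variable at a time.  Simultaneous substitution is avoided since the number of variables may be nonstandard.
\<close>

definition inst :: "'a \<Rightarrow> 'a \<Rightarrow> 'a \<Rightarrow> bool" where
  "inst X \<eta> \<zeta> \<longleftrightarrow> (\<forall>K. \<eta> \<in>\<^sub>c K -->
     (\<forall>\<xi>. \<xi> \<in>\<^sub>c K --> (\<forall>v. is_set v --> is_var v --> (\<forall>x. x \<in>\<^sub>c X --> substx \<xi> v x \<in>\<^sub>c K))) --> \<zeta> \<in>\<^sub>c K)"

lemma dfn_inst [dfn_intros]: "dft True t ==> dft True u ==> dft True w ==> dfn True (\<lambda>s. inst (t s) (u s) (w s))"
  by (rule dfn_comp3[where P = inst]) (unfold inst_def, intro dfn_intros)

lemma inst_induct:
  assumes i: "inst X \<eta> \<zeta>" and e: "is_set \<eta>" and P: "dfn True (\<lambda>s. P (s 0))" and 0: "P \<eta>"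
    and step: "\<And>\<xi> v x. P \<xi> ==> is_var v ==> x \<in>\<^sub>c X ==> P (substx \<xi> v x)"
  shows "P \<zeta>"
proof -
  have K: "z \<in>\<^sub>c cls P \<longleftrightarrow> is_set z \<and> P z" for z by (rule mem_cls[OF P])
  have s: "is_set (substx \<xi> v x)" for \<xi> v x by (simp add: substx_def ff_set)
  have "\<eta> \<in>\<^sub>c cls P" unfolding K using e 0 by blast
  moreover have "substx \<xi> v x \<in>\<^sub>c cls P" if "\<xi> \<in>\<^sub>c cls P" "is_var v" "x \<in>\<^sub>c X" for \<xi> v x
    using that step s unfolding K by blast
  ultimately have "\<zeta> \<in>\<^sub>c cls P" using i unfolding inst_def by blast
  then show ?thesis unfolding K by blast
qed

lemma inst_refl: "inst X \<eta> \<eta>" by (simp add: inst_def)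

lemma inst_subst:
  assumes "inst X \<eta> \<zeta>" "formal_formula \<zeta>" "is_var v" "x \<in>\<^sub>c X" shows "inst X \<eta> (subst \<zeta> v x)"
proof -
  have "substx \<zeta> v x = subst \<zeta> v x" using assms mem_set by (simp add: substx_def)
  then show ?thesis using assms is_var_set unfolding inst_def by metis
qed

text \<open>Plays the part of truth under all assignments for formulas that may still have free
  variables.\<close>

definition valid :: "'a \<Rightarrow> 'a \<Rightarrow> bool" where
  "valid X \<eta> \<longleftrightarrow> (\<forall>\<zeta>. is_set \<zeta> --> inst X \<eta> \<zeta> --> csl X \<zeta> --> \<zeta> \<in>\<^sub>c True_class X)"

lemma dfn_valid: "dft True t ==> dfn True (\<lambda>s. valid X (t s))"
  by (rule dfn_comp1[where P = "valid X"]) (unfold valid_def, intro dfn_intros dft_const_True)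

text \<open>Substitution passes through the quantifier or leaves the formula alone, so every
  instance has the form \<open>fAll w \<eta>'\<close> with an instance \<open>\<eta>'\<close> of
  \<open>\<eta>\<close>. If it is closed, substituting elements of \<open>X\<close> for
  \<open>w\<close> yields closed instances of \<open>\<eta>\<close>.\<close>

lemma valid_All:
  assumes w: "is_var w" and e: "formal_formula \<eta>" and v: "valid X \<eta>" shows "valid X (fAll w \<eta>)"
  unfolding valid_def
proof (intro allI impI)
  fix \<zeta> assume i: "inst X (fAll w \<eta>) \<zeta>" and c: "csl X \<zeta>"
  have xA: "xAll w \<eta>' = fAll w \<eta>'" if "formal_formula \<eta>'" for \<eta>'
    by (rule xd_eq(1)[OF is_var_set[OF w] ff_seq[OF that]])
  have "\<exists>\<eta>'. is_set \<eta>' \<and> formal_formula \<eta>' \<and> inst X \<eta> \<eta>' \<and> \<zeta> = xAll w \<eta>'"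
  proof (rule inst_induct[OF i ff_set[OF ff_derived(3)[OF w e]]])
    show "dfn True (\<lambda>s. \<exists>\<eta>'. is_set \<eta>' \<and> formal_formula \<eta>' \<and> inst X \<eta> \<eta>' \<and> s 0 = xAll w \<eta>')"
      by (intro dfn_intros dft_const_True)
    show "\<exists>\<eta>'. is_set \<eta>' \<and> formal_formula \<eta>' \<and> inst X \<eta> \<eta>' \<and> fAll w \<eta> = xAll w \<eta>'"
      by (rule exI[of _ \<eta>]) (simp add: xA e ff_set inst_refl)
  next
    fix \<xi> u x assume "\<exists>\<eta>'. is_set \<eta>' \<and> formal_formula \<eta>' \<and> inst X \<eta> \<eta>' \<and> \<xi> = xAll w \<eta>'" and u: "is_var u" and x: "x \<in>\<^sub>c X"
    then obtain \<eta>' where e': "formal_formula \<eta>'" "inst X \<eta> \<eta>'" "\<xi> = fAll w \<eta>'" using xA by blast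
    have "substx \<xi> u x = subst (fAll w \<eta>') u x"
      using e' u mem_set[OF x] ff_derived(3)[OF w e'(1)] by (simp add: substx_def)
    also have "\<dots> = (if w = u then fAll w \<eta>' else fAll w (subst \<eta>' u x))"
      by (rule subst_derived(3)[OF u mem_set[OF x] e'(1) w])
    finally have s: "substx \<xi> u x = (if w = u then fAll w \<eta>' else fAll w (subst \<eta>' u x))" .
    have f: "formal_formula (subst \<eta>' u x)" by (rule subst_ff[OF u mem_set[OF x] e'(1)])
    show "\<exists>\<eta>'. is_set \<eta>' \<and> formal_formula \<eta>' \<and> inst X \<eta> \<eta>' \<and> substx \<xi> u x = xAll w \<eta>'"
    proof (cases "w = u")
      case True
      then show ?thesis using s e' xA[OF e'(1)] by (intro exI[of _ \<eta>']) (simp add: ff_set)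
    next
      case False
      then show ?thesis using s f inst_subst[OF e'(2,1) u x] xA[OF f] by (intro exI[of _ "subst \<eta>' u x"]) (simp add: ff_set)
    qed
  qed
  then obtain \<eta>' where e': "formal_formula \<eta>'" "inst X \<eta> \<eta>'" "\<zeta> = fAll w \<eta>'" using xA by blast
  note c' = c[unfolded e'(3)]
  have "X \<Turnstile>\<^sub>f subst \<eta>' w x" if x: "x \<in>\<^sub>c X" for x
  proof -
    have "csl X (subst \<eta>' w x)" by (rule csl_All_subst[OF w e'(1) c' x])
    then show ?thesis using v inst_subst[OF e'(2,1) w x] ff_set[OF csl_ff] unfolding valid_def models_f_def by blast
  qed
  then have "X \<Turnstile>\<^sub>f \<zeta>" unfolding e'(3) models_All[OF w e'(1) c'] by blast
  then show "\<zeta> \<in>\<^sub>c True_class X" unfolding models_f_def .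
qed

context
  fixes x a b assumes vars: "is_var x" "is_var a" "is_var b" and ne: "x \<noteq> a" "x \<noteq> b" "a \<noteq> b"
begin

abbreviation sep :: "'a \<Rightarrow> 'a" where
  "sep \<phi> \<equiv> fAll a (fEx b (fAll x (fIff (fMem x b) (fAnd (fMem x a) \<phi>))))"

abbreviation xsep :: "'a \<Rightarrow> 'a" where
  "xsep \<phi> \<equiv> xAll a (xEx b (xAll x (xIff (xMem x b) (xAnd (xMem x a) \<phi>))))"

lemma sep_ff: "formal_formula \<phi> ==> formal_formula (sep \<phi>)"
  using vars by (simp add: ff_derived ff_Ex ff_atom is_term_var)

lemma xsep_eq: "formal_formula \<phi> ==> xsep \<phi> = sep \<phi>"
  using vars[THEN is_var_set] by (simp add: xd_eq ff_seq f_defs)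

lemma subst_sep:
  assumes "formal_formula \<phi>" "is_var v" "is_set y"
  shows "subst (sep \<phi>) v y = (if v = a \<or> v = b \<or> v = x then sep \<phi> else sep (subst \<phi> v y))"
  using assms vars ne by (auto simp: subst_derived subst_Ex subst_Mem ff_derived ff_Ex ff_atom is_term_var)

text \<open>Substitution acts only on the formula inside the axiom, and \<open>b\<close> stays
  absent from it because nothing but parameters is introduced.\<close>

lemma inst_sep:
  assumes p: "formal_formula \<phi>" "\<not> free_in b \<phi>" and i: "inst X (sep \<phi>) \<zeta>"
  shows "\<exists>\<phi>'. formal_formula \<phi>' \<and> \<not> free_in b \<phi>' \<and> \<zeta> = sep \<phi>'"
proof -
  have fr: "frx b \<phi>' \<longleftrightarrow> free_in b \<phi>'" if "formal_formula \<phi>'" for \<phi>' using free_in_frx[OF vars(3) that] by simp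
  have "\<exists>\<phi>'. is_set \<phi>' \<and> formal_formula \<phi>' \<and> \<not> frx b \<phi>' \<and> \<zeta> = xsep \<phi>'"
  proof (rule inst_induct[OF i ff_set[OF sep_ff[OF p(1)]]])
    show "dfn True (\<lambda>s. \<exists>\<phi>'. is_set \<phi>' \<and> formal_formula \<phi>' \<and> \<not> frx b \<phi>' \<and> s 0 = xsep \<phi>')"
      by (intro dfn_intros dft_const_True)
    show "\<exists>\<phi>'. is_set \<phi>' \<and> formal_formula \<phi>' \<and> \<not> frx b \<phi>' \<and> sep \<phi> = xsep \<phi>'"
      by (rule exI[of _ \<phi>]) (simp add: xsep_eq fr p ff_set)
  next
    fix \<xi> u y assume "\<exists>\<phi>'. is_set \<phi>' \<and> formal_formula \<phi>' \<and> \<not> frx b \<phi>' \<and> \<xi> = xsep \<phi>'" and u: "is_var u" and y: "y \<in>\<^sub>c X"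
    then obtain \<phi>' where q: "formal_formula \<phi>'" "\<not> free_in b \<phi>'" "\<xi> = sep \<phi>'" using xsep_eq fr by blast
    note ys = mem_set[OF y]
    have s: "substx \<xi> u y = (if u = a \<or> u = b \<or> u = x then sep \<phi>' else sep (subst \<phi>' u y))"
      using q u ys sep_ff[OF q(1)] subst_sep[OF q(1) u ys] by (simp add: substx_def)
    have f: "formal_formula (subst \<phi>' u y)" "\<not> free_in b (subst \<phi>' u y)"
      using subst_ff[OF u ys q(1)] free_in_subst[OF q(1) u vars(3) ys] q(2) by blast+
    show "\<exists>\<phi>'. is_set \<phi>' \<and> formal_formula \<phi>' \<and> \<not> frx b \<phi>' \<and> substx \<xi> u y = xsep \<phi>'"
    proof (cases "u = a \<or> u = b \<or> u = x")
      case True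
      then show ?thesis using s q by (intro exI[of _ \<phi>']) (simp add: xsep_eq fr ff_set)
    next
      case False
      then show ?thesis using s f by (intro exI[of _ "subst \<phi>' u y"]) (simp add: xsep_eq fr ff_set)
    qed
  qed
  then show ?thesis using xsep_eq fr by blast
qed

lemma models_sep:
  assumes ZB: "bounded_universe Z B" and p: "formal_formula \<phi>" "\<not> free_in b \<phi>" and c: "csl Z (sep \<phi>)"
  shows "Z \<Turnstile>\<^sub>f sep \<phi>"
proof -
  note t = is_term_var[OF vars(1)] is_term_var[OF vars(2)] is_term_var[OF vars(3)]
  let ?E = "\<lambda>r \<phi>. fEx b (fAll x (fIff (fMem x b) (fAnd (fMem x r) \<phi>)))"
  let ?A = "\<lambda>s r \<phi>. fAll x (fIff (fMem x s) (fAnd (fMem x r) \<phi>))"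
  have ffA: "formal_formula (?A s r \<chi>)" if "is_term s" "is_term r" "formal_formula \<chi>" for s r \<chi>
    using that t vars by (simp add: ff_derived ff_atom)
  have ffE: "formal_formula (?E a \<phi>)" using ffA[OF t(3,2) p(1)] vars(3) ff_Ex by blast
  have "Z \<Turnstile>\<^sub>f subst (?E a \<phi>) a A" if A: "A \<in>\<^sub>c Z" for A
  proof -
    note As = mem_set[OF A]
    let ?\<phi> = "subst \<phi> a A"
    have p1: "formal_formula ?\<phi>" "\<not> free_in b ?\<phi>"
      using subst_ff[OF vars(2) As p(1)] free_in_subst[OF p(1) vars(2,3) As] p(2) by blast+
    have sE: "subst (?E a \<phi>) a A = ?E (par A) ?\<phi>"
      using vars ne As p t by (simp add: subst_derived subst_Ex subst_Mem ff_derived ff_atom)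
    have cE: "csl Z (?E (par A) ?\<phi>)" using csl_All_subst[OF vars(2) ffE c A] unfolding sE .
    \<comment> \<open>Truth of the instances of \<open>?\<phi>\<close> enters comprehension through
      the class parameter \<open>True_class Z\<close>; whatever the formula says, \<open>?D\<close>
      is bounded by the trace of \<open>A\<close>.\<close>
    let ?D = "cls (\<lambda>z. z \<in>\<^sub>c A \<and> z \<in>\<^sub>c Z \<and> substx ?\<phi> x z \<in>\<^sub>c True_class Z)"
    have D: "z \<in>\<^sub>c ?D \<longleftrightarrow> is_set z \<and> z \<in>\<^sub>c A \<and> z \<in>\<^sub>c Z \<and> substx ?\<phi> x z \<in>\<^sub>c True_class Z" for z
      by (rule mem_cls) (intro dfn_intros dft_const_True)
    have "?D \<subseteq>\<^sub>c A \<inter>\<^sub>c Z" by (rule subclsI) (unfold D, simp)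
    from B_code[OF ZB B_down[OF ZB B_mem[OF ZB A] this]]
    obtain q where q: "q \<in>\<^sub>c Z" "\<And>z. z \<in>\<^sub>c Z ==> z \<in>\<^sub>c q \<longleftrightarrow> z \<in>\<^sub>c ?D" by blast
    note qs = mem_set[OF q(1)]
    note tA = is_term_par[OF As] and tq = is_term_par[OF qs]
    \<comment> \<open>Since \<open>b\<close> is not free in \<open>?\<phi>\<close>, putting the
      representative \<open>q\<close> for \<open>b\<close> leaves \<open>?\<phi>\<close>
      unchanged.\<close>
    have sA: "subst (?A b (par A) ?\<phi>) b q = ?A (par q) (par A) ?\<phi>"
      using vars ne As qs p1 t tA subst_not_free[OF p1, of q] is_var_neq(4)[OF vars(3) As]
      by (simp add: subst_derived subst_Mem ff_derived ff_atom)
    have cA: "csl Z (?A (par q) (par A) ?\<phi>)"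
      using csl_subst[OF vars(3) ffA[OF t(3) tA p1(1)] cE q(1)] unfolding sA .
    let ?I = "fIff (fMem x (par q)) (fAnd (fMem x (par A)) ?\<phi>)"
    have ffI: "formal_formula ?I" using p1(1) t tA tq by (simp add: ff_derived ff_atom)
    have "Z \<Turnstile>\<^sub>f subst ?I x z" if z: "z \<in>\<^sub>c Z" for z
    proof -
      note zs = mem_set[OF z]
      let ?\<psi> = "subst ?\<phi> x z"
      have f: "formal_formula ?\<psi>" by (rule subst_ff[OF vars(1) zs p1(1)])
      have sI: "subst ?I x z = fIff (fMem (par z) (par q)) (fAnd (fMem (par z) (par A)) ?\<psi>)"
        using vars zs p1 t tA tq is_var_neq(4)[OF vars(1) As] is_var_neq(4)[OF vars(1) qs]
        by (simp add: subst_derived subst_Mem ff_derived ff_atom)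
      have ffm: "formal_formula (fMem (par z) (par r))" if "is_set r" for r
        using ff_atom(2)[OF is_term_par[OF zs] is_term_par[OF that]] .
      have "csl Z (subst ?I x z)" by (rule csl_All_subst[OF vars(1) ffI cA z])
      then have cs: "csl Z (fMem (par z) (par q))" "csl Z (fAnd (fMem (par z) (par A)) ?\<psi>)"
        "csl Z (fMem (par z) (par A))" "csl Z ?\<psi>"
        unfolding sI using ffm[OF qs] ffm[OF As] f by (simp_all add: csl_derived ff_derived)
      have "z \<in>\<^sub>c ?D \<longleftrightarrow> z \<in>\<^sub>c A \<and> Z \<Turnstile>\<^sub>f ?\<psi>"
        unfolding D models_f_def using z zs p1(1) vars(1) by (simp add: substx_def)
      then have "z \<in>\<^sub>c q \<longleftrightarrow> z \<in>\<^sub>c A \<and> Z \<Turnstile>\<^sub>f ?\<psi>" using q(2)[OF z] by blast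
      then show ?thesis
        unfolding sI models_derived(2)[OF cs(1,2)] models_derived(1)[OF cs(3,4)] models_Mem[OF z q(1)] models_Mem[OF z A] .
    qed
    then have "Z \<Turnstile>\<^sub>f ?A (par q) (par A) ?\<phi>" unfolding models_All[OF vars(1) ffI cA] by blast
    then have "Z \<Turnstile>\<^sub>f subst (?A b (par A) ?\<phi>) b q" unfolding sA .
    then show ?thesis unfolding sE models_Ex[OF vars(3) ffA[OF t(3) tA p1(1)] cE] using q(1) by blast
  qed
  then show ?thesis unfolding models_All[OF vars(2) ffE c] by blast
qed

lemma valid_sep:
  assumes "bounded_universe Z B" "formal_formula \<phi>" "\<not> free_in b \<phi>" shows "valid Z (sep \<phi>)"
  unfolding valid_def
proof (intro allI impI)
  fix \<zeta> assume i: "inst Z (sep \<phi>) \<zeta>" and c: "csl Z \<zeta>"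
  obtain \<phi>' where "formal_formula \<phi>'" "\<not> free_in b \<phi>'" "\<zeta> = sep \<phi>'" using inst_sep[OF assms(2,3) i] by blast
  then show "\<zeta> \<in>\<^sub>c True_class Z" using models_sep[OF assms(1), of \<phi>'] c unfolding models_f_def by blast
qed

end

lemma nat_suc_le:
  assumes n: "is_nat n" and m: "m \<in>\<^sub>c n" shows "suc m \<in>\<^sub>c n \<or> suc m = n"
proof -
  show ?thesis using nat_suc_mono[OF n m] mem_suc[OF nat_is_set[OF n]] by blast
qed

lemma emp_le: "is_nat n ==> emp \<in>\<^sub>c n \<or> emp = n"
  using nat_linear[of emp n] by auto

text \<open>The number \<open>n\<close> of prefixed quantifiers is an internal number. Each
  quantifier lengthens the formula, so \<open>n\<close> is below the small length of
  \<open>\<theta>\<close> and therefore in \<open>SN\<close>; validity, a class formula, can then be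
  carried to \<open>\<theta>\<close> by induction along \<open>SN\<close>.\<close>

lemma models_separation:
  assumes ZB: "bounded_universe Z B" and sl: "SL emp \<theta>" and ax: "ax_separation \<theta>"
  shows "Z \<Turnstile>\<^sub>f \<theta>"
proof -
  obtain \<phi> x a b where p: "formal_formula \<phi>" "is_var x" "is_var a" "is_var b" "x \<noteq> a" "x \<noteq> b" "a \<noteq> b" "\<not> free_in b \<phi>"
    and g: "generalization (fAll a (fEx b (fAll x (fIff (fMem x b) (fAnd (fMem x a) \<phi>))))) \<theta>"
    using ax unfolding ax_separation_def by blast
  let ?\<psi> = "fAll a (fEx b (fAll x (fIff (fMem x b) (fAnd (fMem x a) \<phi>))))"
  obtain f n where f: "is_seq f" "is_nat n" "Dom f = suc n" "ap f emp = ?\<psi>" "ap f n = \<theta>"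
    and st: "\<And>i. i \<in>\<^sub>c n ==> \<exists>w. is_var w \<and> ap f (suc i) = fAll w (ap f i)"
    using g unfolding generalization_def by blast
  have ax: "ap f i = apx f i" if "i \<in>\<^sub>c suc n" for i using ap_apx[OF seq_fun[OF f(1)]] that f(3) by simp
  have ns: "is_set n" by (rule nat_is_set[OF f(2)])
  have le: "m \<in>\<^sub>c n \<and> m \<in>\<^sub>c suc n" if "is_set m" "suc m \<in>\<^sub>c suc n" for m
    using nat_suc_less[OF f(2) that] mem_suc[OF ns] by blast
  have n0: "emp \<in>\<^sub>c suc n" using emp_le[OF f(2)] mem_suc[OF ns] by blast
  have nn: "n \<in>\<^sub>c suc n" using mem_suc[OF ns] by blast
  have c: "csl Z \<theta>" unfolding csl_def
    using SL_mono[OF sl, of Z] \<open>ax_separation \<theta>\<close> unfolding ax_separation_def by (simp add: subcls_def)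
  \<comment> \<open>This bound on the length is established before \<open>n\<close> is known to be
    small, so it has to be a set formula.\<close>
  have ff: "m \<in>\<^sub>c suc n --> formal_formula (apx f m) \<and> m \<in>\<^sub>c Dom (apx f m)" if "is_nat m" for m
  proof (rule nat_induct_set[OF _ that])
    show "dfn False (\<lambda>s. s 0 \<in>\<^sub>c suc n --> formal_formula (apx f (s 0)) \<and> s 0 \<in>\<^sub>c Dom (apx f (s 0)))"
      by (intro dfn_intros dft_const_set) (use f(1) seq_is_set ns in simp_all)
    have fp: "formal_formula ?\<psi>" by (rule sep_ff[OF p(2-7) p(1)])
    have 1: "formal_formula (fEx a (fNeg (fEx b (fAll x (fIff (fMem x b) (fAnd (fMem x a) \<phi>))))))"
      using p by (simp add: ff_derived ff_Ex ff_Neg ff_atom is_term_var)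
    have "emp \<in>\<^sub>c Dom ?\<psi>"
      unfolding fAll_def[of a]
      using Dom_sub(1)[OF ff_seq[OF 1]] emp_le[OF seq_Dom[OF ff_seq[OF 1]]] nat_trans[OF seq_Dom[OF ff_seq[OF ff_Neg[OF 1]]]] by metis
    then show "emp \<in>\<^sub>c suc n --> formal_formula (apx f emp) \<and> emp \<in>\<^sub>c Dom (apx f emp)"
      using fp f(4) ax[OF n0] by simp
  next
    fix m assume m: "is_nat m" and IH: "m \<in>\<^sub>c suc n --> formal_formula (apx f m) \<and> m \<in>\<^sub>c Dom (apx f m)"
    show "suc m \<in>\<^sub>c suc n --> formal_formula (apx f (suc m)) \<and> suc m \<in>\<^sub>c Dom (apx f (suc m))"
    proof
      assume sm: "suc m \<in>\<^sub>c suc n"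
      note l = le[OF nat_is_set[OF m] sm]
      obtain w where w: "is_var w" "ap f (suc m) = fAll w (ap f m)" using st l by blast
      let ?\<alpha> = "apx f m"
      have a: "formal_formula ?\<alpha>" "m \<in>\<^sub>c Dom ?\<alpha>" using IH l by blast+
      have eq: "apx f (suc m) = fAll w ?\<alpha>" using w(2) ax[OF sm] ax l by simp
      have f1: "formal_formula (fNeg ?\<alpha>)" by (rule ff_Neg[OF a(1)])
      have f2: "formal_formula (fEx w (fNeg ?\<alpha>))" by (rule ff_Ex[OF w(1) f1])
      have f3: "formal_formula (fAll w ?\<alpha>)" by (rule ff_derived(3)[OF w(1) a(1)])
      have tr: "i \<in>\<^sub>c Dom \<chi>" if "formal_formula \<chi>" "j \<in>\<^sub>c Dom \<chi>" "i \<in>\<^sub>c j" for i j \<chi>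
        by (rule nat_trans[OF seq_Dom[OF ff_seq[OF that(1)]] that(2,3)])
      have d: "Dom ?\<alpha> \<in>\<^sub>c Dom (fAll w ?\<alpha>)"
        using tr[OF f3] tr[OF f2] Dom_sub(1)[OF ff_seq[OF a(1)]] Dom_sub(1)[OF ff_seq[OF f2]]
          Dom_sub(4)[OF ff_seq[OF f1] is_var_set[OF w(1)]] unfolding fAll_def by metis
      have "suc m \<in>\<^sub>c Dom ?\<alpha> \<or> suc m = Dom ?\<alpha>" by (rule nat_suc_le[OF seq_Dom[OF ff_seq[OF a(1)]] a(2)])
      then have "suc m \<in>\<^sub>c Dom (fAll w ?\<alpha>)" using d tr[OF f3 d] by metis
      then show "formal_formula (apx f (suc m)) \<and> suc m \<in>\<^sub>c Dom (apx f (suc m))" unfolding eq using f3 by blast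
    qed
  qed
  have "n \<in>\<^sub>c Dom \<theta>" using ff[OF f(2)] nn ax[OF nn] f(5) by simp
  then have nSN: "n \<in>\<^sub>c SN" by (rule SN_mem[OF csl_Dom[OF c]])
  have "n \<in>\<^sub>c suc n --> valid Z (apx f n)"
  proof (rule SN_induct[OF _ nSN, where P = "\<lambda>m. m \<in>\<^sub>c suc n --> valid Z (apx f m)"])
    show "dfn True (\<lambda>s. s 0 \<in>\<^sub>c suc n --> valid Z (apx f (s 0)))" by (intro dfn_intros dfn_valid dft_const_True)
    show "emp \<in>\<^sub>c suc n --> valid Z (apx f emp)"
      using valid_sep[OF p(2-7) ZB p(1,8)] f(4) ax[OF n0] by simp
  next
    fix m assume m: "m \<in>\<^sub>c SN" and IH: "m \<in>\<^sub>c suc n --> valid Z (apx f m)"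
    show "suc m \<in>\<^sub>c suc n --> valid Z (apx f (suc m))"
    proof
      assume sm: "suc m \<in>\<^sub>c suc n"
      note l = le[OF mem_set[OF m] sm]
      obtain w where w: "is_var w" "ap f (suc m) = fAll w (ap f m)" using st l by blast
      have eq: "apx f (suc m) = fAll w (apx f m)" using w(2) ax[OF sm] ax l by simp
      show "valid Z (apx f (suc m))" unfolding eq
        by (rule valid_All[OF w(1)]) (use ff[OF SN_nat[OF m]] IH l in blast)+
    qed
  qed
  then have "valid Z \<theta>" using nn ax[OF nn] f(5) by simp
  \<comment> \<open>The formula \<open>\<theta>\<close> is closed and an instance of itself.\<close>
  then show ?thesis using inst_refl c ff_set[OF csl_ff[OF c]] unfolding valid_def models_f_def by blast
qed

end

theorem theorem2:
  fixes X :: "'a :: ths"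
  assumes "thin X"
  shows "\<exists>Z. thin Z \<and>
    (\<exists>x. x \<in>\<^sub>c Z \<and> X = Z \<inter>\<^sub>c x) \<and>
    (\<forall>x C. x \<in>\<^sub>c Z \<and> C \<subseteq>\<^sub>c x \<inter>\<^sub>c Z \<longrightarrow> (\<exists>q. q \<in>\<^sub>c Z \<and> q \<inter>\<^sub>c Z = C)) \<and>
    (\<forall>x. is_set x \<and> x \<subseteq>\<^sub>c Z \<longrightarrow> x \<in>\<^sub>c Z) \<and>
    (\<forall>\<theta>. ZC_minus_axiom \<theta> \<longrightarrow> Z \<Turnstile>\<^sub>f \<theta>)"
proof -
  obtain Z B where ZB: "bounded_universe Z B" and BX: "B X" using universe[OF assms] by blast
  show ?thesis
  proof (rule exI[of _ Z], intro conjI allI impI)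
    show "thin Z" by (rule Z_thin[OF ZB])
    obtain q where "q \<in>\<^sub>c Z" "q \<inter>\<^sub>c Z = X" using B_rep[OF ZB BX] by blast
    then show "\<exists>x. x \<in>\<^sub>c Z \<and> X = Z \<inter>\<^sub>c x" by (intro exI[of _ q] conjI cext) auto
  next
    fix x C assume "x \<in>\<^sub>c Z \<and> C \<subseteq>\<^sub>c x \<inter>\<^sub>c Z"
    \<comment> \<open>The trace of \<open>x\<close> on \<open>Z\<close> is bounded, and boundedness
      passes to subclasses.\<close>
    then have "B C" using B_down[OF ZB B_mem[OF ZB]] by blast
    then show "\<exists>q. q \<in>\<^sub>c Z \<and> q \<inter>\<^sub>c Z = C" using B_rep[OF ZB] by blast
  next
    fix x assume "is_set x \<and> x \<subseteq>\<^sub>c Z"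
    then show "x \<in>\<^sub>c Z" using fin_closedD[OF Z_fin[OF ZB]] by blast
  next
    fix \<theta> :: "'a" assume "ZC_minus_axiom \<theta>"
    then show "Z \<Turnstile>\<^sub>f \<theta>"
      unfolding ZC_minus_axiom_def
      using models_extensionality[OF ZB] models_empty_set[OF ZB] models_pairing[OF ZB] models_union[OF ZB]
        models_power_set[OF ZB] models_infinity[OF ZB] models_choice[OF ZB] models_separation[OF ZB] by blast
  qed
qed

end
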